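(* Let $N\ge 2$ and let $\mathbf{v}=(v_1,\dots,v_N)\in(\mathbb{R}^2)^N$ be such that $v_i\neq v_j$ for $i\neq j$. Let $$\mathcal{A}_{\mathbf{v}}=\Bigl\{\mathbf{A}=(A_1,\dots,A_N)\in GL_2(\mathbb{R})^N : 0<\max_{i\neq j}\frac{\|A_i\|+\|A_j\|}{|v_i-v_j|}\cdot\frac{\|\mathbf{v}\|}{1-\|\mathbf{A}\|}<\frac{\sqrt{2}}{2}\Bigr\}.$$ Then $$\dim_{\mathrm H} E_{\mathbf{A},\mathbf{v}}=\overline{\dim}_{\mathrm M} E_{\mathbf{A},\mathbf{v}}=\dim_{\mathrm{aff}}\mathbf{A}$$ for $\mathcal{L}^{4N}$-almost all $\mathbf{A}\in\mathcal{A}_{\mathbf{v}}$. Moreover, for every probability vector $\mathbf{p}=(p_1,\dots,p_N)\in(0,1)^N$, the corresponding self-affine measure $\mu=\mu_{\mathbf{A},\mathbf{v},\mathbf{p}}$ satisfies $$\dim\mu=\dim_{\mathrm L}\mu=\min\Bigl\{\frac{h_{\mathbf{p}}}{\chi_1(\mathbf{A},\mathbf{p})},\,1+\frac{h_{\mathbf{p}}-\chi_1(\mathbf{A},\mathbf{p})}{\chi_2(\mathbf{A},\mathbf{p})}\Bigr\}$$ for $\mathcal{L}^{4N}$-almost all $\mathbf{A}\in\mathcal{A}_{\mathbf{v}}$.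
   Context: Norms: $|\cdot|$ is the Euclidean norm, $\|A\|$ the operator norm, $\|\mathbf{A}\|=\max_i\|A_i\|$, $\|\mathbf{v}\|=\max_i|v_i|$. $\mathcal{L}^{4N}$ is Lebesgue measure on $GL_2(\mathbb{R})^N\subset\mathbb{R}^{4N}$. (Tuples in $\mathcal{A}_{\mathbf v}$ are contractive, i.e. $\|\mathbf A\|<1$.) For a contractive tuple $\mathbf{A}\in GL_d(\mathbb{R})^N$ and $\mathbf{v}\in(\mathbb{R}^d)^N$ (here $d=2$), let $f_i(x)=A_ix+v_i$. The self-affine set $E_{\mathbf{A},\mathbf{v}}$ is the unique nonempty compact set $E$ with $E=\bigcup_{i=1}^N f_i(E)$. $\Sigma=\{1,\dots,N\}^{\mathbb{N}}$, $\Sigma_n=\{1,\dots,N\}^n$; for $\mathbf{i}=(i_1,\dots,i_n)$, $A_{\mathbf{i}}=A_{i_1}\cdots A_{i_n}$ ($A_\varnothing=I$); $\mathbf{i}|_n$ denotes the first $n$ symbols of $\mathbf{i}$. The natural projection $\pi_{\mathbf{A},\mathbf{v}}:\Sigma\to E_{\mathbf{A},\mathbf{v}}$ is $\pi_{\mathbf{A},\mathbf{v}}(\mathbf{i})=\sum_{k=1}^\infty A_{\mathbf{i}|_{k-1}}v_{i_k}$. $\alpha_1(A)\ge\dots\ge\alpha_d(A)$ are the singular values of $A$. The singular value function is $\varphi^s(A)=\alpha_1(A)\cdots\alpha_{\lfloor s\rfloor}(A)\alpha_{\lceil s\rceil}(A)^{s-\lfloor s\rfloor}$ for $0\le s\le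 d$ and $\varphi^s(A)=|\det A|^{s/d}$ for $s>d$. The pressure is $P_{\mathbf{A}}(s)=\lim_{n\to\infty}\frac1n\log\sum_{\mathbf{i}\in\Sigma_n}\varphi^s(A_{\mathbf{i}})$, which is continuous and strictly decreasing with a unique zero; the affinity dimension $\dim_{\mathrm{aff}}\mathbf{A}$ is the minimum of $d$ and this zero. $\nu_{\mathbf{p}}$ is the Bernoulli measure on $\Sigma$ with probability vector $\mathbf{p}$, $\mu_{\mathbf{A},\mathbf{v},\mathbf{p}}=\nu_{\mathbf{p}}\circ\pi_{\mathbf{A},\mathbf{v}}^{-1}$ is the self-affine measure, and $h_{\mathbf{p}}=-\sum_i p_i\log p_i$. The Lyapunov exponents $0<\chi_1(\mathbf{A},\mathbf{p})\le\dots\le\chi_d(\mathbf{A},\mathbf{p})<\infty$ are the constants with $\chi_i(\mathbf{A},\mathbf{p})=-\lim_{n\to\infty}\frac1n\log\alpha_i(A_{\mathbf{i}|_n})$ for $\nu_{\mathbf{p}}$-a.e. $\mathbf{i}$. The Lyapunov dimension is $\dim_{\mathrm L}\mu=\dim_{\mathrm L}\nu_{\mathbf{p}}=\min\bigl(\{k+(h_{\mathbf{p}}-\sum_{j=1}^k\chi_j(\mathbf{A},\mathbf{p}))/\chi_{k+1}(\mathbf{A},\mathbf{p}):k\in\{0,\dots,d-1\}\}\cup\{d\}\bigr)$. A measure $\mu$ is exact-dimensional if there is a constant, denoted $\dim\mu$, such that $\lim_{r\downarrow0}\log\mu(B(x,r))/\log r=\dim\mu$ for $\mu$-a.e. $x$;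 writing $\dim\mu=c$ means $\mu$ is exact-dimensional with this value. $\dim_{\mathrm H}$ is Hausdorff dimension and $\overline{\dim}_{\mathrm M}$ upper Minkowski dimension. *)

theory Defs
  imports "HOL-Probability.Probability"
begin

section \<open>Matrices, singular values and the affinity dimension\<close>

text \<open>
  An $N$-tuple of $d \times d$ matrices is an element of \<open>real^'d^'d^'n\<close> with \<open>N = CARD('n)\<close>, so
  that the Lebesgue measure on tuples is the one of this Euclidean space. The type \<open>'n\<close> is the
  alphabet, finite words are lists and infinite words are functions \<open>nat \<Rightarrow> 'n\<close>, indexed from 0.
\<close>

definition op_norm :: "real^'d^'d \<Rightarrow> real"
  where "op_norm A = onorm (\<lambda>x. A *v x)"

definition max_op_norm :: "real^'d^'d^'n \<Rightarrow> real"
  where "max_op_norm A = Max (range (\<lambda>i. op_norm (A $ i)))"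

definition max_vec_norm :: "real^'d^'n \<Rightarrow> real"
  where "max_vec_norm v = Max (range (\<lambda>i. norm (v $ i)))"

definition word_matrix :: "real^'d^'d^'n \<Rightarrow> 'n list \<Rightarrow> real^'d^'d"
  where "word_matrix A w = foldr (\<lambda>i M. A $ i ** M) w (mat 1)"

definition prefix_word :: "(nat \<Rightarrow> 'n) \<Rightarrow> nat \<Rightarrow> 'n list"
  where "prefix_word \<omega> n = map \<omega> [0..<n]"

text \<open>
  The singular values of \<open>A\<close> are the square roots of the eigenvalues of \<open>transpose A ** A\<close>. They
  are listed in nonincreasing order, each repeated according to its multiplicity, which is the
  dimension of the eigenspace since \<open>transpose A ** A\<close> is symmetric.
\<close>

definition singular_space :: "real^'d^'d \<Rightarrow> real \<Rightarrow> (real^'d) set"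
  where "singular_space A s = {x. (transpose A ** A) *v x = s\<^sup>2 *\<^sub>R x}"

definition singular_values :: "real^'d^'d \<Rightarrow> real list"
  where "singular_values A =
    concat (map (\<lambda>s. replicate (dim (singular_space A s)) s)
      (rev (sorted_list_of_set {s. 0 \<le> s \<and> singular_space A s \<noteq> {0}})))"

text \<open>\<open>sing_val k A\<close> is the \<open>k\<close>-th largest singular value, for \<open>1 \<le> k \<le> d\<close>.\<close>

definition sing_val :: "nat \<Rightarrow> real^'d^'d \<Rightarrow> real"
  where "sing_val k A = singular_values A ! (k - 1)"

text \<open>
  The definition is meant for invertible \<open>A\<close> and \<open>s \<ge> 0\<close>. The singular values are then positive,
  so the last factor of the product is \<open>x powr 0 = 1\<close> whenever \<open>s\<close> is an integer; in particular
  the value at \<open>s = 0\<close> is 1.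
\<close>

definition sing_val_fun :: "real \<Rightarrow> real^'d^'d \<Rightarrow> real"
  where "sing_val_fun s A =
    (if s \<le> real CARD('d)
     then (\<Prod>j = 1..nat \<lfloor>s\<rfloor>. sing_val j A) * sing_val (nat \<lceil>s\<rceil>) A powr (s - of_int \<lfloor>s\<rfloor>)
     else \<bar>det A\<bar> powr (s / real CARD('d)))"

definition pressure :: "real^'d^'d^'n \<Rightarrow> real \<Rightarrow> real"
  where "pressure A s =
    lim (\<lambda>n. 1 / real n * ln (\<Sum>w\<in>{w. length w = n}. sing_val_fun s (word_matrix A w)))"

definition affinity_dim :: "real^'d^'d^'n \<Rightarrow> real"
  where "affinity_dim A = min (real CARD('d)) (THE s. 0 \<le> s \<and> pressure A s = 0)"


section \<open>Self-affine sets and measures\<close>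

definition self_affine_set :: "real^'d^'d^'n \<Rightarrow> real^'d^'n \<Rightarrow> (real^'d) set"
  where "self_affine_set A v =
    (THE E. compact E \<and> E \<noteq> {} \<and> E = (\<Union>i. (\<lambda>x. A $ i *v x + v $ i) ` E))"

definition natural_proj :: "real^'d^'d^'n \<Rightarrow> real^'d^'n \<Rightarrow> (nat \<Rightarrow> 'n) \<Rightarrow> real^'d"
  where "natural_proj A v \<omega> = (\<Sum>k. word_matrix A (prefix_word \<omega> k) *v (v $ \<omega> k))"

definition bernoulli_measure :: "real^'n \<Rightarrow> (nat \<Rightarrow> 'n) measure"
  where "bernoulli_measure p = PiM UNIV (\<lambda>_. point_measure UNIV (\<lambda>i. ennreal (p $ i)))"

definition self_affine_measure ::
    "real^'d^'d^'n \<Rightarrow> real^'d^'n \<Rightarrow> real^'n \<Rightarrow> (real^'d) measure"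
  where "self_affine_measure A v p = distr (bernoulli_measure p) borel (natural_proj A v)"

definition shannon_entropy :: "real^'n \<Rightarrow> real"
  where "shannon_entropy p = - (\<Sum>i\<in>UNIV. p $ i * ln (p $ i))"

definition lyapunov_exp :: "nat \<Rightarrow> real^'d^'d^'n \<Rightarrow> real^'n \<Rightarrow> real"
  where "lyapunov_exp k A p =
    (THE c. AE \<omega> in bernoulli_measure p.
       (\<lambda>n. - (1 / real n * ln (sing_val k (word_matrix A (prefix_word \<omega> n))))) \<longlonglongrightarrow> c)"

definition lyapunov_dim :: "real^'d^'d^'n \<Rightarrow> real^'n \<Rightarrow> real"
  where "lyapunov_dim A p =
    Min ((\<lambda>k. real k + (shannon_entropy p - (\<Sum>j = 1..k. lyapunov_exp j A p))
                       / lyapunov_exp (k + 1) A p) ` {0..<CARD('d)}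
         \<union> {real CARD('d)})"


section \<open>Dimensions of sets and measures\<close>

text \<open>
  The \<open>s\<close>-th power of the diameter, with the convention that the empty set contributes nothing
  and that every other set contributes 1 when \<open>s = 0\<close> (recall that \<open>0 powr 0 = 0\<close>).
\<close>

definition diam_pow :: "real \<Rightarrow> 'a::metric_space set \<Rightarrow> ennreal"
  where "diam_pow s U =
    (if U = {} then 0 else if s = 0 then 1 else ennreal (diameter U powr s))"

definition hausdorff_premeasure :: "real \<Rightarrow> real \<Rightarrow> 'a::metric_space set \<Rightarrow> ennreal"
  where "hausdorff_premeasure s \<delta> E =
    (INF U \<in> {U :: nat \<Rightarrow> 'a set.
                E \<subseteq> (\<Union>k. U k) \<and> (\<forall>k. bounded (U k) \<and> diameter (U k) \<le> \<delta>)}.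
       (\<Sum>k. diam_pow s (U k)))"

definition hausdorff_measure :: "real \<Rightarrow> 'a::metric_space set \<Rightarrow> ennreal"
  where "hausdorff_measure s E = (SUP \<delta>\<in>{0<..}. hausdorff_premeasure s \<delta> E)"

definition hausdorff_dim :: "'a::metric_space set \<Rightarrow> ereal"
  where "hausdorff_dim E = (INF s\<in>{s. 0 \<le> s \<and> hausdorff_measure s E = 0}. ereal s)"

text \<open>The covering number and the Minkowski dimension are meant for totally bounded sets.\<close>

definition covering_number :: "'a::metric_space set \<Rightarrow> real \<Rightarrow> nat"
  where "covering_number E r = (LEAST m. \<exists>C. finite C \<and> card C = m \<and> E \<subseteq> (\<Union>x\<in>C. cball x r))"

definition upper_minkowski_dim :: "'a::metric_space set \<Rightarrow> ereal"
  where "upper_minkowski_dim E =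
    Limsup (at_right 0) (\<lambda>r. ereal (ln (real (covering_number E r)) / ln (1 / r)))"

text \<open>\<open>has_exact_dim \<mu> c\<close> says that \<open>\<mu>\<close> is exact-dimensional with dimension \<open>c\<close>.\<close>

definition has_exact_dim :: "'a::metric_space measure \<Rightarrow> real \<Rightarrow> bool"
  where "has_exact_dim \<mu> c \<longleftrightarrow>
    (AE x in \<mu>. ((\<lambda>r. ln (measure \<mu> (cball x r)) / ln r) \<longlongrightarrow> c) (at_right 0))"


section \<open>The set of admissible tuples\<close>

text \<open>
  If \<open>max_op_norm A = 1\<close> the quotient below is 0 because of division by zero, and if
  \<open>max_op_norm A > 1\<close> it is at most 0; so the strict lower bound forces \<open>max_op_norm A < 1\<close>,
  i.e. the tuples are contractive.
\<close>

definition admissible_tuples :: "real^2^'n \<Rightarrow> (real^2^2^'n) set"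
  where "admissible_tuples v =
    {A. (\<forall>i. invertible (A $ i)) \<and>
        (let m = Max {(op_norm (A $ i) + op_norm (A $ j)) / norm (v $ i - v $ j)
                      * (max_vec_norm v / (1 - max_op_norm A)) | i j. i \<noteq> j}
         in 0 < m \<and> m < sqrt 2 / 2)}"

end

theory Submission
  imports Defs "HOL-Real_Asymp.Real_Asymp"
begin

text \<open>
  Conjugating every \<open>A\<^sub>i\<close> by one invertible \<open>U\<close> changes neither the pressure nor the Lyapunov
  exponents, and \<open>\<pi>\<close> of \<open>(U\<inverse>A\<^sub>iU)\<close> and \<open>v\<close> is \<open>U\<inverse>\<close> applied to \<open>\<pi>\<close> of \<open>(A\<^sub>i)\<close> and \<open>(Uv\<^sub>i)\<close>. So a perturbation of
  the matrices along conjugacy classes acts as a linear perturbation of the translations: if \<open>x\<close> and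
  \<open>y\<close> are the columns of \<open>U\<close>, then \<open>\<pi>(\<omega>) - \<pi>(\<omega>')\<close> is a linear function of \<open>x\<close> plus one of \<open>y\<close>, with
  coefficients built from the first and the second coordinates of the \<open>v\<^sub>i\<close>. One coordinate of
  \<open>v\<^sub>i - v\<^sub>j\<close> has modulus at least \<open>(\<surd>2/2) |v\<^sub>i - v\<^sub>j|\<close>; by the bound defining the admissible tuples,
  the corresponding linear function is \<open>A\<^sub>w\<close> times a boundedly invertible map, where \<open>w\<close> is the
  longest common prefix of \<open>\<omega>\<close> and \<open>\<omega>'\<close>. This is Falconer's transversality condition, and his potential
  estimate shows that for almost every \<open>U\<close> the images of a Frostman measure for \<open>\<phi>\<^sup>s\<close> and of a
  Bernoulli measure have finite potentials below the affinity and the Lyapunov dimension. By Fubini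
  over \<open>U\<close> near the identity, the set of tuples for which this fails is null. The upper bounds hold for every
  contracting tuple, by covering with images of a ball; for measures they use Kingman's theorem.
\<close>


section \<open>Singular values of planar matrices\<close>

text \<open>The translations are fixed and only the matrices vary, so Falconer's integration over
  translations is available only along conjugacy classes, a family with four parameters whatever
  \<open>N\<close> is; it must be controlled through a single column of \<open>U\<close>. Two
  obstacles shape the rest. Fubini needs Borel exceptional sets, while the Lyapunov exponents come
  from \<open>THE\<close> and Hausdorff measure from an infimum over uncountably many covers; hence
  these sets are described by explicit limits, by open covers of the attractor and by measures of
  sections. Moreover the Frostman measure depends on the tuple, so for sets the exceptional event is
  the vanishing of a Hausdorff measure, whereas a Bernoulli measure is the same for all tuples and
  the exceptional event can be an infinite potential. Admissibility need not survive conjugation; it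
  is enough that the admissible tuples are covered by countably many open sets with a common
  contraction bound. The separation of the first-level images also bounds the sum of the
  determinants by 1, which keeps both dimension formulas at most 2.\<close>

lemma norm_vec2: "(norm (x :: real^2))\<^sup>2 = (x $ 1)\<^sup>2 + (x $ 2)\<^sup>2"
  by (simp add: norm_vec_def L2_set_def sum_2)

lemma mult_vec2:
  "(A *v (x :: real^2)) $ 1 = A $ 1 $ 1 * x $ 1 + A $ 1 $ 2 * x $ 2"
  "(A *v x) $ 2 = A $ 2 $ 1 * x $ 1 + A $ 2 $ 2 * x $ 2"
  by (simp_all add: matrix_vector_mult_def sum_2)

lemma inner_vec2: "(x :: real^2) \<bullet> y = x $ 1 * y $ 1 + x $ 2 * y $ 2"
  by (simp add: inner_vec_def sum_2)

lemma norm_add_scaleR_sq: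
  fixes a b :: "'a::real_inner"
  shows "(norm (a + t *\<^sub>R b))\<^sup>2 = (norm a)\<^sup>2 + 2 * t * (a \<bullet> b) + t\<^sup>2 * (norm b)\<^sup>2"
  unfolding power2_norm_eq_inner
  by (simp add: inner_add_left inner_add_right inner_commute[of b a] power2_eq_square algebra_simps)

lemma op_norm_ge: "norm (A *v x) \<le> op_norm A * norm x"
  unfolding op_norm_def by (rule onorm) simp

lemma op_norm_nonneg: "0 \<le> op_norm A"
  unfolding op_norm_def by (rule onorm_pos_le) simp

lemma op_norm_le: "(\<And>x. norm (A *v x) \<le> b * norm x) \<Longrightarrow> op_norm A \<le> b"
  unfolding op_norm_def by (rule onorm_le)

lemma op_norm_mult_le: "op_norm (A ** B) \<le> op_norm A * op_norm B"
proof (rule op_norm_le)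
  fix x
  have "norm (A *v (B *v x)) \<le> op_norm A * norm (B *v x)" by (rule op_norm_ge)
  also have "\<dots> \<le> op_norm A * (op_norm B * norm x)"
    by (intro mult_left_mono op_norm_ge op_norm_nonneg)
  finally show "norm ((A ** B) *v x) \<le> op_norm A * op_norm B * norm x"
    by (simp add: matrix_vector_mul_assoc mult.assoc)
qed

lemma op_norm_mat_1: "op_norm (mat 1 :: real^'d^'d) = 1"
proof -
  have "(*v) (mat 1 :: real^'d^'d) = (\<lambda>x. x)" by auto
  then show ?thesis unfolding op_norm_def by (simp add: onorm_id)
qed

lemma op_norm_attained: "\<exists>e. norm e = 1 \<and> norm (A *v e) = op_norm (A :: real^'d^'d)"
proof -
  have "compact (sphere (0 :: real^'d) 1)" by simp
  moreover have "sphere (0 :: real^'d) 1 \<noteq> {}" by simp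
  moreover have "continuous_on (sphere 0 1) (\<lambda>x. norm (A *v x))"
    by (intro continuous_intros)
  ultimately obtain e where e: "e \<in> sphere 0 1" "\<And>y. y \<in> sphere 0 1 \<Longrightarrow> norm (A *v y) \<le> norm (A *v e)"
    by (metis continuous_attains_sup)
  have "op_norm A \<le> norm (A *v e)"
  proof (rule op_norm_le)
    fix x :: "real^'d"
    show "norm (A *v x) \<le> norm (A *v e) * norm x"
    proof (cases "x = 0")
      case False
      have "norm (A *v ((1 / norm x) *\<^sub>R x)) \<le> norm (A *v e)"
        by (rule e(2)) (use False in simp)
      then show ?thesis using False
        by (simp add: matrix_vector_mult_scaleR field_simps)
    qed simp
  qed
  with op_norm_ge[of A e] e(1) show ?thesis by (intro exI[of _ e]) auto
qed

text \<open>The smaller singular value, found from the product of both being \<bar>det A\<bar>. In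
  this form its logarithm is additive minus subadditive, so its estimates reduce to
  submultiplicativity of the operator norm.\<close>

definition sing2 :: "real^2^2 \<Rightarrow> real"
  where "sing2 A = \<bar>det A\<bar> / op_norm A"

lemma det_nonzero_op_norm_pos: "det A \<noteq> 0 \<Longrightarrow> 0 < op_norm (A :: real^2^2)"
proof -
  assume d: "det A \<noteq> 0"
  have "op_norm A \<noteq> 0"
  proof
    assume "op_norm A = 0"
    then have "A *v x = 0" for x using op_norm_ge[of A x] by simp
    then have "A = 0" by (metis matrix_eq matrix_vector_mult_0)
    then show False using d by (simp add: det_2)
  qed
  then show ?thesis using op_norm_nonneg[of A] by simp
qed

lemma sing2_pos: "det A \<noteq> 0 \<Longrightarrow> 0 < sing2 A"
  unfolding sing2_def using det_nonzero_op_norm_pos by simp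

lemma op_norm_times_sing2: "det A \<noteq> 0 \<Longrightarrow> op_norm A * sing2 A = \<bar>det A\<bar>"
  unfolding sing2_def using det_nonzero_op_norm_pos by fastforce

text \<open>Singular value decomposition by optimisation: \<open>e1\<close> maximises |Ax| on the
  unit circle, \<open>e2\<close> is \<open>e1\<close> turned by a right angle, and optimality of
  \<open>e1\<close> makes the two images orthogonal.\<close>

lemma singular_basis:
  fixes A :: "real^2^2"
  assumes "det A \<noteq> 0"
  obtains e1 e2 where "norm e1 = 1" "norm e2 = 1" "e1 \<bullet> e2 = 0" "(A *v e1) \<bullet> (A *v e2) = 0"
    "norm (A *v e1) = op_norm A" "norm (A *v e2) = sing2 A"
    "\<And>x. x = (x \<bullet> e1) *\<^sub>R e1 + (x \<bullet> e2) *\<^sub>R e2"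
proof -
  obtain e1 where e1: "norm e1 = 1" "norm (A *v e1) = op_norm A"
    using op_norm_attained by blast
  define e2 :: "real^2" where "e2 = vector [- e1 $ 2, e1 $ 1]"
  have e2c: "e2 $ 1 = - e1 $ 2" "e2 $ 2 = e1 $ 1" by (simp_all add: e2_def)
  have u: "(e1 $ 1)\<^sup>2 + (e1 $ 2)\<^sup>2 = 1" using norm_vec2[of e1] e1 by simp
  have ne2: "norm e2 = 1"
    using norm_vec2[of e2] u unfolding e2c
    by (smt (verit, best) norm_ge_zero power2_eq_1_iff power2_minus)
  have orth: "e1 \<bullet> e2 = 0" by (simp add: inner_vec2 e2c)
  have ex: "x = (x \<bullet> e1) *\<^sub>R e1 + (x \<bullet> e2) *\<^sub>R e2" for x :: "real^2"
  proof -
    have "x $ 1 * ((e1 $ 1)\<^sup>2 + (e1 $ 2)\<^sup>2) = x $ 1" "x $ 2 * ((e1 $ 1)\<^sup>2 + (e1 $ 2)\<^sup>2) = x $ 2"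
      using u by simp_all
    then show ?thesis
      by (simp add: vec_eq_iff forall_2 inner_vec2 e2c algebra_simps power2_eq_square)
  qed
  define M where "M = op_norm A"
  define c where "c = (A *v e1) \<bullet> (A *v e2)"
  \<comment> \<open>Compare |A(e1 + t e2)| with M |e1 + t e2| and square: the terms of order 0 in
    \<open>t\<close> cancel.\<close>
  have key: "2 * t * c \<le> t\<^sup>2 * (M\<^sup>2 - (norm (A *v e2))\<^sup>2)" for t
  proof -
    have "norm (A *v (e1 + t *\<^sub>R e2)) \<le> M * norm (e1 + t *\<^sub>R e2)"
      unfolding M_def by (rule op_norm_ge)
    then have "(norm (A *v (e1 + t *\<^sub>R e2)))\<^sup>2 \<le> (M * norm (e1 + t *\<^sub>R e2))\<^sup>2"
      by (rule power_mono) simp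
    moreover have "(norm (A *v (e1 + t *\<^sub>R e2)))\<^sup>2 = M\<^sup>2 + 2 * t * c + t\<^sup>2 * (norm (A *v e2))\<^sup>2"
      unfolding M_def c_def e1(2)[symmetric] matrix_vector_right_distrib matrix_vector_mult_scaleR
      by (rule norm_add_scaleR_sq)
    moreover have "(norm (e1 + t *\<^sub>R e2))\<^sup>2 = 1 + t\<^sup>2"
      using orth e1 ne2 by (simp add: norm_add_scaleR_sq)
    ultimately show ?thesis by (simp add: power_mult_distrib algebra_simps)
  qed
  have c0: "c = 0"
  proof (rule ccontr)
    assume c: "c \<noteq> 0"
    \<comment> \<open>With \<open>t = c / K\<close> the linear term 2tc is twice the largest value
      that the quadratic term can have, so \<open>c\<close> must vanish.\<close>
    define K where "K = \<bar>M\<^sup>2 - (norm (A *v e2))\<^sup>2\<bar> + 1"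
    have K: "K > 0" unfolding K_def by simp
    have "2 * (c / K) * c \<le> (c / K)\<^sup>2 * (M\<^sup>2 - (norm (A *v e2))\<^sup>2)" by (rule key)
    also have "\<dots> \<le> (c / K)\<^sup>2 * K" unfolding K_def by (intro mult_left_mono) auto
    also have "\<dots> = (c / K) * c" using K by (simp add: power2_eq_square)
    finally have "(c * c) / K \<le> 0" by simp
    then show False using K c
      by (metis divide_pos_pos not_le not_real_square_gt_zero)
  qed
  have "\<bar>det A\<bar> = norm (A *v e1) * norm (A *v e2)"
  proof -
    \<comment> \<open>Lagrange's identity for \<open>A e1\<close> and \<open>A e2\<close>, the
      determinant of the frame \<open>(e1, e2)\<close> being |e1|^2 = 1.\<close>
    have "(det A * ((e1 $ 1)\<^sup>2 + (e1 $ 2)\<^sup>2))\<^sup>2 = (norm (A *v e1))\<^sup>2 * (norm (A *v e2))\<^sup>2 - c\<^sup>2"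
      unfolding c_def norm_vec2 inner_vec2 mult_vec2 e2c det_2 by algebra
    then have "(det A)\<^sup>2 = (norm (A *v e1) * norm (A *v e2))\<^sup>2"
      using u c0 by (simp add: power_mult_distrib)
    then show ?thesis
      by (smt (verit) abs_mult abs_norm_cancel power2_eq_iff mult_nonneg_nonneg norm_ge_zero)
  qed
  then have "norm (A *v e2) = sing2 A"
    using det_nonzero_op_norm_pos[OF assms] by (simp add: sing2_def e1)
  with that[OF e1(1) ne2 orth _ e1(2) _ ex] c0 show ?thesis unfolding c_def by blast
qed

lemma norm_mult_ge_sing2:
  assumes "det A \<noteq> 0" shows "sing2 A * norm x \<le> norm (A *v x)"
proof -
  obtain e1 e2 where e: "norm e1 = 1" "norm e2 = 1" "e1 \<bullet> e2 = 0" "(A *v e1) \<bullet> (A *v e2) = 0"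
    "norm (A *v e1) = op_norm A" "norm (A *v e2) = sing2 A"
    and ex: "\<And>x. x = (x \<bullet> e1) *\<^sub>R e1 + (x \<bullet> e2) *\<^sub>R e2"
    using singular_basis[OF assms] by metis
  define a b where "a = x \<bullet> e1" and "b = x \<bullet> e2"
  have x: "x = a *\<^sub>R e1 + b *\<^sub>R e2" unfolding a_def b_def by (rule ex)
  have le: "sing2 A \<le> op_norm A" using op_norm_ge[of A e2] e by simp
  have n1: "(norm x)\<^sup>2 = a\<^sup>2 + b\<^sup>2"
    unfolding x using e(1-3)
    by (simp add: norm_add_Pythagorean orthogonal_def)
  have n2: "(norm (A *v x))\<^sup>2 = a\<^sup>2 * (op_norm A)\<^sup>2 + b\<^sup>2 * (sing2 A)\<^sup>2"
    unfolding x using e(4-6)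
    by (simp add: norm_add_Pythagorean orthogonal_def matrix_vector_right_distrib
        matrix_vector_mult_scaleR power_mult_distrib)
  have "(sing2 A * norm x)\<^sup>2 = a\<^sup>2 * (sing2 A)\<^sup>2 + b\<^sup>2 * (sing2 A)\<^sup>2"
    by (simp add: power_mult_distrib n1 algebra_simps)
  also have "\<dots> \<le> (norm (A *v x))\<^sup>2"
    unfolding n2 using le sing2_pos[OF assms] by (intro add_mono mult_left_mono power_mono) auto
  finally show ?thesis by (rule power2_le_imp_le) simp
qed

lemma sing2_le_op_norm: "det A \<noteq> 0 \<Longrightarrow> sing2 A \<le> op_norm A"
  using singular_basis[of A] op_norm_ge[of A] by (metis mult.right_neutral)

text \<open>In the coordinates \<open>x \<bullet> e1\<close> and \<open>x \<bullet> e2\<close> the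
  symmetric matrix \<open>transpose A ** A\<close> is diagonal with entries
  \<open>(op_norm A)\<^sup>2\<close> and \<open>(sing2 A)\<^sup>2\<close>.\<close>

lemma singular_space_planar:
  fixes A :: "real^2^2"
  assumes d: "det A \<noteq> 0"
    and e: "norm e1 = 1" "norm e2 = 1" "e1 \<bullet> e2 = 0" "(A *v e1) \<bullet> (A *v e2) = 0"
    "norm (A *v e1) = op_norm A" "norm (A *v e2) = sing2 A"
    and ex: "\<And>x. x = (x \<bullet> e1) *\<^sub>R e1 + (x \<bullet> e2) *\<^sub>R e2"
  shows "singular_space A s =
    {x. ((op_norm A)\<^sup>2 - s\<^sup>2) * (x \<bullet> e1) = 0 \<and> ((sing2 A)\<^sup>2 - s\<^sup>2) * (x \<bullet> e2) = 0}"
proof -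
  have adj: "((transpose A ** A) *v x) \<bullet> y = (A *v x) \<bullet> (A *v y)" for x y
    by (simp add: matrix_vector_mul_assoc[symmetric] dot_lmul_matrix[symmetric]
        transpose_matrix_vector)
  have 1: "(x :: real^2) = y \<longleftrightarrow> x \<bullet> e1 = y \<bullet> e1 \<and> x \<bullet> e2 = y \<bullet> e2" for x y
    using ex[of x] ex[of y] by metis
  have n: "e1 \<bullet> e1 = 1" "e2 \<bullet> e2 = 1" using e(1,2) by (simp_all add: norm_eq_1)
  have m: "(A *v e1) \<bullet> (A *v e1) = (op_norm A)\<^sup>2" "(A *v e2) \<bullet> (A *v e2) = (sing2 A)\<^sup>2"
    using e(5,6) by (simp_all add: power2_norm_eq_inner[symmetric])
  have e4: "(A *v e2) \<bullet> (A *v e1) = 0" using e(4) by (simp add: inner_commute)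
  have A1: "(A *v x) \<bullet> (A *v e1) = (op_norm A)\<^sup>2 * (x \<bullet> e1)" for x
  proof -
    have "(A *v x) \<bullet> (A *v e1) = (A *v ((x \<bullet> e1) *\<^sub>R e1 + (x \<bullet> e2) *\<^sub>R e2)) \<bullet> (A *v e1)"
      using arg_cong[OF ex[of x], of "\<lambda>y. (A *v y) \<bullet> (A *v e1)"] .
    also have "\<dots> = (op_norm A)\<^sup>2 * (x \<bullet> e1)"
      using m e(4) e4 by (simp add: matrix_vector_right_distrib matrix_vector_mult_scaleR
          inner_add_left)
    finally show ?thesis .
  qed
  have A2: "(A *v x) \<bullet> (A *v e2) = (sing2 A)\<^sup>2 * (x \<bullet> e2)" for x
  proof -
    have "(A *v x) \<bullet> (A *v e2) = (A *v ((x \<bullet> e1) *\<^sub>R e1 + (x \<bullet> e2) *\<^sub>R e2)) \<bullet> (A *v e2)"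
      using arg_cong[OF ex[of x], of "\<lambda>y. (A *v y) \<bullet> (A *v e2)"] .
    also have "\<dots> = (sing2 A)\<^sup>2 * (x \<bullet> e2)"
      using m e(4) by (simp add: matrix_vector_right_distrib matrix_vector_mult_scaleR
          inner_add_left)
    finally show ?thesis .
  qed
  show ?thesis
    unfolding singular_space_def 1 adj A1 A2 inner_scaleR_left
    by (rule Collect_cong) (simp add: left_diff_distrib)
qed

text \<open>Index 0 agrees with index 1 by truncated subtraction. It occurs in
  \<open>sing_val_fun\<close> at s = 0, where positivity of \<open>sing_val 0 A\<close> makes the
  last factor 1 instead of \<open>0 powr 0 = 0\<close>.\<close>

lemma sing_val_planar:
  fixes A :: "real^2^2"
  assumes d: "det A \<noteq> 0"
  shows "sing_val 1 A = op_norm A" "sing_val 2 A = sing2 A" "sing_val 0 A = op_norm A"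
proof -
  obtain e1 e2 where e: "norm e1 = 1" "norm e2 = 1" "e1 \<bullet> e2 = 0" "(A *v e1) \<bullet> (A *v e2) = 0"
    "norm (A *v e1) = op_norm A" "norm (A *v e2) = sing2 A"
    and ex: "\<And>x. x = (x \<bullet> e1) *\<^sub>R e1 + (x \<bullet> e2) *\<^sub>R e2"
    using singular_basis[OF assms] by metis
  note S = singular_space_planar[OF d e ex]
  have p: "0 < op_norm A" "0 < sing2 A" using d by (auto intro: det_nonzero_op_norm_pos sing2_pos)
  have n: "e1 \<bullet> e1 = 1" "e2 \<bullet> e2 = 1" "e2 \<bullet> e1 = 0" using e(1-3) by (simp_all add: norm_eq_1 inner_commute)
  have nz: "e1 \<noteq> 0" "e2 \<noteq> 0" using e(1,2) by auto
  have set: "{s. 0 \<le> s \<and> singular_space A s \<noteq> {0}} = {op_norm A, sing2 A}"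
  proof (intro set_eqI iffI)
    fix s assume "s \<in> {s. 0 \<le> s \<and> singular_space A s \<noteq> {0}}"
    then have s: "0 \<le> s" and "singular_space A s \<noteq> {0}" by auto
    moreover have "0 \<in> singular_space A s" by (simp add: singular_space_def)
    ultimately obtain x where x: "x \<in> singular_space A s" "x \<noteq> 0" by blast
    then have "x \<bullet> e1 \<noteq> 0 \<or> x \<bullet> e2 \<noteq> 0" using ex[of x] by auto
    then have "(op_norm A)\<^sup>2 = s\<^sup>2 \<or> (sing2 A)\<^sup>2 = s\<^sup>2" using x(1) unfolding S by auto
    then show "s \<in> {op_norm A, sing2 A}" using p s by (auto simp: power2_eq_iff_nonneg)
  next
    fix s assume "s \<in> {op_norm A, sing2 A}"
    then have "e1 \<in> singular_space A s \<or> e2 \<in> singular_space A s" "0 \<le> s"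
      unfolding S using n e p by auto
    then show "s \<in> {s. 0 \<le> s \<and> singular_space A s \<noteq> {0}}" using nz by auto
  qed
  have "singular_values A = [op_norm A, sing2 A]"
  proof (cases "op_norm A = sing2 A")
    \<comment> \<open>A double singular value is one element of the sorted set; its eigenspace is
      the whole plane, and the multiplicity 2 restores the second entry.\<close>
    case True
    have "singular_space A (sing2 A) = UNIV" unfolding S by (simp add: True)
    then have "dim (singular_space A (sing2 A)) = 2" by simp
    then show ?thesis unfolding singular_values_def set
      by (simp add: True numeral_2_eq_2)
  next
    case False
    then have lt: "sing2 A < op_norm A" using sing2_le_op_norm[OF d] by simp
    then have ne: "(op_norm A)\<^sup>2 \<noteq> (sing2 A)\<^sup>2" using p by (simp add: power2_eq_iff_nonneg)
    have dim_line: "dim {x. x \<bullet> b = 0} = 1" if "a \<noteq> 0" "\<And>x. x \<bullet> b = 0 \<longleftrightarrow> x \<in> span {a}" for a b :: "real^2"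
    proof -
      have "{x. x \<bullet> b = 0} = span {a}" using that(2) by auto
      then show ?thesis using that(1) by (simp only: dim_span dim_singleton if_False)
    qed
    have d1: "dim (singular_space A (op_norm A)) = 1"
    proof -
      have "singular_space A (op_norm A) = {x. x \<bullet> e2 = 0}" unfolding S using ne by auto
      moreover have "x \<bullet> e2 = 0 \<longleftrightarrow> x \<in> span {e1}" for x
        using ex[of x] e(3) by (auto simp: span_singleton image_iff intro: exI[of _ "x \<bullet> e1"])
      ultimately show ?thesis using dim_line[OF nz(1), of e2] by metis
    qed
    have d2: "dim (singular_space A (sing2 A)) = 1"
    proof -
      have "singular_space A (sing2 A) = {x. x \<bullet> e1 = 0}" unfolding S using ne by auto
      moreover have "x \<bullet> e1 = 0 \<longleftrightarrow> x \<in> span {e2}" for x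
        using ex[of x] n(3) by (auto simp: span_singleton image_iff intro: exI[of _ "x \<bullet> e2"])
      ultimately show ?thesis using dim_line[OF nz(2), of e1] by metis
    qed
    have sl: "sorted_list_of_set {op_norm A, sing2 A} = [sing2 A, op_norm A]"
    proof -
      have "sorted_wrt (<) [sing2 A, op_norm A] \<and> set [sing2 A, op_norm A] = {op_norm A, sing2 A}
          \<and> length [sing2 A, op_norm A] = card {op_norm A, sing2 A}"
        using lt False by auto
      then show ?thesis using sorted_list_of_set_unique[of "{op_norm A, sing2 A}"] by blast
    qed
    have "singular_values A = concat (map (\<lambda>s. replicate (dim (singular_space A s)) s) (rev [sing2 A, op_norm A]))"
      unfolding singular_values_def set sl ..
    then show ?thesis by (simp add: d1 d2)
  qed
  then show "sing_val 1 A = op_norm A" "sing_val 2 A = sing2 A" "sing_val 0 A = op_norm A"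
    by (simp_all add: sing_val_def)
qed


section \<open>The singular value function\<close>

text \<open>The singular value function on 0 \<le> s \<le> 2 without floors: the exponents are
  continuous in \<open>s\<close> and ln \<open>phi\<close> is linear in them. For s > 2 it departs
  from \<open>sing_val_fun\<close>, but it still serves as a weight in covering sums.\<close>

definition phi :: "real \<Rightarrow> real^2^2 \<Rightarrow> real"
  where "phi s A = op_norm A powr min s 1 * sing2 A powr max (s - 1) 0"

lemma phi_pos: "det A \<noteq> 0 \<Longrightarrow> 0 < phi s A"
  unfolding phi_def using det_nonzero_op_norm_pos[of A] sing2_pos[of A] by simp

lemma ln_phi:
  assumes "det A \<noteq> 0"
  shows "ln (phi s A) = min s 1 * ln (op_norm A) + max (s - 1) 0 * ln (sing2 A)"
  unfolding phi_def using det_nonzero_op_norm_pos[OF assms] sing2_pos[OF assms]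
  by (simp add: ln_mult ln_powr)

lemma ln_sing2:
  assumes "det A \<noteq> 0" shows "ln (sing2 A) = ln \<bar>det A\<bar> - ln (op_norm A)"
  unfolding sing2_def using det_nonzero_op_norm_pos[OF assms] assms by (simp add: ln_div)

lemma sing_val_fun_eq_phi:
  fixes A :: "real^2^2"
  assumes d: "det A \<noteq> 0" and s: "0 \<le> s" "s \<le> 2"
  shows "sing_val_fun s A = phi s A"
proof -
  have p: "0 < op_norm A" "0 < sing2 A" using d by (auto intro: det_nonzero_op_norm_pos sing2_pos)
  note sv = sing_val_planar[OF d]
  consider "s = 0" | "0 < s" "s < 1" | "s = 1" | "1 < s" "s < 2" | "s = 2" using s by linarith
  then show ?thesis
  proof cases
    case 1 then show ?thesis using p sv by (simp add: sing_val_fun_def phi_def)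
  next
    case 2
    then have "\<lfloor>s\<rfloor> = 0" "\<lceil>s\<rceil> = 1" by linarith+
    then show ?thesis using p sv 2 by (simp add: sing_val_fun_def phi_def)
  next
    case 3 then show ?thesis using p sv by (simp add: sing_val_fun_def phi_def)
  next
    case 4
    then have "\<lfloor>s\<rfloor> = 1" "\<lceil>s\<rceil> = 2" by linarith+
    then show ?thesis using p sv 4 by (simp add: sing_val_fun_def phi_def)
  next
    case 5 then show ?thesis using p sv by (simp add: sing_val_fun_def phi_def numeral_2_eq_2)
  qed
qed

lemma sing_val_fun_gt_2: "2 < s \<Longrightarrow> sing_val_fun s (A :: real^2^2) = \<bar>det A\<bar> powr (s / 2)"
  by (simp add: sing_val_fun_def)

lemma ln_op_norm_mult_le:
  assumes "det A \<noteq> 0" "det (B :: real^2^2) \<noteq> 0"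
  shows "ln (op_norm (A ** B)) \<le> ln (op_norm A) + ln (op_norm B)"
proof -
  have "0 < op_norm (A ** B)" using assms by (intro det_nonzero_op_norm_pos) (simp add: det_mul)
  then have "ln (op_norm (A ** B)) \<le> ln (op_norm A * op_norm B)"
    using op_norm_mult_le[of A B] by simp
  then show ?thesis using assms[THEN det_nonzero_op_norm_pos] by (simp add: ln_mult_pos)
qed

lemma sing2_mult_ge:
  assumes "det A \<noteq> 0" "det (B :: real^2^2) \<noteq> 0"
  shows "sing2 A * sing2 B \<le> sing2 (A ** B)"
proof -
  have "ln (sing2 A * sing2 B) \<le> ln (sing2 (A ** B))"
    using assms ln_op_norm_mult_le[OF assms] sing2_pos[of A] sing2_pos[of B]
    by (simp add: ln_sing2 det_mul abs_mult ln_mult_pos)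
  then show ?thesis using assms sing2_pos[of A] sing2_pos[of B] sing2_pos[of "A ** B"]
    by (simp add: det_mul)
qed

text \<open>The logarithm is \<open>l\<close> times ln of the norm plus a multiple of ln
  \<bar>det\<bar>. The determinant is multiplicative and the norm submultiplicative, and
  \<open>l\<close> \<ge> 0 because 0 \<le> s \<le> 2.\<close>

lemma phi_mult_le:
  assumes "det A \<noteq> 0" "det (B :: real^2^2) \<noteq> 0" "0 \<le> s" "s \<le> 2"
  shows "phi s (A ** B) \<le> phi s A * phi s B"
proof -
  have d: "det (A ** B) \<noteq> 0" using assms by (simp add: det_mul)
  define l where "l = min s 1 - max (s - 1) 0"
  have l: "0 \<le> l" using assms unfolding l_def by auto
  have *: "ln (phi s M) = l * ln (op_norm M) + max (s - 1) 0 * ln \<bar>det M\<bar>" if "det M \<noteq> 0" for M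
    using ln_phi[OF that] ln_sing2[OF that] by (simp add: l_def algebra_simps)
  have pos: "0 < phi s A" "0 < phi s B" "0 < phi s (A ** B)" using assms d by (auto intro: phi_pos)
  have "ln (phi s A * phi s B) = l * (ln (op_norm A) + ln (op_norm B)) + max (s - 1) 0 * (ln \<bar>det A\<bar> + ln \<bar>det B\<bar>)"
    using pos by (simp add: ln_mult_pos *[OF assms(1)] *[OF assms(2)] algebra_simps)
  moreover have "ln \<bar>det (A ** B)\<bar> = ln \<bar>det A\<bar> + ln \<bar>det B\<bar>"
    using assms by (simp add: det_mul abs_mult ln_mult_pos)
  ultimately have "ln (phi s (A ** B)) \<le> ln (phi s A * phi s B)"
    using mult_left_mono[OF ln_op_norm_mult_le[OF assms(1,2)] l] *[OF d] by simp
  then show ?thesis using pos by simp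
qed

text \<open>The increment splits as \<open>t = u + v\<close> with \<open>u\<close> going to the
  larger and \<open>v\<close> to the smaller singular value; the bounds give all of it to one of
  them.\<close>

lemma phi_add_bounds:
  assumes d: "det A \<noteq> 0" and t: "0 \<le> t"
  shows "phi (s + t) A \<le> phi s A * op_norm A powr t" "phi s A * sing2 A powr t \<le> phi (s + t) A"
proof -
  have p: "0 < op_norm A" "0 < sing2 A" using d by (auto intro: det_nonzero_op_norm_pos sing2_pos)
  have le: "ln (sing2 A) \<le> ln (op_norm A)" using sing2_le_op_norm[OF d] p by simp
  define u v where "u = min (s + t) 1 - min s 1" and "v = max (s + t - 1) 0 - max (s - 1) 0"
  have uv: "u \<ge> 0" "v \<ge> 0" "t = u + v" using t unfolding u_def v_def by auto
  have *: "ln (phi (s + t) A) = ln (phi s A) + u * ln (op_norm A) + v * ln (sing2 A)"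
    unfolding ln_phi[OF d] u_def v_def by (simp add: algebra_simps)
  have pos: "0 < phi s A" "0 < phi (s + t) A" using phi_pos[OF d] by auto
  have "ln (phi s A * op_norm A powr t) = ln (phi s A) + t * ln (op_norm A)"
    using p pos by (simp add: ln_mult_pos ln_powr)
  moreover have "u * ln (op_norm A) + v * ln (sing2 A) \<le> t * ln (op_norm A)"
    using mult_left_mono[OF le uv(2)] unfolding uv(3) by (simp add: algebra_simps)
  ultimately have "ln (phi (s + t) A) \<le> ln (phi s A * op_norm A powr t)"
    using * by linarith
  then show "phi (s + t) A \<le> phi s A * op_norm A powr t"
    using p pos by simp
  have "ln (phi s A * sing2 A powr t) = ln (phi s A) + t * ln (sing2 A)"
    using p pos by (simp add: ln_mult_pos ln_powr)
  moreover have "t * ln (sing2 A) \<le> u * ln (op_norm A) + v * ln (sing2 A)"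
    using mult_left_mono[OF le uv(1)] unfolding uv(3) by (simp add: algebra_simps)
  ultimately have "ln (phi s A * sing2 A powr t) \<le> ln (phi (s + t) A)"
    using * by linarith
  then show "phi s A * sing2 A powr t \<le> phi (s + t) A"
    using p pos by simp
qed

lemma phi_0: "det A \<noteq> 0 \<Longrightarrow> phi 0 A = 1"
  unfolding phi_def using det_nonzero_op_norm_pos[of A] sing2_pos[of A] by simp

lemma phi_2: "det A \<noteq> 0 \<Longrightarrow> phi 2 A = \<bar>det A\<bar>"
  unfolding phi_def using det_nonzero_op_norm_pos[of A] sing2_pos[of A] op_norm_times_sing2[of A]
  by simp


section \<open>Sums over words and the pressure\<close>

text \<open>Fekete's lemma; the linear lower bound keeps the infimum finite.\<close>

lemma subadditive_convergent:
  fixes a :: "nat \<Rightarrow> real"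
  assumes sub: "\<And>m n. a (m + n) \<le> a m + a n" and low: "\<And>n. - c * real n \<le> a n"
  obtains L where "(\<lambda>n. a n / real n) \<longlonglongrightarrow> L" "\<And>n. n \<ge> 1 \<Longrightarrow> L \<le> a n / real n"
proof -
  define S where "S = (\<lambda>n. a n / real n) ` {1..}"
  define L where "L = Inf S"
  have bdd: "bdd_below S"
  proof (rule bdd_belowI)
    fix x assume "x \<in> S"
    then obtain n where "n \<ge> 1" "x = a n / real n" unfolding S_def by auto
    then show "- c \<le> x" using low[of n] by (simp add: pos_le_divide_eq)
  qed
  have le: "L \<le> a n / real n" if "n \<ge> 1" for n
    unfolding L_def by (rule cInf_lower) (use that bdd S_def in auto)
  have mult: "a (q * m + k) \<le> real q * a m + a k" for q m k
  proof (induction q)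
    case (Suc q)
    have "a (Suc q * m + k) = a (m + (q * m + k))" by (simp add: algebra_simps)
    also have "\<dots> \<le> a m + a (q * m + k)" by (rule sub)
    finally show ?case using Suc by (simp add: algebra_simps)
  qed simp
  have "(\<lambda>n. a n / real n) \<longlonglongrightarrow> L"
  proof (rule LIMSEQ_I)
    fix e :: real assume e: "e > 0"
    have "L < L + e / 2" "S \<noteq> {}" using e by (auto simp: S_def)
    then obtain m where m: "m \<ge> 1" "a m / real m < L + e / 2"
      using cInf_lessD[of S "L + e / 2"] unfolding L_def S_def by auto
    \<comment> \<open>After division of \<open>n\<close> by \<open>m\<close>, the first summand pays
      for replacing the quotient by \<open>n / m\<close>, the second for the remainder
      block.\<close>
    define B where "B = \<bar>a m\<bar> + (\<Sum>k<m. \<bar>a k\<bar>)"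
    have B: "a n / real n \<le> a m / real m + B / real n" if "n \<ge> 1" for n
    proof -
      define q k where "q = n div m" and "k = n mod m"
      have n: "n = q * m + k" and k: "k < m" using m by (simp_all add: q_def k_def)
      have "\<bar>a k\<bar> \<le> (\<Sum>k<m. \<bar>a k\<bar>)" by (rule member_le_sum) (use k in auto)
      then have 1: "a n \<le> real q * a m + (\<Sum>k<m. \<bar>a k\<bar>)" using mult[of q m k] n by simp
      have "real q = real n / real m - real k / real m" using n m by (simp add: field_simps)
      then have "real q * a m = real n * (a m / real m) - (real k / real m) * a m"
        by (simp only: left_diff_distrib) simp
      moreover have "- ((real k / real m) * a m) \<le> \<bar>a m\<bar>"
      proof -
        have "\<bar>(real k / real m) * a m\<bar> \<le> 1 * \<bar>a m\<bar>"
          unfolding abs_mult using k by (intro mult_right_mono) auto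
        then show ?thesis by linarith
      qed
      ultimately have "a n \<le> real n * (a m / real m) + B" using 1 unfolding B_def by linarith
      then show ?thesis using that by (simp add: field_simps)
    qed
    obtain N :: nat where N: "real N > 2 * B / e" using reals_Archimedean2 by blast
    have "norm (a n / real n - L) < e" if "n \<ge> Suc N" for n
    proof -
      have n: "n \<ge> 1" "real n > 2 * B / e" using that N by auto
      then have "B / real n < e / 2" using e by (simp add: field_simps)
      then have "\<bar>a n / real n - L\<bar> < e" using B[OF n(1)] le[OF n(1)] m(2) by linarith
      then show ?thesis by simp
    qed
    then show "\<exists>no. \<forall>n\<ge>no. norm (a n / real n - L) < e" by blast
  qed
  with le that show ?thesis by blast
qed

lemma finite_words: "finite {w :: 'n::finite list. length w = n}"
  using finite_lists_length_eq[of "UNIV :: 'n set" n] by simp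

lemma sum_words_Suc:
  "(\<Sum>w\<in>{w :: 'n::finite list. length w = Suc n}. f w) = (\<Sum>i\<in>UNIV. \<Sum>w\<in>{w. length w = n}. f (i # w))"
proof -
  have "{w :: 'n list. length w = Suc n} = (\<lambda>(i, w). i # w) ` (UNIV \<times> {w. length w = n})"
    by (auto simp: length_Suc_conv image_iff)
  moreover have "inj_on (\<lambda>(i, w). i # w) (UNIV \<times> {w :: 'n list. length w = n})"
    by (auto simp: inj_on_def)
  ultimately show ?thesis
    by (simp add: sum.reindex sum.cartesian_product split_beta')
qed

lemma sum_words_add:
  "(\<Sum>w\<in>{w :: 'n::finite list. length w = m + n}. f w)
    = (\<Sum>u\<in>{u. length u = m}. \<Sum>w\<in>{w. length w = n}. f (u @ w))"
proof (induction m arbitrary: f)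
  case 0
  have "{u :: 'n list. length u = 0} = {[]}" by auto
  then show ?case by simp
next
  case (Suc m)
  then show ?case by (simp add: sum_words_Suc)
qed

lemma sum_words_prod:
  fixes f :: "'n::finite \<Rightarrow> real"
  shows "(\<Sum>w\<in>{w. length w = n}. prod_list (map f w)) = (\<Sum>i\<in>UNIV. f i) ^ n"
proof (induction n)
  case 0
  have "{u :: 'n list. length u = 0} = {[]}" by auto
  then show ?case by simp
next
  case (Suc n)
  then show ?case by (simp add: sum_words_Suc sum_distrib_left[symmetric] sum_distrib_right[symmetric])
qed

lemma word_matrix_simps [simp]:
  "word_matrix A [] = mat 1" "word_matrix A (i # w) = A $ i ** word_matrix A w"
  by (simp_all add: word_matrix_def)

lemma word_matrix_append: "word_matrix A (u @ w) = word_matrix A u ** word_matrix A w"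
  by (induction u) (simp_all add: matrix_mul_assoc)

lemma length_prefix_word [simp]: "length (prefix_word \<omega> n) = n"
  by (simp add: prefix_word_def)

lemma prefix_word_0 [simp]: "prefix_word \<omega> 0 = []"
  by (simp add: prefix_word_def)

lemma prefix_word_Suc: "prefix_word \<omega> (Suc n) = prefix_word \<omega> n @ [\<omega> n]"
  by (simp add: prefix_word_def)

lemma prefix_word_add: "prefix_word \<omega> (m + n) = prefix_word \<omega> m @ prefix_word (\<lambda>k. \<omega> (m + k)) n"
  by (induction n) (simp_all add: prefix_word_Suc)

lemma prefix_word_eq_iff: "prefix_word \<omega> n = prefix_word \<omega>' n \<longleftrightarrow> (\<forall>k<n. \<omega> k = \<omega>' k)"
  by (auto simp: prefix_word_def)

section \<open>Contracting tuples and their pressure\<close>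

text \<open>The bound \<open>r\<close> is a parameter and not the largest norm: tuples from one open
  family then share it, and all constants derived from it.\<close>

locale contracting_tuple =
  fixes A :: "real^2^2^'n" and r :: real
  assumes det_nz [simp]: "\<And>i. det (A $ i) \<noteq> 0"
    and r_pos: "0 < r" and r_less: "r < 1"
    and op_norm_le_r: "\<And>i. op_norm (A $ i) \<le> r"
begin

lemma det_word_nz [simp]: "det (word_matrix A w) \<noteq> 0"
  by (induction w) (simp_all add: det_mul)

lemma op_norm_word_le: "op_norm (word_matrix A w) \<le> r ^ length w"
proof (induction w)
  case (Cons i w)
  have "op_norm (word_matrix A (i # w)) \<le> op_norm (A $ i) * op_norm (word_matrix A w)"
    by (simp add: op_norm_mult_le)
  also have "\<dots> \<le> r * r ^ length w"
    using r_pos by (intro mult_mono Cons op_norm_le_r op_norm_nonneg) auto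
  finally show ?case by simp
qed (simp add: op_norm_mat_1)

lemma op_norm_word_le_1: "op_norm (word_matrix A w) \<le> 1"
  using op_norm_word_le[of w] power_le_one[of r "length w"] r_pos r_less by linarith

definition a where "a = Min (range (\<lambda>i. sing2 (A $ i)))"

lemma a_pos: "0 < a"
  unfolding a_def by (simp add: sing2_pos)

lemma a_le: "a \<le> sing2 (A $ i)"
  unfolding a_def by (rule Min_le) auto

lemma a_le_r: "a \<le> r"
  using a_le[of undefined] sing2_le_op_norm[OF det_nz, of undefined] op_norm_le_r[of undefined] by linarith

lemma sing2_mat_1: "sing2 (mat 1) = 1"
  by (simp add: sing2_def op_norm_mat_1)

lemma sing2_word_ge: "a ^ length w \<le> sing2 (word_matrix A w)"
proof (induction w)
  case (Cons i w)
  have "a * a ^ length w \<le> sing2 (A $ i) * sing2 (word_matrix A w)"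
    using a_pos a_le sing2_pos[OF det_nz, of i] by (intro mult_mono Cons) auto
  also have "\<dots> \<le> sing2 (A $ i ** word_matrix A w)" by (rule sing2_mult_ge) auto
  finally show ?case by simp
qed (simp add: sing2_mat_1)

text \<open>The partition sum whose exponential growth rate is the pressure, with \<open>phi\<close>
  as weight.\<close>

definition Z where "Z s n = (\<Sum>w\<in>{w. length w = n}. phi s (word_matrix A w))"

lemma Z_pos: "0 < Z s n"
  unfolding Z_def
proof (rule sum_pos)
  have "replicate n undefined \<in> {w :: 'n list. length w = n}" by simp
  then show "{w :: 'n list. length w = n} \<noteq> {}" by blast
qed (auto simp: finite_words phi_pos)

lemma Z_mult_le: "0 \<le> s \<Longrightarrow> s \<le> 2 \<Longrightarrow> Z s (m + n) \<le> Z s m * Z s n"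
  unfolding Z_def sum_words_add sum_product
  by (intro sum_mono) (simp add: word_matrix_append phi_mult_le)

lemma Z_add_bounds:
  assumes "0 \<le> t"
  shows "Z (s + t) n \<le> Z s n * r powr (t * n)" "Z s n * a powr (t * n) \<le> Z (s + t) n"
proof -
  have "phi (s + t) (word_matrix A w) \<le> phi s (word_matrix A w) * r powr (t * n)"
    if "length w = n" for w
  proof -
    have "op_norm (word_matrix A w) powr t \<le> (r ^ n) powr t"
      using op_norm_word_le[of w] that assms op_norm_nonneg by (intro powr_mono2) auto
    also have "\<dots> = r powr (t * n)" using r_pos by (simp add: powr_realpow[symmetric] powr_powr mult.commute)
    finally have "phi s (word_matrix A w) * op_norm (word_matrix A w) powr t \<le> phi s (word_matrix A w) * r powr (t * n)"
      using phi_pos[OF det_word_nz, of s w] by (intro mult_left_mono) auto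
    then show ?thesis using phi_add_bounds(1)[OF det_word_nz assms, of s w] by linarith
  qed
  then show "Z (s + t) n \<le> Z s n * r powr (t * n)"
    unfolding Z_def sum_distrib_right by (intro sum_mono) auto
  have "phi s (word_matrix A w) * a powr (t * n) \<le> phi (s + t) (word_matrix A w)"
    if "length w = n" for w
  proof -
    have "a powr (t * n) = (a ^ n) powr t" using a_pos by (simp add: powr_realpow[symmetric] powr_powr mult.commute)
    also have "\<dots> \<le> sing2 (word_matrix A w) powr t"
      using sing2_word_ge[of w] that assms a_pos by (intro powr_mono2) auto
    finally have "phi s (word_matrix A w) * a powr (t * n) \<le> phi s (word_matrix A w) * sing2 (word_matrix A w) powr t"
      using phi_pos[OF det_word_nz, of s w] by (intro mult_left_mono) auto
    then show ?thesis using phi_add_bounds(2)[OF det_word_nz assms, of s w] by linarith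
  qed
  then show "Z s n * a powr (t * n) \<le> Z (s + t) n"
    unfolding Z_def sum_distrib_right by (intro sum_mono) auto
qed

lemma Z_0: "Z 0 n = real CARD('n) ^ n"
proof -
  have "prod_list (map (\<lambda>i. 1 :: real) w) = 1" for w :: "'n list" by (induction w) auto
  then show ?thesis using sum_words_prod[of "\<lambda>i :: 'n. 1" n] unfolding Z_def phi_0[OF det_word_nz] by simp
qed

lemma Z_2: "Z 2 n = (\<Sum>i\<in>UNIV. \<bar>det (A $ i)\<bar>) ^ n"
proof -
  have "\<bar>det (word_matrix A w)\<bar> = prod_list (map (\<lambda>i. \<bar>det (A $ i)\<bar>) w)" for w
    by (induction w) (simp_all add: abs_mult det_mul)
  then show ?thesis using sum_words_prod[of "\<lambda>i. \<bar>det (A $ i)\<bar>" n]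
    unfolding Z_def phi_2[OF det_word_nz] by simp
qed

text \<open>\<open>pressure\<close> is a bare \<open>lim\<close>; Fekete's lemma, applied to ln of
  the partition sums, shows that the limit exists and is an infimum.\<close>

lemma pressure_LIMSEQ:
  assumes "0 \<le> s" "s \<le> 2"
  shows "(\<lambda>n. ln (Z s n) / real n) \<longlonglongrightarrow> pressure A s"
    and "\<And>n. n \<ge> 1 \<Longrightarrow> pressure A s \<le> ln (Z s n) / real n"
proof -
  have sub: "ln (Z s (m + n)) \<le> ln (Z s m) + ln (Z s n)" for m n
  proof -
    have "ln (Z s (m + n)) \<le> ln (Z s m * Z s n)" by (intro ln_mono Z_mult_le assms Z_pos)
    then show ?thesis using Z_pos[of s m] Z_pos[of s n] by (simp add: ln_mult_pos)
  qed
  have low: "- (- (s * ln a)) * real n \<le> ln (Z s n)" for n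
  proof -
    have "1 * a powr (s * n) \<le> Z 0 n * a powr (s * n)"
      unfolding Z_0 by (intro mult_right_mono) auto
    also have "\<dots> \<le> Z s n" using Z_add_bounds(2)[OF assms(1), of 0 n] by simp
    finally have "ln (a powr (s * n)) \<le> ln (Z s n)" using a_pos by (intro ln_mono) auto
    then show ?thesis using a_pos by (simp add: ln_powr algebra_simps)
  qed
  obtain L where L: "(\<lambda>n. ln (Z s n) / real n) \<longlonglongrightarrow> L" "\<And>n. n \<ge> 1 \<Longrightarrow> L \<le> ln (Z s n) / real n"
    using subadditive_convergent[of "\<lambda>n. ln (Z s n)", OF sub low] by blast
  have "pressure A s = lim (\<lambda>n. ln (Z s n) / real n)"
    unfolding pressure_def Z_def using assms by (simp add: sing_val_fun_eq_phi)
  also have "\<dots> = L" using L(1) by (rule limI)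
  finally show "(\<lambda>n. ln (Z s n) / real n) \<longlonglongrightarrow> pressure A s"
    "\<And>n. n \<ge> 1 \<Longrightarrow> pressure A s \<le> ln (Z s n) / real n" using L by auto
qed

text \<open>The slopes lie between ln a and ln r < 0: the upper bound gives strict decrease, both
  together give Lipschitz continuity.\<close>

lemma pressure_add_bounds:
  assumes "0 \<le> s" "0 \<le> t" "s + t \<le> 2"
  shows "pressure A (s + t) \<le> pressure A s + t * ln r" "pressure A s + t * ln a \<le> pressure A (s + t)"
proof -
  have l1: "(\<lambda>n. ln (Z s n) / real n) \<longlonglongrightarrow> pressure A s"
    and l2: "(\<lambda>n. ln (Z (s + t) n) / real n) \<longlonglongrightarrow> pressure A (s + t)"
    using assms by (auto intro!: pressure_LIMSEQ)
  have "ln (Z (s + t) n) / real n \<le> ln (Z s n) / real n + t * ln r" if "n \<ge> 1" for n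
  proof -
    have "ln (Z (s + t) n) \<le> ln (Z s n * r powr (t * n))"
      by (intro ln_mono Z_add_bounds assms Z_pos)
    also have "\<dots> = ln (Z s n) + t * n * ln r" using Z_pos[of s n] r_pos by (simp add: ln_mult_pos ln_powr)
    finally have "ln (Z (s + t) n) / real n \<le> ln (Z s n) / real n + t * n * ln r / real n"
      using that by (simp only: add_divide_distrib[symmetric] divide_right_mono of_nat_0_le_iff)
    then show ?thesis using that by simp
  qed
  then show "pressure A (s + t) \<le> pressure A s + t * ln r"
    by (intro tendsto_le[OF _ tendsto_add[OF l1 tendsto_const] l2]) (auto simp: eventually_sequentially)
  have "ln (Z s n) / real n + t * ln a \<le> ln (Z (s + t) n) / real n" if "n \<ge> 1" for n
  proof -
    have "ln (Z s n) + t * n * ln a = ln (Z s n * a powr (t * n))"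
      using Z_pos[of s n] a_pos by (simp add: ln_mult_pos ln_powr)
    also have "\<dots> \<le> ln (Z (s + t) n)"
      using Z_pos[of s n] a_pos by (intro ln_mono Z_add_bounds assms) auto
    finally have "ln (Z s n) / real n + t * n * ln a / real n \<le> ln (Z (s + t) n) / real n"
      using that by (simp only: add_divide_distrib[symmetric] divide_right_mono of_nat_0_le_iff)
    then show ?thesis using that by simp
  qed
  then show "pressure A s + t * ln a \<le> pressure A (s + t)"
    by (intro tendsto_le[OF _ l2 tendsto_add[OF l1 tendsto_const]]) (auto simp: eventually_sequentially)
qed

lemma pressure_0: "pressure A 0 = ln (real CARD('n))"
proof -
  have "\<forall>\<^sub>F n in sequentially. ln (Z 0 n) / real n = ln (real CARD('n))"
    using eventually_gt_at_top[of 0] by eventually_elim (simp add: Z_0 ln_realpow)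
  then have "(\<lambda>n. ln (Z 0 n) / real n) \<longlonglongrightarrow> ln (real CARD('n))" by (rule tendsto_eventually)
  then show ?thesis using pressure_LIMSEQ(1)[of 0] LIMSEQ_unique by fastforce
qed

lemma sum_det_pos: "0 < (\<Sum>i\<in>UNIV. \<bar>det (A $ i)\<bar>)"
  by (rule sum_pos) auto

lemma pressure_2: "pressure A 2 = ln (\<Sum>i\<in>UNIV. \<bar>det (A $ i)\<bar>)"
proof -
  have "\<forall>\<^sub>F n in sequentially. ln (Z 2 n) / real n = ln (\<Sum>i\<in>UNIV. \<bar>det (A $ i)\<bar>)"
    using eventually_gt_at_top[of 0] by eventually_elim (use sum_det_pos in \<open>simp add: Z_2 ln_realpow\<close>)
  then have "(\<lambda>n. ln (Z 2 n) / real n) \<longlonglongrightarrow> ln (\<Sum>i\<in>UNIV. \<bar>det (A $ i)\<bar>)" by (rule tendsto_eventually)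
  then show ?thesis using pressure_LIMSEQ(1)[of 2] LIMSEQ_unique by fastforce
qed

text \<open>The \<open>THE\<close> in \<open>affinity_dim\<close> ranges over all s \<ge> 0, so
  zeros beyond 2 must be excluded. There the weight is multiplicative, the sums are powers of one
  number \<open>D\<close>, and \<bar>det\<bar> < 1 makes \<open>D\<close> smaller than the sum of
  the determinants.\<close>

lemma pressure_gt_2_neg:
  assumes "2 < s" "(\<Sum>i\<in>UNIV. \<bar>det (A $ i)\<bar>) \<le> 1"
  shows "pressure A s < 0"
proof -
  define D where "D = (\<Sum>i\<in>UNIV. \<bar>det (A $ i)\<bar> powr (s / 2))"
  have Dpos: "0 < D" unfolding D_def by (rule sum_pos) auto
  have "\<bar>det (A $ i)\<bar> powr (s / 2) < \<bar>det (A $ i)\<bar>" for i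
  proof -
    have "\<bar>det (A $ i)\<bar> = op_norm (A $ i) * sing2 (A $ i)" by (simp add: op_norm_times_sing2)
    also have "\<dots> \<le> r * r" using sing2_le_op_norm[OF det_nz, of i] op_norm_le_r[of i] r_pos sing2_pos[OF det_nz, of i]
      by (intro mult_mono) auto
    also have "\<dots> < 1" using r_pos r_less mult_strict_mono[of r 1 r 1] by simp
    finally have "\<bar>det (A $ i)\<bar> < 1" .
    then have "\<bar>det (A $ i)\<bar> powr (s / 2) < \<bar>det (A $ i)\<bar> powr 1"
      using assms by (intro powr_less_mono') auto
    then show ?thesis by simp
  qed
  then have D: "D < (\<Sum>i\<in>UNIV. \<bar>det (A $ i)\<bar>)" unfolding D_def by (intro sum_strict_mono) auto
  have "(\<Sum>w\<in>{w. length w = n}. sing_val_fun s (word_matrix A w)) = D ^ n" for n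
  proof -
    have "\<bar>det (word_matrix A w)\<bar> powr (s / 2) = prod_list (map (\<lambda>i. \<bar>det (A $ i)\<bar> powr (s / 2)) w)" for w
      by (induction w) (simp_all add: det_mul abs_mult powr_mult)
    then show ?thesis using sum_words_prod[of "\<lambda>i. \<bar>det (A $ i)\<bar> powr (s / 2)" n]
      unfolding D_def by (simp add: sing_val_fun_gt_2[OF assms(1)])
  qed
  then have "pressure A s = lim (\<lambda>n. ln (D ^ n) / real n)" unfolding pressure_def by simp
  moreover have "\<forall>\<^sub>F n in sequentially. ln (D ^ n) / real n = ln D"
    using eventually_gt_at_top[of 0] by eventually_elim (use Dpos in \<open>simp add: ln_realpow\<close>)
  then have "(\<lambda>n. ln (D ^ n) / real n) \<longlonglongrightarrow> ln D" by (rule tendsto_eventually)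
  ultimately have "pressure A s = ln D" by (simp add: limI)
  then show ?thesis using D assms Dpos by simp
qed

lemma pressure_strict: "0 \<le> s \<Longrightarrow> s < t \<Longrightarrow> t \<le> 2 \<Longrightarrow> pressure A t < pressure A s"
  using pressure_add_bounds(1)[of s "t - s"] r_pos r_less
    mult_pos_neg[of "t - s" "ln r"] by simp

text \<open>The determinant bound means that the pressure at 2 is at most 0. The intermediate value
  theorem then finds the zero in [0,2], and the minimum with 2 does not change it.\<close>

lemma affinity_dim_zero:
  assumes N: "CARD('n) \<ge> 2" and D: "(\<Sum>i\<in>UNIV. \<bar>det (A $ i)\<bar>) \<le> 1"
  shows "0 < affinity_dim A" "affinity_dim A \<le> 2" "pressure A (affinity_dim A) = 0"
proof -
  have P0: "pressure A 0 > 0" unfolding pressure_0 using N by simp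
  have P2: "pressure A 2 \<le> 0" unfolding pressure_2 using D sum_det_pos by simp
  have "continuous_on {0..2} (pressure A)"
  proof (rule continuous_onI)
    fix x e :: real assume x: "x \<in> {0..2}" and e: "0 < e"
    have bnd: "\<bar>pressure A y - pressure A x\<bar> \<le> \<bar>y - x\<bar> * - ln a" if "x \<in> {0..2}" "y \<in> {0..2}" "x \<le> y" for x y
      using pressure_add_bounds[of x "y - x"] that r_pos r_less mult_nonneg_nonpos[of "y - x" "ln r"] by auto
    have la: "0 < - ln a" using a_pos a_le_r r_less by simp
    show "\<exists>d>0. \<forall>x'\<in>{0..2}. dist x' x < d \<longrightarrow> dist (pressure A x') (pressure A x) \<le> e"
    proof (intro exI[of _ "e / - ln a"] conjI ballI impI)
      show "0 < e / - ln a" using e la by (rule divide_pos_pos)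
      fix y :: real assume y: "y \<in> {0..2}" "dist y x < e / - ln a"
      have "\<bar>pressure A y - pressure A x\<bar> \<le> \<bar>y - x\<bar> * - ln a"
        using bnd[of x y] bnd[of y x] x y by (cases "x \<le> y") (auto simp: abs_minus_commute)
      also have "\<dots> \<le> e" using y la by (simp add: dist_real_def field_simps)
      finally show "dist (pressure A y) (pressure A x) \<le> e" by (simp add: dist_real_def)
    qed
  qed
  then obtain s where s: "0 \<le> s" "s \<le> 2" "pressure A s = 0"
    using IVT2'[of "pressure A" 2 0 0] P0 P2 by auto
  have uniq: "s' = s" if "0 \<le> s'" "pressure A s' = 0" for s'
    using that s pressure_gt_2_neg[of s'] D pressure_strict[of s s'] pressure_strict[of s' s]
    by (cases s' s rule: linorder_cases; cases "s' > 2") auto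
  have "(THE s. 0 \<le> s \<and> pressure A s = 0) = s" using s(1,3) uniq by (intro the_equality) blast+
  then have "affinity_dim A = s" unfolding affinity_dim_def using s by simp
  then show "0 < affinity_dim A" "affinity_dim A \<le> 2" "pressure A (affinity_dim A) = 0"
    using s P0 by (auto simp: less_le)
qed

end


section \<open>The self-affine set as the image of the natural projection\<close>

definition seq_shift :: "nat \<Rightarrow> (nat \<Rightarrow> 'n) \<Rightarrow> nat \<Rightarrow> 'n"
  where "seq_shift n \<omega> = (\<lambda>k. \<omega> (n + k))"

lemma prefix_word_drop: "prefix_word \<omega> (m + n) = prefix_word \<omega> m @ prefix_word (seq_shift m \<omega>) n"
  unfolding seq_shift_def by (rule prefix_word_add)

lemma seq_shift_0 [simp]: "seq_shift 0 \<omega> = \<omega>"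
  by (simp add: seq_shift_def)

lemma seq_shift_seq_shift: "seq_shift m (seq_shift n \<omega>) = seq_shift (n + m) \<omega>"
  by (simp add: seq_shift_def add.assoc)

lemma norm_le_max_vec_norm: "norm (v $ i) \<le> max_vec_norm v"
  unfolding max_vec_norm_def by (rule Max_ge) auto

lemma max_vec_norm_nonneg: "0 \<le> max_vec_norm v"
  using norm_le_max_vec_norm[of v undefined] norm_ge_zero[of "v $ undefined"] by linarith

definition word_map :: "real^2^2^'n \<Rightarrow> real^2^'n \<Rightarrow> 'n list \<Rightarrow> real^2 \<Rightarrow> real^2"
  where "word_map A v w x = foldr (\<lambda>i y. A $ i *v y + v $ i) w x"

lemma word_map_simps [simp]:
  "word_map A v [] x = x" "word_map A v (i # w) x = A $ i *v word_map A v w x + v $ i"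
  by (simp_all add: word_map_def)

lemma word_map_append: "word_map A v (u @ w) x = word_map A v u (word_map A v w x)"
  by (simp add: word_map_def)

lemma word_map_affine: "word_map A v w x = word_map A v w 0 + word_matrix A w *v x"
  by (induction w) (simp_all add: matrix_vector_mul_assoc[symmetric] matrix_vector_right_distrib)

lemma word_map_diff: "word_map A v w x - word_map A v w y = word_matrix A w *v (x - y)"
  using word_map_affine[of A v w x] word_map_affine[of A v w y]
  by (simp add: matrix_vector_mult_diff_distrib)

lemma word_map_prefix:
  "word_map A v (prefix_word \<omega> n) x
    = (\<Sum>k<n. word_matrix A (prefix_word \<omega> k) *v (v $ \<omega> k)) + word_matrix A (prefix_word \<omega> n) *v x"
proof (induction n arbitrary: x)
  case (Suc n)
  show ?case
    by (simp add: prefix_word_Suc word_map_append Suc word_matrix_append matrix_vector_right_distrib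
        matrix_vector_mul_assoc[symmetric] add_ac)
qed simp

context contracting_tuple
begin

lemma norm_word_le: "norm (word_matrix A w *v x) \<le> r ^ length w * norm x"
  using op_norm_ge[of "word_matrix A w" x] mult_right_mono[OF op_norm_word_le[of w] norm_ge_zero[of x]]
  by linarith

text \<open>The closed ball of this radius about 0 is mapped into itself by every map of the
  system.\<close>

definition rad where "rad v = max_vec_norm v / (1 - r)"

lemma rad_nonneg: "0 \<le> rad v"
  unfolding rad_def using r_less by (intro divide_nonneg_pos max_vec_norm_nonneg) simp

lemma natural_proj_term_le:
  "norm (word_matrix A (prefix_word \<omega> k) *v (v $ \<omega> k)) \<le> r ^ k * max_vec_norm v"
  using norm_word_le[of "prefix_word \<omega> k" "v $ \<omega> k"]
  by (rule order_trans) (use r_pos in \<open>auto intro!: mult_left_mono norm_le_max_vec_norm\<close>)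

lemma summable_bound: "summable (\<lambda>k. r ^ k * c)"
  using r_pos r_less by (intro summable_mult2 summable_geometric) auto

lemma suminf_bound: "(\<Sum>k. r ^ k * c) = c / (1 - r)"
  using r_pos r_less by (simp add: suminf_mult2[symmetric] suminf_geometric summable_geometric)

lemma summable_natural_proj:
  "summable (\<lambda>k. word_matrix A (prefix_word \<omega> k) *v (v $ \<omega> k))"
  by (rule summable_comparison_test'[OF summable_bound natural_proj_term_le])

lemma norm_natural_proj_le: "norm (natural_proj A v \<omega>) \<le> rad v"
proof -
  have "norm (natural_proj A v \<omega>) \<le> (\<Sum>k. r ^ k * max_vec_norm v)"
    unfolding natural_proj_def
    by (intro natural_proj_term_le summable_bound norm_suminf_le)
  then show ?thesis unfolding suminf_bound rad_def .
qed

text \<open>The base points may change with \<open>n\<close>: the factor \<open>r ^ n\<close> erases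
  any bounded choice. This allows base points that wander through an invariant set.\<close>

lemma word_map_tendsto:
  assumes "\<And>n. norm (x n) \<le> C"
  shows "(\<lambda>n. word_map A v (prefix_word \<omega> n) (x n)) \<longlonglongrightarrow> natural_proj A v \<omega>"
proof -
  have lim: "(\<lambda>n. r ^ n * C) \<longlonglongrightarrow> 0" using r_pos r_less by (intro tendsto_mult_left_zero LIMSEQ_power_zero) auto
  have "norm (word_matrix A (prefix_word \<omega> n) *v x n) \<le> r ^ n * C" for n
    using norm_word_le[of "prefix_word \<omega> n" "x n"]
    by (rule order_trans) (use r_pos assms in \<open>auto intro!: mult_left_mono\<close>)
  then have "(\<lambda>n. word_matrix A (prefix_word \<omega> n) *v x n) \<longlonglongrightarrow> 0"
    by (intro Lim_null_comparison[OF always_eventually lim]) blast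
  from tendsto_add[OF summable_LIMSEQ[OF summable_natural_proj] this] show ?thesis
    unfolding word_map_prefix natural_proj_def by simp
qed

lemma natural_proj_shift:
  "natural_proj A v \<omega> = word_map A v (prefix_word \<omega> n) (natural_proj A v (seq_shift n \<omega>))"
proof (rule LIMSEQ_unique)
  show "(\<lambda>m. word_map A v (prefix_word \<omega> (m + n)) 0) \<longlonglongrightarrow> natural_proj A v \<omega>"
    by (rule LIMSEQ_ignore_initial_segment[OF word_map_tendsto[of "\<lambda>_. 0" 0]]) simp
  have "(\<lambda>m. word_map A v (prefix_word (seq_shift n \<omega>) m) 0) \<longlonglongrightarrow> natural_proj A v (seq_shift n \<omega>)"
    by (rule word_map_tendsto[of "\<lambda>_. 0" 0]) simp
  then have "(\<lambda>m. word_map A v (prefix_word \<omega> n) 0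
      + word_matrix A (prefix_word \<omega> n) *v (word_map A v (prefix_word (seq_shift n \<omega>) m) 0))
      \<longlonglongrightarrow> word_map A v (prefix_word \<omega> n) 0 + word_matrix A (prefix_word \<omega> n) *v (natural_proj A v (seq_shift n \<omega>))"
    by (intro tendsto_intros bounded_linear.tendsto[OF matrix_vector_mul_bounded_linear])
  then show "(\<lambda>m. word_map A v (prefix_word \<omega> (m + n)) 0)
      \<longlonglongrightarrow> word_map A v (prefix_word \<omega> n) (natural_proj A v (seq_shift n \<omega>))"
    by (simp add: add.commute[of _ n] prefix_word_drop word_map_append word_map_affine[symmetric])
qed

text \<open>Over a common prefix the translations cancel, so the difference is a matrix applied to a
  difference of tails. If the tails start with different letters, transversality applies to
  them.\<close>

lemma natural_proj_diff:
  assumes "prefix_word \<omega> n = prefix_word \<omega>' n"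
  shows "natural_proj A v \<omega> - natural_proj A v \<omega>' =
    word_matrix A (prefix_word \<omega> n) *v (natural_proj A v (seq_shift n \<omega>) - natural_proj A v (seq_shift n \<omega>'))"
  using natural_proj_shift[of v \<omega> n] natural_proj_shift[of v \<omega>' n] assms word_map_diff[of A v]
  by simp

lemma natural_proj_in_word_image: "natural_proj A v \<omega> \<in> word_map A v (prefix_word \<omega> n) ` cball 0 (rad v)"
  using natural_proj_shift[of v \<omega> n] norm_natural_proj_le[of v "seq_shift n \<omega>"] by auto

lemma range_natural_proj_invariant:
  "range (natural_proj A v) = (\<Union>i. (\<lambda>x. A $ i *v x + v $ i) ` range (natural_proj A v))"
proof (intro equalityI subsetI)
  fix x assume "x \<in> range (natural_proj A v)"
  then obtain \<omega> where "x = natural_proj A v \<omega>" by auto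
  then have "x = A $ \<omega> 0 *v natural_proj A v (seq_shift 1 \<omega>) + v $ \<omega> 0"
    using natural_proj_shift[of v \<omega> 1] prefix_word_Suc[of \<omega> 0] by simp
  then show "x \<in> (\<Union>i. (\<lambda>x. A $ i *v x + v $ i) ` range (natural_proj A v))" by auto
next
  fix x assume "x \<in> (\<Union>i. (\<lambda>x. A $ i *v x + v $ i) ` range (natural_proj A v))"
  then obtain i \<omega> where x: "x = A $ i *v natural_proj A v \<omega> + v $ i" by auto
  have "seq_shift 1 (case_nat i \<omega>) = \<omega>" by (simp add: seq_shift_def)
  then have "x = natural_proj A v (case_nat i \<omega>)"
    using natural_proj_shift[of v "case_nat i \<omega>" 1] prefix_word_Suc[of "case_nat i \<omega>" 0] x by simp
  then show "x \<in> range (natural_proj A v)" by auto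
qed

text \<open>Choosing for each point of \<open>E\<close> a preimage in \<open>E\<close> and its
  letter, and iterating, produces an address of the point. Conversely \<open>E\<close> is closed and
  contains every \<open>word_map A v w e\<close> with \<open>e\<close> in \<open>E\<close>.\<close>

lemma invariant_compact_eq:
  assumes E: "compact E" "E \<noteq> {}" "E = (\<Union>i. (\<lambda>x. A $ i *v x + v $ i) ` E)"
  shows "E = range (natural_proj A v)"
proof (intro equalityI subsetI)
  obtain C where C: "\<And>x. x \<in> E \<Longrightarrow> norm x \<le> C"
    using compact_imp_bounded[OF E(1)] by (auto simp: bounded_iff)
  {
    fix x assume "x \<in> E"
    have "\<forall>y\<in>E. \<exists>p. snd p \<in> E \<and> y = A $ fst p *v snd p + v $ fst p"
    proof
      fix y assume "y \<in> E"
      then have "y \<in> (\<Union>i. (\<lambda>x. A $ i *v x + v $ i) ` E)" using E(3) by simp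
      then obtain i z where "z \<in> E" "y = A $ i *v z + v $ i" by auto
      then show "\<exists>p. snd p \<in> E \<and> y = A $ fst p *v snd p + v $ fst p" by (intro exI[of _ "(i, z)"]) simp
    qed
    then obtain p where p: "\<And>y. y \<in> E \<Longrightarrow> snd (p y) \<in> E \<and> y = A $ fst (p y) *v snd (p y) + v $ fst (p y)"
      by metis
    define X where "X n = ((\<lambda>y. snd (p y)) ^^ n) x" for n
    define \<omega> where "\<omega> n = fst (p (X n))" for n
    have X: "X n \<in> E" for n by (induction n) (use p \<open>x \<in> E\<close> in \<open>auto simp: X_def\<close>)
    have "word_map A v (prefix_word \<omega> n) (X n) = x" for n
    proof (induction n)
      case (Suc n)
      have "X n = A $ \<omega> n *v X (Suc n) + v $ \<omega> n" using p[OF X[of n]] by (simp add: \<omega>_def X_def)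
      then show ?case using Suc by (simp add: prefix_word_Suc word_map_append)
    qed (simp add: X_def)
    then have "(\<lambda>n. x) \<longlonglongrightarrow> natural_proj A v \<omega>"
      using word_map_tendsto[of X C v \<omega>] C[OF X] by simp
    then have "x = natural_proj A v \<omega>" by (simp add: LIMSEQ_const_iff)
    then show "x \<in> range (natural_proj A v)" by auto
  }
  fix x assume "x \<in> range (natural_proj A v)"
  then obtain \<omega> where x: "x = natural_proj A v \<omega>" by auto
  obtain e where e: "e \<in> E" using E(2) by auto
  have "word_map A v w e \<in> E" for w
  proof (induction w)
    case (Cons i w)
    then have "A $ i *v word_map A v w e + v $ i \<in> (\<Union>i. (\<lambda>x. A $ i *v x + v $ i) ` E)" by auto
    then show ?case using E(3) by simp
  qed (use e in simp)
  then show "x \<in> E"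
    using closed_sequentially[OF compact_imp_closed[OF E(1)] _ word_map_tendsto[of "\<lambda>_. e" "norm e" v \<omega>]] x
    by auto
qed

text \<open>Compactness is obtained without a topology on sequences: the closure of the range is
  compact and again invariant, so the uniqueness just proved identifies it with the range.\<close>

lemma self_affine_set_eq: "self_affine_set A v = range (natural_proj A v)"
  and compact_range_natural_proj: "compact (range (natural_proj A v))"
proof -
  define X where "X = range (natural_proj A v)"
  define f where "f i x = A $ i *v x + v $ i" for i and x :: "real^2"
  have X: "X = (\<Union>i. f i ` X)" unfolding X_def f_def by (rule range_natural_proj_invariant)
  have "bounded X" unfolding X_def bounded_iff using norm_natural_proj_le by auto
  then have K: "compact (closure X)" by simp
  have cf: "continuous_on S (f i)" for S i unfolding f_def by (intro continuous_intros)
  have inv: "closure X = (\<Union>i. f i ` closure X)"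
  proof
    have "closed (\<Union>i. f i ` closure X)"
      by (intro closed_UN ballI compact_imp_closed compact_continuous_image cf K) auto
    moreover have "X \<subseteq> (\<Union>i. f i ` closure X)" using X closure_subset[of X] by blast
    ultimately show "closure X \<subseteq> (\<Union>i. f i ` closure X)" by (intro closure_minimal)
    have "f i ` closure X \<subseteq> closure X" for i
      using X closure_subset[of X] by (intro image_closure_subset cf) auto
    then show "(\<Union>i. f i ` closure X) \<subseteq> closure X" by auto
  qed
  have ne: "closure X \<noteq> {}" unfolding X_def by simp
  have eq: "closure X = X"
    using invariant_compact_eq[OF K ne, of v] inv unfolding X_def f_def by blast
  then show "compact (range (natural_proj A v))" using K X_def by simp
  show "self_affine_set A v = range (natural_proj A v)"
    unfolding self_affine_set_def
  proof (rule the_equality)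
    show "compact (range (natural_proj A v)) \<and> range (natural_proj A v) \<noteq> {} \<and>
      range (natural_proj A v) = (\<Union>i. (\<lambda>x. A $ i *v x + v $ i) ` range (natural_proj A v))"
      using K[unfolded eq] range_natural_proj_invariant unfolding X_def by blast
  qed (use invariant_compact_eq in blast)
qed

end


section \<open>Upper bounds for the dimensions of the self-affine set\<close>

text \<open>In the singular frame the image is an ellipse, and centres spaced by
  \<open>sing2 M\<close> along its long axis suffice; \<open>q\<close> is the ratio of the
  axes.\<close>

lemma ellipse_cover:
  fixes M :: "real^2^2"
  assumes d: "det M \<noteq> 0" and R: "0 \<le> R"
  obtains C where "finite C" "real (card C) \<le> (2 * R + 3) * (op_norm M / sing2 M)"
    "(\<lambda>x. M *v x) ` cball 0 R \<subseteq> (\<Union>c\<in>C. cball c ((R + 1) * sing2 M))"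
proof -
  obtain e1 e2 where e: "norm e1 = 1" "norm e2 = 1" "e1 \<bullet> e2 = 0" "(M *v e1) \<bullet> (M *v e2) = 0"
    "norm (M *v e1) = op_norm M" "norm (M *v e2) = sing2 M"
    and ex: "\<And>x. x = (x \<bullet> e1) *\<^sub>R e1 + (x \<bullet> e2) *\<^sub>R e2"
    using singular_basis[OF d] by metis
  define q where "q = op_norm M / sing2 M"
  have s: "0 < sing2 M" "sing2 M \<le> op_norm M" using sing2_pos[OF d] sing2_le_op_norm[OF d] .
  have q: "1 \<le> q" using s unfolding q_def by simp
  define I where "I = {- \<lceil>R * q\<rceil>..\<lceil>R * q\<rceil>}"
  define C where "C = (\<lambda>k :: int. (real_of_int k / q) *\<^sub>R (M *v e1)) ` I"
  have finI: "finite I" unfolding I_def by simp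
  then have "finite C" unfolding C_def by simp
  have "real (card C) \<le> real (card I)" unfolding C_def using finI by (simp add: card_image_le)
  also have "real (card I) = 2 * real_of_int \<lceil>R * q\<rceil> + 1"
  proof -
    have "0 \<le> R * q" using R q by simp
    then have "0 \<le> \<lceil>R * q\<rceil>" by linarith
    then show ?thesis unfolding I_def by simp
  qed
  also have "\<dots> \<le> 2 * R * q + 3" using ceiling_correct[of "R * q"] by linarith
  also have "\<dots> \<le> (2 * R + 3) * q" using q by (simp add: algebra_simps)
  finally have card: "real (card C) \<le> (2 * R + 3) * (op_norm M / sing2 M)" unfolding q_def .
  have "(\<lambda>x. M *v x) ` cball 0 R \<subseteq> (\<Union>c\<in>C. cball c ((R + 1) * sing2 M))"
  proof
    fix y assume "y \<in> (\<lambda>x. M *v x) ` cball 0 R"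
    then obtain x where x: "norm x \<le> R" "y = M *v x" by auto
    define u w where "u = x \<bullet> e1" and "w = x \<bullet> e2"
    have xe: "x = u *\<^sub>R e1 + w *\<^sub>R e2" unfolding u_def w_def by (rule ex)
    have u: "\<bar>u\<bar> \<le> R" and w: "\<bar>w\<bar> \<le> R"
      using Cauchy_Schwarz_ineq2[of x e1] Cauchy_Schwarz_ineq2[of x e2] e x unfolding u_def w_def by auto
    define k where "k = \<lfloor>u * q\<rfloor>"
    have "\<bar>u * q\<bar> \<le> R * q" unfolding abs_mult using u q by (intro mult_mono) auto
    then have kI: "k \<in> I" unfolding k_def I_def by (simp add: le_floor_iff floor_le_iff) linarith
    have ukq: "\<bar>u - real_of_int k / q\<bar> \<le> 1 / q"
    proof -
      have "\<bar>u * q - real_of_int k\<bar> \<le> 1" unfolding k_def by linarith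
      then have "\<bar>u * q - real_of_int k\<bar> / q \<le> 1 / q" using q by (intro divide_right_mono) auto
      moreover have "u - real_of_int k / q = (u * q - real_of_int k) / q" using q by (simp add: field_simps)
      ultimately show ?thesis using q by (simp add: abs_divide)
    qed
    have "y - (real_of_int k / q) *\<^sub>R (M *v e1) = (u - real_of_int k / q) *\<^sub>R (M *v e1) + w *\<^sub>R (M *v e2)"
      unfolding x(2) xe by (simp add: matrix_vector_right_distrib matrix_vector_mult_scaleR algebra_simps)
    then have "norm (y - (real_of_int k / q) *\<^sub>R (M *v e1)) \<le> \<bar>u - real_of_int k / q\<bar> * op_norm M + \<bar>w\<bar> * sing2 M"
      using norm_triangle_ineq[of "(u - real_of_int k / q) *\<^sub>R (M *v e1)" "w *\<^sub>R (M *v e2)"] e by simp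
    also have "\<dots> \<le> (1 / q) * op_norm M + R * sing2 M"
      using s ukq w by (intro add_mono mult_right_mono) auto
    also have "(1 / q) * op_norm M = sing2 M" unfolding q_def using s by simp
    finally have "y \<in> cball ((real_of_int k / q) *\<^sub>R (M *v e1)) ((R + 1) * sing2 M)"
      by (simp add: dist_norm norm_minus_commute algebra_simps)
    then show "y \<in> (\<Union>c\<in>C. cball c ((R + 1) * sing2 M))" unfolding C_def using kI by blast
  qed
  with that \<open>finite C\<close> card show ?thesis by blast
qed

text \<open>Test the product on the preimage under \<open>A\<close> of a vector at which
  \<open>M\<close> attains its norm; that preimage has length at most
  \<open>1 / sing2 A\<close>.\<close>

lemma op_norm_mult_ge:
  assumes d: "det A \<noteq> 0"
  shows "op_norm M * sing2 A \<le> op_norm (M ** A :: real^2^2)"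
proof -
  obtain e where e: "norm e = 1" "norm (M *v e) = op_norm M" using op_norm_attained by blast
  have "invertible A" using d by (simp add: invertible_det_nz)
  then obtain B where B: "A ** B = mat 1" unfolding invertible_def by blast
  define x where "x = B *v e"
  have Ax: "A *v x = e" unfolding x_def by (simp add: matrix_vector_mul_assoc B)
  have "op_norm M * sing2 A = norm ((M ** A) *v x) * sing2 A"
    using e Ax by (simp add: matrix_vector_mul_assoc[symmetric])
  also have "\<dots> \<le> op_norm (M ** A) * norm x * sing2 A"
    using sing2_pos[OF d] by (intro mult_right_mono op_norm_ge) auto
  also have "\<dots> \<le> op_norm (M ** A) * 1"
    unfolding mult.assoc using norm_mult_ge_sing2[OF d, of x] Ax e
    by (intro mult_left_mono op_norm_nonneg) (simp add: mult.commute)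
  finally show ?thesis by simp
qed

context contracting_tuple
begin

lemma word_image_cover:
  assumes R: "0 \<le> R"
  obtains C where "finite C" "real (card C) \<le> (2 * R + 3) * (op_norm (word_matrix A w) / sing2 (word_matrix A w))"
    "word_map A v w ` cball 0 R \<subseteq> (\<Union>c\<in>C. cball c ((R + 1) * sing2 (word_matrix A w)))"
proof -
  obtain C where C: "finite C" "real (card C) \<le> (2 * R + 3) * (op_norm (word_matrix A w) / sing2 (word_matrix A w))"
    "(\<lambda>x. word_matrix A w *v x) ` cball 0 R \<subseteq> (\<Union>c\<in>C. cball c ((R + 1) * sing2 (word_matrix A w)))"
    using ellipse_cover[OF det_word_nz R, of w] by blast
  define t where "t = word_map A v w 0"
  have "word_map A v w ` cball 0 R \<subseteq> (\<Union>c\<in>(+) t ` C. cball c ((R + 1) * sing2 (word_matrix A w)))"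
  proof
    fix y assume "y \<in> word_map A v w ` cball 0 R"
    then obtain x where x: "x \<in> cball 0 R" "y = t + word_matrix A w *v x"
      unfolding t_def using word_map_affine[of A v w] by blast
    then obtain c where "c \<in> C" "word_matrix A w *v x \<in> cball c ((R + 1) * sing2 (word_matrix A w))"
      using C(3) by blast
    then show "y \<in> (\<Union>c\<in>(+) t ` C. cball c ((R + 1) * sing2 (word_matrix A w)))"
      using x by (auto simp: dist_norm)
  qed
  moreover have "card ((+) t ` C) = card C" by (simp add: card_image)
  ultimately show ?thesis using that[of "(+) t ` C"] C by simp
qed

lemma word_image_single_ball:
  assumes R: "0 \<le> R"
  shows "word_map A v w ` cball 0 R \<subseteq> cball (word_map A v w 0) ((R + 1) * op_norm (word_matrix A w))"
proof
  fix y assume "y \<in> word_map A v w ` cball 0 R"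
  then obtain x where x: "norm x \<le> R" "y = word_map A v w x" by auto
  have "norm (y - word_map A v w 0) \<le> op_norm (word_matrix A w) * norm x"
    unfolding x(2) word_map_diff using op_norm_ge[of "word_matrix A w" x] by simp
  also have "\<dots> \<le> op_norm (word_matrix A w) * (R + 1)"
    using x by (intro mult_left_mono op_norm_nonneg) auto
  finally show "y \<in> cball (word_map A v w 0) ((R + 1) * op_norm (word_matrix A w))"
    by (simp add: dist_norm norm_minus_commute mult.commute)
qed

text \<open>Up to s = 2 negative pressure gives geometric decay. Beyond 2, where \<open>phi\<close>
  no longer matches \<open>pressure\<close>, compare with \<open>Z 2 n\<close> \<le> 1, which is the
  determinant bound.\<close>

lemma summable_Z:
  assumes N: "CARD('n) \<ge> 2" and D: "(\<Sum>i\<in>UNIV. \<bar>det (A $ i)\<bar>) \<le> 1"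
    and s: "affinity_dim A < s"
  shows "summable (Z s)"
proof -
  define s0 where "s0 = affinity_dim A"
  note s0 = affinity_dim_zero[OF N D, folded s0_def]
  have nn: "0 \<le> Z s n" for n using Z_pos[of s n] by simp
  show ?thesis
  proof (cases "s \<le> 2")
    case True
    define P where "P = pressure A s"
    have P: "P < 0" using pressure_strict[of s0 s] s s0 True unfolding P_def s0_def by simp
    have "(\<lambda>n. ln (Z s n) / real n) \<longlonglongrightarrow> P"
      unfolding P_def by (rule pressure_LIMSEQ(1)) (use s s0 True in \<open>auto simp: s0_def\<close>)
    then have "\<forall>\<^sub>F n in sequentially. ln (Z s n) / real n < P / 2" using P by (intro order_tendstoD) auto
    then have "\<forall>\<^sub>F n in sequentially. norm (Z s n) \<le> exp (P / 2) ^ n"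
      using eventually_gt_at_top[of 0]
    proof eventually_elim
      case (elim n)
      then have "ln (Z s n) \<le> real n * (P / 2)" by (simp add: field_simps)
      then have "Z s n \<le> exp (real n * (P / 2))" using Z_pos[of s n] by (metis exp_le_cancel_iff exp_ln)
      then show ?case using nn[of n] by (simp add: exp_of_nat_mult[symmetric])
    qed
    then show ?thesis by (rule summable_comparison_test_ev) (use P in \<open>auto intro!: summable_geometric\<close>)
  next
    case False
    have le: "norm (Z s n) \<le> (r powr (s - 2)) ^ n" for n
    proof -
      have "Z s n \<le> Z 2 n * r powr ((s - 2) * n)" using Z_add_bounds(1)[of "s - 2" 2 n] False by simp
      also have "\<dots> \<le> 1 * r powr ((s - 2) * n)"
        unfolding Z_2 using D sum_det_pos by (intro mult_right_mono power_le_one) auto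
      also have "\<dots> = (r powr (s - 2)) ^ n" using r_pos by (simp add: powr_realpow[symmetric] powr_powr)
      finally show ?thesis using nn[of n] by simp
    qed
    have "r powr (s - 2) < 1" using powr_less_mono'[of r 0 "s - 2"] r_pos r_less False by simp
    then have "summable (\<lambda>n. (r powr (s - 2)) ^ n)" by (intro summable_geometric) simp
    then show ?thesis by (rule summable_comparison_test'[OF _ le])
  qed
qed

text \<open>Each sequence is stopped when the relevant singular value \<open>g\<close> first drops
  to \<rho>: the larger one if s \<le> 1, with one ball per word, the smaller one otherwise, with
  about the axis ratio many balls. Either way a word costs a constant times its \<open>phi s\<close>
  weight times \<rho> to the power -s, and the weights of all words together have a finite
  sum.\<close>

lemma stopping_cover:
  assumes N: "CARD('n) \<ge> 2" and D: "(\<Sum>i\<in>UNIV. \<bar>det (A $ i)\<bar>) \<le> 1"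
    and s: "affinity_dim A < s"
  obtains K where "K > 0" "\<And>\<rho>. 0 < \<rho> \<Longrightarrow> \<rho> < 1 \<Longrightarrow> \<exists>C. finite C \<and> real (card C) \<le> K * \<rho> powr - s \<and>
      range (natural_proj A v) \<subseteq> (\<Union>c\<in>C. cball c (K * \<rho>))"
proof -
  define R where "R = rad v"
  have R: "0 \<le> R" unfolding R_def by (rule rad_nonneg)
  have s_pos: "0 < s" using affinity_dim_zero(1)[OF N D] s by simp
  define g where "g w = (if s \<le> 1 then op_norm (word_matrix A w) else sing2 (word_matrix A w))" for w
  have g_Nil: "g [] = 1" by (simp add: g_def op_norm_mat_1 sing2_mat_1)
  have g_le: "g w \<le> r ^ length w" for w
    unfolding g_def using op_norm_word_le[of w] sing2_le_op_norm[OF det_word_nz, of w] by auto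
  have g_snoc: "g w * a \<le> g (w @ [i])" for w i
  proof (cases "s \<le> 1")
    case True
    have "op_norm (word_matrix A w) * a \<le> op_norm (word_matrix A w) * sing2 (A $ i)"
      by (intro mult_left_mono a_le op_norm_nonneg)
    also have "\<dots> \<le> op_norm (word_matrix A w ** A $ i)" by (rule op_norm_mult_ge) simp
    finally show ?thesis using True by (simp add: g_def word_matrix_append)
  next
    case False
    have "sing2 (word_matrix A w) * a \<le> sing2 (word_matrix A w) * sing2 (A $ i)"
      using sing2_pos[OF det_word_nz, of w] by (intro mult_left_mono a_le) simp
    also have "\<dots> \<le> sing2 (word_matrix A w ** A $ i)" by (rule sing2_mult_ge) simp_all
    finally show ?thesis using False by (simp add: g_def word_matrix_append)
  qed
  define S where "S = (\<Sum>n. Z s n)"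
  have sumZ: "summable (Z s)" by (rule summable_Z[OF N D s])
  have S: "0 < S" unfolding S_def using sumZ Z_pos by (rule suminf_pos)
  define K where "K = max (R + 1) ((2 * R + 3) * a powr - s * S)"
  have K: "K > 0" "R + 1 \<le> K" "(2 * R + 3) * a powr - s * S \<le> K" unfolding K_def using R by auto
  have "\<exists>C. finite C \<and> real (card C) \<le> K * \<rho> powr - s \<and> range (natural_proj A v) \<subseteq> (\<Union>c\<in>C. cball c (K * \<rho>))"
    if \<rho>: "0 < \<rho>" "\<rho> < 1" for \<rho>
  proof -
    \<comment> \<open>Only consequences of stopping are recorded. The last one holds since
      \<open>g\<close> still exceeds \<rho> at the parent word; it bounds the length, hence makes
      \<open>W\<close> finite.\<close>
    define W where "W = {w. g w \<le> \<rho> \<and> a * \<rho> \<le> g w \<and> (\<rho> \<le> r ^ (length w - 1))}"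
    obtain L where L: "r ^ L < \<rho>" using real_arch_pow_inv[OF \<rho>(1) r_less] by blast
    have len: "length w \<le> L" if "w \<in> W" for w
    proof (rule ccontr)
      assume "\<not> length w \<le> L"
      then have "r ^ (length w - 1) \<le> r ^ L" using r_pos r_less by (intro power_decreasing) auto
      then show False using that L unfolding W_def by auto
    qed
    have "finite {w :: 'n list. set w \<subseteq> UNIV \<and> length w \<le> L}" by (rule finite_lists_length_le) simp
    then have finW: "finite W" by (rule rev_finite_subset) (use len in auto)
    have cov: "\<exists>w\<in>W. natural_proj A v \<omega> \<in> word_map A v w ` cball 0 R" for \<omega>
    proof -
      define n where "n = (LEAST n. g (prefix_word \<omega> n) \<le> \<rho>)"
      have "g (prefix_word \<omega> L) \<le> \<rho>" using g_le[of "prefix_word \<omega> L"] L by simp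
      then have n: "g (prefix_word \<omega> n) \<le> \<rho>" unfolding n_def by (rule LeastI)
      have "n \<noteq> 0" using n g_Nil \<rho> by (metis not_le prefix_word_0)
      then obtain m where m: "n = Suc m" by (cases n) auto
      then have gm: "\<rho> < g (prefix_word \<omega> m)"
        using not_less_Least[of m "\<lambda>n. g (prefix_word \<omega> n) \<le> \<rho>"] unfolding n_def by auto
      have "a * \<rho> \<le> g (prefix_word \<omega> m) * a" using gm a_pos by (simp add: mult.commute)
      also have "\<dots> \<le> g (prefix_word \<omega> n)" unfolding m prefix_word_Suc by (rule g_snoc)
      finally have "prefix_word \<omega> n \<in> W"
        unfolding W_def using n gm g_le[of "prefix_word \<omega> m"] m by auto
      then show ?thesis using natural_proj_in_word_image[of v \<omega> n] unfolding R_def by blast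
    qed
    have "\<exists>C. finite C \<and> real (card C) \<le> (2 * R + 3) * phi s (word_matrix A w) * (a * \<rho>) powr - s \<and>
        word_map A v w ` cball 0 R \<subseteq> (\<Union>c\<in>C. cball c (K * \<rho>))" if w: "w \<in> W" for w
    proof -
      define M where "M = word_matrix A w"
      have M: "0 < op_norm M" "0 < sing2 M" using det_nonzero_op_norm_pos sing2_pos det_word_nz unfolding M_def by auto
      have g: "g w \<le> \<rho>" "a * \<rho> \<le> g w" "0 < a * \<rho>" using w \<rho> a_pos unfolding W_def by auto
      have gs: "g w powr - s \<le> (a * \<rho>) powr - s" using g s_pos by (intro powr_mono2') auto
      show ?thesis
      proof (cases "s \<le> 1")
        case True
        have gM: "g w = op_norm M" using True by (simp add: g_def M_def)
        \<comment> \<open>For s \<le> 1 the weight \<open>phi s M\<close> is exactly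
          \<open>op_norm M powr s\<close>.\<close>
        have "1 = phi s M * g w powr - s" unfolding phi_def gM using True M by (simp add: powr_minus field_simps)
        also have "\<dots> \<le> phi s M * (a * \<rho>) powr - s"
          using gs phi_pos[OF det_word_nz, of s w] unfolding M_def by (intro mult_left_mono) auto
        finally have "1 \<le> phi s M * (a * \<rho>) powr - s" .
        then have "1 * 1 \<le> (2 * R + 3) * (phi s M * (a * \<rho>) powr - s)" using R by (intro mult_mono) auto
        then have c: "real (card {word_map A v w 0}) \<le> (2 * R + 3) * phi s M * (a * \<rho>) powr - s" by (simp add: mult.assoc)
        have "(R + 1) * op_norm M \<le> K * \<rho>" using K R g(1) gM M by (intro mult_mono) auto
        then have "cball (word_map A v w 0) ((R + 1) * op_norm M) \<subseteq> cball (word_map A v w 0) (K * \<rho>)"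
          by (rule subset_cball)
        then show ?thesis using c word_image_single_ball[OF R, of v w] unfolding M_def
          by (intro exI[of _ "{word_map A v w 0}"]) auto
      next
        case False
        have gM: "g w = sing2 M" using False by (simp add: g_def M_def)
        obtain C where C: "finite C" "real (card C) \<le> (2 * R + 3) * (op_norm M / sing2 M)"
          "word_map A v w ` cball 0 R \<subseteq> (\<Union>c\<in>C. cball c ((R + 1) * sing2 M))"
          unfolding M_def using word_image_cover[OF R] by metis
        \<comment> \<open>For s > 1, dividing \<open>op_norm M * sing2 M powr (s - 1)\<close> by
          \<open>sing2 M powr s\<close> leaves the ratio of the axes.\<close>
        have "op_norm M / sing2 M = phi s M * g w powr - s"
          unfolding phi_def gM using False M by (simp add: powr_minus powr_diff field_simps)
        also have "\<dots> \<le> phi s M * (a * \<rho>) powr - s"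
          using gs phi_pos[OF det_word_nz, of s w] unfolding M_def by (intro mult_left_mono) auto
        finally have "(2 * R + 3) * (op_norm M / sing2 M) \<le> (2 * R + 3) * (phi s M * (a * \<rho>) powr - s)"
          using R by (intro mult_left_mono) auto
        then have c: "real (card C) \<le> (2 * R + 3) * phi s M * (a * \<rho>) powr - s"
          using C(2) by (simp add: mult.assoc)
        have "(R + 1) * sing2 M \<le> K * \<rho>" using K R g(1) gM M by (intro mult_mono) auto
        then have "cball c ((R + 1) * sing2 M) \<subseteq> cball c (K * \<rho>)" for c by (rule subset_cball)
        then have "word_map A v w ` cball 0 R \<subseteq> (\<Union>c\<in>C. cball c (K * \<rho>))" using C(3) by blast
        then show ?thesis using c C(1) unfolding M_def by blast
      qed
    qed
    then obtain C where C: "\<And>w. w \<in> W \<Longrightarrow> finite (C w)"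
      "\<And>w. w \<in> W \<Longrightarrow> real (card (C w)) \<le> (2 * R + 3) * phi s (word_matrix A w) * (a * \<rho>) powr - s"
      "\<And>w. w \<in> W \<Longrightarrow> word_map A v w ` cball 0 R \<subseteq> (\<Union>c\<in>C w. cball c (K * \<rho>))" by metis
    have sumphi: "(\<Sum>w\<in>W. phi s (word_matrix A w)) \<le> S"
    proof -
      have "(\<Sum>w\<in>W. phi s (word_matrix A w)) \<le> (\<Sum>w\<in>(\<Union>n\<le>L. {w. length w = n}). phi s (word_matrix A w))"
        using len phi_pos[OF det_word_nz] by (intro sum_mono2) (auto simp: finite_words less_imp_le)
      also have "\<dots> = (\<Sum>n\<le>L. Z s n)" unfolding Z_def by (rule sum.UNION_disjoint) (auto simp: finite_words)
      also have "\<dots> \<le> S" unfolding S_def using sumZ Z_pos by (intro sum_le_suminf) (auto simp: less_imp_le)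
      finally show ?thesis .
    qed
    define C' where "C' = (\<Union>w\<in>W. C w)"
    have "real (card C') \<le> (\<Sum>w\<in>W. real (card (C w)))"
      unfolding C'_def using card_UN_le[OF finW, of C] by (metis of_nat_le_iff of_nat_sum)
    also have "\<dots> \<le> (\<Sum>w\<in>W. (2 * R + 3) * phi s (word_matrix A w) * (a * \<rho>) powr - s)"
      by (intro sum_mono C)
    also have "\<dots> = (2 * R + 3) * (a * \<rho>) powr - s * (\<Sum>w\<in>W. phi s (word_matrix A w))"
      by (subst sum_distrib_left) (rule sum.cong, simp_all)
    also have "\<dots> \<le> (2 * R + 3) * (a * \<rho>) powr - s * S"
      using R by (intro mult_left_mono sumphi) auto
    also have "\<dots> = ((2 * R + 3) * a powr - s * S) * \<rho> powr - s"
      using a_pos \<rho> by (simp add: powr_mult mult_ac)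
    also have "\<dots> \<le> K * \<rho> powr - s" using K by (intro mult_right_mono) auto
    finally have "real (card C') \<le> K * \<rho> powr - s" .
    moreover have "finite C'" unfolding C'_def using finW C(1) by auto
    moreover have "range (natural_proj A v) \<subseteq> (\<Union>c\<in>C'. cball c (K * \<rho>))"
      unfolding C'_def using cov C(3) by blast
    ultimately show ?thesis by blast
  qed
  with that K show ?thesis by blast
qed

lemma upper_minkowski_le:
  assumes N: "CARD('n) \<ge> 2" and D: "(\<Sum>i\<in>UNIV. \<bar>det (A $ i)\<bar>) \<le> 1"
  shows "upper_minkowski_dim (range (natural_proj A v)) \<le> ereal (affinity_dim A)"
proof (rule ereal_le_epsilon2)
  fix e :: real assume "0 < e"
  define s where "s = affinity_dim A + e"
  have "affinity_dim A < s" using \<open>0 < e\<close> s_def by simp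
  then obtain K where K: "K > 0" "\<And>\<rho>. 0 < \<rho> \<Longrightarrow> \<rho> < 1 \<Longrightarrow> \<exists>C. finite C \<and> real (card C) \<le> K * \<rho> powr - s \<and>
      range (natural_proj A v) \<subseteq> (\<Union>c\<in>C. cball c (K * \<rho>))"
    using stopping_cover[OF N D, where v = v] by blast
  define E where "E = range (natural_proj A v)"
  define h where "h \<rho> = ((1 + s) * ln K) / ln (1 / \<rho>) + s" for \<rho> :: real
  have bound: "ln (real (covering_number E \<rho>)) / ln (1 / \<rho>) \<le> h \<rho>" if \<rho>: "0 < \<rho>" "\<rho> < min 1 K" for \<rho>
  proof -
    \<comment> \<open>The cover is taken at scale \<open>\<rho> / K\<close>, so that its balls have
      radius exactly \<rho>; the powers of \<open>K\<close> go into the vanishing term of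
      \<open>h\<close>.\<close>
    have "0 < \<rho> / K" "\<rho> / K < 1" using \<rho> K(1) by auto
    then obtain C where C: "finite C" "real (card C) \<le> K * (\<rho> / K) powr - s" "E \<subseteq> (\<Union>c\<in>C. cball c \<rho>)"
      using K(2)[of "\<rho> / K"] K(1) unfolding E_def by auto
    have "covering_number E \<rho> \<le> card C" unfolding covering_number_def by (rule Least_le) (use C in blast)
    then have le: "real (covering_number E \<rho>) \<le> K * (\<rho> / K) powr - s" using C(2) by linarith
    have "covering_number E \<rho> \<noteq> 0"
    proof
      assume "covering_number E \<rho> = 0"
      moreover have "\<exists>C. finite C \<and> card C = covering_number E \<rho> \<and> E \<subseteq> (\<Union>x\<in>C. cball x \<rho>)"
        unfolding covering_number_def by (rule LeastI[of _ "card C"]) (use C in blast)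
      ultimately have "E = {}" by auto
      then show False unfolding E_def by simp
    qed
    then have "ln (real (covering_number E \<rho>)) \<le> ln (K * (\<rho> / K) powr - s)" using le by (intro ln_mono) auto
    also have "\<dots> = (1 + s) * ln K + s * ln (1 / \<rho>)"
      using \<rho> K(1) by (simp add: ln_mult_pos ln_powr ln_div algebra_simps)
    finally show ?thesis using \<rho> unfolding h_def by (simp add: ln_div field_simps)
  qed
  have ev: "\<forall>\<^sub>F \<rho> in at_right 0. ereal (ln (real (covering_number E \<rho>)) / ln (1 / \<rho>)) \<le> ereal (h \<rho>)"
    unfolding eventually_at_right_field using bound K(1) by (intro exI[of _ "min 1 K"]) auto
  have "(h \<longlongrightarrow> s) (at_right 0)"
    unfolding h_def by real_asymp
  then have "((\<lambda>\<rho>. ereal (h \<rho>)) \<longlongrightarrow> ereal s) (at_right 0)" by simp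
  then have lim: "Limsup (at_right 0) (\<lambda>\<rho>. ereal (h \<rho>)) = ereal s" by (intro lim_imp_Limsup) auto
  have "upper_minkowski_dim E \<le> ereal s"
    unfolding upper_minkowski_dim_def using Limsup_mono[OF ev] lim by simp
  then show "upper_minkowski_dim (range (natural_proj A v)) \<le> ereal (affinity_dim A) + ereal e"
    unfolding E_def s_def by simp
qed

end

section \<open>Hausdorff dimension against upper Minkowski dimension\<close>

lemma hausdorff_dim_le_upper_minkowski_dim:
  fixes E :: "'a::euclidean_space set"
  assumes "bounded E"
  shows "hausdorff_dim E \<le> upper_minkowski_dim E"
proof (rule ereal_le_real)
  fix t :: real assume "upper_minkowski_dim E \<le> ereal t"
  have nn: "0 \<le> upper_minkowski_dim E"
  proof -
    have "\<forall>\<^sub>F \<rho> in at_right 0. (0 :: ereal) \<le> ereal (ln (real (covering_number E \<rho>)) / ln (1 / \<rho>))"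
    proof -
      have "0 \<le> ln (real n)" for n :: nat by (cases "n = 0") auto
      then show ?thesis unfolding eventually_at_right_field
        by (intro exI[of _ 1]) (auto intro!: divide_nonneg_nonneg)
    qed
    from Limsup_mono[OF this] show ?thesis unfolding upper_minkowski_dim_def by (simp add: Limsup_const)
  qed
  show "hausdorff_dim E \<le> ereal t"
  proof (rule ereal_le_epsilon2)
    fix e :: real assume e: "0 < e"
    \<comment> \<open>The surplus \<open>e\<close> is halved: one half is lost in the bound of the
      covering number by \<rho> to the power \<open>- u\<close>, the other leaves the factor
      \<open>\<rho> powr (e / 2)\<close> that tends to 0.\<close>
    define u where "u = t + e / 2"
    have t: "0 \<le> t" using nn \<open>upper_minkowski_dim E \<le> ereal t\<close> by (metis ereal_less_eq(5) order_trans)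
    have "upper_minkowski_dim E < ereal u" using \<open>upper_minkowski_dim E \<le> ereal t\<close> e
      unfolding u_def by (metis ereal_less(2) less_add_same_cancel1 half_gt_zero less_ereal.simps(1) order_le_less_trans)
    then have "\<forall>\<^sub>F \<rho> in at_right 0. ereal (ln (real (covering_number E \<rho>)) / ln (1 / \<rho>)) < ereal u"
      unfolding upper_minkowski_dim_def by (rule Limsup_lessD)
    then obtain b where b: "0 < b" "\<And>\<rho>. 0 < \<rho> \<Longrightarrow> \<rho> < b \<Longrightarrow> ln (real (covering_number E \<rho>)) / ln (1 / \<rho>) < u"
      unfolding eventually_at_right_field by auto
    have bound: "hausdorff_premeasure (t + e) \<delta> E \<le> ennreal (2 powr (t + e) * \<rho> powr (e / 2))"
      if \<delta>: "0 < \<delta>" and \<rho>: "0 < \<rho>" "\<rho> < min b (min 1 (\<delta> / 2))" for \<delta> \<rho>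
    proof -
      have "\<exists>C. finite C \<and> card C = covering_number E \<rho> \<and> E \<subseteq> (\<Union>x\<in>C. cball x \<rho>)"
      proof -
        have "compact (closure E)" using assms by simp
        then obtain C where "finite C" "closure E \<subseteq> (\<Union>x\<in>C. ball x \<rho>)"
          using \<rho>(1) unfolding compact_eq_totally_bounded by metis
        moreover have "(\<Union>x\<in>C. ball x \<rho>) \<subseteq> (\<Union>x\<in>C. cball x \<rho>)" by (intro UN_mono order_refl ball_subset_cball)
        ultimately have C: "E \<subseteq> (\<Union>x\<in>C. cball x \<rho>)" using closure_subset[of E] by blast
        show ?thesis unfolding covering_number_def
          by (rule LeastI[of _ "card C"]) (use C \<open>finite C\<close> in blast)
      qed
      then obtain C where C: "finite C" "card C = covering_number E \<rho>" "E \<subseteq> (\<Union>x\<in>C. cball x \<rho>)" by blast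
      have l: "0 < ln (1 / \<rho>)" using \<rho> by simp
      have card: "real (card C) \<le> \<rho> powr - u"
      proof (cases "card C = 0")
        case False
        have "ln (real (card C)) \<le> u * ln (1 / \<rho>)" using b(2)[of \<rho>] \<rho> l unfolding C(2) by (simp add: field_simps)
        also have "\<dots> = ln (\<rho> powr - u)" using \<rho> by (simp add: ln_powr ln_div)
        finally have "ln (real (card C)) \<le> ln (\<rho> powr - u)" .
        then show ?thesis using False \<rho> by (subst (asm) ln_le_cancel_iff) auto
      qed simp
      obtain f where f: "bij_betw f {..<card C} C" using C(1) ex_bij_betw_nat_finite[of C] by (auto simp: atLeast0LessThan)
      define U where "U k = (if k < card C then cball (f k) \<rho> else {})" for k
      have dU: "bounded (U k) \<and> diameter (U k) \<le> 2 * \<rho>" for k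
        unfolding U_def using \<rho> by (simp add: diameter_cball)
      have dU\<delta>: "diameter (U k) \<le> \<delta>" for k using conjunct2[OF dU[of k]] \<rho>(2) by simp
      have EU: "E \<subseteq> (\<Union>k. U k)"
      proof
        fix x assume "x \<in> E"
        then obtain c where c: "c \<in> C" "x \<in> cball c \<rho>" using C(3) by blast
        then obtain k where "k < card C" "f k = c" using f unfolding bij_betw_def by (metis imageE lessThan_iff)
        then show "x \<in> (\<Union>k. U k)" using c by (auto simp: U_def)
      qed
      have dp: "diam_pow (t + e) (U k) \<le> ennreal ((2 * \<rho>) powr (t + e))" for k
        unfolding diam_pow_def using t e dU[of k] \<rho> diameter_ge_0
        by (auto intro!: ennreal_leI powr_mono2 simp: diameter_ge_0)
      have "hausdorff_premeasure (t + e) \<delta> E \<le> (\<Sum>k. diam_pow (t + e) (U k))"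
        unfolding hausdorff_premeasure_def using EU dU dU\<delta> by (intro INF_lower) auto
      also have "\<dots> = (\<Sum>k<card C. diam_pow (t + e) (U k))"
        by (rule suminf_finite) (auto simp: U_def diam_pow_def)
      also have "\<dots> \<le> (\<Sum>k<card C. ennreal ((2 * \<rho>) powr (t + e)))" by (intro sum_mono dp)
      also have "\<dots> = ennreal (real (card C) * (2 * \<rho>) powr (t + e))" by (simp add: ennreal_mult ennreal_of_nat_eq_real_of_nat)
      also have "\<dots> \<le> ennreal (\<rho> powr - u * (2 * \<rho>) powr (t + e))" by (intro ennreal_leI mult_right_mono card) auto
      also have "\<rho> powr - u * (2 * \<rho>) powr (t + e) = 2 powr (t + e) * \<rho> powr (e / 2)"
        using \<rho> unfolding u_def by (simp add: powr_mult powr_add[symmetric])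
      finally show ?thesis .
    qed
    have "hausdorff_premeasure (t + e) \<delta> E = 0" if \<delta>: "0 < \<delta>" for \<delta>
    proof -
      have "((\<lambda>\<rho>. ennreal (2 powr (t + e) * \<rho> powr (e / 2))) \<longlongrightarrow> ennreal 0) (at_right 0)"
      proof (rule tendsto_ennrealI)
        show "((\<lambda>\<rho>. 2 powr (t + e) * \<rho> powr (e / 2)) \<longlongrightarrow> 0) (at_right 0)" using e by real_asymp
      qed
      moreover have "\<forall>\<^sub>F \<rho> in at_right 0. hausdorff_premeasure (t + e) \<delta> E \<le> ennreal (2 powr (t + e) * \<rho> powr (e / 2))"
        unfolding eventually_at_right_field using bound[OF \<delta>] b(1) \<delta> by (intro exI[of _ "min b (min 1 (\<delta> / 2))"]) auto
      ultimately have "hausdorff_premeasure (t + e) \<delta> E \<le> ennreal 0"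
        by (intro tendsto_lowerbound[where F = "at_right 0"]) auto
      then show ?thesis by simp
    qed
    then have "hausdorff_measure (t + e) E = 0" unfolding hausdorff_measure_def by (simp add: SUP_eq_const)
    then show "hausdorff_dim E \<le> ereal t + ereal e" unfolding hausdorff_dim_def
      using t e by (intro INF_lower2[of "t + e"]) auto
  qed
qed


section \<open>Subadditive cocycles over an ergodic map\<close>

locale ergodic_map = prob_space +
  fixes T :: "'a \<Rightarrow> 'a"
  assumes T [measurable]: "T \<in> measurable M M"
    and preserving: "distr M M T = M"
    and ergodic: "\<And>X. X \<in> sets M \<Longrightarrow> T -` X \<inter> space M = X \<Longrightarrow> prob X = 0 \<or> prob X = 1"
begin

lemma T_pow [measurable]: "(T ^^ k) \<in> measurable M M"
proof (induction k)
  case (Suc k)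
  show ?case unfolding funpow.simps by (rule measurable_comp[OF Suc T])
qed (simp add: id_def)

lemma distr_T_pow: "distr M M (T ^^ k) = M"
proof (induction k)
  case (Suc k)
  have "distr M M (T ^^ Suc k) = distr (distr M M (T ^^ k)) M T"
    unfolding funpow.simps by (rule distr_distr[symmetric]) auto
  then show ?case using Suc preserving by (simp add: comp_def)
qed (simp add: id_def distr_id2)

lemma expectation_T_pow:
  assumes [measurable]: "f \<in> borel_measurable M"
  shows "expectation (\<lambda>x. f ((T ^^ k) x)) = expectation (f :: 'a \<Rightarrow> real)"
proof -
  have "expectation f = integral\<^sup>L (distr M M (T ^^ k)) f" by (simp add: distr_T_pow)
  also have "\<dots> = expectation (\<lambda>x. f ((T ^^ k) x))" by (rule integral_distr) auto
  finally show ?thesis by simp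
qed

end

lemma (in prob_space) integrable_bounded:
  assumes "f \<in> borel_measurable M" "\<And>x. x \<in> space M \<Longrightarrow> \<bar>f x\<bar> \<le> (C :: real)"
  shows "integrable M f"
  by (rule integrable_const_bound[where B = C]) (use assms in \<open>auto intro: AE_I2\<close>)

text \<open>The assumption \<open>near\<close> bounds the effect of dropping the first step. This
  makes the lower growth rate of \<open>g\<close> invariant under \<open>T\<close>, so that
  ergodicity can be used.\<close>

locale subadditive_cocycle = ergodic_map +
  fixes g :: "nat \<Rightarrow> 'a \<Rightarrow> real" and C \<gamma> :: real
  assumes g [measurable]: "\<And>n. g n \<in> borel_measurable M"
    and sub: "\<And>m n x. x \<in> space M \<Longrightarrow> g (m + n) x \<le> g m x + g n ((T ^^ m) x)"
    and bound: "\<And>n x. x \<in> space M \<Longrightarrow> \<bar>g n x\<bar> \<le> C * real n"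
    and near: "\<And>n x. x \<in> space M \<Longrightarrow> \<bar>g (Suc n) x - g n (T x)\<bar> \<le> C"
    and lim: "(\<lambda>n. expectation (g n) / real n) \<longlonglongrightarrow> \<gamma>"
begin

lemma C_nonneg: "0 \<le> C"
proof -
  obtain x where "x \<in> space M" using not_empty by blast
  from near[OF this, of 0] show ?thesis by linarith
qed

lemma T_pow_space: "x \<in> space M \<Longrightarrow> (T ^^ k) x \<in> space M"
  using measurable_space[OF T_pow] by blast

text \<open>The first return estimate of Katznelson--Weiss and Steele: the points \<open>T\<^sup>k x\<close> with \<open>k < n\<close>
  are grouped greedily into blocks on which the average is at most \<open>c\<close>, except for those in the bad
  set and for a final segment of length \<open>N\<close>.\<close>

definition late :: "real \<Rightarrow> nat \<Rightarrow> 'a set" where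
  "late c N = {x \<in> space M. \<forall>m\<in>{1..N}. c * real m < g m x}"

lemma late_sets [measurable]: "late c N \<in> sets M"
  unfolding late_def by measurable

lemma greedy_bound:
  assumes "x \<in> space M"
  shows "g n x \<le> c * real n + (C + \<bar>c\<bar>) * (\<Sum>k<n. indicator (late c N) ((T ^^ k) x)) + (C + \<bar>c\<bar>) * real N"
  using assms
proof (induction n arbitrary: x rule: less_induct)
  case (less n)
  define K where "K = C + \<bar>c\<bar>"
  have K: "0 \<le> K" "C - c \<le> K" unfolding K_def using C_nonneg by auto
  define S where "S n y = (\<Sum>k<n. indicator (late c N) ((T ^^ k) y) :: real)" for n y
  have S_nonneg: "0 \<le> S n y" for n y unfolding S_def by (intro sum_nonneg) auto
  have S_add: "S (m + l) y = S m y + S l ((T ^^ m) y)" for m l y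
    unfolding S_def
    by (induction l) (simp_all add: funpow_add[of _ m, unfolded comp_def] add.commute[of m])
  have IH: "g l y \<le> c * real l + K * S l y + K * real N" if "l < n" "y \<in> space M" for l y
    using less.IH[OF that] unfolding K_def S_def .
  have "g n x \<le> c * real n + K * S n x + K * real N"
  proof (cases "n \<le> N")
    case True
    have "g n x \<le> C * real n" using bound[OF less.prems, of n] by linarith
    also have "\<dots> \<le> c * real n + K * real n" using K(2) by (simp add: distrib_right[symmetric] mult_right_mono)
    also have "\<dots> \<le> c * real n + K * real N" using True K by (simp add: mult_left_mono)
    finally show ?thesis using mult_nonneg_nonneg[OF K(1) S_nonneg[of n x]] by linarith
  next
    case False
    show ?thesis
    proof (cases "x \<in> late c N")
      case True
      obtain l where l: "n = 1 + l" using False by (cases n) auto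
      have "g n x \<le> g 1 x + g l ((T ^^ 1) x)" unfolding l by (rule sub[OF less.prems])
      also have "\<dots> \<le> C + (c * real l + K * S l ((T ^^ 1) x) + K * real N)"
        using bound[OF less.prems, of 1] by (intro add_mono IH T_pow_space less.prems) (auto simp: l)
      also have "\<dots> \<le> c * real n + K * (1 + S l ((T ^^ 1) x)) + K * real N"
        using K(2) by (simp add: l algebra_simps)
      also have "1 + S l ((T ^^ 1) x) = S n x" unfolding l S_add using True by (simp add: S_def)
      finally show ?thesis .
    next
      case nl: False
      then obtain m where m: "m \<in> {1..N}" "g m x \<le> c * real m"
        using less.prems unfolding late_def by force
      obtain l where l: "n = m + l" using m False by (metis atLeastAtMost_iff le_Suc_ex nat_le_linear order_trans)
      have "g n x \<le> g m x + g l ((T ^^ m) x)" unfolding l by (rule sub[OF less.prems])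
      also have "\<dots> \<le> c * real m + (c * real l + K * S l ((T ^^ m) x) + K * real N)"
        using m by (intro add_mono IH T_pow_space less.prems) (auto simp: l)
      also have "\<dots> \<le> c * real n + K * S n x + K * real N"
        unfolding l S_add using mult_nonneg_nonneg[OF K(1) S_nonneg[of m x]] by (simp add: algebra_simps)
      finally show ?thesis .
    qed
  qed
  then show ?case unfolding K_def S_def .
qed

text \<open>The points where the lower limit of \<open>g n x / n\<close> is below \<open>c\<close>;
  the rational witness turns this into a countable union and makes the set measurable.\<close>

definition low :: "real \<Rightarrow> 'a set" where
  "low c = {x \<in> space M. \<exists>d::rat. of_rat d < c \<and> (\<forall>N. \<exists>n. N \<le> n \<and> g n x < of_rat d * real n)}"

lemma low_sets [measurable]: "low c \<in> sets M"
  unfolding low_def by measurable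

text \<open>Passing between \<open>x\<close> and \<open>T x\<close> changes \<open>g\<close> by at
  most \<open>C\<close> and shifts \<open>n\<close> by one; for large \<open>n\<close> this fits
  between two rationals below \<open>c\<close>.\<close>

lemma low_invariant: "T -` low c \<inter> space M = low c"
proof -
  have rat: "\<exists>e::rat. of_rat d < (of_rat e :: real) \<and> of_rat e < c" if "of_rat d < c" for d
    using of_rat_dense[OF that] by blast
  have big: "\<exists>N. \<forall>n\<ge>N. b \<le> (e - d) * real n" if "d < e" for b d e :: real
  proof -
    obtain N :: nat where N: "b / (e - d) \<le> real N" using real_arch_simple by blast
    have "b \<le> (e - d) * real n" if "N \<le> n" for n
    proof -
      have "b / (e - d) \<le> real n" using N that by linarith
      then show ?thesis using \<open>d < e\<close> by (simp only: pos_divide_le_eq diff_gt_0_iff_gt mult.commute)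
    qed
    then show ?thesis by blast
  qed
  have "T x \<in> low c \<longleftrightarrow> x \<in> low c" if x: "x \<in> space M" for x
  proof
    assume "T x \<in> low c"
    then obtain d :: rat where d: "of_rat d < c" "\<And>N. \<exists>n\<ge>N. g n (T x) < of_rat d * real n"
      unfolding low_def by auto
    obtain e :: rat where e: "of_rat d < (of_rat e :: real)" "of_rat e < c" using rat[OF d(1)] by blast
    obtain N0 where N0: "\<And>n. n \<ge> N0 \<Longrightarrow> C - of_rat e \<le> (of_rat e - of_rat d) * real n"
      using big[OF e(1)] by blast
    have "\<exists>n\<ge>N. g n x < of_rat e * real n" for N
    proof -
      obtain n where n: "n \<ge> max N N0" "g n (T x) < of_rat d * real n" using d(2) by blast
      have "g (Suc n) x < of_rat d * real n + C" using n(2) near[OF x, of n] by linarith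
      also have "\<dots> \<le> of_rat e * real (Suc n)" using N0[of n] n(1) by (simp add: algebra_simps)
      finally show ?thesis using n(1) by (intro exI[of _ "Suc n"]) auto
    qed
    then show "x \<in> low c" unfolding low_def using x e(2) by blast
  next
    assume "x \<in> low c"
    then obtain d :: rat where d: "of_rat d < c" "\<And>N. \<exists>n\<ge>N. g n x < of_rat d * real n"
      unfolding low_def by auto
    obtain e :: rat where e: "of_rat d < (of_rat e :: real)" "of_rat e < c" using rat[OF d(1)] by blast
    obtain N0 where N0: "\<And>n. n \<ge> N0 \<Longrightarrow> C + of_rat d \<le> (of_rat e - of_rat d) * real n"
      using big[OF e(1)] by blast
    have "\<exists>n\<ge>N. g n (T x) < of_rat e * real n" for N
    proof -
      obtain k where k: "k \<ge> Suc (max N N0)" "g k x < of_rat d * real k" using d(2) by blast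
      obtain n where n: "k = Suc n" using k by (cases k) auto
      have "g n (T x) < of_rat d * real k + C" using k(2) near[OF x, of n] n by simp
      also have "\<dots> \<le> of_rat e * real n" using N0[of n] k(1) n by (simp add: algebra_simps)
      finally show ?thesis using k(1) n by (intro exI[of _ n]) auto
    qed
    then show "T x \<in> low c" unfolding low_def using measurable_space[OF T x] e(2) by blast
  qed
  moreover have "low c \<subseteq> space M" unfolding low_def by blast
  ultimately show ?thesis by auto
qed

text \<open>A point of \<open>low c\<close> has some good block, so it leaves the decreasing sets
  \<open>late c N\<close> once \<open>N\<close> reaches the length of that block.\<close>

lemma prob_late_tendsto:
  assumes "prob (low c) = 1"
  shows "(\<lambda>N. prob (late c N)) \<longlonglongrightarrow> 0"
proof -
  have "late c N \<subseteq> late c N'" if "N' \<le> N" for N N' using that unfolding late_def by auto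
  then have "decseq (late c)" unfolding decseq_def by blast
  then have "(\<lambda>N. prob (late c N)) \<longlonglongrightarrow> prob (\<Inter>N. late c N)"
    by (intro finite_Lim_measure_decseq) auto
  moreover have "(\<Inter>N. late c N) \<inter> low c = {}"
  proof (intro equals0I)
    fix x assume x: "x \<in> (\<Inter>N. late c N) \<inter> low c"
    then obtain d :: rat where d: "of_rat d < c" "\<And>N. \<exists>n\<ge>N. g n x < of_rat d * real n"
      unfolding low_def by auto
    obtain n where n: "n \<ge> 1" "g n x < of_rat d * real n" using d(2) by blast
    have "x \<in> late c n" using x by auto
    then have "c * real n < g n x" using n unfolding late_def by auto
    then show False using n d(1) mult_right_mono[of "of_rat d" c "real n"] by linarith
  qed
  then have "prob (\<Inter>N. late c N) = 0"
  proof -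
    assume e: "(\<Inter>N. late c N) \<inter> low c = {}"
    have "prob ((\<Inter>N. late c N) \<union> low c) = prob (\<Inter>N. late c N) + prob (low c)"
      by (rule finite_measure_Union) (use e in auto)
    then show ?thesis using assms prob_le_1[of "(\<Inter>N. late c N) \<union> low c"] measure_nonneg[of M "\<Inter>N. late c N"]
      by linarith
  qed
  ultimately show ?thesis by simp
qed

text \<open>By ergodicity the set \<open>low e\<close>, with \<open>e\<close> between
  \<open>c\<close> and \<gamma>, has probability 0 or 1. Probability 1 is impossible: the integrated
  greedy bound would give \<gamma> \<le> \<open>e + K * prob (late e N)\<close>, which tends to
  \<open>e\<close>.\<close>

lemma lower_half:
  assumes "c < \<gamma>"
  shows "AE x in M. \<forall>\<^sub>F n in sequentially. c \<le> g n x / real n"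
proof -
  define e where "e = (c + \<gamma>) / 2"
  have e: "c < e" "e < \<gamma>" using assms unfolding e_def by auto
  have "prob (low e) \<noteq> 1"
  proof
    assume p: "prob (low e) = 1"
    define K where "K = C + \<bar>e\<bar>"
    have le: "\<gamma> \<le> e + K * prob (late e N)" for N
    proof -
      have "expectation (g n) / real n \<le> e + K * prob (late e N) + K * real N / real n" if "n \<ge> 1" for n
      proof -
        have int: "integrable M (\<lambda>x. indicator (late e N) ((T ^^ k) x) :: real)" for k
          by (rule integrable_bounded[where C = 1]) (auto simp: indicator_def)
        have "expectation (g n) \<le> expectation (\<lambda>x. e * real n + K * (\<Sum>k<n. indicator (late e N) ((T ^^ k) x)) + K * real N)"
        proof (rule integral_mono)
          show "integrable M (g n)" by (rule integrable_bounded[OF g bound])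
          show "integrable M (\<lambda>x. e * real n + K * (\<Sum>k<n. indicator (late e N) ((T ^^ k) x)) + K * real N)"
            by (intro Bochner_Integration.integrable_add integrable_mult_right Bochner_Integration.integrable_sum int) auto
        qed (use greedy_bound in \<open>auto simp: K_def\<close>)
        also have "\<dots> = e * real n + K * (\<Sum>k<n. expectation (\<lambda>x. indicator (late e N) ((T ^^ k) x))) + K * real N"
          using int by (simp add: prob_space)
        also have "(\<Sum>k<n. expectation (\<lambda>x. indicator (late e N) ((T ^^ k) x))) = real n * prob (late e N)"
          by (subst expectation_T_pow[where f = "indicator (late e N)"]) auto
        finally have "expectation (g n) / real n \<le> (e * real n + K * (real n * prob (late e N)) + K * real N) / real n"
          using that by (intro divide_right_mono) auto
        also have "\<dots> = e + K * prob (late e N) + K * real N / real n" using that by (simp add: field_simps)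
        finally show ?thesis .
      qed
      moreover have "(\<lambda>n. e + K * prob (late e N) + K * real N / real n) \<longlonglongrightarrow> e + K * prob (late e N) + 0"
        by (intro tendsto_add tendsto_const lim_const_over_n)
      ultimately show ?thesis using LIMSEQ_le[OF lim] by fastforce
    qed
    have "(\<lambda>N. e + K * prob (late e N)) \<longlonglongrightarrow> e + K * 0"
      by (intro tendsto_add tendsto_mult tendsto_const prob_late_tendsto p)
    from LIMSEQ_le_const[OF this, of \<gamma>] le e(2) show False by auto
  qed
  then have "prob (low e) = 0" using ergodic[OF low_sets low_invariant] by blast
  then have "low e \<in> null_sets M" by (simp add: emeasure_eq_measure null_sets_def)
  then have "AE x in M. x \<notin> low e" by (rule AE_not_in)
  then show ?thesis
  proof (rule AE_mp, intro AE_I2 impI)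
    fix x assume x: "x \<in> space M" "x \<notin> low e"
    obtain d :: rat where d: "c < of_rat d" "of_rat d < e" using of_rat_dense[OF e(1)] by blast
    then obtain N where N: "\<And>n. n \<ge> N \<Longrightarrow> of_rat d * real n \<le> g n x"
      using x unfolding low_def by force
    have "c \<le> g n x / real n" if "n \<ge> Suc N" for n
    proof -
      have "c * real n \<le> of_rat d * real n" using d(1) by (intro mult_right_mono) auto
      then have "c * real n \<le> g n x" using N[of n] that by linarith
      then show ?thesis using that by (simp add: pos_le_divide_eq)
    qed
    then show "\<forall>\<^sub>F n in sequentially. c \<le> g n x / real n" unfolding eventually_sequentially by blast
  qed
qed

text \<open>Otherwise \<open>g n x / n\<close> is almost surely at least some \<open>d\<close> >
  \<gamma> from some \<open>n\<close> on. Truncated at \<open>d\<close> it converges boundedly to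
  \<open>d\<close>, which forces the limit \<gamma> of the means to be at least
  \<open>d\<close>.\<close>

lemma prob_low_eq_1:
  assumes "\<gamma> < c"
  shows "prob (low c) = 1"
proof (rule ccontr)
  assume "prob (low c) \<noteq> 1"
  then have "prob (low c) = 0" using ergodic[OF low_sets low_invariant] by blast
  then have "low c \<in> null_sets M" by (simp add: emeasure_eq_measure null_sets_def)
  then have ae: "AE x in M. x \<notin> low c" by (rule AE_not_in)
  obtain d :: rat where d: "\<gamma> < of_rat d" "of_rat d < c" using of_rat_dense[OF assms] by blast
  have "(\<lambda>n. expectation (\<lambda>x. min (g n x / real n) (of_rat d))) \<longlonglongrightarrow> expectation (\<lambda>x. of_rat d)"
  proof (rule integral_dominated_convergence[where w = "\<lambda>_. C + \<bar>of_rat d\<bar>"])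
    show "AE x in M. (\<lambda>n. min (g n x / real n) (of_rat d)) \<longlonglongrightarrow> of_rat d"
      using ae
    proof (rule AE_mp, intro AE_I2 impI)
      fix x assume x: "x \<in> space M" "x \<notin> low c"
      then obtain N where N: "\<And>n. n \<ge> N \<Longrightarrow> of_rat d * real n \<le> g n x"
        using d(2) unfolding low_def by force
      have "\<forall>\<^sub>F n in sequentially. min (g n x / real n) (of_rat d) = of_rat d"
        using eventually_ge_at_top[of "Suc N"]
      proof eventually_elim
        case (elim n)
        then show ?case using N[of n] by (simp add: field_simps min_def)
      qed
      then show "(\<lambda>n. min (g n x / real n) (of_rat d)) \<longlonglongrightarrow> of_rat d" by (rule tendsto_eventually)
    qed
    show "AE x in M. norm (min (g n x / real n) (of_rat d)) \<le> C + \<bar>of_rat d\<bar>" for n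
    proof (rule AE_I2)
      fix x assume "x \<in> space M"
      have "\<bar>g n x / real n\<bar> \<le> C"
        using bound[OF \<open>x \<in> space M\<close>, of n] C_nonneg by (cases "n = 0") (auto simp: field_simps)
      moreover have "\<bar>min u w\<bar> \<le> C + \<bar>w\<bar>" if "\<bar>u\<bar> \<le> C" for u w :: real
        using that C_nonneg by (auto simp: min_def)
      ultimately show "norm (min (g n x / real n) (of_rat d)) \<le> C + \<bar>of_rat d\<bar>" unfolding real_norm_def by blast
    qed
  qed auto
  then have l: "(\<lambda>n. expectation (\<lambda>x. min (g n x / real n) (of_rat d))) \<longlonglongrightarrow> of_rat d" by (simp add: prob_space)
  have "expectation (\<lambda>x. min (g n x / real n) (of_rat d)) \<le> expectation (g n) / real n" for n
  proof -
    have i: "integrable M (\<lambda>x. g n x / real n)" by (intro integrable_divide integrable_bounded[OF g bound])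
    have "expectation (\<lambda>x. min (g n x / real n) (of_rat d)) \<le> expectation (\<lambda>x. g n x / real n)"
      by (intro integral_mono i integrable_min) auto
    then show ?thesis by simp
  qed
  then have "of_rat d \<le> \<gamma>" using LIMSEQ_le[OF l lim] by blast
  then show False using d(1) by simp
qed

end

section \<open>Birkhoff's and Kingman's theorems\<close>

context ergodic_map
begin

lemma birkhoff_cocycle:
  assumes [measurable]: "f \<in> borel_measurable M" and b: "\<And>x. x \<in> space M \<Longrightarrow> \<bar>f x\<bar> \<le> C"
  shows "subadditive_cocycle M T (\<lambda>n x. \<Sum>k<n. f ((T ^^ k) x)) C (expectation f)"
proof
  show "(\<lambda>x. \<Sum>k<n. f ((T ^^ k) x)) \<in> borel_measurable M" for n by measurable
  show "(\<Sum>k<m + n. f ((T ^^ k) x)) \<le> (\<Sum>k<m. f ((T ^^ k) x)) + (\<Sum>k<n. f ((T ^^ k) ((T ^^ m) x)))" for m n x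
    by (induction n) (simp_all add: funpow_add[of _ m, unfolded comp_def] add.commute[of m])
  have Tp: "x \<in> space M \<Longrightarrow> (T ^^ k) x \<in> space M" for k x using measurable_space[OF T_pow] by blast
  show "\<bar>\<Sum>k<n. f ((T ^^ k) x)\<bar> \<le> C * real n" if "x \<in> space M" for n x
  proof -
    have "\<bar>\<Sum>k<n. f ((T ^^ k) x)\<bar> \<le> (\<Sum>k<n. \<bar>f ((T ^^ k) x)\<bar>)" by (rule sum_abs)
    also have "\<dots> \<le> (\<Sum>k<n. C)" by (intro sum_mono b Tp that)
    finally show ?thesis by (simp add: mult.commute)
  qed
  show "\<bar>(\<Sum>k<Suc n. f ((T ^^ k) x)) - (\<Sum>k<n. f ((T ^^ k) (T x)))\<bar> \<le> C" if "x \<in> space M" for n x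
    using b[OF that] unfolding sum.lessThan_Suc_shift by (simp add: funpow_swap1)
  have "integrable M (\<lambda>x. f ((T ^^ k) x))" for k
    by (rule integrable_bounded[where C = C]) (use b Tp in auto)
  then have e: "expectation (\<lambda>x. \<Sum>k<n. f ((T ^^ k) x)) = real n * expectation f" for n
    by (simp add: expectation_T_pow)
  have "\<forall>\<^sub>F n in sequentially. expectation (\<lambda>x. \<Sum>k<n. f ((T ^^ k) x)) / real n = expectation f"
    using eventually_gt_at_top[of 0] by eventually_elim (simp add: e)
  then show "(\<lambda>n. expectation (\<lambda>x. \<Sum>k<n. f ((T ^^ k) x)) / real n) \<longlonglongrightarrow> expectation f"
    by (rule tendsto_eventually)
qed

lemma AE_tendstoI:
  fixes h :: "nat \<Rightarrow> 'a \<Rightarrow> real"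
  assumes "\<And>c. c < l \<Longrightarrow> AE x in M. \<forall>\<^sub>F n in sequentially. c \<le> h n x"
    and "\<And>c. l < c \<Longrightarrow> AE x in M. \<forall>\<^sub>F n in sequentially. h n x \<le> c"
  shows "AE x in M. (\<lambda>n. h n x) \<longlonglongrightarrow> l"
proof -
  have "AE x in M. \<forall>j. (\<forall>\<^sub>F n in sequentially. l - inverse (real (Suc j)) \<le> h n x) \<and> (\<forall>\<^sub>F n in sequentially. h n x \<le> l + inverse (real (Suc j)))"
    unfolding AE_all_countable by (intro allI AE_conjI assms) auto
  then show ?thesis
  proof (rule AE_mp, intro AE_I2 impI)
    fix x assume *: "\<forall>j. (\<forall>\<^sub>F n in sequentially. l - inverse (real (Suc j)) \<le> h n x) \<and> (\<forall>\<^sub>F n in sequentially. h n x \<le> l + inverse (real (Suc j)))"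
    show "(\<lambda>n. h n x) \<longlonglongrightarrow> l"
    proof (rule tendstoI)
      fix e :: real assume "0 < e"
      then obtain j where j: "inverse (real (Suc j)) < e" using reals_Archimedean by blast
      from *[rule_format, of j] have "\<forall>\<^sub>F n in sequentially. l - inverse (real (Suc j)) \<le> h n x"
        "\<forall>\<^sub>F n in sequentially. h n x \<le> l + inverse (real (Suc j))" by auto
      then show "\<forall>\<^sub>F n in sequentially. dist (h n x) l < e"
        by eventually_elim (use j in \<open>auto simp: dist_real_def\<close>)
    qed
  qed
qed

text \<open>Additive cocycles may be negated, so the lower half for \<open>f\<close> and for
  \<open>- f\<close> gives both sides.\<close>

lemma birkhoff:
  assumes [measurable]: "f \<in> borel_measurable M" and b: "\<And>x. x \<in> space M \<Longrightarrow> \<bar>f x\<bar> \<le> C"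
  shows "AE x in M. (\<lambda>n. (\<Sum>k<n. f ((T ^^ k) x)) / real n) \<longlonglongrightarrow> expectation f"
proof (rule AE_tendstoI)
  interpret p: subadditive_cocycle M T "\<lambda>n x. \<Sum>k<n. f ((T ^^ k) x)" C "expectation f"
    by (rule birkhoff_cocycle[OF assms])
  interpret m: subadditive_cocycle M T "\<lambda>n x. \<Sum>k<n. - f ((T ^^ k) x)" C "expectation (\<lambda>x. - f x)"
    by (rule birkhoff_cocycle) (use b in auto)
  show "AE x in M. \<forall>\<^sub>F n in sequentially. c \<le> (\<Sum>k<n. f ((T ^^ k) x)) / real n" if "c < expectation f" for c
    by (rule p.lower_half[OF that])
  show "AE x in M. \<forall>\<^sub>F n in sequentially. (\<Sum>k<n. f ((T ^^ k) x)) / real n \<le> c" if "expectation f < c" for c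
  proof -
    have "AE x in M. \<forall>\<^sub>F n in sequentially. - c \<le> (\<Sum>k<n. - f ((T ^^ k) x)) / real n"
      by (rule m.lower_half) (use that in simp)
    then show ?thesis by (simp add: sum_negf)
  qed
qed

end

context subadditive_cocycle
begin

text \<open>The upper half uses the greedy bound pointwise. By Birkhoff the visits to
  \<open>late e N\<close> have frequency equal to its probability, which is small for large
  \<open>N\<close>.\<close>

theorem kingman: "AE x in M. (\<lambda>n. g n x / real n) \<longlonglongrightarrow> \<gamma>"
proof (rule AE_tendstoI)
  show "AE x in M. \<forall>\<^sub>F n in sequentially. c \<le> g n x / real n" if "c < \<gamma>" for c
    by (rule lower_half[OF that])
  show "AE x in M. \<forall>\<^sub>F n in sequentially. g n x / real n \<le> c" if "\<gamma> < c" for c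
  proof -
    define e where "e = (c + \<gamma>) / 2"
    have e: "\<gamma> < e" "e < c" using that unfolding e_def by auto
    define K where "K = C + \<bar>e\<bar>"
    have "(\<lambda>N. K * prob (late e N)) \<longlonglongrightarrow> K * 0"
      by (intro tendsto_mult tendsto_const prob_late_tendsto prob_low_eq_1 e)
    then have "\<forall>\<^sub>F N in sequentially. K * prob (late e N) < c - e" using e by (intro order_tendstoD) auto
    then obtain N where N: "K * prob (late e N) < c - e" unfolding eventually_sequentially by blast
    have "AE x in M. (\<lambda>n. (\<Sum>k<n. indicator (late e N) ((T ^^ k) x)) / real n) \<longlonglongrightarrow> expectation (indicator (late e N))"
      by (rule birkhoff[where C = 1]) (auto simp: indicator_def)
    then show ?thesis
    proof (rule AE_mp, intro AE_I2 impI)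
      fix x assume x: "x \<in> space M"
        and "(\<lambda>n. (\<Sum>k<n. indicator (late e N) ((T ^^ k) x)) / real n) \<longlonglongrightarrow> expectation (indicator (late e N))"
      then have "(\<lambda>n. e + K * ((\<Sum>k<n. indicator (late e N) ((T ^^ k) x)) / real n) + K * real N / real n)
          \<longlonglongrightarrow> e + K * prob (late e N) + 0"
        by (intro tendsto_add tendsto_mult tendsto_const lim_const_over_n) simp
      then have "\<forall>\<^sub>F n in sequentially. e + K * ((\<Sum>k<n. indicator (late e N) ((T ^^ k) x)) / real n) + K * real N / real n < c"
        using N by (intro order_tendstoD) auto
      then show "\<forall>\<^sub>F n in sequentially. g n x / real n \<le> c"
        using eventually_gt_at_top[of 0]
      proof eventually_elim
        case (elim n)
        have "g n x / real n \<le> (e * real n + K * (\<Sum>k<n. indicator (late e N) ((T ^^ k) x)) + K * real N) / real n"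
          unfolding K_def by (intro divide_right_mono greedy_bound x) auto
        also have "\<dots> = e + K * ((\<Sum>k<n. indicator (late e N) ((T ^^ k) x)) / real n) + K * real N / real n"
          using elim by (simp add: add_divide_distrib)
        finally show ?case using elim by linarith
      qed
    qed
  qed
qed

end


section \<open>Bernoulli measures and Lyapunov exponents\<close>

abbreviation seq_space :: "(nat \<Rightarrow> 'n) measure"
  where "seq_space \<equiv> PiM UNIV (\<lambda>_. count_space UNIV)"

lemma space_seq_space [simp]: "space seq_space = UNIV"
  by (simp add: space_PiM)

lemma measurable_coord [measurable]: "(\<lambda>\<omega>. \<omega> k) \<in> measurable seq_space (count_space UNIV)"
  by (rule measurable_component_singleton) simp

lemma prefix_word_eq_nth_iff: "prefix_word \<omega> n = w \<longleftrightarrow> length w = n \<and> (\<forall>k<n. \<omega> k = w ! k)"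
proof
  assume "length w = n \<and> (\<forall>k<n. \<omega> k = w ! k)"
  then show "prefix_word \<omega> n = w" by (intro nth_equalityI) (auto simp: prefix_word_def)
qed (auto simp: prefix_word_def)

lemma measurable_prefix_word [measurable]:
  "(\<lambda>\<omega> :: nat \<Rightarrow> 'n::finite. prefix_word \<omega> n) \<in> measurable seq_space (count_space UNIV)"
  unfolding measurable_count_space_eq2_countable
proof (intro conjI ballI)
  fix w :: "'n list"
  show "(\<lambda>\<omega>. prefix_word \<omega> n) -` {w} \<inter> space seq_space \<in> sets seq_space"
  proof (cases "length w = n")
    case True
    have "(\<lambda>\<omega>. prefix_word \<omega> n) -` {w} \<inter> space seq_space = {\<omega> \<in> space seq_space. \<forall>k\<in>{..<n}. \<omega> k = w ! k}"
      using True by (auto simp: prefix_word_eq_nth_iff)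
    also have "\<dots> \<in> sets seq_space"
    proof (rule sets.sets_Collect_finite_All)
      fix k
      have "{\<omega> \<in> space seq_space. \<omega> k = w ! k} = (\<lambda>\<omega>. \<omega> k) -` {w ! k} \<inter> space seq_space" by auto
      also have "\<dots> \<in> sets seq_space" by (rule measurable_sets[OF measurable_coord]) simp
      finally show "{\<omega> \<in> space seq_space. \<omega> k = w ! k} \<in> sets seq_space" .
    qed simp
    finally show ?thesis .
  next
    case False
    then have "(\<lambda>\<omega>. prefix_word \<omega> n) -` {w} \<inter> space seq_space = {}" by auto
    then show ?thesis by simp
  qed
qed auto

lemma measurable_seq_shift [measurable]: "seq_shift n \<in> measurable seq_space (seq_space :: (nat \<Rightarrow> 'n::finite) measure)"
  unfolding seq_shift_def[abs_def] by (rule measurable_PiM_single') auto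

lemma measurable_fun_prefix:
  fixes F :: "'n::finite list \<Rightarrow> 'b" assumes "\<And>w. F w \<in> space N"
  shows "(\<lambda>\<omega>. F (prefix_word \<omega> n)) \<in> measurable seq_space N"
  by (rule measurable_compose[OF measurable_prefix_word]) (use assms in auto)

definition cyl :: "'n list \<Rightarrow> (nat \<Rightarrow> 'n) set"
  where "cyl w = {\<omega>. prefix_word \<omega> (length w) = w}"

lemma cyl_sets [measurable]: "cyl (w :: 'n::finite list) \<in> sets seq_space"
proof -
  have "cyl w = (\<lambda>\<omega>. prefix_word \<omega> (length w)) -` {w} \<inter> space seq_space" by (auto simp: cyl_def)
  also have "\<dots> \<in> sets seq_space" by (rule measurable_sets[OF measurable_prefix_word]) simp
  finally show ?thesis .
qed

lemma mem_cyl_prefix: "\<omega>' \<in> cyl (prefix_word \<omega> n) \<longleftrightarrow> prefix_word \<omega>' n = prefix_word \<omega> n"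
  by (simp add: cyl_def)

lemma expectation_prefix:
  fixes F :: "'n::finite list \<Rightarrow> real" and M :: "(nat \<Rightarrow> 'n) measure"
  assumes "prob_space M" and [measurable_cong, simp]: "sets M = sets seq_space"
  shows "(\<integral>\<omega>. F (prefix_word \<omega> n) \<partial>M) = (\<Sum>w\<in>{w. length w = n}. F w * measure M (cyl w))"
proof -
  interpret prob_space M by fact
  have "F (prefix_word \<omega> n) = (\<Sum>w\<in>{w. length w = n}. F w * indicator (cyl w) \<omega>)" for \<omega>
  proof -
    have "(\<Sum>w\<in>{w. length w = n}. F w * indicator (cyl w) \<omega>) = (\<Sum>w\<in>{prefix_word \<omega> n}. F w * indicator (cyl w) \<omega>)"
      by (rule sum.mono_neutral_right) (auto simp: finite_words cyl_def indicator_def)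
    then show ?thesis by (simp add: cyl_def indicator_def)
  qed
  then have "expectation (\<lambda>\<omega>. F (prefix_word \<omega> n)) = expectation (\<lambda>\<omega>. \<Sum>w\<in>{w. length w = n}. F w * indicator (cyl w) \<omega>)"
    by simp
  also have "\<dots> = (\<Sum>w\<in>{w. length w = n}. F w * prob (cyl w))"
  proof -
    have "integrable M (indicat_real (cyl w))" for w by (rule integrable_bounded[where C = 1]) (auto simp: indicator_def)
    then show ?thesis by (simp add: Int_absorb2 sets_eq_imp_space_eq)
  qed
  finally show ?thesis .
qed

locale prob_vector =
  fixes p :: "real^'n"
  assumes p_pos: "\<And>i. 0 < p $ i" and p_sum: "(\<Sum>i\<in>UNIV. p $ i) = 1"
begin

abbreviation letter_measure where "letter_measure \<equiv> point_measure UNIV (\<lambda>i. ennreal (p $ i))"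

lemma sets_bernoulli [measurable_cong, simp]: "sets (bernoulli_measure p) = sets seq_space"
  unfolding bernoulli_measure_def by (intro sets_PiM_cong) (simp_all add: sets_point_measure)

lemma space_bernoulli [simp]: "space (bernoulli_measure p) = UNIV"
  using sets_eq_imp_space_eq[OF sets_bernoulli] by simp

lemma prob_space_letter: "prob_space letter_measure"
  using p_pos p_sum by (intro prob_space_point_measure) (auto simp: sum_ennreal less_imp_le)

lemma sequence_space_letter: "sequence_space letter_measure"
  unfolding sequence_space_def product_prob_space_def product_sigma_finite_def product_prob_space_axioms_def
  using prob_space_letter prob_space_imp_sigma_finite by blast

lemma prob_space_bernoulli: "prob_space (bernoulli_measure p)"
  unfolding bernoulli_measure_def by (intro prob_space_PiM prob_space_letter)

sublocale B: prob_space "bernoulli_measure p"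
  by (rule prob_space_bernoulli)

lemma emeasure_letter: "emeasure letter_measure {i} = ennreal (p $ i)"
  by (simp add: emeasure_point_measure_finite)

lemma prob_cyl: "measure (bernoulli_measure p) (cyl w) = prod_list (map (($) p) w)"
proof -
  have "cyl w = prod_emb UNIV (\<lambda>_. letter_measure) {..<length w} (\<Pi>\<^sub>E k\<in>{..<length w}. {w ! k})"
    by (rule set_eqI) (simp add: cyl_def prod_emb_def prefix_word_eq_nth_iff space_point_measure restrict_PiE_iff PiE_UNIV_domain Pi_iff Ball_def)
  then have "emeasure (bernoulli_measure p) (cyl w) = (\<Prod>k<length w. ennreal (p $ (w ! k)))"
    unfolding bernoulli_measure_def
    by (simp add: emeasure_PiM_emb prob_space_letter sets_point_measure emeasure_letter)
  also have "\<dots> = ennreal (\<Prod>k<length w. p $ (w ! k))" by (intro prod_ennreal) (simp add: p_pos less_imp_le)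
  also have "(\<Prod>k<length w. p $ (w ! k)) = prod_list (map (($) p) w)"
    by (induction w) (simp_all add: prod.lessThan_Suc_shift del: prod.lessThan_Suc)
  finally have e: "emeasure (bernoulli_measure p) (cyl w) = ennreal (prod_list (map (($) p) w))" .
  have "0 \<le> prod_list (map (($) p) w)" by (induction w) (auto simp: p_pos less_imp_le)
  with e show ?thesis by (simp add: measure_def)
qed

text \<open>An invariant set is determined by the letters from any position on, so it is a tail
  event of independent coordinates and Kolmogorov's 0-1 law applies.\<close>

lemma ergodic_map_bernoulli: "ergodic_map (bernoulli_measure p) (seq_shift 1)"
proof
  interpret S: sequence_space letter_measure by (rule sequence_space_letter)
  have S_eq: "(\<Pi>\<^sub>M i\<in>UNIV. letter_measure) = bernoulli_measure p" by (simp add: bernoulli_measure_def)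
  show T: "seq_shift 1 \<in> measurable (bernoulli_measure p) (bernoulli_measure p)"
    by (simp add: measurable_cong_sets[OF sets_bernoulli sets_bernoulli])
  have Tn: "seq_shift n \<in> measurable (bernoulli_measure p) (bernoulli_measure p)" for n
    by (simp add: measurable_cong_sets[OF sets_bernoulli sets_bernoulli])
  let ?B = "bernoulli_measure p"
  \<comment> \<open>Realise the measure by prepending one letter of an independent copy; the shift
    then becomes the projection to the second factor.\<close>
  have "distr ?B ?B (seq_shift 1) = distr (distr (?B \<Otimes>\<^sub>M ?B) ?B (\<lambda>(\<omega>, \<omega>'). comb_seq 1 \<omega> \<omega>')) ?B (seq_shift 1)"
    using S.PiM_comb_seq[of 1] unfolding S_eq by simp
  also have "\<dots> = distr (?B \<Otimes>\<^sub>M ?B) ?B (seq_shift 1 \<circ> (\<lambda>(\<omega>, \<omega>'). comb_seq 1 \<omega> \<omega>'))"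
    using measurable_comb_seq[of 1 letter_measure] unfolding S_eq by (intro distr_distr T)
  also have "seq_shift 1 \<circ> (\<lambda>(\<omega>, \<omega>'). comb_seq 1 \<omega> \<omega>') = (snd :: (nat \<Rightarrow> 'n) \<times> (nat \<Rightarrow> 'n) \<Rightarrow> _)"
    by (auto simp: fun_eq_iff seq_shift_def)
  also have "distr (?B \<Otimes>\<^sub>M ?B) ?B snd = ?B" 
  proof (rule measure_eqI)
    fix X assume "X \<in> sets (distr (?B \<Otimes>\<^sub>M ?B) ?B snd)"
    then have X: "X \<in> sets ?B" by simp
    have "emeasure (distr (?B \<Otimes>\<^sub>M ?B) ?B snd) X = emeasure (?B \<Otimes>\<^sub>M ?B) (space ?B \<times> X)"
      using X by (subst emeasure_distr) (auto intro!: arg_cong[where f = "emeasure (?B \<Otimes>\<^sub>M ?B)"] simp: space_pair_measure)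
    also have "\<dots> = emeasure ?B (space ?B) * emeasure ?B X" by (rule B.emeasure_pair_measure_Times[OF sets.top X])
    also have "\<dots> = emeasure ?B X" unfolding B.emeasure_space_1 by simp
    finally show "emeasure (distr (?B \<Otimes>\<^sub>M ?B) ?B snd) X = emeasure ?B X" .
  qed simp
  finally show "distr ?B ?B (seq_shift 1) = ?B" .
  fix X assume X: "X \<in> sets ?B" and inv: "seq_shift 1 -` X \<inter> space ?B = X"
  have inv1: "seq_shift 1 \<omega> \<in> X \<longleftrightarrow> \<omega> \<in> X" for \<omega> using inv by auto
  have invn: "seq_shift n \<omega> \<in> X \<longleftrightarrow> \<omega> \<in> X" for n \<omega>
  proof (induction n)
    case (Suc n)
    have "seq_shift (Suc n) \<omega> = seq_shift 1 (seq_shift n \<omega>)" by (simp add: seq_shift_seq_shift)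
    then show ?case using inv1 Suc by simp
  qed simp
  define A where "A i = sigma_sets (space ?B) {(\<lambda>\<omega>. \<omega> i) -` E \<inter> space ?B | E. E \<in> sets letter_measure}" for i :: nat
  have rv: "(\<lambda>\<omega>. \<omega> i) \<in> measurable ?B letter_measure" for i
    unfolding bernoulli_measure_def by measurable
  have "B.indep_vars (\<lambda>_. letter_measure) (\<lambda>i \<omega>. \<omega> i) UNIV"
  proof (subst B.indep_vars_iff_distr_eq_PiM)
    have "distr ?B letter_measure (\<lambda>\<omega>. \<omega> i) = letter_measure" for i
      unfolding bernoulli_measure_def by (rule S.PiM_component) simp
    then show "distr ?B (\<Pi>\<^sub>M i\<in>UNIV. letter_measure) (\<lambda>x. \<lambda>i\<in>UNIV. x i)
        = (\<Pi>\<^sub>M i\<in>UNIV. distr ?B letter_measure (\<lambda>\<omega>. \<omega> i))"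
      by (simp add: S_eq restrict_UNIV distr_id2 distr_id)
  qed (use rv in auto)
  then have indep: "B.indep_sets A UNIV" unfolding B.indep_vars_def A_def by blast
  have sa: "sigma_algebra (space ?B) (A i)" for i
    unfolding A_def by (rule sigma_algebra_sigma_sets) auto
  \<comment> \<open>Invariance lets \<open>X\<close> be written as the preimage of itself under
    \<open>seq_shift n\<close>, which only reads coordinates with index at least
    \<open>n\<close>.\<close>
  have "X \<in> sigma_sets (space ?B) (\<Union> (A ` {n..}))" for n
  proof -
    have sub: "\<Union> (A ` {n..}) \<subseteq> Pow (space ?B)" by auto
    let ?N = "sigma (space ?B) (\<Union> (A ` {n..}))"
    have "seq_shift n \<in> measurable ?N (\<Pi>\<^sub>M i\<in>UNIV. letter_measure)"
      unfolding seq_shift_def[abs_def]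
    proof (rule measurable_PiM_single')
      show "(\<lambda>\<omega>. \<omega> (n + i)) \<in> measurable ?N letter_measure" for i
      proof (rule measurableI)
        fix E assume "E \<in> sets letter_measure"
        then have "(\<lambda>\<omega>. \<omega> (n + i)) -` E \<inter> space ?B \<in> A (n + i)" unfolding A_def by blast
        then have "(\<lambda>\<omega>. \<omega> (n + i)) -` E \<inter> space ?B \<in> \<Union> (A ` {n..})" by auto
        then show "(\<lambda>\<omega>. \<omega> (n + i)) -` E \<inter> space ?N \<in> sets ?N"
          using sub by (simp add: sets_measure_of space_measure_of)
      qed (simp add: space_point_measure)
    qed (simp add: space_point_measure)
    then have "seq_shift n -` X \<inter> space ?N \<in> sets ?N"
      using X unfolding S_eq by (rule measurable_sets)
    moreover have "seq_shift n -` X \<inter> space ?N = X" using invn by (auto simp: space_measure_of_conv)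
    ultimately show ?thesis using sub by (simp add: sets_measure_of)
  qed
  then have "X \<in> B.tail_events A" unfolding B.tail_events_def by blast
  then show "B.prob X = 0 \<or> B.prob X = 1" by (rule B.kolmogorov_0_1_law[OF sa indep])
qed

sublocale B: ergodic_map "bernoulli_measure p" "seq_shift 1"
  by (rule ergodic_map_bernoulli)

lemma funpow_seq_shift: "(seq_shift 1 ^^ k) \<omega> = seq_shift k \<omega>"
  by (induction k) (simp_all add: seq_shift_seq_shift)

lemma sum_p_words: "(\<Sum>w\<in>{w. length w = n}. prod_list (map (($) p) w)) = 1"
  using sum_words_prod[of "($) p" n] p_sum by simp

lemma birkhoff_letters:
  fixes f :: "'n \<Rightarrow> real"
  shows "AE \<omega> in bernoulli_measure p. (\<lambda>n. (\<Sum>k<n. f (\<omega> k)) / real n) \<longlonglongrightarrow> (\<Sum>i\<in>UNIV. p $ i * f i)"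
proof -
  have meas: "(\<lambda>\<omega>. f (\<omega> 0)) \<in> borel_measurable (bernoulli_measure p)"
    unfolding measurable_cong_sets[OF sets_bernoulli refl] by measurable
  have "AE \<omega> in bernoulli_measure p. (\<lambda>n. (\<Sum>k<n. f ((seq_shift 1 ^^ k) \<omega> 0)) / real n) \<longlonglongrightarrow> B.expectation (\<lambda>\<omega>. f (\<omega> 0))"
  proof (rule B.birkhoff[OF meas])
    fix \<omega> :: "nat \<Rightarrow> 'n"
    show "\<bar>f (\<omega> 0)\<bar> \<le> (\<Sum>i\<in>UNIV. \<bar>f i\<bar>)" by (rule member_le_sum) auto
  qed
  moreover have "B.expectation (\<lambda>\<omega>. f (\<omega> 0)) = (\<Sum>i\<in>UNIV. p $ i * f i)"
  proof -
    have "B.expectation (\<lambda>\<omega>. f (\<omega> 0)) = B.expectation (\<lambda>\<omega>. f (hd (prefix_word \<omega> 1)))"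
      by (simp add: prefix_word_def)
    also have "\<dots> = (\<Sum>w\<in>{w. length w = Suc 0}. f (hd w) * prod_list (map (($) p) w))"
      using expectation_prefix[OF prob_space_bernoulli sets_bernoulli, of "\<lambda>w. f (hd w)" "Suc 0"]
      by (simp add: prob_cyl)
    also have "\<dots> = (\<Sum>i\<in>UNIV. f i * p $ i)" unfolding sum_words_Suc by simp
    finally show ?thesis by (simp add: mult.commute)
  qed
  ultimately show ?thesis unfolding funpow_seq_shift by (simp add: seq_shift_def)
qed

end

section \<open>Lyapunov exponents of Bernoulli measures\<close>

locale bernoulli_system = contracting_tuple A r + prob_vector p
  for A :: "real^2^2^'n" and r and p :: "real^'n"
begin

definition lognorm :: "nat \<Rightarrow> (nat \<Rightarrow> 'n) \<Rightarrow> real"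
  where "lognorm n \<omega> = ln (op_norm (word_matrix A (prefix_word \<omega> n)))"

lemma ln_a_neg: "ln a < 0"
  using a_pos a_le_r r_less by simp

lemma ln_op_norm_word_bounds: "real (length w) * ln a \<le> ln (op_norm (word_matrix A w))"
  "ln (op_norm (word_matrix A w)) \<le> real (length w) * ln r"
  "real (length w) * ln a \<le> ln (sing2 (word_matrix A w))"
proof -
  have p: "0 < op_norm (word_matrix A w)" "0 < sing2 (word_matrix A w)"
    using det_word_nz det_nonzero_op_norm_pos sing2_pos by auto
  have "ln (a ^ length w) \<le> ln (sing2 (word_matrix A w))"
    using sing2_word_ge[of w] a_pos by (intro ln_mono) auto
  then show 1: "real (length w) * ln a \<le> ln (sing2 (word_matrix A w))" using a_pos by (simp add: ln_realpow)
  have "ln (sing2 (word_matrix A w)) \<le> ln (op_norm (word_matrix A w))"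
    using p by (intro ln_mono sing2_le_op_norm det_word_nz)
  with 1 show "real (length w) * ln a \<le> ln (op_norm (word_matrix A w))" by linarith
  have "ln (op_norm (word_matrix A w)) \<le> ln (r ^ length w)" using p by (intro ln_mono op_norm_word_le)
  then show "ln (op_norm (word_matrix A w)) \<le> real (length w) * ln r" using r_pos by (simp add: ln_realpow)
qed

text \<open>The mean of \<open>lognorm n\<close> as a finite sum over words: an explicit function of
  the tuple, from which the top exponent can be read off without almost sure limits.\<close>

definition mean_lognorm :: "nat \<Rightarrow> real"
  where "mean_lognorm n = (\<Sum>w\<in>{w. length w = n}. ln (op_norm (word_matrix A w)) * prod_list (map (($) p) w))"

lemma lognorm_measurable [measurable]: "lognorm n \<in> borel_measurable (bernoulli_measure p)"
  unfolding measurable_cong_sets[OF sets_bernoulli refl] lognorm_def[abs_def]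
  by (rule measurable_fun_prefix) simp

lemma expectation_lognorm: "B.expectation (lognorm n) = mean_lognorm n"
  unfolding lognorm_def[abs_def] mean_lognorm_def
  using expectation_prefix[OF prob_space_bernoulli sets_bernoulli, of "\<lambda>w. ln (op_norm (word_matrix A w))" n]
  by (simp add: prob_cyl)

lemma lognorm_sub: "lognorm (m + n) \<omega> \<le> lognorm m \<omega> + lognorm n (seq_shift m \<omega>)"
  unfolding lognorm_def prefix_word_drop word_matrix_append by (rule ln_op_norm_mult_le) simp_all

lemma lognorm_bound: "\<bar>lognorm n \<omega>\<bar> \<le> - ln a * real n"
  using ln_op_norm_word_bounds[of "prefix_word \<omega> n"] mult_nonneg_nonpos[of "real n" "ln r"] r_pos r_less
  unfolding lognorm_def by (simp add: abs_le_iff mult.commute)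

text \<open>Removing the first matrix multiplies the norm by a factor controlled from both sides:
  that matrix shrinks no vector by more than \<open>a\<close> and expands none.\<close>

lemma lognorm_near: "\<bar>lognorm (Suc n) \<omega> - lognorm n (seq_shift 1 \<omega>)\<bar> \<le> - ln a"
proof -
  define M where "M = word_matrix A (prefix_word (seq_shift 1 \<omega>) n)"
  have M: "det M \<noteq> 0" "0 < op_norm M" using det_nonzero_op_norm_pos by (auto simp: M_def)
  have p: "0 < op_norm (A $ \<omega> 0 ** M)" by (rule det_nonzero_op_norm_pos) (simp add: det_mul M)
  have "a * op_norm M \<le> op_norm (A $ \<omega> 0 ** M)"
  proof -
    obtain e where e: "norm e = 1" "norm (M *v e) = op_norm M" using op_norm_attained by blast
    have "a * op_norm M \<le> sing2 (A $ \<omega> 0) * norm (M *v e)"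
      using e M a_le[of "\<omega> 0"] by (simp add: mult_right_mono)
    also have "\<dots> \<le> norm (A $ \<omega> 0 *v (M *v e))" by (rule norm_mult_ge_sing2) simp
    also have "\<dots> \<le> op_norm (A $ \<omega> 0 ** M)"
      using op_norm_ge[of "A $ \<omega> 0 ** M" e] e by (simp add: matrix_vector_mul_assoc)
    finally show ?thesis .
  qed
  then have "ln (a * op_norm M) \<le> ln (op_norm (A $ \<omega> 0 ** M))" using M a_pos by (intro ln_mono) auto
  then have 1: "ln a + ln (op_norm M) \<le> ln (op_norm (A $ \<omega> 0 ** M))" using M a_pos by (simp add: ln_mult_pos)
  have "ln (op_norm (A $ \<omega> 0 ** M)) \<le> ln (op_norm (A $ \<omega> 0)) + ln (op_norm M)"
    by (rule ln_op_norm_mult_le) (simp_all add: M)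
  moreover have "ln (op_norm (A $ \<omega> 0)) \<le> 0"
    using op_norm_le_r[of "\<omega> 0"] r_less det_nonzero_op_norm_pos[OF det_nz, of "\<omega> 0"] by simp
  moreover have "lognorm (Suc n) \<omega> = ln (op_norm (A $ \<omega> 0 ** M))"
    unfolding lognorm_def M_def using prefix_word_drop[of \<omega> 1 n] by (simp add: prefix_word_def)
  moreover have "lognorm n (seq_shift 1 \<omega>) = ln (op_norm M)" unfolding lognorm_def M_def ..
  ultimately show ?thesis using 1 ln_a_neg by (simp add: abs_le_iff)
qed

lemma mean_lognorm_convergent:
  obtains l where "(\<lambda>n. mean_lognorm n / real n) \<longlonglongrightarrow> l"
proof -
  have int: "integrable (bernoulli_measure p) (lognorm n)" for n
    by (rule B.integrable_bounded[OF lognorm_measurable lognorm_bound])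
  have Tm: "seq_shift m \<in> measurable (bernoulli_measure p) (bernoulli_measure p)" for m
    using B.T_pow[of m] funpow_seq_shift[of m] by (simp add: ext[of "seq_shift 1 ^^ m" "seq_shift m"])
  have int2: "integrable (bernoulli_measure p) (\<lambda>\<omega>. lognorm n (seq_shift m \<omega>))" for m n
    by (rule B.integrable_bounded[OF measurable_compose[OF Tm lognorm_measurable] lognorm_bound])
  have "mean_lognorm (m + n) \<le> mean_lognorm m + mean_lognorm n" for m n
  proof -
    have "B.expectation (lognorm (m + n)) \<le> B.expectation (\<lambda>\<omega>. lognorm m \<omega> + lognorm n (seq_shift m \<omega>))"
      by (intro integral_mono int int2 Bochner_Integration.integrable_add lognorm_sub)
    also have "\<dots> = mean_lognorm m + B.expectation (\<lambda>\<omega>. lognorm n (seq_shift m \<omega>))"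
      by (simp add: int int2 expectation_lognorm)
    also have "B.expectation (\<lambda>\<omega>. lognorm n (seq_shift m \<omega>)) = mean_lognorm n"
      using B.expectation_T_pow[OF lognorm_measurable, of n m] unfolding funpow_seq_shift expectation_lognorm .
    finally show ?thesis by (simp add: expectation_lognorm)
  qed
  moreover have "- (- ln a) * real n \<le> mean_lognorm n" for n
  proof -
    have "real n * ln a = (\<Sum>w\<in>{w. length w = n}. real n * ln a * prod_list (map (($) p) w))"
      using sum_p_words[of n] by (simp add: sum_distrib_left[symmetric])
    also have "\<dots> \<le> mean_lognorm n" unfolding mean_lognorm_def
    proof (intro sum_mono mult_right_mono)
      fix w :: "'n list" assume "w \<in> {w. length w = n}"
      then show "real n * ln a \<le> ln (op_norm (word_matrix A w))" using ln_op_norm_word_bounds(1)[of w] by simp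
      show "0 \<le> prod_list (map (($) p) w)" by (induction w) (auto simp: p_pos less_imp_le)
    qed
    finally show ?thesis by (simp add: mult.commute)
  qed
  ultimately show ?thesis using subadditive_convergent[of mean_lognorm "- ln a"] that by blast
qed

lemma lyapunov_expI:
  assumes "AE \<omega> in bernoulli_measure p. (\<lambda>n. ln (sing_val k (word_matrix A (prefix_word \<omega> n))) / real n) \<longlonglongrightarrow> - c"
  shows "lyapunov_exp k A p = c"
  unfolding lyapunov_exp_def
proof (rule the_equality)
  have eq: "- (1 / real n * ln (sing_val k (word_matrix A (prefix_word \<omega> n)))) = - (ln (sing_val k (word_matrix A (prefix_word \<omega> n))) / real n)" for n \<omega>
    by simp
  show 1: "AE \<omega> in bernoulli_measure p. (\<lambda>n. - (1 / real n * ln (sing_val k (word_matrix A (prefix_word \<omega> n))))) \<longlonglongrightarrow> c"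
    using assms by (rule AE_mp, intro AE_I2 impI) (use tendsto_minus in \<open>fastforce simp: eq\<close>)
  fix c' assume 2: "AE \<omega> in bernoulli_measure p. (\<lambda>n. - (1 / real n * ln (sing_val k (word_matrix A (prefix_word \<omega> n))))) \<longlonglongrightarrow> c'"
  from 1 2 have "AE \<omega> in bernoulli_measure p. c' = c" by eventually_elim (rule LIMSEQ_unique)
  then show "c' = c" by (simp add: B.AE_const)
qed

text \<open>Kingman gives the top exponent. ln \<bar>det\<bar> is an additive cocycle, so Birkhoff
  gives the sum of the exponents, and the second one is the difference.\<close>

lemma lyapunov_limits:
  shows lyapunov_1_limit: "(\<lambda>n. mean_lognorm n / real n) \<longlonglongrightarrow> - lyapunov_exp 1 A p"
    and lyapunov_sum: "lyapunov_exp 1 A p + lyapunov_exp 2 A p = - (\<Sum>i\<in>UNIV. p $ i * ln \<bar>det (A $ i)\<bar>)"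
    and lyapunov_1_AE: "AE \<omega> in bernoulli_measure p. (\<lambda>n. ln (op_norm (word_matrix A (prefix_word \<omega> n))) / real n) \<longlonglongrightarrow> - lyapunov_exp 1 A p"
    and lyapunov_2_AE: "AE \<omega> in bernoulli_measure p. (\<lambda>n. ln (sing2 (word_matrix A (prefix_word \<omega> n))) / real n) \<longlonglongrightarrow> - lyapunov_exp 2 A p"
proof -
  obtain l where l: "(\<lambda>n. mean_lognorm n / real n) \<longlonglongrightarrow> l" using mean_lognorm_convergent .
  interpret K: subadditive_cocycle "bernoulli_measure p" "seq_shift 1" lognorm "- ln a" l
  proof (intro subadditive_cocycle.intro subadditive_cocycle_axioms.intro B.ergodic_map_axioms)
    show "lognorm (m + n) \<omega> \<le> lognorm m \<omega> + lognorm n ((seq_shift 1 ^^ m) \<omega>)" for m n \<omega>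
      unfolding funpow_seq_shift by (rule lognorm_sub)
    show "(\<lambda>n. B.expectation (lognorm n) / real n) \<longlonglongrightarrow> l" unfolding expectation_lognorm by (rule l)
  qed (rule lognorm_measurable lognorm_bound lognorm_near)+
  have 1: "AE \<omega> in bernoulli_measure p. (\<lambda>n. ln (op_norm (word_matrix A (prefix_word \<omega> n))) / real n) \<longlonglongrightarrow> l"
    using K.kingman unfolding lognorm_def .
  define D where "D = (\<Sum>i\<in>UNIV. p $ i * ln \<bar>det (A $ i)\<bar>)"
  have lndet: "ln \<bar>det (word_matrix A (prefix_word \<omega> n))\<bar> = (\<Sum>k<n. ln \<bar>det (A $ \<omega> k)\<bar>)" for \<omega> n
    by (induction n) (simp_all add: prefix_word_Suc word_matrix_append det_mul abs_mult ln_mult_pos)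
  have 2: "AE \<omega> in bernoulli_measure p. (\<lambda>n. ln (sing2 (word_matrix A (prefix_word \<omega> n))) / real n) \<longlonglongrightarrow> D - l"
    using 1 birkhoff_letters[of "\<lambda>i. ln \<bar>det (A $ i)\<bar>", folded D_def]
  proof eventually_elim
    case (elim \<omega>)
    from tendsto_diff[OF elim(2,1)] show ?case by (simp add: ln_sing2 lndet diff_divide_distrib)
  qed
  have e1: "lyapunov_exp 1 A p = - l"
    by (rule lyapunov_expI) (use 1 in \<open>simp add: sing_val_planar(1)[OF det_word_nz, simplified]\<close>)
  have e2: "lyapunov_exp 2 A p = l - D"
    by (rule lyapunov_expI) (use 2 in \<open>simp add: sing_val_planar(2)[OF det_word_nz, simplified]\<close>)
  show "(\<lambda>n. mean_lognorm n / real n) \<longlonglongrightarrow> - lyapunov_exp 1 A p" using l e1 by simp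
  show "lyapunov_exp 1 A p + lyapunov_exp 2 A p = - (\<Sum>i\<in>UNIV. p $ i * ln \<bar>det (A $ i)\<bar>)"
    using e1 e2 by (simp add: D_def)
  show "AE \<omega> in bernoulli_measure p. (\<lambda>n. ln (op_norm (word_matrix A (prefix_word \<omega> n))) / real n) \<longlonglongrightarrow> - lyapunov_exp 1 A p"
    using 1 e1 by simp
  show "AE \<omega> in bernoulli_measure p. (\<lambda>n. ln (sing2 (word_matrix A (prefix_word \<omega> n))) / real n) \<longlonglongrightarrow> - lyapunov_exp 2 A p"
    using 2 e2 by simp
qed

lemma entropy_AE: "AE \<omega> in bernoulli_measure p. (\<lambda>n. ln (prod_list (map (($) p) (prefix_word \<omega> n))) / real n) \<longlonglongrightarrow> - shannon_entropy p"
proof -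
  have pos: "0 < prod_list (map (($) p) w)" for w by (induction w) (auto simp: p_pos)
  have "ln (prod_list (map (($) p) (prefix_word \<omega> n))) = (\<Sum>k<n. ln (p $ \<omega> k))" for \<omega> n
    by (induction n) (simp_all add: prefix_word_Suc ln_mult_pos pos p_pos)
  then show ?thesis using birkhoff_letters[of "\<lambda>i. ln (p $ i)"] by (simp add: shannon_entropy_def)
qed

lemma lyapunov_1_pos: "0 < lyapunov_exp 1 A p"
  and lyapunov_1_le_2: "lyapunov_exp 1 A p \<le> lyapunov_exp 2 A p"
proof -
  have "AE \<omega> in bernoulli_measure p. - lyapunov_exp 1 A p \<le> ln r \<and> - lyapunov_exp 2 A p \<le> - lyapunov_exp 1 A p"
    using lyapunov_1_AE lyapunov_2_AE
  proof eventually_elim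
    case (elim \<omega>)
    have "ln (op_norm (word_matrix A (prefix_word \<omega> n))) / real n \<le> ln r" if "n \<ge> 1" for n
      using ln_op_norm_word_bounds(2)[of "prefix_word \<omega> n"] that by (simp add: field_simps)
    then have "- lyapunov_exp 1 A p \<le> ln r" by (intro LIMSEQ_le_const2[OF elim(1)]) blast
    moreover have "ln (sing2 (word_matrix A (prefix_word \<omega> n))) / real n \<le> ln (op_norm (word_matrix A (prefix_word \<omega> n))) / real n" for n
      by (intro divide_right_mono ln_mono sing2_le_op_norm sing2_pos det_word_nz) simp
    then have "- lyapunov_exp 2 A p \<le> - lyapunov_exp 1 A p" by (intro LIMSEQ_le[OF elim(2,1)]) blast
    ultimately show ?case ..
  qed
  then have "- lyapunov_exp 1 A p \<le> ln r \<and> - lyapunov_exp 2 A p \<le> - lyapunov_exp 1 A p" by (simp add: B.AE_const)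
  then show "0 < lyapunov_exp 1 A p" "lyapunov_exp 1 A p \<le> lyapunov_exp 2 A p" using r_pos r_less
    by (auto simp: ln_less_zero intro: order_less_le_trans[of 0 "- ln r"])
qed

lemma entropy_nonneg: "0 \<le> shannon_entropy p"
proof -
  have "p $ i * ln (p $ i) \<le> 0" for i
  proof -
    have "p $ i \<le> (\<Sum>j\<in>UNIV. p $ j)" by (rule member_le_sum) (auto simp: p_pos less_imp_le)
    then show ?thesis using p_sum p_pos[of i] by (intro mult_nonneg_nonpos) auto
  qed
  then show ?thesis unfolding shannon_entropy_def by (simp add: sum_nonpos)
qed

text \<open>Gibbs' inequality: apply ln x \<le> x - 1 to the quotients of determinants by
  probabilities and average with weights \<open>p\<close>. Consequently the value 2 drops out of the
  minimum in \<open>lyapunov_dim\<close>.\<close>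

lemma entropy_le_lyapunov_sum:
  assumes "(\<Sum>i\<in>UNIV. \<bar>det (A $ i)\<bar>) \<le> 1"
  shows "shannon_entropy p \<le> lyapunov_exp 1 A p + lyapunov_exp 2 A p"
proof -
  have "p $ i * ln \<bar>det (A $ i)\<bar> - p $ i * ln (p $ i) \<le> \<bar>det (A $ i)\<bar> - p $ i" for i
  proof -
    have "ln (\<bar>det (A $ i)\<bar> / p $ i) \<le> \<bar>det (A $ i)\<bar> / p $ i - 1" using p_pos[of i] by (intro ln_le_minus_one) simp
    then have "p $ i * ln (\<bar>det (A $ i)\<bar> / p $ i) \<le> p $ i * (\<bar>det (A $ i)\<bar> / p $ i - 1)"
      using p_pos[of i] by (intro mult_left_mono) auto
    then show ?thesis using p_pos[of i] by (simp add: ln_div right_diff_distrib)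
  qed
  then have "(\<Sum>i\<in>UNIV. p $ i * ln \<bar>det (A $ i)\<bar> - p $ i * ln (p $ i)) \<le> (\<Sum>i\<in>UNIV. \<bar>det (A $ i)\<bar> - p $ i)"
    by (intro sum_mono)
  then show ?thesis using assms unfolding lyapunov_sum shannon_entropy_def by (simp add: sum_subtractf p_sum)
qed

lemma lyapunov_dim_eq:
  assumes "(\<Sum>i\<in>UNIV. \<bar>det (A $ i)\<bar>) \<le> 1"
  shows "lyapunov_dim A p = min (shannon_entropy p / lyapunov_exp 1 A p)
    (1 + (shannon_entropy p - lyapunov_exp 1 A p) / lyapunov_exp 2 A p)"
proof -
  define h c1 c2 where "h = shannon_entropy p" and "c1 = lyapunov_exp 1 A p" and "c2 = lyapunov_exp 2 A p"
  have c: "0 < c1" "c1 \<le> c2" "h \<le> c1 + c2"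
    using lyapunov_1_pos lyapunov_1_le_2 entropy_le_lyapunov_sum[OF assms] unfolding h_def c1_def c2_def by auto
  have "{0..<CARD(2)} = {0, 1 :: nat}" by auto
  then have "lyapunov_dim A p = Min {h / c1, 1 + (h - c1) / c2, 2}"
    unfolding lyapunov_dim_def by (simp add: h_def c1_def c2_def numeral_2_eq_2)
  also have "1 + (h - c1) / c2 \<le> 2" using c by (simp add: field_simps)
  then have "Min {h / c1, 1 + (h - c1) / c2, 2} = min (h / c1) (1 + (h - c1) / c2)" by (simp add: min_def)
  finally show ?thesis unfolding h_def c1_def c2_def .
qed

end


section \<open>Upper bounds for local dimensions\<close>

lemma measurable_natural_proj [measurable]: "natural_proj A v \<in> borel_measurable seq_space"
proof -
  have "(\<lambda>\<omega>. word_matrix A (prefix_word \<omega> k) *v (v $ \<omega> k)) \<in> borel_measurable seq_space" for k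
  proof -
    \<comment> \<open>The k-th term reads the first \<open>k + 1\<close> letters;
      \<open>butlast\<close> and \<open>last\<close> split that prefix into the word of the matrix
      and the letter of the translation.\<close>
    have "(\<lambda>\<omega>. (\<lambda>w. word_matrix A (butlast w) *v (v $ last w)) (prefix_word \<omega> (Suc k))) \<in> borel_measurable seq_space"
      by (rule measurable_fun_prefix) simp
    then show ?thesis by (simp add: prefix_word_Suc)
  qed
  then show ?thesis unfolding natural_proj_def[abs_def] by (rule borel_measurable_suminf)
qed

lemma le_exp_if_ln_le: "0 < x \<Longrightarrow> ln x \<le> y \<Longrightarrow> x \<le> exp (y :: real)"
  by (metis exp_le_cancel_iff exp_ln)

text \<open>Among the covering balls at stage \<open>n\<close>, those of mass below exp(-bn) with b
  > \<beta> carry a summable total mass. By Borel-Cantelli almost every point eventually lies in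
  heavy balls only, and radii between two stages cost a constant.\<close>

lemma local_dim_upper:
  fixes \<mu> :: "'a::euclidean_space measure"
  assumes "finite_measure \<mu>" and sets [measurable_cong, simp]: "sets \<mu> = sets borel"
    and \<alpha>: "0 < \<alpha>" and \<beta>: "0 \<le> \<beta>" and c: "0 < c" and d: "\<beta> / \<alpha> < d"
    and C: "\<And>n. finite (C n)" "\<And>n. real (card (C n)) \<le> c * exp (\<beta> * real n)"
    and cov: "AE x in \<mu>. \<forall>\<^sub>F n in sequentially. x \<in> (\<Union>y\<in>C n. cball y (c * exp (- \<alpha> * real n)))"
  shows "AE x in \<mu>. \<forall>\<^sub>F \<rho> in at_right 0. \<rho> powr d \<le> measure \<mu> (cball x \<rho>)"
proof -
  interpret finite_measure \<mu> by fact
  \<comment> \<open>Any value strictly between \<beta> and \<open>d * \<alpha>\<close> works; the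
    gap to \<open>d * \<alpha>\<close> later absorbs all constants.\<close>
  define b where "b = (\<beta> + d * \<alpha>) / 2"
  have b: "\<beta> < b" "b < d * \<alpha>" "0 < b" using d \<alpha> \<beta> unfolding b_def by (auto simp: field_simps)
  define \<rho>n where "\<rho>n n = c * exp (- \<alpha> * real n)" for n
  define bad where "bad n = (\<Union>y\<in>{y \<in> C n. measure \<mu> (cball y (\<rho>n n)) < exp (- b * real n)}. cball y (\<rho>n n))" for n
  have bad_sets: "bad n \<in> sets \<mu>" for n
    unfolding bad_def by (intro sets.finite_UN) (use C(1)[of n] in auto)
  have bad_le: "measure \<mu> (bad n) \<le> c * exp (\<beta> - b) ^ n" for n
  proof -
    let ?B = "{y \<in> C n. measure \<mu> (cball y (\<rho>n n)) < exp (- b * real n)}"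
    have "measure \<mu> (bad n) \<le> (\<Sum>y\<in>?B. measure \<mu> (cball y (\<rho>n n)))"
      unfolding bad_def by (rule finite_measure_subadditive_finite) (use C(1)[of n] in auto)
    also have "\<dots> \<le> (\<Sum>y\<in>?B. exp (- b * real n))" by (intro sum_mono) auto
    also have "\<dots> = real (card ?B) * exp (- b * real n)" by simp
    also have "\<dots> \<le> (c * exp (\<beta> * real n)) * exp (- b * real n)"
    proof (rule mult_right_mono)
      have "card ?B \<le> card (C n)" by (intro card_mono C(1)) auto
      then show "real (card ?B) \<le> c * exp (\<beta> * real n)" using C(2)[of n] by linarith
    qed simp
    also have "\<dots> = c * exp (\<beta> - b) ^ n" by (simp add: exp_of_nat_mult[symmetric] exp_add[symmetric] algebra_simps)
    finally show ?thesis .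
  qed
  have "summable (\<lambda>n. c * exp (\<beta> - b) ^ n)" using b by (intro summable_mult summable_geometric) auto
  then have "summable (\<lambda>n. measure \<mu> (bad n))"
    by (rule summable_comparison_test') (use bad_le in auto)
  then have "AE x in \<mu>. \<forall>\<^sub>F n in sequentially. x \<in> space \<mu> - bad n"
    by (intro borel_cantelli_AE1 bad_sets) (auto simp: less_top[symmetric])
  with cov show ?thesis
  proof eventually_elim
    case (elim x)
    from elim have "\<forall>\<^sub>F n in sequentially. exp (- b * real n) \<le> measure \<mu> (cball x (2 * \<rho>n n))"
    proof eventually_elim
      case (elim n)
      then obtain y where y: "y \<in> C n" "x \<in> cball y (\<rho>n n)" unfolding \<rho>n_def by blast
      then have "exp (- b * real n) \<le> measure \<mu> (cball y (\<rho>n n))" using elim(2) unfolding bad_def by force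
      also have "\<dots> \<le> measure \<mu> (cball x (2 * \<rho>n n))"
      proof (rule finite_measure_mono)
        show "cball y (\<rho>n n) \<subseteq> cball x (2 * \<rho>n n)"
        proof
          fix z assume "z \<in> cball y (\<rho>n n)"
          then show "z \<in> cball x (2 * \<rho>n n)" using y(2) dist_triangle[of x z y] by (simp add: dist_commute)
        qed
      qed simp
      finally show ?case .
    qed
    then obtain N where N: "\<And>n. n \<ge> N \<Longrightarrow> exp (- b * real n) \<le> measure \<mu> (cball x (2 * \<rho>n n))"
      unfolding eventually_sequentially by blast
    \<comment> \<open>\<open>K * \<rho> powr (b / \<alpha>)\<close> equals exp(-b(t + 1)), where
      \<open>t\<close> is the real stage at which twice the covering radius is \<rho>.\<close>
    define K where "K = exp (- b) * (2 * c) powr - (b / \<alpha>)"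
    have K: "0 < K" unfolding K_def using c by simp
    have "((\<lambda>\<rho>. \<rho> powr (d - b / \<alpha>)) \<longlongrightarrow> 0) (at_right 0)"
    proof -
      have "0 < d - b / \<alpha>" using b \<alpha> by (simp add: field_simps)
      then show ?thesis by real_asymp
    qed
    then have "\<forall>\<^sub>F \<rho> in at_right 0. \<rho> powr (d - b / \<alpha>) < K" using K by (rule order_tendstoD)
    moreover have "\<forall>\<^sub>F \<rho> in at_right 0. 0 < \<rho> \<and> \<rho> < 2 * c * exp (- \<alpha> * (real N + 1))"
      unfolding eventually_at_right_field using c by (intro exI[of _ "2 * c * exp (- \<alpha> * (real N + 1))"]) auto
    ultimately show ?case
    proof eventually_elim
      case (elim \<rho>)
      then have \<rho>: "0 < \<rho>" "\<rho> < 2 * c * exp (- \<alpha> * (real N + 1))" by auto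
      \<comment> \<open>The real solution of \<rho> = 2c exp(-\<alpha>t); rounding it up to
        \<open>n\<close> costs less than one stage.\<close>
      define t where "t = ln (2 * c / \<rho>) / \<alpha>"
      have "ln \<rho> < ln (2 * c * exp (- \<alpha> * (real N + 1)))" using \<rho> c by (subst ln_less_cancel_iff) auto
      then have "\<alpha> * (real N + 1) < ln (2 * c / \<rho>)" using \<rho> c by (simp add: ln_mult_pos ln_div)
      then have tN: "real N + 1 < t" unfolding t_def using \<alpha> by (simp add: pos_less_divide_eq mult.commute)
      define n where "n = nat \<lceil>t\<rceil>"
      have n: "t \<le> real n" "real n \<le> t + 1" "n \<ge> N" using tN unfolding n_def by linarith+
      have "ln (2 * c / \<rho>) \<le> \<alpha> * real n" using n(1) \<alpha> unfolding t_def by (simp add: pos_divide_le_eq mult.commute)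
      then have "2 * c / \<rho> \<le> exp (\<alpha> * real n)" using \<rho> c by (intro le_exp_if_ln_le) auto
      then have "2 * \<rho>n n \<le> \<rho>" unfolding \<rho>n_def using \<rho> by (simp add: exp_minus field_simps)
      then have sub: "cball x (2 * \<rho>n n) \<subseteq> cball x \<rho>" by (rule subset_cball)
      have "\<rho> powr d = \<rho> powr (d - b / \<alpha>) * \<rho> powr (b / \<alpha>)" using \<rho> by (simp add: powr_add[symmetric])
      also have "\<dots> \<le> K * \<rho> powr (b / \<alpha>)" using elim by (intro mult_right_mono) auto
      also have "\<dots> = exp (- b * (t + 1))"
      proof -
        have "(2 * c) powr - (b / \<alpha>) * \<rho> powr (b / \<alpha>) = exp (- b * t)"
          unfolding powr_def t_def using \<rho> c by (simp add: exp_add[symmetric] ln_div ln_mult_pos algebra_simps diff_divide_distrib add_divide_distrib)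
        then show ?thesis unfolding K_def by (simp add: mult.assoc exp_add[symmetric] algebra_simps)
      qed
      also have "\<dots> \<le> exp (- b * real n)" using n b(3) by simp
      also have "\<dots> \<le> measure \<mu> (cball x (2 * \<rho>n n))" by (rule N[OF n(3)])
      also have "\<dots> \<le> measure \<mu> (cball x \<rho>)" by (rule finite_measure_mono[OF sub]) simp
      finally show ?case .
    qed
  qed
qed

context bernoulli_system
begin

lemma sets_self_affine_measure [simp]: "sets (self_affine_measure A v p) = sets borel"
  by (simp add: self_affine_measure_def)

lemma natural_proj_measurable_bernoulli [measurable]: "natural_proj A v \<in> borel_measurable (bernoulli_measure p)"
  unfolding measurable_cong_sets[OF sets_bernoulli refl] by (rule measurable_natural_proj)

lemma finite_measure_self_affine: "finite_measure (self_affine_measure A v p)"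
  unfolding self_affine_measure_def by (rule B.finite_measure_distr[OF natural_proj_measurable_bernoulli])

lemma prob_words_pos: "0 < prod_list (map (($) p) w)"
  by (induction w) (auto simp: p_pos)

lemma card_likely_words:
  assumes "\<And>w. w \<in> W \<Longrightarrow> length w = n \<and> exp (- t) \<le> prod_list (map (($) p) w)"
  shows "real (card W) \<le> exp t"
proof -
  have "real (card W) * exp (- t) = (\<Sum>w\<in>W. exp (- t))" by simp
  also have "\<dots> \<le> (\<Sum>w\<in>W. prod_list (map (($) p) w))" using assms by (intro sum_mono) auto
  also have "\<dots> \<le> (\<Sum>w\<in>{w. length w = n}. prod_list (map (($) p) w))"
    using assms prob_words_pos by (intro sum_mono2) (auto simp: finite_words less_imp_le)
  finally show ?thesis by (simp add: sum_p_words exp_minus field_simps)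
qed

lemma eventually_likely:
  assumes "0 < e"
  shows "AE \<omega> in bernoulli_measure p. \<forall>\<^sub>F n in sequentially.
    exp (- (shannon_entropy p + e) * real n) \<le> prod_list (map (($) p) (prefix_word \<omega> n)) \<and>
    op_norm (word_matrix A (prefix_word \<omega> n)) \<le> exp (- (lyapunov_exp 1 A p - e) * real n) \<and>
    sing2 (word_matrix A (prefix_word \<omega> n)) \<le> exp (- (lyapunov_exp 2 A p - e) * real n) \<and>
    exp (- (lyapunov_exp 2 A p + e) * real n) \<le> sing2 (word_matrix A (prefix_word \<omega> n))"
  using entropy_AE lyapunov_1_AE lyapunov_2_AE
proof eventually_elim
  case (elim \<omega>)
  have "\<forall>\<^sub>F n in sequentially. - shannon_entropy p - e < ln (prod_list (map (($) p) (prefix_word \<omega> n))) / real n"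
    by (rule order_tendstoD[OF elim(1)]) (use assms in simp)
  moreover have "\<forall>\<^sub>F n in sequentially. ln (op_norm (word_matrix A (prefix_word \<omega> n))) / real n < - lyapunov_exp 1 A p + e"
    by (rule order_tendstoD[OF elim(2)]) (use assms in simp)
  moreover have "\<forall>\<^sub>F n in sequentially. ln (sing2 (word_matrix A (prefix_word \<omega> n))) / real n < - lyapunov_exp 2 A p + e"
    by (rule order_tendstoD[OF elim(3)]) (use assms in simp)
  moreover have "\<forall>\<^sub>F n in sequentially. - lyapunov_exp 2 A p - e < ln (sing2 (word_matrix A (prefix_word \<omega> n))) / real n"
    by (rule order_tendstoD[OF elim(3)]) (use assms in simp)
  ultimately show ?case using eventually_gt_at_top[of 0]
  proof eventually_elim
    case (elim n)
    have ub: "x \<le> exp (- (l - e) * real n)" if "ln x / real n < - l + e" "0 < x" for x l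
    proof -
      have "ln x < (- l + e) * real n" using that(1) elim(5) by (simp only: pos_divide_less_eq of_nat_0_less_iff)
      then show ?thesis using that(2) by (intro le_exp_if_ln_le) simp_all
    qed
    have lb: "exp (- (l + e) * real n) \<le> x" if "- l - e < ln x / real n" "0 < x" for x l
    proof -
      have "(- l - e) * real n < ln x" using that(1) elim(5) by (simp only: pos_less_divide_eq of_nat_0_less_iff)
      then have "exp ((- l - e) * real n) \<le> exp (ln x)" by simp
      then show ?thesis using that(2) by simp
    qed
    show ?case using ub lb elim prob_words_pos det_nonzero_op_norm_pos[OF det_word_nz] sing2_pos[OF det_word_nz] by simp
  qed
qed

lemma self_affine_cover_AE:
  assumes "AE \<omega> in bernoulli_measure p. \<forall>\<^sub>F n in sequentially. prefix_word \<omega> n \<in> W n"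
    and D: "\<And>n w. w \<in> W n \<Longrightarrow> word_map A v w ` cball 0 (rad v) \<subseteq> (\<Union>y\<in>D w. cball y (\<rho> n))"
    and fin: "\<And>n. finite (\<Union>w\<in>W n. D w)"
  shows "AE x in self_affine_measure A v p. \<forall>\<^sub>F n in sequentially. x \<in> (\<Union>y\<in>(\<Union>w\<in>W n. D w). cball y (\<rho> n))"
proof -
  define U where "U n = (\<Union>y\<in>(\<Union>w\<in>W n. D w). cball y (\<rho> n))" for n
  have [measurable]: "U n \<in> sets borel" for n unfolding U_def by (intro sets.finite_UN fin) auto
  have "AE \<omega> in bernoulli_measure p. \<forall>\<^sub>F n in sequentially. natural_proj A v \<omega> \<in> U n"
    using assms(1)
  proof eventually_elim
    case (elim \<omega>)
    then show ?case
    proof eventually_elim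
      case (elim n)
      then show ?case using D[OF elim] natural_proj_in_word_image[of v \<omega> n] unfolding U_def by blast
    qed
  qed
  then have "AE x in distr (bernoulli_measure p) borel (natural_proj A v). \<forall>\<^sub>F n in sequentially. x \<in> U n"
    by (subst AE_distr_iff) (auto simp: eventually_sequentially)
  then show ?thesis unfolding self_affine_measure_def U_def .
qed

text \<open>At stage \<open>n\<close> there are at most about exp(hn) typical words, and the image
  of the invariant ball under each fits into one ball of radius about exp(-c1 n).\<close>

lemma local_dim_upper_1:
  assumes "shannon_entropy p / lyapunov_exp 1 A p < d"
  shows "AE x in self_affine_measure A v p. \<forall>\<^sub>F \<rho> in at_right 0. \<rho> powr d \<le> measure (self_affine_measure A v p) (cball x \<rho>)"
proof -
  define h c1 where "h = shannon_entropy p" and "c1 = lyapunov_exp 1 A p"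
  have h: "0 \<le> h" and c1: "0 < c1" unfolding h_def c1_def by (rule entropy_nonneg, rule lyapunov_1_pos)
  have "0 < (d * c1 - h) / (2 * (1 + \<bar>d\<bar>))"
    using assms c1 unfolding h_def[symmetric] c1_def[symmetric] by (simp add: pos_divide_less_eq)
  \<comment> \<open>Small enough that the perturbed quotient (h + e)/(c1 - e) stays below
    \<open>d\<close>; \<bar>d\<bar> appears since the sign of \<open>d\<close> is not fixed.\<close>
  define e where "e = min (c1 / 2) ((d * c1 - h) / (2 * (1 + \<bar>d\<bar>)))"
  have "e \<le> c1 / 2" unfolding e_def by (rule min.cobounded1)
  moreover have "0 < e" using \<open>0 < _ / _\<close> c1 unfolding e_def by auto
  ultimately have e: "0 < e" "e < c1" using c1 by linarith+
  have "e * (2 * (1 + \<bar>d\<bar>)) \<le> d * c1 - h" unfolding e_def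
    by (subst pos_le_divide_eq[symmetric]) (auto intro: min.cobounded2)
  then have "h + e < d * (c1 - e)" proof -
    have "e * (2 * (1 + \<bar>d\<bar>)) = 2 * e + 2 * (e * \<bar>d\<bar>)" "d * (c1 - e) = d * c1 - e * d"
      by (simp_all add: algebra_simps)
    moreover have "e * d \<le> e * \<bar>d\<bar>" "0 \<le> e * \<bar>d\<bar>" using e(1) by (auto intro: mult_left_mono)
    moreover assume "e * (2 * (1 + \<bar>d\<bar>)) \<le> d * c1 - h"
    ultimately show ?thesis using e(1) by linarith
  qed
  then have d: "(h + e) / (c1 - e) < d" using e(2) by (simp add: pos_divide_less_eq)
  define R where "R = rad v"
  have R: "0 \<le> R" unfolding R_def by (rule rad_nonneg)
  define W where "W n = {w. length w = n \<and> exp (- (h + e) * real n) \<le> prod_list (map (($) p) w) \<and>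
      op_norm (word_matrix A w) \<le> exp (- (c1 - e) * real n)}" for n
  have finW: "finite (W n)" for n unfolding W_def by (rule finite_subset[OF _ finite_words[of n]]) auto
  show ?thesis
  proof (rule local_dim_upper[where \<alpha> = "c1 - e" and \<beta> = "h + e" and c = "R + 1" and C = "\<lambda>n. \<Union>w\<in>W n. {word_map A v w 0}"])
    show "AE x in self_affine_measure A v p. \<forall>\<^sub>F n in sequentially.
        x \<in> (\<Union>y\<in>(\<Union>w\<in>W n. {word_map A v w 0}). cball y ((R + 1) * exp (- (c1 - e) * real n)))"
    proof (rule self_affine_cover_AE)
      show "AE \<omega> in bernoulli_measure p. \<forall>\<^sub>F n in sequentially. prefix_word \<omega> n \<in> W n"
        using eventually_likely[OF e(1)]
        by (rule AE_mp, intro AE_I2 impI) (auto simp: W_def h_def c1_def elim: eventually_mono)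
      fix n w assume "w \<in> W n"
      then have "(R + 1) * op_norm (word_matrix A w) \<le> (R + 1) * exp (- (c1 - e) * real n)"
        using R unfolding W_def by (intro mult_left_mono) auto
      then have "cball (word_map A v w 0) ((R + 1) * op_norm (word_matrix A w)) \<subseteq> cball (word_map A v w 0) ((R + 1) * exp (- (c1 - e) * real n))"
        by (rule subset_cball)
      then show "word_map A v w ` cball 0 (rad v) \<subseteq> (\<Union>y\<in>{word_map A v w 0}. cball y ((R + 1) * exp (- (c1 - e) * real n)))"
        using word_image_single_ball[OF R, of v w] unfolding R_def by auto
    qed (use finW in auto)
    fix n
    have "real (card (\<Union>w\<in>W n. {word_map A v w 0})) \<le> real (card (W n))"
      using card_image_le[OF finW[of n], of "\<lambda>w. word_map A v w 0"] by (simp add: UNION_singleton_eq_range)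
    also have "\<dots> \<le> exp ((h + e) * real n)" by (rule card_likely_words[of _ n]) (auto simp: W_def algebra_simps)
    also have "\<dots> \<le> (R + 1) * exp ((h + e) * real n)" using R by simp
    finally show "real (card (\<Union>w\<in>W n. {word_map A v w 0})) \<le> (R + 1) * exp ((h + e) * real n)" .
  qed (use d e h R finW finite_measure_self_affine in auto)
qed

text \<open>Now the image for a typical word is cut into about exp((c2 - c1)n) balls as small as its
  short axis. The error 3e consists of one \<open>e\<close> from counting words and two from the
  ratio of the axes.\<close>

lemma local_dim_upper_2:
  assumes "1 + (shannon_entropy p - lyapunov_exp 1 A p) / lyapunov_exp 2 A p < d"
  shows "AE x in self_affine_measure A v p. \<forall>\<^sub>F \<rho> in at_right 0. \<rho> powr d \<le> measure (self_affine_measure A v p) (cball x \<rho>)"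
proof -
  define h c1 c2 where "h = shannon_entropy p" and "c1 = lyapunov_exp 1 A p" and "c2 = lyapunov_exp 2 A p"
  have h: "0 \<le> h" and c1: "0 < c1" "c1 \<le> c2" unfolding h_def c1_def c2_def
    by (rule entropy_nonneg, rule lyapunov_1_pos, rule lyapunov_1_le_2)
  have g: "h + c2 - c1 < d * c2" using assms c1 unfolding h_def[symmetric] c1_def[symmetric] c2_def[symmetric]
    by (simp add: field_simps)
  then have "0 < (d * c2 - (h + c2 - c1)) / (2 * (3 + \<bar>d\<bar>))" by simp
  define e where "e = min (c2 / 2) ((d * c2 - (h + c2 - c1)) / (2 * (3 + \<bar>d\<bar>)))"
  have "e \<le> c2 / 2" unfolding e_def by (rule min.cobounded1)
  moreover have "0 < e" using \<open>0 < _ / _\<close> c1 unfolding e_def by auto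
  ultimately have e: "0 < e" "e < c2" using c1 by linarith+
  have "e * (2 * (3 + \<bar>d\<bar>)) \<le> d * c2 - (h + c2 - c1)" unfolding e_def
    by (subst pos_le_divide_eq[symmetric]) (auto intro: min.cobounded2)
  then have "h + c2 - c1 + 3 * e < d * (c2 - e)" proof -
    have "e * (2 * (3 + \<bar>d\<bar>)) = 6 * e + 2 * (e * \<bar>d\<bar>)" "d * (c2 - e) = d * c2 - e * d"
      by (simp_all add: algebra_simps)
    moreover have "e * d \<le> e * \<bar>d\<bar>" "0 \<le> e * \<bar>d\<bar>" using e(1) by (auto intro: mult_left_mono)
    moreover assume "e * (2 * (3 + \<bar>d\<bar>)) \<le> d * c2 - (h + c2 - c1)"
    ultimately show ?thesis using e(1) by linarith
  qed
  then have d: "(h + c2 - c1 + 3 * e) / (c2 - e) < d" using e(2) by (simp add: pos_divide_less_eq)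
  define R where "R = rad v"
  have R: "0 \<le> R" unfolding R_def by (rule rad_nonneg)
  define W where "W n = {w. length w = n \<and> exp (- (h + e) * real n) \<le> prod_list (map (($) p) w) \<and>
      op_norm (word_matrix A w) \<le> exp (- (c1 - e) * real n) \<and>
      sing2 (word_matrix A w) \<le> exp (- (c2 - e) * real n) \<and>
      exp (- (c2 + e) * real n) \<le> sing2 (word_matrix A w)}" for n
  have finW: "finite (W n)" for n unfolding W_def by (rule finite_subset[OF _ finite_words[of n]]) auto
  have "\<exists>C. finite C \<and> real (card C) \<le> (2 * R + 3) * (op_norm (word_matrix A w) / sing2 (word_matrix A w)) \<and>
    word_map A v w ` cball 0 R \<subseteq> (\<Union>c\<in>C. cball c ((R + 1) * sing2 (word_matrix A w)))" for w
    using word_image_cover[OF R] by metis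
  then obtain D where D: "\<And>w. finite (D w)"
    "\<And>w. real (card (D w)) \<le> (2 * R + 3) * (op_norm (word_matrix A w) / sing2 (word_matrix A w))"
    "\<And>w. word_map A v w ` cball 0 R \<subseteq> (\<Union>c\<in>D w. cball c ((R + 1) * sing2 (word_matrix A w)))" by metis
  define K where "K = 2 * R + 3"
  have K: "0 < K" "R + 1 \<le> K" using R unfolding K_def by auto
  show ?thesis
  proof (rule local_dim_upper[where \<alpha> = "c2 - e" and \<beta> = "h + c2 - c1 + 3 * e" and c = K and C = "\<lambda>n. \<Union>w\<in>W n. D w"])
    show "AE x in self_affine_measure A v p. \<forall>\<^sub>F n in sequentially.
        x \<in> (\<Union>y\<in>(\<Union>w\<in>W n. D w). cball y (K * exp (- (c2 - e) * real n)))"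
    proof (rule self_affine_cover_AE)
      show "AE \<omega> in bernoulli_measure p. \<forall>\<^sub>F n in sequentially. prefix_word \<omega> n \<in> W n"
        using eventually_likely[OF e(1)]
        by (rule AE_mp, intro AE_I2 impI) (auto simp: W_def h_def c1_def c2_def elim: eventually_mono)
      fix n w assume "w \<in> W n"
      then have "(R + 1) * sing2 (word_matrix A w) \<le> K * exp (- (c2 - e) * real n)"
        using R K sing2_pos[OF det_word_nz, of w] unfolding W_def by (intro mult_mono) auto
      then have "cball y ((R + 1) * sing2 (word_matrix A w)) \<subseteq> cball y (K * exp (- (c2 - e) * real n))" for y
        by (rule subset_cball)
      then show "word_map A v w ` cball 0 (rad v) \<subseteq> (\<Union>y\<in>D w. cball y (K * exp (- (c2 - e) * real n)))"
        using D(3)[of w] unfolding R_def by blast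
    qed (use finW D in auto)
    fix n
    have DW: "real (card (D w)) \<le> K * exp ((c2 - c1 + 2 * e) * real n)" if "w \<in> W n" for w
    proof -
      have p: "0 < sing2 (word_matrix A w)" by (rule sing2_pos) simp
      have "op_norm (word_matrix A w) / sing2 (word_matrix A w) \<le> exp (- (c1 - e) * real n) / exp (- (c2 + e) * real n)"
        using that p unfolding W_def by (intro frac_le) auto
      also have "\<dots> = exp ((c2 - c1 + 2 * e) * real n)" by (simp add: exp_diff[symmetric] algebra_simps)
      finally have "(2 * R + 3) * (op_norm (word_matrix A w) / sing2 (word_matrix A w)) \<le> K * exp ((c2 - c1 + 2 * e) * real n)"
        unfolding K_def using R by (intro mult_left_mono) auto
      then show ?thesis using D(2)[of w] by linarith
    qed
    have "real (card (\<Union>w\<in>W n. D w)) \<le> (\<Sum>w\<in>W n. real (card (D w)))"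
      using card_UN_le[OF finW[of n], of D] by (metis of_nat_le_iff of_nat_sum)
    also have "\<dots> \<le> (\<Sum>w\<in>W n. K * exp ((c2 - c1 + 2 * e) * real n))" by (intro sum_mono DW)
    also have "\<dots> = real (card (W n)) * (K * exp ((c2 - c1 + 2 * e) * real n))" by simp
    also have "\<dots> \<le> exp ((h + e) * real n) * (K * exp ((c2 - c1 + 2 * e) * real n))"
      using K by (intro mult_right_mono card_likely_words[of _ n]) (auto simp: W_def algebra_simps)
    also have "\<dots> = K * exp ((h + c2 - c1 + 3 * e) * real n)" by (simp add: exp_add[symmetric] algebra_simps)
    finally show "real (card (\<Union>w\<in>W n. D w)) \<le> K * exp ((h + c2 - c1 + 3 * e) * real n)" .
  qed (use d e h c1 K finW D finite_measure_self_affine in auto)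
qed

end


section \<open>Transversality integrals\<close>

text \<open>Lebesgue measure is characterised by its values on boxes, so only preimages of boxes,
  which are images under the inverse matrix, have to be measured.\<close>

lemma lborel_linear_image:
  fixes T :: "real^2^2"
  assumes d: "det T \<noteq> 0"
  shows "lborel = density (distr lborel borel (\<lambda>x. T *v x)) (\<lambda>_. ennreal \<bar>det T\<bar>)"
proof (rule lborel_eqI)
  fix l u :: "real^2" assume lu: "\<And>b. b \<in> Basis \<Longrightarrow> l \<bullet> b \<le> u \<bullet> b"
  have [measurable]: "(\<lambda>x. T *v x) \<in> borel_measurable borel"
    by (intro borel_measurable_continuous_onI continuous_intros)
  obtain S where S: "T ** S = mat 1" "S ** T = mat 1" using d unfolding invertible_det_nz[symmetric] invertible_def by blast
  have dS: "\<bar>det T\<bar> * \<bar>det S\<bar> = 1" using det_mul[of T S] S by (simp add: abs_mult[symmetric])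
  have im: "(\<lambda>x. T *v x) -` box l u = (\<lambda>x. S *v x) ` box l u"
  proof (intro set_eqI iffI)
    fix x assume "x \<in> (\<lambda>x. T *v x) -` box l u"
    then show "x \<in> (\<lambda>x. S *v x) ` box l u"
      by (intro image_eqI[of _ _ "T *v x"]) (auto simp: matrix_vector_mul_assoc S)
  next
    fix x assume "x \<in> (\<lambda>x. S *v x) ` box l u"
    then show "x \<in> (\<lambda>x. T *v x) -` box l u" by (auto simp: matrix_vector_mul_assoc S)
  qed
  have lm: "(\<lambda>x. S *v x) ` box l u \<in> lmeasurable"
    and ms: "measure lebesgue ((\<lambda>x. S *v x) ` box l u) = \<bar>det S\<bar> * measure lebesgue (box l u)"
    using measurable_linear_image[of "\<lambda>x. S *v x" "box l u"] measure_linear_image[of "\<lambda>x. S *v x" "box l u"] by simp_all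
  have sb: "(\<lambda>x. S *v x) ` box l u \<in> sets borel"
    unfolding im[symmetric] using measurable_sets[of "\<lambda>x. T *v x" borel borel "box l u"] by simp
  have "emeasure (density (distr lborel borel (\<lambda>x. T *v x)) (\<lambda>_. ennreal \<bar>det T\<bar>)) (box l u)
      = ennreal \<bar>det T\<bar> * emeasure lborel ((\<lambda>x. S *v x) ` box l u)"
    by (simp add: emeasure_density nn_integral_cmult_indicator emeasure_distr im)
  also have "emeasure lborel ((\<lambda>x. S *v x) ` box l u) = emeasure lebesgue ((\<lambda>x. S *v x) ` box l u)"
    using sb by (simp add: emeasure_completion)
  also have "\<dots> = ennreal (measure lebesgue ((\<lambda>x. S *v x) ` box l u))"
    using lm by (simp add: emeasure_eq_measure2 fmeasurableD2)
  also have "\<dots> = ennreal (\<bar>det S\<bar> * measure lebesgue (box l u))" using ms by simp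
  also have "ennreal \<bar>det T\<bar> * \<dots> = ennreal (measure lebesgue (box l u))"
    using dS by (simp add: ennreal_mult[symmetric] mult.assoc[symmetric])
  also have "measure lebesgue (box l u) = (\<Prod>b\<in>Basis. (u - l) \<bullet> b)"
    using lu by (simp add: measure_completion measure_lborel_box)
  finally show "emeasure (density (distr lborel borel (\<lambda>x. T *v x)) (\<lambda>_. ennreal \<bar>det T\<bar>)) (box l u) = (\<Prod>b\<in>Basis. (u - l) \<bullet> b)" .
qed simp

lemma nn_integral_affine_image:
  fixes T :: "real^2^2"
  assumes d: "det T \<noteq> 0" and f [measurable]: "f \<in> borel_measurable borel"
  shows "\<bar>det T\<bar> * (\<integral>\<^sup>+x. f (T *v x + b) \<partial>lborel) = (\<integral>\<^sup>+x. f x \<partial>lborel)"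
proof -
  have [measurable]: "(\<lambda>x. T *v x) \<in> borel_measurable borel"
    by (intro borel_measurable_continuous_onI continuous_intros)
  have "(\<integral>\<^sup>+x. f x \<partial>lborel) = (\<integral>\<^sup>+x. f (b + x) \<partial>lborel)"
    by (subst lborel_distr_plus[of b, symmetric], subst nn_integral_distr) auto
  also have "\<dots> = (\<integral>\<^sup>+x. f (b + x) \<partial>density (distr lborel borel (\<lambda>x. T *v x)) (\<lambda>_. ennreal \<bar>det T\<bar>))"
    using lborel_linear_image[OF d] by simp
  also have "\<dots> = \<bar>det T\<bar> * (\<integral>\<^sup>+x. f (b + T *v x) \<partial>lborel)"
    by (simp add: nn_integral_density nn_integral_distr nn_integral_cmult)
  finally show ?thesis by (simp add: add.commute)
qed

lemma nn_integral_lborel_vec2: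
  fixes g h :: "real \<Rightarrow> ennreal"
  assumes [measurable]: "g \<in> borel_measurable borel" "h \<in> borel_measurable borel"
  shows "(\<integral>\<^sup>+x. g ((x :: real^2) $ 1) * h (x $ 2) \<partial>lborel) = (\<integral>\<^sup>+t. g t \<partial>lborel) * (\<integral>\<^sup>+t. h t \<partial>lborel)"
proof -
  have B: "(Basis :: (real^2) set) = {axis 1 1, axis 2 1}" by (auto simp: Basis_vec_def UNIV_2)
  have ne: "(axis 1 1 :: real^2) \<noteq> axis 2 1" by (simp add: axis_eq_axis)
  define f where "f b = (if b = (axis 1 1 :: real^2) then g else h)" for b
  have "(\<integral>\<^sup>+x. (\<Prod>b\<in>Basis. f b (x \<bullet> b)) \<partial>lborel) = (\<Prod>b\<in>Basis. (\<integral>\<^sup>+x. f b x \<partial>lborel))"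
    by (rule nn_integral_lborel_prod) (auto simp: f_def)
  then show ?thesis unfolding B using ne by (simp add: f_def inner_axis)
qed

section \<open>Riesz kernels composed with planar matrices\<close>

text \<open>The Riesz kernel. The value at 0 is set to \<open>top\<close> by hand, since
  \<open>0 powr - q = 0\<close> would make coincident points invisible.\<close>

definition pker :: "real \<Rightarrow> real \<Rightarrow> ennreal"
  where "pker q s = (if s = 0 then top else ennreal (s powr - q))"

lemma pker_measurable [measurable]: "pker q \<in> borel_measurable borel"
  unfolding pker_def[abs_def] by measurable

lemma pker_integrable:
  assumes "\<theta> < 1"
  shows "(\<integral>\<^sup>+t. pker \<theta> \<bar>t\<bar> * indicator {-\<rho>..\<rho>} t \<partial>lborel) < \<infinity>"
proof -
  define I where "I = (\<integral>\<^sup>+t. ennreal (t powr - \<theta>) * indicator {0..\<bar>\<rho>\<bar>} t \<partial>lborel)"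
  have I: "I < \<infinity>"
    unfolding I_def
    by (subst nn_integral_has_integral_lebesgue'[OF _ has_integral_powr_from_0]) (use assms in auto)
  have I2: "(\<integral>\<^sup>+t. ennreal ((- t) powr - \<theta>) * indicator {0..\<bar>\<rho>\<bar>} (- t) \<partial>lborel) = I"
    unfolding I_def by (subst (2) nn_integral_real_affine[where c = "-1" and t = 0]) auto
  have "AE t in lborel. t \<noteq> (0 :: real)" by (rule AE_lborel_singleton)
  then have "AE t in lborel. pker \<theta> \<bar>t\<bar> * indicator {-\<rho>..\<rho>} t \<le>
      ennreal (t powr - \<theta>) * indicator {0..\<bar>\<rho>\<bar>} t + ennreal ((- t) powr - \<theta>) * indicator {0..\<bar>\<rho>\<bar>} (- t)"
    by eventually_elim (auto simp: pker_def indicator_def abs_if)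
  then have "(\<integral>\<^sup>+t. pker \<theta> \<bar>t\<bar> * indicator {-\<rho>..\<rho>} t \<partial>lborel) \<le>
      (\<integral>\<^sup>+t. ennreal (t powr - \<theta>) * indicator {0..\<bar>\<rho>\<bar>} t + ennreal ((- t) powr - \<theta>) * indicator {0..\<bar>\<rho>\<bar>} (- t) \<partial>lborel)"
    by (rule nn_integral_mono_AE)
  also have "\<dots> = I + I" by (subst nn_integral_add) (auto simp: I2 I_def[symmetric])
  also have "\<dots> < \<infinity>" using I by simp
  finally show ?thesis .
qed

text \<open>The exponents leave a margin between \<open>q\<close> and \<open>t\<close>, so that both one-dimensional integrals converge.\<close>

lemma phi_exponents:
  assumes "0 < q" "q < t" "t \<le> 2"
  obtains \<theta> \<eta> where "0 \<le> \<theta>" "\<theta> < 1" "0 \<le> \<eta>" "\<eta> < 1" "\<theta> + \<eta> = q"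
    "\<And>M. det M \<noteq> 0 \<Longrightarrow> op_norm M \<le> 1 \<Longrightarrow> phi t M \<le> op_norm M powr \<theta> * sing2 M powr \<eta>"
proof (cases "q < 1")
  case True
  have "phi t M \<le> op_norm M powr q * sing2 M powr 0" if M: "det M \<noteq> 0" "op_norm M \<le> 1" for M
  proof -
    have p: "0 < op_norm M" "0 < sing2 M" "sing2 M \<le> 1"
      using M det_nonzero_op_norm_pos sing2_pos sing2_le_op_norm[of M] by auto
    show ?thesis unfolding phi_def using p M True assms by (intro mult_mono powr_mono') auto
  qed
  then show ?thesis using that[of q 0] assms True by simp
next
  case False
  define e where "e = (t - q) / 2"
  have e: "0 < e" "e \<le> 1 / 2" "q + e \<le> t" "q + e < 2" using assms False unfolding e_def by (auto simp: field_simps)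
  have "phi t M \<le> op_norm M powr (1 - e) * sing2 M powr (q - (1 - e))" if M: "det M \<noteq> 0" "op_norm M \<le> 1" for M
  proof -
    have p: "0 < op_norm M" "0 < sing2 M" "sing2 M \<le> 1"
      using M det_nonzero_op_norm_pos sing2_pos sing2_le_op_norm[of M] by auto
    show ?thesis unfolding phi_def using p M False e assms by (intro mult_mono powr_mono') auto
  qed
  then show ?thesis using that[of "1 - e" "q - (1 - e)"] e False by simp
qed

text \<open>In the singular frame |Mz| dominates both coordinates of \<open>Mz\<close>, so the
  exponent can be divided between them; the result is a product of one-dimensional kernels.\<close>

lemma pker_matrix_le:
  fixes M :: "real^2^2"
  assumes d: "det M \<noteq> 0" and e: "norm e1 = 1" "norm e2 = 1" "e1 \<bullet> e2 = 0" "(M *v e1) \<bullet> (M *v e2) = 0"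
    "norm (M *v e1) = op_norm M" "norm (M *v e2) = sing2 M"
    and ex: "\<And>x. x = (x \<bullet> e1) *\<^sub>R e1 + (x \<bullet> e2) *\<^sub>R e2"
    and \<theta>: "0 \<le> \<theta>" "0 \<le> \<eta>"
  shows "pker (\<theta> + \<eta>) (norm (M *v z)) \<le> ennreal (1 / (op_norm M powr \<theta> * sing2 M powr \<eta>)) * (pker \<theta> \<bar>z \<bullet> e1\<bar> * pker \<eta> \<bar>z \<bullet> e2\<bar>)"
proof -
  define u w where "u = z \<bullet> e1" and "w = z \<bullet> e2"
  have p: "0 < op_norm M" "0 < sing2 M" using d det_nonzero_op_norm_pos sing2_pos by auto
  have q: "0 < 1 / (op_norm M powr \<theta> * sing2 M powr \<eta>)" using p by simp
  have z: "z = u *\<^sub>R e1 + w *\<^sub>R e2" unfolding u_def w_def by (rule ex)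
  show ?thesis
  proof (cases "u = 0 \<or> w = 0")
    \<comment> \<open>The right-hand side is infinite: the kernel never vanishes, so the infinite
      factor is not lost to \<open>0 * top = 0\<close>.\<close>
    case True
    have "pker \<theta> \<bar>u\<bar> * pker \<eta> \<bar>w\<bar> = top"
    proof -
      have "pker \<theta> \<bar>u\<bar> \<noteq> 0" "pker \<eta> \<bar>w\<bar> \<noteq> 0" by (auto simp: pker_def)
      then show ?thesis using True by (auto simp: pker_def ennreal_mult_top ennreal_top_mult)
    qed
    then show ?thesis unfolding u_def[symmetric] w_def[symmetric] using p by (simp add: ennreal_mult_top)
  next
    case False
    have n2: "(norm (M *v z))\<^sup>2 = (op_norm M * \<bar>u\<bar>)\<^sup>2 + (sing2 M * \<bar>w\<bar>)\<^sup>2"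
      unfolding z using e(4-6)
      by (simp add: norm_add_Pythagorean orthogonal_def matrix_vector_right_distrib
          matrix_vector_mult_scaleR power_mult_distrib mult.commute)
    have "(op_norm M * \<bar>u\<bar>)\<^sup>2 \<le> (norm (M *v z))\<^sup>2" "(sing2 M * \<bar>w\<bar>)\<^sup>2 \<le> (norm (M *v z))\<^sup>2" unfolding n2 by auto
    then have le: "op_norm M * \<bar>u\<bar> \<le> norm (M *v z)" "sing2 M * \<bar>w\<bar> \<le> norm (M *v z)"
      by (auto intro: power2_le_imp_le)
    have "0 < op_norm M * \<bar>u\<bar>" "0 < sing2 M * \<bar>w\<bar>" using p False by simp_all
    moreover from this have "0 < norm (M *v z)" using le(1) by linarith
    ultimately have pos: "0 < op_norm M * \<bar>u\<bar>" "0 < sing2 M * \<bar>w\<bar>" "0 < norm (M *v z)" by auto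
    have "norm (M *v z) powr - (\<theta> + \<eta>) = norm (M *v z) powr - \<theta> * norm (M *v z) powr - \<eta>"
      using pos by (simp add: powr_add[symmetric])
    also have "\<dots> \<le> (op_norm M * \<bar>u\<bar>) powr - \<theta> * (sing2 M * \<bar>w\<bar>) powr - \<eta>"
      using pos le \<theta> by (intro mult_mono powr_mono2') auto
    also have "\<dots> = 1 / (op_norm M powr \<theta> * sing2 M powr \<eta>) * (\<bar>u\<bar> powr - \<theta> * \<bar>w\<bar> powr - \<eta>)"
      using p by (simp add: powr_mult powr_minus field_simps)
    finally have "ennreal (norm (M *v z) powr - (\<theta> + \<eta>)) \<le> ennreal (1 / (op_norm M powr \<theta> * sing2 M powr \<eta>)) * (ennreal (\<bar>u\<bar> powr - \<theta>) * ennreal (\<bar>w\<bar> powr - \<eta>))"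
      by (simp add: ennreal_mult[symmetric] ennreal_leI)
    then show ?thesis unfolding u_def[symmetric] w_def[symmetric] using pos False by (simp add: pker_def)
  qed
qed

text \<open>Since \<open>L\<close> shrinks no vector by more than \<open>c\<close>, substituting
  \<open>L x + b\<close> costs a factor at most 1/c^2; the bound \<open>K\<close> confines the new
  variable to a square. What remains is a product of two convergent integrals that no longer involve
  \<open>M\<close>, \<open>L\<close> or \<open>b\<close>.\<close>

lemma transversality_integral:
  assumes qt: "0 < q" "q < t" "t \<le> 2" and c: "0 < c"
  obtains J :: ennreal where "J < \<infinity>"
    "\<And>M (L :: real^2^2) b. det M \<noteq> 0 \<Longrightarrow> op_norm M \<le> 1 \<Longrightarrow> \<forall>x. c * norm x \<le> norm (L *v x) \<Longrightarrow>
      \<forall>x. norm x \<le> \<rho> \<longrightarrow> norm (L *v x + b) \<le> K \<Longrightarrow>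
      (\<integral>\<^sup>+x. pker q (norm (M *v (L *v x + b))) * indicator (cball 0 \<rho>) x \<partial>lborel) \<le> J * ennreal (1 / phi t M)"
proof -
  obtain \<theta> \<eta> where \<theta>: "0 \<le> \<theta>" "\<theta> < 1" "0 \<le> \<eta>" "\<eta> < 1" "\<theta> + \<eta> = q"
    "\<And>M. det M \<noteq> 0 \<Longrightarrow> op_norm M \<le> 1 \<Longrightarrow> phi t M \<le> op_norm M powr \<theta> * sing2 M powr \<eta>"
    using phi_exponents[OF qt] by metis
  define k where "k \<theta> s = pker \<theta> \<bar>s\<bar> * indicator {-K..K} s" for \<theta> s :: real
  have k_meas [measurable]: "k \<theta> \<in> borel_measurable borel" for \<theta> unfolding k_def[abs_def] by measurable
  define I where "I = (\<integral>\<^sup>+s. k \<theta> s \<partial>lborel) * (\<integral>\<^sup>+s. k \<eta> s \<partial>lborel)"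
  have I: "I < \<infinity>" unfolding I_def k_def using pker_integrable \<theta> by (auto simp: ennreal_mult_less_top)
  define J where "J = I * ennreal (1 / c\<^sup>2)"
  have "J < \<infinity>" unfolding J_def using I by (auto simp: ennreal_mult_less_top)
  moreover have "(\<integral>\<^sup>+x. pker q (norm (M *v (L *v x + b))) * indicator (cball 0 \<rho>) x \<partial>lborel) \<le> J * ennreal (1 / phi t M)"
    if M: "det M \<noteq> 0" "op_norm M \<le> 1" and L: "\<forall>x. c * norm x \<le> norm (L *v x)"
      and LK: "\<forall>x. norm x \<le> \<rho> \<longrightarrow> norm (L *v x + b) \<le> K" for M L :: "real^2^2" and b :: "real^2"
  proof -
    obtain e1 e2 where e: "norm e1 = 1" "norm e2 = 1" "e1 \<bullet> e2 = 0" "(M *v e1) \<bullet> (M *v e2) = 0"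
      "norm (M *v e1) = op_norm M" "norm (M *v e2) = sing2 M"
      and ex: "\<And>x. x = (x \<bullet> e1) *\<^sub>R e1 + (x \<bullet> e2) *\<^sub>R e2"
      using singular_basis[OF M(1)] by metis
    \<comment> \<open>The isometry onto the coordinates of the singular frame of
      \<open>M\<close>.\<close>
    define Q :: "real^2^2" where "Q = vector [e1, e2]"
    have Q: "(Q *v z) $ 1 = z \<bullet> e1" "(Q *v z) $ 2 = z \<bullet> e2" for z
      by (simp_all add: Q_def mult_vec2 inner_vec2 mult.commute)
    have nQ: "norm (Q *v z) = norm z" for z
    proof -
      have "(norm (Q *v z))\<^sup>2 = (z \<bullet> e1)\<^sup>2 + (z \<bullet> e2)\<^sup>2" by (simp add: norm_vec2 Q)
      also have "\<dots> = (norm ((z \<bullet> e1) *\<^sub>R e1 + (z \<bullet> e2) *\<^sub>R e2))\<^sup>2"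
        using e(1-3) by (simp add: norm_add_Pythagorean orthogonal_def power_mult_distrib)
      also have "\<dots> = (norm z)\<^sup>2" using ex[of z] by simp
      finally show ?thesis by (simp add: power2_eq_iff_nonneg)
    qed
    define T where "T = Q ** L"
    have Tx: "T *v x = Q *v (L *v x)" for x by (simp add: T_def matrix_vector_mul_assoc)
    have T_low: "c * norm x \<le> norm (T *v x)" for x using L by (simp add: Tx nQ)
    have dT: "det T \<noteq> 0"
    proof
      assume "det T = 0"
      then have "\<not> inj ((*v) T)" using det_nz_iff_inj[of "(*v) T"] by simp
      then obtain x where "x \<noteq> 0" "T *v x = 0"
        using linear_injective_0[of "(*v) T"] by auto
      then show False using T_low[of x] c by (simp add: mult_le_0_iff)
    qed
    have dc: "c\<^sup>2 \<le> \<bar>det T\<bar>"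
    \<comment> \<open>Both singular values of \<open>T\<close> are at least \<open>c\<close>, and
      \<bar>det T\<bar> is their product.\<close>
    proof -
      obtain e1' e2' where e': "norm e2' = 1" "norm (T *v e2') = sing2 T" using singular_basis[OF dT] by metis
      have "c \<le> sing2 T" using T_low[of e2'] e' by simp
      moreover have "c \<le> op_norm T" using \<open>c \<le> sing2 T\<close> sing2_le_op_norm[OF dT] by linarith
      ultimately have "c * c \<le> op_norm T * sing2 T" using c by (intro mult_mono) auto
      then show ?thesis using op_norm_times_sing2[OF dT] by (simp add: power2_eq_square)
    qed
    define G where "G z = k \<theta> (z $ 1) * k \<eta> (z $ 2)" for z :: "real^2"
    have [measurable]: "G \<in> borel_measurable borel" unfolding G_def[abs_def] by measurable
    define B where "B = ennreal (1 / (op_norm M powr \<theta> * sing2 M powr \<eta>))"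
    have pt: "pker q (norm (M *v (L *v x + b))) * indicator (cball 0 \<rho>) x \<le> B * G (T *v x + Q *v b)" for x
    proof (cases "x \<in> cball 0 \<rho>")
      case True
      define z where "z = L *v x + b"
      have zK: "norm z \<le> K" using LK True unfolding z_def by simp
      have "\<bar>z \<bullet> e1\<bar> \<le> K" "\<bar>z \<bullet> e2\<bar> \<le> K"
        using Cauchy_Schwarz_ineq2[of z e1] Cauchy_Schwarz_ineq2[of z e2] e zK by auto
      moreover have "T *v x + Q *v b = Q *v z" by (simp add: z_def Tx matrix_vector_right_distrib)
      ultimately have "G (T *v x + Q *v b) = pker \<theta> \<bar>z \<bullet> e1\<bar> * pker \<eta> \<bar>z \<bullet> e2\<bar>"
        by (auto simp: G_def k_def Q indicator_def abs_le_iff)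
      then show ?thesis
        using pker_matrix_le[OF M(1) e ex \<theta>(1,3), of z] True \<theta>(5) unfolding B_def z_def by simp
    qed simp
    have cont: "(\<lambda>x. T *v x + Q *v b) \<in> borel_measurable borel"
      by (intro borel_measurable_continuous_onI continuous_intros)
    have [measurable]: "(\<lambda>x. G (T *v x + Q *v b)) \<in> borel_measurable borel"
      by (rule measurable_compose[OF cont]) measurable
    have "(\<integral>\<^sup>+x. pker q (norm (M *v (L *v x + b))) * indicator (cball 0 \<rho>) x \<partial>lborel) \<le> (\<integral>\<^sup>+x. B * G (T *v x + Q *v b) \<partial>lborel)"
      by (intro nn_integral_mono pt)
    also have "\<dots> = B * (\<integral>\<^sup>+x. G (T *v x + Q *v b) \<partial>lborel)" by (rule nn_integral_cmult) simp
    also have "\<dots> \<le> ennreal (1 / phi t M) * J"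
    proof (rule mult_mono)
      show "B \<le> ennreal (1 / phi t M)" unfolding B_def
        using \<theta>(6)[OF M] phi_pos[OF M(1), of t] by (intro ennreal_leI divide_left_mono) auto
      have "ennreal (c\<^sup>2) * (\<integral>\<^sup>+x. G (T *v x + Q *v b) \<partial>lborel) \<le> ennreal \<bar>det T\<bar> * (\<integral>\<^sup>+x. G (T *v x + Q *v b) \<partial>lborel)"
        using dc by (intro mult_right_mono ennreal_leI) auto
      also have "\<dots> = (\<integral>\<^sup>+x. G x \<partial>lborel)" by (rule nn_integral_affine_image[OF dT]) simp
      also have "\<dots> = I" unfolding G_def I_def by (rule nn_integral_lborel_vec2) auto
      finally have "ennreal (1 / c\<^sup>2) * (ennreal (c\<^sup>2) * (\<integral>\<^sup>+x. G (T *v x + Q *v b) \<partial>lborel)) \<le> ennreal (1 / c\<^sup>2) * I"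
        by (intro mult_left_mono) auto
      then show "(\<integral>\<^sup>+x. G (T *v x + Q *v b) \<partial>lborel) \<le> J"
        unfolding J_def mult.assoc[symmetric] using c by (simp add: ennreal_mult[symmetric] mult.commute)
    qed auto
    finally show ?thesis by (simp add: mult.commute)
  qed
  ultimately show ?thesis by (rule that)
qed


section \<open>Potentials along the family of linear changes of coordinates\<close>

lemma continuous_on_word_matrix: "continuous_on UNIV (\<lambda>A :: real^2^2^'n. word_matrix A w)"
proof (induction w)
  case (Cons i w)
  have *: "A $ i ** word_matrix A w = (\<chi> j l. A $ i $ j $ 1 * word_matrix A w $ 1 $ l + A $ i $ j $ 2 * word_matrix A w $ 2 $ l)"
    for A :: "real^2^2^'n"
    by (simp add: matrix_matrix_mult_def sum_2)
  show ?case unfolding word_matrix_simps *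
    by (intro continuous_on_vec_lambda continuous_intros Cons)
qed simp

lemma continuous_on_mult_vec:
  fixes f :: "'a::topological_space \<Rightarrow> real^2^2" and g :: "'a \<Rightarrow> real^2"
  assumes "continuous_on S f" "continuous_on S g"
  shows "continuous_on S (\<lambda>x. f x *v g x)"
proof -
  have "f x *v g x = (\<chi> j. f x $ j $ 1 * g x $ 1 + f x $ j $ 2 * g x $ 2)" for x
    by (simp add: matrix_vector_mult_def sum_2)
  then show ?thesis using assms by (auto intro!: continuous_on_vec_lambda continuous_intros)
qed

text \<open>The prefix takes countably many values, and for a fixed word the corresponding term is
  continuous in matrices and translations.\<close>

lemma measurable_natural_proj_joint:
  fixes f :: "'a \<Rightarrow> real^2^2^'n" and u :: "'a \<Rightarrow> real^2^'n" and g :: "'a \<Rightarrow> nat \<Rightarrow> 'n"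
  assumes [measurable]: "f \<in> borel_measurable M" "u \<in> borel_measurable M" "g \<in> measurable M seq_space"
  shows "(\<lambda>x. natural_proj (f x) (u x) (g x)) \<in> borel_measurable M"
  unfolding natural_proj_def
proof (rule borel_measurable_suminf)
  fix k
  have "(\<lambda>x. (\<lambda>w x. word_matrix (f x) (butlast w) *v (u x $ last w)) (prefix_word (g x) (Suc k)) x) \<in> borel_measurable M"
  proof (rule measurable_compose_countable[where g = "\<lambda>x. prefix_word (g x) (Suc k)"
        and f = "\<lambda>w x. word_matrix (f x) (butlast w) *v (u x $ last w)"])
    show "(\<lambda>x. prefix_word (g x) (Suc k)) \<in> measurable M (count_space UNIV)"
      by (rule measurable_compose[OF assms(3) measurable_prefix_word])
    fix w :: "'n list"
    have "(\<lambda>p :: (real^2^2^'n) \<times> (real^2^'n). word_matrix (fst p) (butlast w) *v (snd p $ last w)) \<in> borel_measurable borel"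
      by (intro borel_measurable_continuous_onI continuous_on_mult_vec continuous_intros
          continuous_on_compose2[OF continuous_on_word_matrix]) auto
    then have c: "(\<lambda>p :: (real^2^2^'n) \<times> (real^2^'n). word_matrix (fst p) (butlast w) *v (snd p $ last w)) \<in> borel_measurable (borel \<Otimes>\<^sub>M borel)"
      by (simp add: borel_prod)
    show "(\<lambda>x. word_matrix (f x) (butlast w) *v (u x $ last w)) \<in> borel_measurable M"
      using measurable_compose[OF measurable_Pair[OF assms(1,2)] c] by simp
  qed
  then show "(\<lambda>x. word_matrix (f x) (prefix_word (g x) k) *v (u x $ g x k)) \<in> borel_measurable M"
    by (simp add: prefix_word_Suc)
qed

definition umat :: "real^2 \<Rightarrow> real^2 \<Rightarrow> real^2^2"
  where "umat x y = (\<chi> i. vector [x $ i, y $ i])"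

lemma umat_mult: "umat x y *v z = z $ 1 *\<^sub>R x + z $ 2 *\<^sub>R y"
  by (simp add: umat_def vec_eq_iff forall_2 mult_vec2 mult.commute)

text \<open>The share of one column of \<open>U\<close> in the translations \<open>U v_i\<close>:
  the column \<open>x\<close>, scaled by the k-th coordinates of the \<open>v_i\<close>.\<close>

definition col :: "real^2^'n \<Rightarrow> 2 \<Rightarrow> real^2 \<Rightarrow> real^2^'n"
  where "col v k x = (\<chi> i. v $ i $ k *\<^sub>R x)"

definition umat_vecs :: "real^2^'n \<Rightarrow> (real^2) \<times> (real^2) \<Rightarrow> real^2^'n"
  where "umat_vecs v u = (\<chi> i. umat (fst u) (snd u) *v (v $ i))"

lemma umat_vecs_eq: "umat_vecs v u = col v 1 (fst u) + col v 2 (snd u)"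
  by (simp add: umat_vecs_def col_def vec_eq_iff umat_mult)

lemma umat_vecs_measurable [measurable]: "umat_vecs v \<in> borel_measurable (lborel \<Otimes>\<^sub>M lborel)"
proof -
  have "continuous_on UNIV (umat_vecs v)"
    unfolding umat_vecs_def umat_mult by (intro continuous_on_vec_lambda continuous_intros)
  then have "umat_vecs v \<in> borel_measurable (borel \<Otimes>\<^sub>M borel)"
    unfolding borel_prod by (rule borel_measurable_continuous_onI)
  then show ?thesis by (simp add: measurable_def space_pair_measure sets_pair_measure)
qed

context contracting_tuple
begin

lemma natural_proj_add: "natural_proj A (u + v) \<omega> = natural_proj A u \<omega> + natural_proj A v \<omega>"
  unfolding natural_proj_def
  by (subst suminf_add[OF summable_natural_proj summable_natural_proj]) (simp add: matrix_vector_right_distrib)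

lemma natural_proj_scaleR: "natural_proj A (c *\<^sub>R v) \<omega> = c *\<^sub>R natural_proj A v \<omega>"
  unfolding natural_proj_def
  by (subst suminf_scaleR_right[OF summable_natural_proj]) (simp add: matrix_vector_mult_scaleR)

lemma linear_natural_proj_col: "linear (\<lambda>x. natural_proj A (col v k x) \<omega>)"
proof (rule linearI)
  have "col v k (x + y) = col v k x + col v k y" "col v k (c *\<^sub>R x) = c *\<^sub>R col v k x" for x y c
    by (simp_all add: col_def vec_eq_iff algebra_simps)
  then show "natural_proj A (col v k (x + y)) \<omega> = natural_proj A (col v k x) \<omega> + natural_proj A (col v k y) \<omega>"
    "natural_proj A (col v k (c *\<^sub>R x)) \<omega> = c *\<^sub>R natural_proj A (col v k x) \<omega>" for x y c
    by (simp_all add: natural_proj_add natural_proj_scaleR)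
qed

text \<open>The constant is the radius of the original translations, the one that occurs in the
  separation condition.\<close>

lemma norm_natural_proj_col_le: "norm (natural_proj A (col v k x) \<omega>) \<le> rad v * norm x"
proof -
  have "max_vec_norm (col v k x) \<le> max_vec_norm v * norm x"
    unfolding max_vec_norm_def[of "col v k x"]
  proof (rule Max.boundedI)
    fix s assume "s \<in> range (\<lambda>i. norm (col v k x $ i))"
    then obtain i where "s = \<bar>v $ i $ k\<bar> * norm x" by (auto simp: col_def)
    moreover have "\<bar>v $ i $ k\<bar> \<le> max_vec_norm v"
      using component_le_norm_cart[of "v $ i" k] norm_le_max_vec_norm[of v i] by linarith
    ultimately show "s \<le> max_vec_norm v * norm x" by (simp add: mult_right_mono)
  qed auto
  then have "rad (col v k x) \<le> rad v * norm x" unfolding rad_def using r_less by (simp add: divide_right_mono)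
  then show ?thesis using norm_natural_proj_le[of "col v k x" \<omega>] by linarith
qed

lemma natural_proj_col_shift:
  "natural_proj A (col v k x) \<omega> = v $ \<omega> 0 $ k *\<^sub>R x + A $ \<omega> 0 *v natural_proj A (col v k x) (seq_shift 1 \<omega>)"
  using natural_proj_shift[of "col v k x" \<omega> 1] prefix_word_Suc[of \<omega> 0] by (simp add: col_def add.commute)

end

text \<open>Origin of the constant \<open>sqrt 2 / 2\<close>: in the plane one coordinate carries at
  least half of the squared length.\<close>

lemma large_component: "\<exists>k. sqrt 2 / 2 * norm d \<le> \<bar>(d :: real^2) $ k\<bar>"
proof (rule ccontr)
  assume "\<nexists>k. sqrt 2 / 2 * norm d \<le> \<bar>d $ k\<bar>"
  then have "\<bar>d $ k\<bar> < sqrt 2 / 2 * norm d" for k by (auto simp: not_le)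
  then have "\<bar>d $ k\<bar>\<^sup>2 < (sqrt 2 / 2 * norm d)\<^sup>2" for k by (intro power_strict_mono) auto
  then have "(d $ k)\<^sup>2 < (norm d)\<^sup>2 / 2" for k by (simp add: power_mult_distrib power_divide)
  from this[of 1] this[of 2] norm_vec2[of d] show False by linarith
qed

text \<open>The condition \<open>sep\<close> is the admissibility bound multiplied out, with
  \<open>r\<close> in place of the largest operator norm.\<close>

locale transversal_tuple = contracting_tuple A r
  for A :: "real^2^2^'n" and r +
  fixes v :: "real^2^'n"
  assumes sep: "\<And>i j. i \<noteq> j \<Longrightarrow> (op_norm (A $ i) + op_norm (A $ j)) * rad v < sqrt 2 / 2 * norm (v $ i - v $ j)"
begin

lemma transversality_constant:
  obtains c where "0 < c" "\<And>i j. i \<noteq> j \<Longrightarrow> (op_norm (A $ i) + op_norm (A $ j)) * rad v + c \<le> sqrt 2 / 2 * norm (v $ i - v $ j)"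
proof -
  define f where "f p = sqrt 2 / 2 * norm (v $ fst p - v $ snd p) - (op_norm (A $ fst p) + op_norm (A $ snd p)) * rad v" for p
  define S where "S = insert 1 (f ` {p. fst p \<noteq> snd p})"
  have S: "finite S" "S \<noteq> {}" unfolding S_def by auto
  have "0 < Min S" using S sep by (auto simp: S_def f_def Min_gr_iff)
  moreover have "(op_norm (A $ i) + op_norm (A $ j)) * rad v + Min S \<le> sqrt 2 / 2 * norm (v $ i - v $ j)" if "i \<noteq> j" for i j
  proof -
    have "f (i, j) \<in> S" using that unfolding S_def by force
    then have "Min S \<le> f (i, j)" using S by (intro Min_le) auto
    then show ?thesis by (simp add: f_def)
  qed
  ultimately show ?thesis using that by blast
qed

text \<open>Splitting off the different first letters leaves a multiple of \<open>x\<close> by the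
  k-th coordinate of \<open>v_i - v_j\<close>, perturbed by the images of two vectors of length at
  most \<open>rad v * norm x\<close>. The separation leaves the margin \<open>c\<close>.\<close>

lemma col_diff_lower:
  assumes ne: "\<omega> 0 \<noteq> \<omega>' 0" and k: "sqrt 2 / 2 * norm (v $ \<omega> 0 - v $ \<omega>' 0) \<le> \<bar>(v $ \<omega> 0 - v $ \<omega>' 0) $ k\<bar>"
    and c: "\<And>i j. i \<noteq> j \<Longrightarrow> (op_norm (A $ i) + op_norm (A $ j)) * rad v + c \<le> sqrt 2 / 2 * norm (v $ i - v $ j)"
  shows "c * norm x \<le> norm (natural_proj A (col v k x) \<omega> - natural_proj A (col v k x) \<omega>')"
proof -
  define i j where "i = \<omega> 0" and "j = \<omega>' 0"
  define z z' where "z = natural_proj A (col v k x) (seq_shift 1 \<omega>)" and "z' = natural_proj A (col v k x) (seq_shift 1 \<omega>')"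
  have zz: "norm z \<le> rad v * norm x" "norm z' \<le> rad v * norm x"
    unfolding z_def z'_def by (rule norm_natural_proj_col_le)+
  have "norm (A $ i *v z) \<le> op_norm (A $ i) * (rad v * norm x)"
    using op_norm_ge[of "A $ i" z] mult_left_mono[OF zz(1) op_norm_nonneg[of "A $ i"]] by linarith
  moreover have "norm (A $ j *v z') \<le> op_norm (A $ j) * (rad v * norm x)"
    using op_norm_ge[of "A $ j" z'] mult_left_mono[OF zz(2) op_norm_nonneg[of "A $ j"]] by linarith
  moreover have eq: "natural_proj A (col v k x) \<omega> - natural_proj A (col v k x) \<omega>' = ((v $ i - v $ j) $ k) *\<^sub>R x - (A $ j *v z' - A $ i *v z)"
    using natural_proj_col_shift[of v k x \<omega>] natural_proj_col_shift[of v k x \<omega>']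
    by (simp add: i_def j_def z_def z'_def algebra_simps)
  moreover have "norm (((v $ i - v $ j) $ k) *\<^sub>R x) - (norm (A $ j *v z') + norm (A $ i *v z)) \<le> norm (natural_proj A (col v k x) \<omega> - natural_proj A (col v k x) \<omega>')"
    unfolding eq using norm_triangle_ineq2[of "((v $ i - v $ j) $ k) *\<^sub>R x" "A $ j *v z' - A $ i *v z"]
      norm_triangle_ineq4[of "A $ j *v z'" "A $ i *v z"] by linarith
  moreover have "((op_norm (A $ i) + op_norm (A $ j)) * rad v + c) * norm x \<le> norm (((v $ i - v $ j) $ k) *\<^sub>R x)"
    unfolding norm_scaleR using c[of i j] ne k unfolding i_def j_def by (intro mult_right_mono) auto
  ultimately show ?thesis by (simp add: algebra_simps)
qed

text \<open>Only one of the two columns is sure to act invertibly, and which one depends on the pair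
  of sequences. By Tonelli that column is integrated first, the other entering as a constant shift
  and contributing the area of its disc.\<close>

lemma transversality:
  assumes qt: "0 < q" "q < t" "t \<le> 2"
  obtains C :: ennreal where "C < \<infinity>"
    "\<And>M \<omega> \<omega>'. det M \<noteq> 0 \<Longrightarrow> op_norm M \<le> 1 \<Longrightarrow> \<omega> 0 \<noteq> \<omega>' 0 \<Longrightarrow>
      (\<integral>\<^sup>+u. pker q (norm (M *v (natural_proj A (umat_vecs v u) \<omega> - natural_proj A (umat_vecs v u) \<omega>')))
        * indicator (cball 0 \<rho> \<times> cball 0 \<rho>) u \<partial>(lborel \<Otimes>\<^sub>M lborel)) \<le> C * ennreal (1 / phi t M)"
proof -
  obtain c where c: "0 < c" "\<And>i j. i \<noteq> j \<Longrightarrow> (op_norm (A $ i) + op_norm (A $ j)) * rad v + c \<le> sqrt 2 / 2 * norm (v $ i - v $ j)"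
    using transversality_constant by blast
  \<comment> \<open>The bound \<open>4 * rad v * \<rho>\<close>: two columns of length at most
    \<rho>, each giving a difference of two points of norm at most
    \<open>rad v * \<rho>\<close>.\<close>
  obtain J where J: "J < \<infinity>"
    "\<And>M (L :: real^2^2) b. det M \<noteq> 0 \<Longrightarrow> op_norm M \<le> 1 \<Longrightarrow> \<forall>x. c * norm x \<le> norm (L *v x) \<Longrightarrow>
      \<forall>x. norm x \<le> \<rho> \<longrightarrow> norm (L *v x + b) \<le> 4 * rad v * \<rho> \<Longrightarrow>
      (\<integral>\<^sup>+x. pker q (norm (M *v (L *v x + b))) * indicator (cball 0 \<rho>) x \<partial>lborel) \<le> J * ennreal (1 / phi t M)"
    using transversality_integral[OF qt c(1), of \<rho> "4 * rad v * \<rho>"] by blast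
  define C where "C = J * emeasure lborel (cball (0 :: real^2) \<rho>)"
  have "C < \<infinity>" unfolding C_def using J(1) emeasure_lborel_cball_finite[of "0 :: real^2" \<rho>]
    by (auto simp: ennreal_mult_less_top)
  moreover have "(\<integral>\<^sup>+u. pker q (norm (M *v (natural_proj A (umat_vecs v u) \<omega> - natural_proj A (umat_vecs v u) \<omega>')))
        * indicator (cball 0 \<rho> \<times> cball 0 \<rho>) u \<partial>(lborel \<Otimes>\<^sub>M lborel)) \<le> C * ennreal (1 / phi t M)"
    if M: "det M \<noteq> 0" "op_norm M \<le> 1" and ne: "\<omega> 0 \<noteq> \<omega>' 0" for M \<omega> \<omega>'
  proof -
    define l where "l k x = natural_proj A (col v k x) \<omega> - natural_proj A (col v k x) \<omega>'" for k x
    have lin: "linear (l k)" for k unfolding l_def by (intro linear_compose_sub linear_natural_proj_col)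
    have lc: "continuous_on S (l k)" for S k
      using lin[of k] by (simp add: linear_continuous_on linear_conv_bounded_linear)
    have l_le: "norm (l k x) \<le> 2 * rad v * norm x" for k x
      using norm_triangle_ineq4[of "natural_proj A (col v k x) \<omega>" "natural_proj A (col v k x) \<omega>'"]
        norm_natural_proj_col_le[of v k x \<omega>] norm_natural_proj_col_le[of v k x \<omega>'] unfolding l_def by linarith
    have D: "natural_proj A (umat_vecs v u) \<omega> - natural_proj A (umat_vecs v u) \<omega>' = l 1 (fst u) + l 2 (snd u)" for u
      by (simp add: umat_vecs_eq natural_proj_add l_def)
    have low: "\<exists>k. \<forall>x. c * norm x \<le> norm (l k x)"
    proof -
      obtain k where k: "sqrt 2 / 2 * norm (v $ \<omega> 0 - v $ \<omega>' 0) \<le> \<bar>(v $ \<omega> 0 - v $ \<omega>' 0) $ k\<bar>"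
        using large_component by blast
      have "c * norm x \<le> norm (l k x)" for x
        unfolding l_def by (rule col_diff_lower[where \<omega> = \<omega> and \<omega>' = \<omega>', OF ne k]) (rule c(2))
      then show ?thesis by blast
    qed
    have inner: "(\<integral>\<^sup>+x. pker q (norm (M *v (l k x + l k' y))) * indicator (cball 0 \<rho>) x \<partial>lborel) \<le> J * ennreal (1 / phi t M)"
      if k: "\<forall>x. c * norm x \<le> norm (l k x)" and y: "norm y \<le> \<rho>" for k k' y
    proof -
      have L: "matrix (l k) *v x = l k x" for x using lin by (simp add: matrix_vector_mul)
      have "norm (l k x + l k' y) \<le> 4 * rad v * \<rho>" if "norm x \<le> \<rho>" for x
      proof -
        have "norm (l k x + l k' y) \<le> 2 * rad v * norm x + 2 * rad v * norm y"
          using norm_triangle_ineq[of "l k x" "l k' y"] l_le[of k x] l_le[of k' y] by linarith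
        also have "\<dots> \<le> 2 * rad v * \<rho> + 2 * rad v * \<rho>"
          using that y rad_nonneg[of v] by (intro add_mono mult_left_mono) auto
        finally show ?thesis by (simp add: mult_ac)
      qed
      then show ?thesis using J(2)[OF M, of "matrix (l k)" "l k' y"] k unfolding L by blast
    qed
    define F where "F u = pker q (norm (M *v (l 1 (fst u) + l 2 (snd u)))) * indicator (cball 0 \<rho> \<times> cball 0 \<rho>) u" for u
    have F_meas: "F \<in> borel_measurable (lborel \<Otimes>\<^sub>M lborel)"
    proof -
      have "(\<lambda>u. norm (M *v (l 1 (fst u) + l 2 (snd u)))) \<in> borel_measurable borel"
        by (intro borel_measurable_continuous_onI continuous_on_norm continuous_on_mult_vec continuous_on_const
            continuous_on_add continuous_on_compose2[OF lc[of UNIV]] continuous_on_fst continuous_on_snd continuous_on_id) auto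
      then have "(\<lambda>u. pker q (norm (M *v (l 1 (fst u) + l 2 (snd u))))) \<in> borel_measurable borel"
        by (rule measurable_compose) measurable
      moreover have "indicator (cball 0 \<rho> \<times> cball 0 \<rho>) \<in> borel_measurable (borel :: ((real^2) \<times> (real^2)) measure)"
        by (intro borel_measurable_indicator borel_closed closed_Times) auto
      ultimately have "F \<in> borel_measurable borel" unfolding F_def[abs_def] by (rule borel_measurable_times_ennreal)
      then show ?thesis
        by (simp add: measurable_cong_sets[of "lborel \<Otimes>\<^sub>M lborel" "borel" borel borel] borel_prod[symmetric] sets_pair_measure_cong[of lborel borel lborel borel])
    qed
    obtain k where k: "\<forall>x. c * norm x \<le> norm (l k x)" using low by blast
    have outer: "(\<integral>\<^sup>+y. J * ennreal (1 / phi t M) * indicator (cball 0 \<rho>) y \<partial>(lborel :: (real^2) measure)) = C * ennreal (1 / phi t M)"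
      unfolding C_def by (subst nn_integral_cmult_indicator) (auto simp: mult_ac)
    have "(\<integral>\<^sup>+u. F u \<partial>(lborel \<Otimes>\<^sub>M lborel)) \<le> C * ennreal (1 / phi t M)"
    proof (cases "k = 1")
      case True
      have "(\<integral>\<^sup>+u. F u \<partial>(lborel \<Otimes>\<^sub>M lborel)) = (\<integral>\<^sup>+y. \<integral>\<^sup>+x. F (x, y) \<partial>lborel \<partial>lborel)"
        by (rule lborel_pair.nn_integral_snd[symmetric]) (rule F_meas)
      also have "\<dots> \<le> (\<integral>\<^sup>+y. J * ennreal (1 / phi t M) * indicator (cball 0 \<rho>) y \<partial>(lborel :: (real^2) measure))"
      proof (rule nn_integral_mono)
        fix y :: "real^2"
        show "(\<integral>\<^sup>+x. F (x, y) \<partial>lborel) \<le> J * ennreal (1 / phi t M) * indicator (cball 0 \<rho>) y"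
        proof (cases "y \<in> cball 0 \<rho>")
          case y: True
          then have "(\<integral>\<^sup>+x. F (x, y) \<partial>lborel) = (\<integral>\<^sup>+x. pker q (norm (M *v (l 1 x + l 2 y))) * indicator (cball 0 \<rho>) x \<partial>lborel)"
            by (simp add: F_def indicator_times)
          then show ?thesis using inner[of 1 y 2] k True y by simp
        qed (simp add: F_def indicator_times)
      qed
      finally show ?thesis unfolding outer .
    next
      case False
      then have k2: "k = 2" using exhaust_2 by blast
      have "(\<integral>\<^sup>+u. F u \<partial>(lborel \<Otimes>\<^sub>M lborel)) = (\<integral>\<^sup>+x. \<integral>\<^sup>+y. F (x, y) \<partial>lborel \<partial>lborel)"
        by (rule lborel.nn_integral_fst[symmetric]) (rule F_meas)
      also have "\<dots> \<le> (\<integral>\<^sup>+x. J * ennreal (1 / phi t M) * indicator (cball 0 \<rho>) x \<partial>(lborel :: (real^2) measure))"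
      proof (rule nn_integral_mono)
        fix x :: "real^2"
        show "(\<integral>\<^sup>+y. F (x, y) \<partial>lborel) \<le> J * ennreal (1 / phi t M) * indicator (cball 0 \<rho>) x"
        proof (cases "x \<in> cball 0 \<rho>")
          case x: True
          then have "(\<integral>\<^sup>+y. F (x, y) \<partial>lborel) = (\<integral>\<^sup>+y. pker q (norm (M *v (l 2 y + l 1 x))) * indicator (cball 0 \<rho>) y \<partial>lborel)"
            by (simp add: F_def indicator_times add.commute)
          then show ?thesis using inner[of 2 x 1] k k2 x by simp
        qed (simp add: F_def indicator_times)
      qed
      finally show ?thesis unfolding outer .
    qed
    then show ?thesis unfolding F_def D .
  qed
  ultimately show ?thesis by (rule that)
qed

end

text \<open>The Riesz potential of the projected measure at the point coded by \<omega>, written on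
  the symbolic space, where \<open>m\<close> need not change when the maps do.\<close>

definition potential :: "real \<Rightarrow> (nat \<Rightarrow> 'n::finite) measure \<Rightarrow> real^2^2^'n \<Rightarrow> real^2^'n \<Rightarrow> (nat \<Rightarrow> 'n) \<Rightarrow> ennreal"
  where "potential q m A v \<omega> = (\<integral>\<^sup>+\<omega>'. pker q (norm (natural_proj A v \<omega> - natural_proj A v \<omega>')) \<partial>m)"

lemma measurable_potential:
  assumes "sigma_finite_measure m" and [measurable_cong]: "sets m = sets seq_space"
    and [measurable]: "f \<in> borel_measurable M" "u \<in> borel_measurable M" "g \<in> measurable M m"
  shows "(\<lambda>x. potential q m (f x) (u x) (g x)) \<in> borel_measurable M"
proof -
  interpret sigma_finite_measure m by fact
  have 1: "g \<in> measurable M seq_space" using assms(5) unfolding measurable_cong_sets[OF refl assms(2)] .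
  have s: "snd \<in> measurable (M \<Otimes>\<^sub>M m) seq_space" by measurable
  have f: "(\<lambda>z. f (fst z)) \<in> borel_measurable (M \<Otimes>\<^sub>M m)" and u: "(\<lambda>z. u (fst z)) \<in> borel_measurable (M \<Otimes>\<^sub>M m)"
    and g: "(\<lambda>z. g (fst z)) \<in> measurable (M \<Otimes>\<^sub>M m) seq_space"
    using 1 by (auto intro: measurable_compose[OF measurable_fst])
  have "(\<lambda>z. natural_proj (f (fst z)) (u (fst z)) (g (fst z)) - natural_proj (f (fst z)) (u (fst z)) (snd z)) \<in> borel_measurable (M \<Otimes>\<^sub>M m)"
    by (intro borel_measurable_diff measurable_natural_proj_joint f u g s)
  then have "(\<lambda>z. pker q (norm (natural_proj (f (fst z)) (u (fst z)) (g (fst z)) - natural_proj (f (fst z)) (u (fst z)) (snd z)))) \<in> borel_measurable (M \<Otimes>\<^sub>M m)"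
    by measurable
  then have "(\<lambda>x. \<integral>\<^sup>+y. pker q (norm (natural_proj (f x) (u x) (g x) - natural_proj (f x) (u x) y)) \<partial>m) \<in> borel_measurable M"
    by (intro borel_measurable_nn_integral) (simp add: split_beta')
  then show ?thesis unfolding potential_def .
qed

context transversal_tuple
begin

lemma first_difference:
  assumes "\<omega> \<noteq> \<omega>'"
  obtains n where "prefix_word \<omega> n = prefix_word \<omega>' n" "seq_shift n \<omega> 0 \<noteq> seq_shift n \<omega>' 0"
proof -
  obtain k where k: "\<omega> k \<noteq> \<omega>' k" using assms by blast
  define n where "n = (LEAST k. \<omega> k \<noteq> \<omega>' k)"
  have "\<omega> n \<noteq> \<omega>' n" unfolding n_def by (rule LeastI[of "\<lambda>k. \<omega> k \<noteq> \<omega>' k", OF k])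
  moreover have "\<omega> k = \<omega>' k" if "k < n" for k using not_less_Least[of k "\<lambda>k. \<omega> k \<noteq> \<omega>' k"] that unfolding n_def by blast
  ultimately show ?thesis using that[of n] by (simp add: prefix_word_eq_iff seq_shift_def)
qed

text \<open>Falconer's argument: integrate the potential over \<open>u\<close>, exchange the
  integrals and sort the second sequence by its common prefix with \<omega>. Transversality bounds
  the contribution of prefix length \<open>n\<close> by a constant times the n-th term of the energy
  series.\<close>

lemma AE_potential_finite:
  assumes qt: "0 < q" "q < t" "t \<le> 2"
    and m: "prob_space m" and sets_m [measurable_cong]: "sets m = sets seq_space"
    and energy: "AE \<omega> in m. (\<Sum>n. ennreal (measure m (cyl (prefix_word \<omega> n)) / phi t (word_matrix A (prefix_word \<omega> n)))) < \<infinity>"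
  shows "AE u in lborel \<Otimes>\<^sub>M lborel. AE \<omega> in m. potential q m A (umat_vecs v u) \<omega> < \<infinity>"
proof -
  interpret prob_space m by (rule m)
  interpret P: pair_sigma_finite m "lborel \<Otimes>\<^sub>M lborel :: ((real^2) \<times> (real^2)) measure" ..
  let ?U = "lborel \<Otimes>\<^sub>M lborel :: ((real^2) \<times> (real^2)) measure"
  have space_m: "space m = UNIV" using sets_eq_imp_space_eq[OF sets_m] by simp
  have pot_meas: "(\<lambda>z. potential q m A (umat_vecs v (snd z)) (fst z)) \<in> borel_measurable (m \<Otimes>\<^sub>M ?U)"
    by (rule measurable_potential[OF _ sets_m]) (auto intro: sigma_finite_measure_axioms measurable_compose[OF measurable_snd umat_vecs_measurable])
  \<comment> \<open>Lebesgue measure on the parameters is infinite, hence the restriction to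
    products of discs, which exhaust the parameter space.\<close>
  have key: "AE u in ?U. u \<in> cball 0 (real N) \<times> cball 0 (real N) \<longrightarrow> potential q m A (umat_vecs v u) \<omega> < \<infinity>"
    if fin: "(\<Sum>n. ennreal (measure m (cyl (prefix_word \<omega> n)) / phi t (word_matrix A (prefix_word \<omega> n)))) < \<infinity>" for \<omega> and N :: nat
  proof -
    define B where "B = cball (0 :: real^2) (real N) \<times> cball (0 :: real^2) (real N)"
    have B [measurable]: "B \<in> sets ?U" unfolding B_def by (intro pair_measureI) auto
    obtain C where C: "C < \<infinity>" and C': "\<And>M \<omega> \<omega>'. det M \<noteq> 0 \<Longrightarrow> op_norm M \<le> 1 \<Longrightarrow> \<omega> 0 \<noteq> \<omega>' 0 \<Longrightarrow>
      (\<integral>\<^sup>+u. pker q (norm (M *v (natural_proj A (umat_vecs v u) \<omega> - natural_proj A (umat_vecs v u) \<omega>')))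
        * indicator (cball 0 (real N) \<times> cball 0 (real N)) u \<partial>?U) \<le> C * ennreal (1 / phi t M)"
      using transversality[OF qt, of "real N"] by blast
    note C' = C'[folded B_def]
    define a where "a n = measure m (cyl (prefix_word \<omega> n)) / phi t (word_matrix A (prefix_word \<omega> n))" for n
    have phi1: "phi t (word_matrix A w) \<le> 1" for w
      using phi_add_bounds(1)[OF det_word_nz[of w], of t 0] qt op_norm_word_le_1[of w] powr_mono2[of t "op_norm (word_matrix A w)" 1]
        det_nonzero_op_norm_pos[OF det_word_nz[of w]] by (simp add: phi_0)
    have a_nn: "0 \<le> a n" for n unfolding a_def using phi_pos[OF det_word_nz, of t] by (simp add: less_imp_le)
    have "summable a" using fin a_nn unfolding a_def[symmetric] by (intro summable_suminf_not_top) (auto simp: less_top)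
    then have a0: "a \<longlonglongrightarrow> 0" by (rule summable_LIMSEQ_zero)
    \<comment> \<open>The kernel is infinite on the diagonal, so \<omega> must not be an atom. The
      terms of the energy series tend to 0 and, as \<open>phi\<close> is at most 1, dominate the
      masses of the cylinders around \<omega>.\<close>
    have single: "AE \<omega>' in m. \<omega>' \<noteq> \<omega>"
    proof -
      have sing: "{\<omega>} \<in> sets m"
      proof -
        have "{\<omega>} = (\<Inter>n. cyl (prefix_word \<omega> n))"
        proof (intro equalityI subsetI)
          fix \<omega>' assume "\<omega>' \<in> (\<Inter>n. cyl (prefix_word \<omega> n))"
          then have "prefix_word \<omega>' (Suc k) = prefix_word \<omega> (Suc k)" for k using mem_cyl_prefix by blast
          then have "\<omega>' k = \<omega> k" for k using prefix_word_eq_iff by blast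
          then show "\<omega>' \<in> {\<omega>}" by auto
        qed (simp add: mem_cyl_prefix)
        also have "\<dots> \<in> sets m" unfolding sets_m by (intro sets.countable_INT) auto
        finally show ?thesis .
      qed
      have "prob {\<omega>} \<le> a n" for n
      proof -
        have "prob {\<omega>} \<le> prob (cyl (prefix_word \<omega> n))"
          by (intro finite_measure_mono) (auto simp: mem_cyl_prefix sets_m)
        also have "\<dots> \<le> a n" unfolding a_def using phi1[of "prefix_word \<omega> n"] phi_pos[OF det_word_nz, of t "prefix_word \<omega> n"]
          by (simp add: pos_le_divide_eq mult_left_le)
        finally show ?thesis .
      qed
      then have "prob {\<omega>} \<le> 0" by (intro LIMSEQ_le_const[OF a0]) auto
      then have "prob {\<omega>} = 0" using measure_nonneg[of m "{\<omega>}"] by linarith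
      then have "{\<omega>} \<in> null_sets m" using sing by (auto simp: null_sets_def emeasure_eq_measure)
      then have "AE x in m. x \<notin> {\<omega>}" by (rule AE_not_in)
      then show ?thesis by simp
    qed
    have bound: "(\<integral>\<^sup>+u. pker q (norm (natural_proj A (umat_vecs v u) \<omega> - natural_proj A (umat_vecs v u) \<omega>')) * indicator B u \<partial>?U)
        \<le> (\<Sum>n. C * ennreal (1 / phi t (word_matrix A (prefix_word \<omega> n))) * indicator (cyl (prefix_word \<omega> n)) \<omega>')"
      if ne: "\<omega>' \<noteq> \<omega>" for \<omega>'
    proof -
      obtain n where n: "prefix_word \<omega> n = prefix_word \<omega>' n" "seq_shift n \<omega> 0 \<noteq> seq_shift n \<omega>' 0"
        using first_difference[of \<omega> \<omega>'] ne by blast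
      have "(\<integral>\<^sup>+u. pker q (norm (natural_proj A (umat_vecs v u) \<omega> - natural_proj A (umat_vecs v u) \<omega>')) * indicator B u \<partial>?U)
        \<le> C * ennreal (1 / phi t (word_matrix A (prefix_word \<omega> n)))"
        unfolding natural_proj_diff[OF n(1)] by (rule C') (rule det_word_nz op_norm_word_le_1 n(2))+
      also have "\<dots> = C * ennreal (1 / phi t (word_matrix A (prefix_word \<omega> n))) * indicator (cyl (prefix_word \<omega> n)) \<omega>'"
        using n(1) by (simp add: mem_cyl_prefix)
      \<comment> \<open>Only one prefix length is relevant, but the sum over all of them is a
        measurable majorant that can be integrated termwise.\<close>
      also have "\<dots> \<le> (\<Sum>n. C * ennreal (1 / phi t (word_matrix A (prefix_word \<omega> n))) * indicator (cyl (prefix_word \<omega> n)) \<omega>')"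
      proof -
        have "h n \<le> (\<Sum>n. h n)" for h :: "nat \<Rightarrow> ennreal"
          using sum_le_suminf[of h "{n}"] by simp
        then show ?thesis .
      qed
      finally show ?thesis .
    qed
    have F_meas: "(\<lambda>(u, \<omega>'). pker q (norm (natural_proj A (umat_vecs v u) \<omega> - natural_proj A (umat_vecs v u) \<omega>')) * indicator B u) \<in> borel_measurable (?U \<Otimes>\<^sub>M m)"
    proof -
      have u: "(\<lambda>z. umat_vecs v (fst z)) \<in> borel_measurable (?U \<Otimes>\<^sub>M m)" by (rule measurable_compose[OF measurable_fst umat_vecs_measurable])
      have s: "snd \<in> measurable (?U \<Otimes>\<^sub>M m) seq_space" by measurable
      have "(\<lambda>z. natural_proj A (umat_vecs v (fst z)) \<omega> - natural_proj A (umat_vecs v (fst z)) (snd z)) \<in> borel_measurable (?U \<Otimes>\<^sub>M m)"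
        by (intro borel_measurable_diff measurable_natural_proj_joint u s measurable_const) auto
      then have "(\<lambda>z. pker q (norm (natural_proj A (umat_vecs v (fst z)) \<omega> - natural_proj A (umat_vecs v (fst z)) (snd z))) * indicator B (fst z)) \<in> borel_measurable (?U \<Otimes>\<^sub>M m)"
        by measurable
      then show ?thesis by (simp add: split_beta')
    qed
    interpret Q: pair_sigma_finite ?U m ..
    have pB: "(\<lambda>u. potential q m A (umat_vecs v u) \<omega>) \<in> borel_measurable ?U"
      by (rule measurable_potential[OF _ sets_m]) (auto intro: sigma_finite_measure_axioms umat_vecs_measurable simp: space_m)
    have "(\<integral>\<^sup>+u. potential q m A (umat_vecs v u) \<omega> * indicator B u \<partial>?U)
      = (\<integral>\<^sup>+u. \<integral>\<^sup>+\<omega>'. pker q (norm (natural_proj A (umat_vecs v u) \<omega> - natural_proj A (umat_vecs v u) \<omega>')) * indicator B u \<partial>m \<partial>?U)"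
    proof (rule nn_integral_cong)
      fix u
      have "(\<lambda>\<omega>'. pker q (norm (natural_proj A (umat_vecs v u) \<omega> - natural_proj A (umat_vecs v u) \<omega>'))) \<in> borel_measurable m"
      proof -
        have "natural_proj A (umat_vecs v u) \<in> borel_measurable m" unfolding measurable_cong_sets[OF sets_m refl] by measurable
        then show ?thesis by measurable
      qed
      then show "potential q m A (umat_vecs v u) \<omega> * indicator B u = (\<integral>\<^sup>+\<omega>'. pker q (norm (natural_proj A (umat_vecs v u) \<omega> - natural_proj A (umat_vecs v u) \<omega>')) * indicator B u \<partial>m)"
        unfolding potential_def by (rule nn_integral_multc[symmetric])
    qed
    also have "\<dots> = (\<integral>\<^sup>+\<omega>'. \<integral>\<^sup>+u. pker q (norm (natural_proj A (umat_vecs v u) \<omega> - natural_proj A (umat_vecs v u) \<omega>')) * indicator B u \<partial>?U \<partial>m)"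
      by (rule Q.Fubini'[symmetric]) (rule F_meas)
    also have "\<dots> \<le> (\<integral>\<^sup>+\<omega>'. (\<Sum>n. C * ennreal (1 / phi t (word_matrix A (prefix_word \<omega> n))) * indicator (cyl (prefix_word \<omega> n)) \<omega>') \<partial>m)"
      by (rule nn_integral_mono_AE) (use single in \<open>eventually_elim, use bound in blast\<close>)
    also have "\<dots> = (\<Sum>n. C * ennreal (1 / phi t (word_matrix A (prefix_word \<omega> n))) * emeasure m (cyl (prefix_word \<omega> n)))"
      by (subst nn_integral_suminf) (auto simp: nn_integral_cmult_indicator sets_m)
    also have "\<dots> = (\<Sum>n. C * ennreal (a n))"
    proof (rule suminf_cong)
      fix n
      have "ennreal (1 / phi t (word_matrix A (prefix_word \<omega> n))) * emeasure m (cyl (prefix_word \<omega> n)) = ennreal (a n)"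
        unfolding a_def emeasure_eq_measure using phi_pos[OF det_word_nz, of t "prefix_word \<omega> n"]
        by (simp add: ennreal_mult'[symmetric] less_imp_le)
      then show "C * ennreal (1 / phi t (word_matrix A (prefix_word \<omega> n))) * emeasure m (cyl (prefix_word \<omega> n)) = C * ennreal (a n)"
        by (simp add: mult.assoc)
    qed
    also have "\<dots> = C * (\<Sum>n. ennreal (a n))" by (rule ennreal_suminf_cmult)
    also have "\<dots> < \<infinity>" using C fin unfolding a_def[symmetric] by (auto simp: ennreal_mult_less_top)
    finally have "(\<integral>\<^sup>+u. potential q m A (umat_vecs v u) \<omega> * indicator B u \<partial>?U) \<noteq> \<infinity>" by simp
    then have "AE u in ?U. potential q m A (umat_vecs v u) \<omega> * indicator B u \<noteq> \<infinity>"
      using pB by (intro nn_integral_PInf_AE borel_measurable_times_ennreal) auto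
    then show ?thesis by eventually_elim (auto simp: B_def[symmetric] indicator_def less_top split: if_splits)
  qed
  have "AE \<omega> in m. AE u in ?U. potential q m A (umat_vecs v u) \<omega> < \<infinity>"
    using energy
  proof eventually_elim
    case (elim \<omega>)
    have "AE u in ?U. \<forall>N. u \<in> cball 0 (real N) \<times> cball 0 (real N) \<longrightarrow> potential q m A (umat_vecs v u) \<omega> < \<infinity>"
      unfolding AE_all_countable by (intro allI key elim)
    then show ?case
    proof eventually_elim
      case (elim u)
      obtain N :: nat where "max (norm (fst u)) (norm (snd u)) \<le> real N" using real_arch_simple by blast
      then have "u \<in> cball 0 (real N) \<times> cball 0 (real N)" by (cases u) auto
      then show ?case using elim by blast
    qed
  qed
  then show ?thesis
  proof (subst (asm) P.AE_commute)
    show "{x \<in> space (m \<Otimes>\<^sub>M ?U). potential q m A (umat_vecs v (snd x)) (fst x) < \<infinity>} \<in> sets (m \<Otimes>\<^sub>M ?U)"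
      using pot_meas by measurable
  qed
qed

end


section \<open>Consequences of finite potentials\<close>

lemma pker_antimono:
  assumes "0 < q" "0 \<le> s" "s \<le> s'"
  shows "pker q s' \<le> pker q s"
  using assms by (auto simp: pker_def intro!: ennreal_leI powr_mono2')

text \<open>Markov's inequality for the kernel. At radius 0 the kernel is infinite, so a finite
  potential excludes an atom.\<close>

lemma potential_ball_bound:
  fixes g :: "'a \<Rightarrow> real^2"
  assumes g [measurable]: "g \<in> borel_measurable m" and q: "0 < q" and d: "0 \<le> d" and K: "0 \<le> K"
    and pot: "(\<integral>\<^sup>+\<omega>'. pker q (norm (x - g \<omega>')) \<partial>m) \<le> ennreal K"
  shows "emeasure m (g -` cball x d \<inter> space m) \<le> ennreal (K * d powr q)"
proof -
  define B where "B = g -` cball x d \<inter> space m"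
  have B [measurable]: "B \<in> sets m" unfolding B_def by measurable
  have "pker q d * emeasure m B = (\<integral>\<^sup>+\<omega>'. pker q d * indicator B \<omega>' \<partial>m)"
    by (simp add: nn_integral_cmult_indicator)
  also have "\<dots> \<le> (\<integral>\<^sup>+\<omega>'. pker q (norm (x - g \<omega>')) \<partial>m)"
    by (intro nn_integral_mono) (auto simp: B_def indicator_def dist_norm intro!: pker_antimono q)
  finally have le: "pker q d * emeasure m B \<le> ennreal K" using pot by (rule order_trans)
  show ?thesis
  proof (cases "d = 0")
    case True
    have "emeasure m B = 0"
    proof (rule ccontr)
      assume "emeasure m B \<noteq> 0"
      then have "pker q d * emeasure m B = top" using True by (simp add: pker_def ennreal_top_mult)
      then show False using le by (simp add: top_unique)
    qed
    then show ?thesis unfolding B_def by simp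
  next
    case False
    then have d: "0 < d" using d by simp
    have "emeasure m B = ennreal (d powr q) * (pker q d * emeasure m B)"
      using d by (simp add: pker_def mult.assoc[symmetric] ennreal_mult[symmetric] powr_minus)
    also have "\<dots> \<le> ennreal (d powr q) * ennreal K" by (intro mult_left_mono le) simp
    also have "\<dots> = ennreal (K * d powr q)" using K by (simp add: ennreal_mult mult.commute)
    finally show ?thesis unfolding B_def .
  qed
qed

text \<open>The mass distribution principle on a set \<open>G N\<close> of positive measure where
  the potential is bounded, at scale 1.\<close>

lemma hausdorff_measure_pos_if_potential_finite:
  fixes A :: "real^2^2^'n"
  assumes m: "prob_space m" and sets_m: "sets m = sets seq_space" and q: "0 < q"
    and fin: "AE \<omega> in m. potential q m A v \<omega> < \<infinity>"
  shows "hausdorff_measure q (range (natural_proj A v)) \<noteq> 0"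
proof -
  interpret prob_space m by (rule m)
  have space_m: "space m = UNIV" using sets_eq_imp_space_eq[OF sets_m] by simp
  define g where "g = natural_proj A v"
  have g [measurable]: "g \<in> borel_measurable m"
    unfolding g_def measurable_cong_sets[OF sets_m refl] by (rule measurable_natural_proj)
  have pot [measurable]: "potential q m A v \<in> borel_measurable m"
    by (rule measurable_potential[OF _ sets_m, where f = "\<lambda>_. A" and u = "\<lambda>_. v" and g = "\<lambda>\<omega>. \<omega>"]) (auto intro: sigma_finite_measure_axioms)
  define G where "G N = {\<omega> \<in> space m. potential q m A v \<omega> \<le> ennreal (real (Suc N))}" for N
  have G [measurable]: "G N \<in> sets m" for N unfolding G_def by measurable
  have "\<exists>N. emeasure m (G N) \<noteq> 0"
  proof (rule ccontr)
    assume "\<nexists>N. emeasure m (G N) \<noteq> 0"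
    then have "AE \<omega> in m. \<forall>N. \<omega> \<notin> G N"
      unfolding AE_all_countable by (intro allI AE_not_in) (auto simp: null_sets_def)
    with fin have "AE \<omega> in m. False"
    proof eventually_elim
      case (elim \<omega>)
      then obtain k where k: "potential q m A v \<omega> = ennreal k" "0 \<le> k" by (cases "potential q m A v \<omega>") auto
      obtain N :: nat where "k \<le> real N" using real_arch_simple by blast
      then have "k \<le> real (Suc N)" by simp
      then have "\<omega> \<in> G N" using k by (simp add: G_def space_m ennreal_leI del: of_nat_Suc)
      then show ?case using elim by blast
    qed
    then show False by simp
  qed
  then obtain N where N: "emeasure m (G N) \<noteq> 0" by blast
  have cover: "emeasure m (G N) \<le> ennreal (real (Suc N)) * (\<Sum>k. diam_pow q (U k))"
    if U: "range g \<subseteq> (\<Union>k. U k)" "\<And>k. bounded (U k)" for U :: "nat \<Rightarrow> (real^2) set"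
  proof -
    \<comment> \<open>The ball estimate holds only at points coded in \<open>G N\<close>, and
      covering sets need not be measurable; each is replaced by a ball about such a point, with its
      diameter as radius.\<close>
    define W where "W k = (if \<exists>\<omega>\<in>G N. g \<omega> \<in> U k then g -` cball (g (SOME \<omega>. \<omega> \<in> G N \<and> g \<omega> \<in> U k)) (diameter (U k)) \<inter> space m else {})" for k
    have W [measurable]: "W k \<in> sets m" for k unfolding W_def by (auto intro: measurable_sets[OF g])
    have W_le: "emeasure m (W k) \<le> ennreal (real (Suc N)) * diam_pow q (U k)" for k
    proof (cases "\<exists>\<omega>\<in>G N. g \<omega> \<in> U k")
      case True
      define \<omega> where "\<omega> = (SOME \<omega>. \<omega> \<in> G N \<and> g \<omega> \<in> U k)"
      have \<omega>: "\<omega> \<in> G N" "g \<omega> \<in> U k" using someI_ex[of "\<lambda>\<omega>. \<omega> \<in> G N \<and> g \<omega> \<in> U k"] True unfolding \<omega>_def by blast+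
      have "emeasure m (W k) \<le> ennreal (real (Suc N) * diameter (U k) powr q)"
        unfolding W_def \<omega>_def[symmetric] using True
        by (simp del: of_nat_Suc, intro potential_ball_bound[OF g q diameter_ge_0[OF U(2)]])
          (use \<omega>(1) in \<open>auto simp: G_def potential_def g_def simp del: of_nat_Suc\<close>)
      also have "\<dots> = ennreal (real (Suc N)) * diam_pow q (U k)"
        using q \<omega>(2) by (auto simp: diam_pow_def ennreal_mult simp del: of_nat_Suc)
      finally show ?thesis .
    qed (simp add: W_def)
    have "G N \<subseteq> (\<Union>k. W k)"
    proof
      fix \<omega> assume \<omega>: "\<omega> \<in> G N"
      then obtain k where k: "g \<omega> \<in> U k" using U(1) by blast
      define \<omega>' where "\<omega>' = (SOME \<omega>. \<omega> \<in> G N \<and> g \<omega> \<in> U k)"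
      have \<omega>': "g \<omega>' \<in> U k" using someI_ex[of "\<lambda>\<omega>. \<omega> \<in> G N \<and> g \<omega> \<in> U k"] \<omega> k unfolding \<omega>'_def by blast
      have "dist (g \<omega>') (g \<omega>) \<le> diameter (U k)" by (rule diameter_bounded_bound[OF U(2) \<omega>' k])
      then have "\<omega> \<in> W k" unfolding W_def \<omega>'_def[symmetric] using \<omega> k by (auto simp: space_m)
      then show "\<omega> \<in> (\<Union>k. W k)" by blast
    qed
    then have "emeasure m (G N) \<le> emeasure m (\<Union>k. W k)" by (intro emeasure_mono) auto
    also have "\<dots> \<le> (\<Sum>k. emeasure m (W k))" by (intro emeasure_subadditive_countably) auto
    also have "\<dots> \<le> (\<Sum>k. ennreal (real (Suc N)) * diam_pow q (U k))" by (intro suminf_le W_le) auto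
    also have "\<dots> = ennreal (real (Suc N)) * (\<Sum>k. diam_pow q (U k))" by (rule ennreal_suminf_cmult)
    finally show ?thesis .
  qed
  have "emeasure m (G N) \<le> ennreal (real (Suc N)) * hausdorff_premeasure q 1 (range g)"
  proof -
    have "emeasure m (G N) / ennreal (real (Suc N)) \<le> hausdorff_premeasure q 1 (range g)"
      unfolding hausdorff_premeasure_def
    proof (rule INF_greatest)
      fix U assume "U \<in> {U :: nat \<Rightarrow> (real^2) set. range g \<subseteq> (\<Union>k. U k) \<and> (\<forall>k. bounded (U k) \<and> diameter (U k) \<le> 1)}"
      then have "emeasure m (G N) \<le> ennreal (real (Suc N)) * (\<Sum>k. diam_pow q (U k))" by (intro cover) auto
      then show "emeasure m (G N) / ennreal (real (Suc N)) \<le> (\<Sum>k. diam_pow q (U k))"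
        by (intro divide_le_posI_ennreal) (auto simp: mult.commute simp del: of_nat_Suc)
    qed
    then have "ennreal (real (Suc N)) * (emeasure m (G N) / ennreal (real (Suc N))) \<le> ennreal (real (Suc N)) * hausdorff_premeasure q 1 (range g)"
      by (rule mult_left_mono) simp
    moreover have "ennreal (real (Suc N)) * (emeasure m (G N) / ennreal (real (Suc N))) = emeasure m (G N)"
      by (subst ennreal_times_divide, subst mult.commute, rule mult_divide_eq_ennreal) auto
    ultimately show ?thesis by simp
  qed
  then have "hausdorff_premeasure q 1 (range g) \<noteq> 0" using N by auto
  moreover have "hausdorff_premeasure q 1 (range g) \<le> hausdorff_measure q (range g)"
    unfolding hausdorff_measure_def by (rule SUP_upper) simp
  ultimately show ?thesis unfolding g_def by auto
qed

lemma local_dim_lower_if_potential_finite: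
  fixes A :: "real^2^2^'n"
  assumes m: "prob_space m" and sets_m: "sets m = sets seq_space" and q: "0 < q"
    and fin: "AE \<omega> in m. potential q m A v \<omega> < \<infinity>"
  shows "AE x in distr m borel (natural_proj A v). \<exists>K. \<forall>\<rho>>0. measure (distr m borel (natural_proj A v)) (cball x \<rho>) \<le> K * \<rho> powr q"
proof -
  interpret prob_space m by (rule m)
  define g where "g = natural_proj A v"
  have g [measurable]: "g \<in> borel_measurable m"
    unfolding g_def measurable_cong_sets[OF sets_m refl] by (rule measurable_natural_proj)
  define h where "h x = (\<integral>\<^sup>+\<omega>'. pker q (norm (x - g \<omega>')) \<partial>m)" for x
  have "(\<lambda>(x, \<omega>'). pker q (norm (x - g \<omega>'))) \<in> borel_measurable (borel \<Otimes>\<^sub>M m)" by measurable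
  then have h [measurable]: "h \<in> borel_measurable borel" unfolding h_def[abs_def] by (rule borel_measurable_nn_integral)
  have "AE \<omega> in m. h (g \<omega>) < \<infinity>" using fin unfolding potential_def h_def g_def .
  then have "AE x in distr m borel g. h x < \<infinity>" by (subst AE_distr_iff) auto
  then show ?thesis unfolding g_def[symmetric]
  proof eventually_elim
    case (elim x)
    then obtain K where K: "h x = ennreal K" "0 \<le> K" by (cases "h x") auto
    have "measure (distr m borel g) (cball x \<rho>) \<le> K * \<rho> powr q" if "0 < \<rho>" for \<rho>
    proof -
      have "emeasure m (g -` cball x \<rho> \<inter> space m) \<le> ennreal (K * \<rho> powr q)"
        by (rule potential_ball_bound[OF g q _ K(2)]) (use that K h_def in auto)
      then have "emeasure (distr m borel g) (cball x \<rho>) \<le> ennreal (K * \<rho> powr q)" by (subst emeasure_distr) auto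
      then show ?thesis unfolding measure_def using K(2) by (intro enn2real_leI) auto
    qed
    then show ?case by blast
  qed
qed


section \<open>Conjugation\<close>

definition mat2_inv :: "real^2^2 \<Rightarrow> real^2^2"
  where "mat2_inv U = (1 / det U) *\<^sub>R vector [vector [U $ 2 $ 2, - U $ 1 $ 2], vector [- U $ 2 $ 1, U $ 1 $ 1]]"

lemma mat2_inv:
  assumes "det U \<noteq> 0"
  shows "mat2_inv U ** U = mat 1" "U ** mat2_inv U = mat 1"
  using assms
  by (simp_all add: mat2_inv_def vec_eq_iff forall_2 matrix_matrix_mult_def sum_2 mat_def det_2 divide_simps)

definition conj_tuple :: "real^2^2 \<Rightarrow> real^2^2^'n \<Rightarrow> real^2^2^'n"
  where "conj_tuple U A = (\<chi> i. mat2_inv U ** A $ i ** U)"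

lemma word_matrix_conj_tuple:
  assumes "det U \<noteq> 0"
  shows "word_matrix (conj_tuple U A) w = mat2_inv U ** word_matrix A w ** U"
proof (induction w)
  case (Cons i w)
  have "mat2_inv U ** A $ i ** U ** (mat2_inv U ** word_matrix A w ** U)
      = mat2_inv U ** A $ i ** (U ** mat2_inv U) ** word_matrix A w ** U"
    by (simp only: matrix_mul_assoc)
  then show ?case using Cons by (simp add: conj_tuple_def mat2_inv[OF assms] matrix_mul_assoc)
qed (simp add: mat2_inv[OF assms])

lemma natural_proj_conj_tuple:
  assumes U: "det U \<noteq> 0" and A: "contracting_tuple A r"
  shows "natural_proj (conj_tuple U A) v \<omega> = mat2_inv U *v natural_proj A (\<chi> i. U *v (v $ i)) \<omega>"
proof -
  interpret contracting_tuple A r by fact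
  have "natural_proj (conj_tuple U A) v \<omega> = (\<Sum>k. mat2_inv U *v (word_matrix A (prefix_word \<omega> k) *v (\<chi> i. U *v (v $ i)) $ \<omega> k))"
    unfolding natural_proj_def word_matrix_conj_tuple[OF U] by (simp add: matrix_vector_mul_assoc[symmetric])
  also have "\<dots> = mat2_inv U *v natural_proj A (\<chi> i. U *v (v $ i)) \<omega>"
    unfolding natural_proj_def
    by (rule bounded_linear.suminf[OF matrix_vector_mul_bounded_linear summable_natural_proj, symmetric])
  finally show ?thesis .
qed

text \<open>The projection changes by the linear map \<open>mat2_inv U\<close>, which shrinks no
  distance by more than the factor \<open>1 / op_norm U\<close>.\<close>

lemma potential_conj_tuple:
  assumes U: "det U \<noteq> 0" and A: "contracting_tuple A r" and q: "0 < q" and m: "sets m = sets seq_space"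
    and fin: "potential q m A (\<chi> i. U *v (v $ i)) \<omega> < \<infinity>"
  shows "potential q m (conj_tuple U A) v \<omega> < \<infinity>"
proof -
  define k where "k = op_norm U"
  have k: "0 < k" unfolding k_def using U by (rule det_nonzero_op_norm_pos)
  have le: "pker q (norm (mat2_inv U *v x)) \<le> ennreal (k powr q) * pker q (norm x)" for x
  proof (cases "x = 0")
    case True
    then show ?thesis using k by (simp add: pker_def ennreal_mult_top)
  next
    case False
    have "norm x = norm (U *v (mat2_inv U *v x))" by (simp add: matrix_vector_mul_assoc mat2_inv[OF U])
    also have "\<dots> \<le> k * norm (mat2_inv U *v x)" unfolding k_def by (rule op_norm_ge)
    finally have 1: "norm x / k \<le> norm (mat2_inv U *v x)" using k by (simp add: field_simps)
    have "pker q (norm (mat2_inv U *v x)) \<le> pker q (norm x / k)" using k 1 by (intro pker_antimono q) auto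
    also have "\<dots> = ennreal (k powr q) * pker q (norm x)"
      using k False by (simp add: pker_def ennreal_mult[symmetric] powr_divide powr_minus field_simps)
    finally show ?thesis .
  qed
  let ?u = "\<chi> i. U *v (v $ i)"
  have meas: "(\<lambda>\<omega>'. pker q (norm (natural_proj A ?u \<omega> - natural_proj A ?u \<omega>'))) \<in> borel_measurable m"
  proof -
    have [measurable]: "natural_proj A ?u \<in> borel_measurable m"
      unfolding measurable_cong_sets[OF m refl] by (rule measurable_natural_proj)
    show ?thesis by measurable
  qed
  have "potential q m (conj_tuple U A) v \<omega> \<le> (\<integral>\<^sup>+\<omega>'. ennreal (k powr q) * pker q (norm (natural_proj A ?u \<omega> - natural_proj A ?u \<omega>')) \<partial>m)"
    unfolding potential_def natural_proj_conj_tuple[OF U A] matrix_vector_mult_diff_distrib[symmetric]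
    by (intro nn_integral_mono le)
  also have "\<dots> = ennreal (k powr q) * potential q m A ?u \<omega>"
    unfolding potential_def by (rule nn_integral_cmult[OF meas])
  also have "\<dots> < \<infinity>" using fin by (simp add: ennreal_mult_less_top)
  finally show ?thesis .
qed


section \<open>A Frostman measure on the symbolic space\<close>

text \<open>A letter is drawn independently at every node of the tree of words; following the drawn
  letters from the root gives a random sequence with the prescribed transition probabilities.\<close>

primrec walk :: "('n list \<Rightarrow> 'n) \<Rightarrow> nat \<Rightarrow> 'n list"
  where "walk \<xi> 0 = []" | "walk \<xi> (Suc n) = walk \<xi> n @ [\<xi> (walk \<xi> n)]"

lemma prefix_word_walk: "prefix_word (\<lambda>k. \<xi> (walk \<xi> k)) n = walk \<xi> n"
  by (induction n) (simp_all add: prefix_word_Suc)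

lemma walk_eq_iff: "walk \<xi> (length w) = w \<longleftrightarrow> (\<forall>k<length w. \<xi> (take k w) = w ! k)"
proof (induction w rule: rev_induct)
  case (snoc i w)
  have "(\<forall>k<length w. \<xi> (take k (w @ [i])) = (w @ [i]) ! k) \<longleftrightarrow> (\<forall>k<length w. \<xi> (take k w) = w ! k)"
    by (auto simp: nth_append)
  then show ?case using snoc by (auto simp: less_Suc_eq)
qed simp

lemma markov_measure_exists:
  fixes t :: "'n::finite list \<Rightarrow> 'n \<Rightarrow> real"
  assumes t_nonneg: "\<And>w i. 0 \<le> t w i" and t_sum: "\<And>w. (\<Sum>i\<in>UNIV. t w i) = 1"
  obtains m where "prob_space m" "sets m = sets seq_space"
    "\<And>w. measure m (cyl w) = (\<Prod>k<length w. t (take k w) (w ! k))"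
proof -
  let ?M = "\<lambda>w :: 'n list. point_measure UNIV (\<lambda>i. ennreal (t w i))"
  have pM: "prob_space (?M w)" for w
    using t_nonneg t_sum[of w] by (intro prob_space_point_measure) (auto simp: sum_ennreal)
  define P where "P = PiM UNIV ?M"
  interpret P: prob_space P unfolding P_def by (intro prob_space_PiM pM)
  have coord: "(\<lambda>\<xi>. \<xi> w) \<in> measurable P (count_space UNIV)" for w
    unfolding P_def by (rule measurable_compose[OF measurable_component_singleton[of w UNIV ?M]]) auto
  have walk_meas: "(\<lambda>\<xi>. walk \<xi> n) \<in> measurable P (count_space UNIV)" for n
  proof (induction n)
    case (Suc n)
    have "(\<lambda>\<xi>. (\<lambda>w \<xi>. w @ [\<xi> w]) (walk \<xi> n) \<xi>) \<in> measurable P (count_space UNIV)"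
      by (rule measurable_compose_countable[OF _ Suc]) (rule measurable_compose[OF coord], simp)
    then show ?case by simp
  qed simp
  have next_meas: "(\<lambda>\<xi>. \<xi> (walk \<xi> n)) \<in> measurable P (count_space UNIV)" for n
    by (rule measurable_compose_countable[OF coord walk_meas])
  define X where "X \<xi> = (\<lambda>k. \<xi> (walk \<xi> k))" for \<xi> :: "'n list \<Rightarrow> 'n"
  have X [measurable]: "X \<in> measurable P seq_space"
    unfolding X_def[abs_def] by (rule measurable_PiM_single') (auto intro: next_meas)
  define m where "m = distr P seq_space X"
  have "measure m (cyl w) = (\<Prod>k<length w. t (take k w) (w ! k))" for w
  proof -
    let ?J = "(\<lambda>k. take k w) ` {..<length w}"
    have inj: "inj_on (\<lambda>k. take k w) {..<length w}"
      by (rule inj_onI) (metis length_take lessThan_iff min.absorb4)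
    \<comment> \<open>Following \<open>w\<close> means that the nodes \<open>take k w\<close>, which
      are distinct, carry the letters of \<open>w\<close>; these are independent events.\<close>
    have "X -` cyl w \<inter> space P = prod_emb UNIV ?M ?J (\<Pi>\<^sub>E u\<in>?J. {w ! length u})"
      by (rule set_eqI) (auto simp: X_def cyl_def prefix_word_walk walk_eq_iff prod_emb_def P_def space_PiM
          space_point_measure restrict_PiE_iff PiE_UNIV_domain Pi_iff)
    then have "emeasure m (cyl w) = (\<Prod>u\<in>?J. emeasure (?M u) {w ! length u})"
      unfolding m_def by (simp add: emeasure_distr) (simp add: P_def emeasure_PiM_emb pM sets_point_measure)
    also have "\<dots> = (\<Prod>u\<in>?J. ennreal (t u (w ! length u)))"
      by (simp add: emeasure_point_measure_finite)
    also have "\<dots> = (\<Prod>k<length w. ennreal (t (take k w) (w ! k)))"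
      by (subst prod.reindex[OF inj]) (simp add: min.absorb4)
    also have "\<dots> = ennreal (\<Prod>k<length w. t (take k w) (w ! k))" by (intro prod_ennreal t_nonneg)
    finally show ?thesis by (simp add: measure_def prod_nonneg t_nonneg)
  qed
  moreover have "prob_space m" unfolding m_def by (rule P.prob_space_distr) measurable
  moreover have "sets m = sets seq_space" by (simp add: m_def)
  ultimately show ?thesis using that by blast
qed

context contracting_tuple
begin

text \<open>\<open>net s d w\<close> is the least \<open>\<phi>\<^sup>s\<close>-weight of a section of the tree below \<open>w\<close> of relative height at most \<open>d\<close>.\<close>

primrec net :: "real \<Rightarrow> nat \<Rightarrow> 'n list \<Rightarrow> real" where
  "net s 0 w = phi s (word_matrix A w)"
| "net s (Suc d) w = min (phi s (word_matrix A w)) (\<Sum>i\<in>UNIV. net s d (w @ [i]))"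

lemma net_nonneg: "0 \<le> net s d w"
  by (induction d arbitrary: w) (auto simp: phi_pos less_imp_le intro: sum_nonneg)

lemma net_le_phi: "net s d w \<le> phi s (word_matrix A w)"
  by (cases d) auto

lemma net_decreasing: "net s (Suc d) w \<le> net s d w"
proof (induction d arbitrary: w)
  case (Suc d)
  have "(\<Sum>i\<in>UNIV. net s (Suc d) (w @ [i])) \<le> (\<Sum>i\<in>UNIV. net s d (w @ [i]))" by (intro sum_mono Suc)
  then show ?case by (simp only: net.simps(2)[of s "Suc d"] net.simps(2)[of s d])
qed simp

text \<open>If some section had weight below 1, then splitting long words along it and using
  submultiplicativity would bound all partition sums by those of short words, so the pressure could
  not be positive.\<close>

lemma net_root:
  assumes s: "0 \<le> s" "s \<le> 2" and P: "0 < pressure A s"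
  shows "net s d [] = 1"
proof (rule ccontr)
  have phi_mat1: "phi s (mat 1) = 1" by (simp add: phi_def op_norm_mat_1 sing2_mat_1)
  assume "net s d [] \<noteq> 1"
  then obtain e where e: "d = Suc e" "(\<Sum>i\<in>UNIV. net s e [i]) < 1"
    by (cases d) (auto simp: phi_mat1 min_def split: if_splits)
  define K where "K = (\<Sum>j\<le>d. Z s j)"
  have K0: "0 \<le> K" unfolding K_def using Z_pos by (intro sum_nonneg) (simp add: less_imp_le)
  have small: "Z s k \<le> K" if "k \<le> d" for k
    unfolding K_def by (rule member_le_sum) (use that Z_pos in \<open>auto simp: less_imp_le\<close>)
  have "Z s k \<le> K" for k
  proof (induction k rule: less_induct)
    case (less k)
    show ?case
    proof (cases "k \<le> d")
      case False
      define Y where "Y w l = (\<Sum>u\<in>{u. length u = l}. phi s (word_matrix A (w @ u)))" for w l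
      have Y_phi: "Y w (k - length w) \<le> K * phi s (word_matrix A w)" if "1 \<le> length w" for w
      proof -
        have "Y w (k - length w) \<le> (\<Sum>u\<in>{u. length u = k - length w}. phi s (word_matrix A w) * phi s (word_matrix A u))"
          unfolding Y_def word_matrix_append by (intro sum_mono phi_mult_le s) simp_all
        also have "\<dots> = phi s (word_matrix A w) * Z s (k - length w)" by (simp add: Z_def sum_distrib_left)
        also have "\<dots> \<le> phi s (word_matrix A w) * K"
          using phi_pos[OF det_word_nz, of s w] less[of "k - length w"] that False by (intro mult_left_mono) auto
        finally show ?thesis by (simp add: mult.commute)
      qed
      \<comment> \<open>Down the tree, each node is either kept, at the price \<open>Y_phi\<close>,
        or replaced by its children; \<open>net\<close> takes the cheaper option.\<close>
      have Y_net: "Y w (k - length w) \<le> K * net s d' w" if "1 \<le> length w" "length w + d' \<le> d" for w d'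
        using that
      proof (induction d' arbitrary: w)
        case 0
        then show ?case using Y_phi by simp
      next
        case (Suc d')
        have k: "k - length w = Suc (k - Suc (length w))" using Suc.prems False by simp
        have "Y w (k - length w) = (\<Sum>i\<in>UNIV. Y (w @ [i]) (k - length (w @ [i])))"
          unfolding Y_def k sum_words_Suc by simp
        also have "\<dots> \<le> (\<Sum>i\<in>UNIV. K * net s d' (w @ [i]))" by (intro sum_mono Suc.IH) (use Suc.prems in auto)
        finally have "Y w (k - length w) \<le> K * (\<Sum>i\<in>UNIV. net s d' (w @ [i]))" by (simp add: sum_distrib_left)
        then show ?case using Y_phi[OF Suc.prems(1)] by (simp add: min_def)
      qed
      have "Z s k = (\<Sum>i\<in>UNIV. Y [i] (k - length [i]))"
      proof -
        have "k = Suc (k - 1)" using False by simp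
        then show ?thesis unfolding Z_def Y_def using sum_words_Suc[of "\<lambda>w. phi s (word_matrix A w)" "k - 1"] by simp
      qed
      also have "\<dots> \<le> (\<Sum>i\<in>UNIV. K * net s e [i])" by (intro sum_mono Y_net) (auto simp: e)
      also have "\<dots> = K * (\<Sum>i\<in>UNIV. net s e [i])" by (simp add: sum_distrib_left)
      also have "\<dots> \<le> K" using e(2) K0 by (simp add: mult_left_le)
      finally show ?thesis .
    qed (rule small)
  qed
  then have "ln (Z s n) / real n \<le> ln K / real n" for n using Z_pos by (intro divide_right_mono ln_mono) auto
  moreover have "(\<lambda>n. ln K / real n) \<longlonglongrightarrow> 0" by (rule lim_const_over_n)
  ultimately have "pressure A s \<le> 0" using LIMSEQ_le[OF pressure_LIMSEQ(1)[OF s]] by blast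
  then show False using P by simp
qed

text \<open>The limit \<open>F\<close> of the nets is at most \<open>phi\<close>, equals 1 at the
  root and is at most the sum over the children. Distributing mass in proportion to \<open>F\<close>
  therefore never puts more than \<open>F w\<close> on a cylinder.\<close>

lemma frostman:
  assumes s: "0 \<le> s" "s \<le> 2" and P: "0 < pressure A s"
  obtains m where "prob_space m" "sets m = sets seq_space" "\<And>w. measure m (cyl w) \<le> phi s (word_matrix A w)"
proof -
  have "\<exists>l. (\<lambda>d. net s d w) \<longlonglongrightarrow> l" for w
  proof -
    have "decseq (\<lambda>d. net s d w)" by (rule decseq_SucI) (rule net_decreasing)
    then show ?thesis using decseq_convergent[of "\<lambda>d. net s d w" 0] net_nonneg by metis
  qed
  then obtain F where F: "\<And>w. (\<lambda>d. net s d w) \<longlonglongrightarrow> F w" by metis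
  have F_nonneg: "0 \<le> F w" for w by (rule LIMSEQ_le_const[OF F]) (use net_nonneg in blast)
  have F_le_phi: "F w \<le> phi s (word_matrix A w)" for w by (rule LIMSEQ_le_const2[OF F]) (use net_le_phi in blast)
  define S where "S w = (\<Sum>i\<in>UNIV. F (w @ [i]))" for w
  have S_nonneg: "0 \<le> S w" for w unfolding S_def by (intro sum_nonneg F_nonneg)
  have F_le_S: "F w \<le> S w" for w
  proof (rule LIMSEQ_le)
    show "(\<lambda>d. net s (Suc d) w) \<longlonglongrightarrow> F w" by (rule LIMSEQ_Suc[OF F])
    show "(\<lambda>d. \<Sum>i\<in>UNIV. net s d (w @ [i])) \<longlonglongrightarrow> S w" unfolding S_def by (intro tendsto_sum F)
  qed auto
  have F_root: "F [] = 1"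
    using F[of "[]"] unfolding net_root[OF assms] by (simp add: LIMSEQ_const_iff)
  \<comment> \<open>If all children have \<open>F\<close> equal to 0, so does the node itself and it
    carries no mass; any transition probabilities will do.\<close>
  define t where "t w i = (if S w = 0 then (if i = undefined then 1 else 0) else F (w @ [i]) / S w)" for w and i :: 'n
  have t_nonneg: "0 \<le> t w i" for w i unfolding t_def using F_nonneg S_nonneg by simp
  have t_sum: "(\<Sum>i\<in>UNIV. t w i) = 1" for w
    unfolding t_def by (cases "S w = 0") (simp_all add: sum_divide_distrib[symmetric] S_def[symmetric])
  obtain m where m: "prob_space m" "sets m = sets seq_space"
    "\<And>w. measure m (cyl w) = (\<Prod>k<length w. t (take k w) (w ! k))"
    using markov_measure_exists[of t, OF t_nonneg t_sum] by blast
  have "measure m (cyl w) \<le> F w" for w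
  proof (induction w rule: rev_induct)
    case Nil
    then show ?case by (simp add: m(3) F_root)
  next
    case (snoc i w)
    have "measure m (cyl (w @ [i])) = measure m (cyl w) * t w i"
      by (simp add: m(3) nth_append)
    also have "\<dots> \<le> F w * t w i" by (intro mult_right_mono snoc t_nonneg)
    also have "\<dots> \<le> F (w @ [i])"
    proof (cases "S w = 0")
      case True
      then have "F w = 0" using F_le_S[of w] F_nonneg[of w] by simp
      then show ?thesis using F_nonneg by simp
    next
      case False
      then have "F w * F (w @ [i]) \<le> S w * F (w @ [i])" by (intro mult_right_mono F_le_S F_nonneg)
      then show ?thesis using False S_nonneg[of w] by (simp add: t_def pos_divide_le_eq mult.commute)
    qed
    finally show ?case .
  qed
  then have "measure m (cyl w) \<le> phi s (word_matrix A w)" for w using F_le_phi[of w] by (rule order_trans)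
  with m that show ?thesis by blast
qed

end


section \<open>Lower bounds for almost every conjugate\<close>

context transversal_tuple
begin

lemma rad_pos:
  assumes "CARD('n) \<ge> 2" shows "0 < rad v"
proof (rule ccontr)
  assume "\<not> 0 < rad v"
  then have "rad v = 0" using rad_nonneg[of v] by simp
  then have "max_vec_norm v = 0" using r_less by (simp add: rad_def)
  then have v: "v $ i = 0" for i using norm_le_max_vec_norm[of v i] by simp
  obtain i j :: 'n where "i \<noteq> j" using assms by (metis card_2_iff' card_le_Suc_iff ex_card finite UNIV_I)
  then show False using sep[of i j] v \<open>rad v = 0\<close> by simp
qed

text \<open>Area count: the first-level images of the invariant ball lie in that ball, and the
  separation, with \<open>sqrt 2 / 2\<close> below 1, makes them disjoint.\<close>

lemma sum_det_le_1:
  assumes N: "CARD('n) \<ge> 2" shows "(\<Sum>i\<in>UNIV. \<bar>det (A $ i)\<bar>) \<le> 1"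
proof -
  define R where "R = rad v"
  have R: "0 < R" unfolding R_def by (rule rad_pos[OF N])
  define B where "B = cball (0 :: real^2) R"
  define f where "f i x = v $ i + A $ i *v x" for i x
  have f_meas: "f i ` B \<in> lmeasurable" and f_measure: "measure lebesgue (f i ` B) = \<bar>det (A $ i)\<bar> * measure lebesgue B" for i
  proof -
    have e: "f i ` B = (+) (v $ i) ` ((\<lambda>x. A $ i *v x) ` B)" by (auto simp: f_def)
    have l: "(\<lambda>x. A $ i *v x) ` B \<in> lmeasurable" "measure lebesgue ((\<lambda>x. A $ i *v x) ` B) = \<bar>det (A $ i)\<bar> * measure lebesgue B"
      using measurable_linear_image[of "\<lambda>x. A $ i *v x" B] measure_linear_image[of "\<lambda>x. A $ i *v x" B] by (simp_all add: B_def)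
    show "f i ` B \<in> lmeasurable" unfolding e by (rule measurable_translation[OF l(1)])
    show "measure lebesgue (f i ` B) = \<bar>det (A $ i)\<bar> * measure lebesgue B" unfolding e measure_translation l(2) ..
  qed
  have sub: "f i ` B \<subseteq> B" for i
  proof
    fix y assume "y \<in> f i ` B"
    then obtain x where x: "norm x \<le> R" "y = f i x" by (auto simp: B_def)
    have "norm y \<le> norm (v $ i) + norm (A $ i *v x)" unfolding x(2) f_def by (rule norm_triangle_ineq)
    also have "\<dots> \<le> max_vec_norm v + r * R"
      using norm_le_max_vec_norm[of v i] op_norm_ge[of "A $ i" x] mult_mono[OF op_norm_le_r[of i] x(1)] r_pos by fastforce
    also have "\<dots> = R" unfolding R_def rad_def using r_less by (simp add: field_simps)
    finally show "y \<in> B" by (simp add: B_def)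
  qed
  have disj: "disjoint_family (\<lambda>i. f i ` B)"
    unfolding disjoint_family_on_def
  proof (intro ballI impI)
    fix i j :: 'n assume ij: "i \<noteq> j"
    show "f i ` B \<inter> f j ` B = {}"
    proof (rule ccontr)
      assume "f i ` B \<inter> f j ` B \<noteq> {}"
      then obtain x y where xy: "norm x \<le> R" "norm y \<le> R" "f i x = f j y" unfolding B_def by fastforce
      have e: "v $ i - v $ j = A $ j *v y - A $ i *v x" using xy(3) by (simp add: f_def algebra_simps)
      have "norm (v $ i - v $ j) \<le> norm (A $ j *v y) + norm (A $ i *v x)" unfolding e by (rule norm_triangle_ineq4)
      also have "\<dots> \<le> op_norm (A $ j) * R + op_norm (A $ i) * R"
        using op_norm_ge[of "A $ j" y] op_norm_ge[of "A $ i" x] mult_left_mono[OF xy(2) op_norm_nonneg[of "A $ j"]]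
          mult_left_mono[OF xy(1) op_norm_nonneg[of "A $ i"]] by linarith
      also have "\<dots> < sqrt 2 / 2 * norm (v $ i - v $ j)" using sep[OF ij] unfolding R_def by (simp add: algebra_simps)
      also have "\<dots> \<le> 1 * norm (v $ i - v $ j)" using sqrt2_less_2 by (intro mult_right_mono) auto
      finally show False by simp
    qed
  qed
  have "(\<Sum>i\<in>UNIV. \<bar>det (A $ i)\<bar>) * measure lebesgue B = (\<Sum>i\<in>UNIV. measure lebesgue (f i ` B))"
    by (simp add: f_measure sum_distrib_right)
  also have "\<dots> = measure lebesgue (\<Union>i. f i ` B)"
    by (rule measure_finite_Union[symmetric]) (use disj fmeasurableD[OF f_meas] fmeasurableD2[OF f_meas] in auto)
  also have "\<dots> \<le> measure lebesgue B"
    by (rule measure_mono_fmeasurable) (use sub f_meas in \<open>auto simp: B_def fmeasurableD\<close>)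
  finally have "(\<Sum>i\<in>UNIV. \<bar>det (A $ i)\<bar>) * measure lebesgue B \<le> 1 * measure lebesgue B" by simp
  moreover have "0 < measure lebesgue B" unfolding B_def using R by (simp add: content_cball_pos)
  ultimately show ?thesis by (simp only: mult_le_cancel_right_pos)
qed

text \<open>An exponent \<open>t\<close> is inserted between \<open>q'\<close> and \<open>q\<close>:
  the gap from \<open>q\<close> to \<open>t\<close> makes the energy of the Frostman measure
  geometric at every sequence, the gap from \<open>t\<close> to \<open>q'\<close> is the margin for
  transversality.\<close>

lemma AE_conj_hausdorff_measure:
  assumes q: "0 < q'" "q' < q" "q \<le> 2" and P: "0 < pressure A q"
  shows "AE u in lborel \<Otimes>\<^sub>M lborel. det (umat (fst u) (snd u)) \<noteq> 0 \<longrightarrow>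
    hausdorff_measure q' (range (natural_proj (conj_tuple (umat (fst u) (snd u)) A) v)) \<noteq> 0"
proof -
  obtain m where m: "prob_space m" "sets m = sets seq_space" "\<And>w. measure m (cyl w) \<le> phi q (word_matrix A w)"
    using frostman[of q] q P by auto
  define t where "t = (q' + q) / 2"
  have t: "q' < t" "t < q" using q unfolding t_def by auto
  have term_le: "measure m (cyl (prefix_word \<omega> n)) / phi t (word_matrix A (prefix_word \<omega> n)) \<le> (r powr (q - t)) ^ n" for \<omega> n
  proof -
    define M where "M = word_matrix A (prefix_word \<omega> n)"
    have p: "0 < phi t M" unfolding M_def by (rule phi_pos) simp
    have "measure m (cyl (prefix_word \<omega> n)) \<le> phi q M" unfolding M_def by (rule m(3))
    also have "\<dots> \<le> phi t M * op_norm M powr (q - t)"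
      using phi_add_bounds(1)[of M "q - t" t] t unfolding M_def by simp
    also have "\<dots> \<le> phi t M * (r powr (q - t)) ^ n"
    proof (rule mult_left_mono)
      have "op_norm M powr (q - t) \<le> (r ^ n) powr (q - t)"
        using op_norm_word_le[of "prefix_word \<omega> n"] t op_norm_nonneg unfolding M_def by (intro powr_mono2) auto
      also have "\<dots> = (r powr (q - t)) ^ n" using r_pos by (simp add: powr_realpow[symmetric] powr_powr mult.commute)
      finally show "op_norm M powr (q - t) \<le> (r powr (q - t)) ^ n" .
    qed (use p in simp)
    finally show ?thesis using p unfolding M_def by (simp add: divide_le_eq mult.commute)
  qed
  have "r powr (q - t) < 1" using powr_less_mono'[of r 0 "q - t"] r_pos r_less t by simp
  then have sm: "summable (\<lambda>n. (r powr (q - t)) ^ n)" by (intro summable_geometric) simp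
  have "(\<Sum>n. ennreal (measure m (cyl (prefix_word \<omega> n)) / phi t (word_matrix A (prefix_word \<omega> n)))) < \<infinity>" for \<omega>
  proof -
    have "(\<Sum>n. ennreal (measure m (cyl (prefix_word \<omega> n)) / phi t (word_matrix A (prefix_word \<omega> n)))) \<le> (\<Sum>n. ennreal ((r powr (q - t)) ^ n))"
      by (intro suminf_le ennreal_leI term_le) auto
    also have "\<dots> = ennreal (\<Sum>n. (r powr (q - t)) ^ n)" by (rule suminf_ennreal2[OF _ sm]) simp
    also have "\<dots> < \<infinity>" by simp
    finally show ?thesis .
  qed
  then have "AE u in lborel \<Otimes>\<^sub>M lborel. AE \<omega> in m. potential q' m A (umat_vecs v u) \<omega> < \<infinity>"
    using q t by (intro AE_potential_finite[OF q(1) t(1) _ m(1,2)]) auto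
  then show ?thesis
  proof eventually_elim
    case (elim u)
    show ?case
    proof
      assume d: "det (umat (fst u) (snd u)) \<noteq> 0"
      have "AE \<omega> in m. potential q' m (conj_tuple (umat (fst u) (snd u)) A) v \<omega> < \<infinity>"
        using elim
        by eventually_elim (rule potential_conj_tuple[OF d contracting_tuple_axioms q(1) m(2)], simp add: umat_vecs_def)
      then show "hausdorff_measure q' (range (natural_proj (conj_tuple (umat (fst u) (snd u)) A) v)) \<noteq> 0"
        by (rule hausdorff_measure_pos_if_potential_finite[OF m(1,2) q(1)])
    qed
  qed
qed

text \<open>Along almost every sequence the terms of the energy series have an exponential rate,
  which is negative for any exponent \<open>t\<close> below the Lyapunov dimension.\<close>

lemma AE_conj_potential:
  fixes p :: "real^'n"
  assumes p: "prob_vector p" and q: "0 < q" "q < 2"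
    and q1: "q < shannon_entropy p / lyapunov_exp 1 A p"
    and q2: "q < 1 + (shannon_entropy p - lyapunov_exp 1 A p) / lyapunov_exp 2 A p"
  shows "AE u in lborel \<Otimes>\<^sub>M lborel. det (umat (fst u) (snd u)) \<noteq> 0 \<longrightarrow>
    (AE \<omega> in bernoulli_measure p. potential q (bernoulli_measure p) (conj_tuple (umat (fst u) (snd u)) A) v \<omega> < \<infinity>)"
proof -
  interpret prob_vector p by (rule p)
  interpret bernoulli_system A r p ..
  define h c1 c2 where "h = shannon_entropy p" and "c1 = lyapunov_exp 1 A p" and "c2 = lyapunov_exp 2 A p"
  have c: "0 < c1" "c1 \<le> c2" using lyapunov_1_pos lyapunov_1_le_2 by (auto simp: c1_def c2_def)
  have "q < min 2 (min (h / c1) (1 + (h - c1) / c2))" using q q1 q2 unfolding h_def c1_def c2_def by simp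
  then obtain t where "q < t" "t < min 2 (min (h / c1) (1 + (h - c1) / c2))" using dense by blast
  then have t: "q < t" "t < 2" "t < h / c1" "t < 1 + (h - c1) / c2" by simp_all
  \<comment> \<open>The rate of cylinder mass over \<open>phi t\<close>. Its sign for t \<le> 1 uses
    the first term of the minimum, otherwise the second.\<close>
  define e where "e = min t 1 * c1 + max (t - 1) 0 * c2 - h"
  have e: "e < 0"
  proof (cases "t \<le> 1")
    case True
    then show ?thesis using t(3) c unfolding e_def by (simp add: pos_less_divide_eq)
  next
    case False
    have "(t - 1) * c2 < h - c1" using t(4) c by (simp add: pos_less_divide_eq[symmetric])
    then show ?thesis using False unfolding e_def by simp
  qed
  have energy: "AE \<omega> in bernoulli_measure p. (\<Sum>n. ennreal (measure (bernoulli_measure p) (cyl (prefix_word \<omega> n)) / phi t (word_matrix A (prefix_word \<omega> n)))) < \<infinity>"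
    using entropy_AE lyapunov_1_AE lyapunov_2_AE
  proof eventually_elim
    case (elim \<omega>)
    define b where "b n = measure (bernoulli_measure p) (cyl (prefix_word \<omega> n)) / phi t (word_matrix A (prefix_word \<omega> n))" for n
    have b_pos: "0 < b n" for n
      unfolding b_def prob_cyl using prob_words_pos phi_pos[OF det_word_nz] by simp
    have "(\<lambda>n. ln (prod_list (map (($) p) (prefix_word \<omega> n))) / real n
        - (min t 1 * (ln (op_norm (word_matrix A (prefix_word \<omega> n))) / real n)
          + max (t - 1) 0 * (ln (sing2 (word_matrix A (prefix_word \<omega> n))) / real n)))
        \<longlonglongrightarrow> - h - (min t 1 * - c1 + max (t - 1) 0 * - c2)"
      unfolding h_def c1_def c2_def by (intro tendsto_diff tendsto_add tendsto_mult tendsto_const elim)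
    moreover have "ln (b n) / real n = ln (prod_list (map (($) p) (prefix_word \<omega> n))) / real n
        - (min t 1 * (ln (op_norm (word_matrix A (prefix_word \<omega> n))) / real n)
          + max (t - 1) 0 * (ln (sing2 (word_matrix A (prefix_word \<omega> n))) / real n))" for n
      unfolding b_def prob_cyl using prob_words_pos[of "prefix_word \<omega> n"] phi_pos[OF det_word_nz, of t "prefix_word \<omega> n"]
      by (simp add: ln_div ln_phi diff_divide_distrib add_divide_distrib)
    moreover have "- h - (min t 1 * - c1 + max (t - 1) 0 * - c2) = e" by (simp add: e_def)
    ultimately have "(\<lambda>n. ln (b n) / real n) \<longlonglongrightarrow> e" by simp
    then have "\<forall>\<^sub>F n in sequentially. ln (b n) / real n < e / 2" using e by (intro order_tendstoD) auto
    then have "\<forall>\<^sub>F n in sequentially. norm (b n) \<le> exp (e / 2) ^ n"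
      using eventually_gt_at_top[of 0]
    proof eventually_elim
      case (elim n)
      then have "ln (b n) \<le> real n * (e / 2)" by (simp add: field_simps)
      then have "b n \<le> exp (real n * (e / 2))" using b_pos by (intro le_exp_if_ln_le) auto
      then show ?case using b_pos[of n] by (simp add: exp_of_nat_mult[symmetric])
    qed
    then have "summable b" by (rule summable_comparison_test_ev) (use e in \<open>auto intro!: summable_geometric\<close>)
    then have "(\<Sum>n. ennreal (b n)) = ennreal (\<Sum>n. b n)" by (intro suminf_ennreal2) (use b_pos in \<open>auto simp: less_imp_le\<close>)
    then show ?case unfolding b_def by simp
  qed
  have "AE u in lborel \<Otimes>\<^sub>M lborel. AE \<omega> in bernoulli_measure p. potential q (bernoulli_measure p) A (umat_vecs v u) \<omega> < \<infinity>"
    using q t by (intro AE_potential_finite[OF q(1) t(1) _ prob_space_bernoulli sets_bernoulli energy]) auto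
  then show ?thesis
  proof eventually_elim
    case (elim u)
    show ?case
    proof
      assume d: "det (umat (fst u) (snd u)) \<noteq> 0"
      show "AE \<omega> in bernoulli_measure p. potential q (bernoulli_measure p) (conj_tuple (umat (fst u) (snd u)) A) v \<omega> < \<infinity>"
        using elim
        by eventually_elim (rule potential_conj_tuple[OF d contracting_tuple_axioms q(1) sets_bernoulli], simp add: umat_vecs_def)
    qed
  qed
qed

end


section \<open>Null sets of tuples via conjugation\<close>

text \<open>The factor 4 counts the matrix entries; all that matters is continuity of
  \<open>op_norm\<close>.\<close>

lemma op_norm_diff_le: "\<bar>op_norm A - op_norm B\<bar> \<le> 4 * norm (A - B :: real^2^2)"
proof -
  have tri: "op_norm (A + B) \<le> op_norm A + op_norm B" for A B :: "real^2^2"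
    unfolding op_norm_def matrix_vector_mult_add_rdistrib by (rule onorm_triangle) simp_all
  have small: "op_norm C \<le> 4 * norm C" for C :: "real^2^2"
  proof -
    have "\<bar>C $ i $ j\<bar> \<le> norm C" for i j
      using component_le_norm_cart[of "C $ i" j] Finite_Cartesian_Product.norm_nth_le[of C i] by (rule order_trans)
    then have "(\<Sum>i\<in>UNIV. \<Sum>j\<in>UNIV. \<bar>C $ i $ j\<bar>) \<le> (\<Sum>i\<in>(UNIV :: 2 set). \<Sum>j\<in>(UNIV :: 2 set). norm C)"
      by (intro sum_mono)
    then show ?thesis using onorm_le_matrix_component_sum[of C] unfolding op_norm_def by simp
  qed
  have "op_norm A \<le> op_norm (A - B) + op_norm B" "op_norm B \<le> op_norm (B - A) + op_norm A"
    using tri[of "A - B" B] tri[of "B - A" A] by simp_all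
  then show ?thesis using small[of "A - B"] small[of "B - A"] by (simp add: norm_minus_commute abs_le_iff)
qed

lemma continuous_on_op_norm [continuous_intros]:
  assumes "continuous_on S f" shows "continuous_on S (\<lambda>x. op_norm (f x :: real^2^2))"
proof -
  have "continuous_on UNIV (op_norm :: real^2^2 \<Rightarrow> real)"
  proof (rule continuous_onI)
    fix x :: "real^2^2" and e :: real assume "0 < e"
    have "dist (op_norm y) (op_norm x) \<le> e" if "dist y x < e / 4" for y
      using op_norm_diff_le[of y x] that by (simp add: dist_norm)
    then show "\<exists>d>0. \<forall>y\<in>UNIV. dist y x < d \<longrightarrow> dist (op_norm y) (op_norm x) \<le> e"
      using \<open>0 < e\<close> by (intro exI[of _ "e / 4"]) auto
  qed
  then show ?thesis using continuous_on_compose2[OF _ assms] by blast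
qed

lemma continuous_on_det2 [continuous_intros]:
  assumes "continuous_on S f" shows "continuous_on S (\<lambda>x. det (f x :: real^2^2))"
  unfolding det_2 by (intro continuous_intros assms)

lemma continuous_on_mult_mat2:
  fixes f g :: "'a::topological_space \<Rightarrow> real^2^2"
  assumes "continuous_on S f" "continuous_on S g"
  shows "continuous_on S (\<lambda>x. f x ** g x)"
proof -
  have "f x ** g x = (\<chi> j l. f x $ j $ 1 * g x $ 1 $ l + f x $ j $ 2 * g x $ 2 $ l)" for x
    by (simp add: matrix_matrix_mult_def sum_2)
  then show ?thesis using assms by (auto intro!: continuous_on_vec_lambda continuous_intros)
qed

lemma continuous_on_mat2_inv:
  assumes "continuous_on S f" "\<And>x. x \<in> S \<Longrightarrow> det (f x) \<noteq> 0"
  shows "continuous_on S (\<lambda>x. mat2_inv (f x))"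
proof -
  have "mat2_inv M = (\<chi> i j. (if i = 1 then (if j = 1 then M $ 2 $ 2 else - M $ 1 $ 2) else (if j = 1 then - M $ 2 $ 1 else M $ 1 $ 1)) / det M)" for M
    by (simp add: mat2_inv_def vec_eq_iff forall_2)
  moreover have "continuous_on S (\<lambda>x. (if i = 1 then (if j = 1 then f x $ 2 $ 2 else - f x $ 1 $ 2) else (if j = 1 then - f x $ 2 $ 1 else f x $ 1 $ 1)) / det (f x))" for i j :: 2
    using assms by (cases "i = 1"; cases "j = 1") (auto intro!: continuous_intros)
  ultimately show ?thesis by (auto intro!: continuous_on_vec_lambda)
qed

abbreviation umat2 :: "(real^2) \<times> (real^2) \<Rightarrow> real^2^2"
  where "umat2 u \<equiv> umat (fst u) (snd u)"

lemma continuous_on_umat2: "continuous_on S umat2"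
proof -
  have "umat2 u = (\<chi> i j. if j = 1 then fst u $ i else snd u $ i)" for u
    by (simp add: umat_def vec_eq_iff forall_2)
  moreover have "continuous_on S (\<lambda>u :: (real^2) \<times> (real^2). if j = 1 then fst u $ i else snd u $ i)" for i j :: 2
    by (cases "j = 1") (auto intro!: continuous_intros)
  ultimately show ?thesis by (auto intro!: continuous_on_vec_lambda)
qed

lemma conj_tuple_inverse:
  assumes "det U \<noteq> 0"
  shows "conj_tuple U (\<chi> i. U ** A $ i ** mat2_inv U) = A"
proof -
  have "mat2_inv U ** (U ** M ** mat2_inv U) ** U = (mat2_inv U ** U) ** M ** (mat2_inv U ** U)" for M
    by (simp only: matrix_mul_assoc)
  then show ?thesis by (simp add: conj_tuple_def mat2_inv[OF assms] vec_eq_iff)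
qed

lemma linear_conj_tuple: "linear (conj_tuple U)"
proof (rule linearI)
  show "conj_tuple U (A + B) = conj_tuple U A + conj_tuple U B" for A B
    by (simp add: conj_tuple_def vec_eq_iff matrix_matrix_mult_def sum_2 algebra_simps)
  show "conj_tuple U (c *\<^sub>R A) = c *\<^sub>R conj_tuple U A" for A c
    by (simp add: conj_tuple_def vec_eq_iff matrix_matrix_mult_def sum_2 algebra_simps)
qed

text \<open>Fubini gives \<open>U\<^sub>n\<close> tending to the identity such that, for each \<open>n\<close>, the conjugate by \<open>U\<^sub>n\<close> of
  almost every tuple in \<open>G\<close> lies outside \<open>B\<close>. Every tuple in \<open>B\<close> is for large \<open>n\<close> the conjugate by
  \<open>U\<^sub>n\<close> of a tuple in \<open>G\<close>, so \<open>B\<close> is covered by countably many linear images of null sets.\<close>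

lemma null_set_by_conjugation:
  fixes B G :: "(real^2^2^'n) set"
  assumes G: "open G" and B: "B \<in> sets borel" "B \<subseteq> G"
    and ae: "\<And>A. A \<in> G \<Longrightarrow> AE u in lborel \<Otimes>\<^sub>M lborel. det (umat2 u) \<noteq> 0 \<longrightarrow> conj_tuple (umat2 u) A \<notin> B"
  shows "B \<in> null_sets lborel"
proof -
  let ?U = "lborel \<Otimes>\<^sub>M lborel :: ((real^2) \<times> (real^2)) measure"
  interpret P: pair_sigma_finite "lborel :: (real^2^2^'n) measure" ?U ..
  define D where "D = {z :: (real^2^2^'n) \<times> ((real^2) \<times> (real^2)). det (umat2 (snd z)) \<noteq> 0}"
  have cdet: "continuous_on UNIV (\<lambda>u. det (umat2 u))" by (intro continuous_on_det2 continuous_on_umat2)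
  have D: "open D"
    unfolding D_def
    by (intro open_Collect_neq continuous_on_compose2[OF cdet] continuous_intros) auto
  \<comment> \<open>The value 0 outside the open set \<open>D\<close> makes \<open>F\<close> Borel
    everywhere; \<open>S\<close> keeps only points of \<open>D\<close>.\<close>
  define F where "F z = (if z \<in> D then conj_tuple (umat2 (snd z)) (fst z) else 0)" for z :: "(real^2^2^'n) \<times> ((real^2) \<times> (real^2))"
  have "F \<in> borel_measurable borel"
    unfolding F_def[abs_def]
  proof (rule borel_measurable_continuous_on_if)
    show "continuous_on D (\<lambda>z. conj_tuple (umat2 (snd z)) (fst z))"
      unfolding conj_tuple_def
      by (intro continuous_on_vec_lambda continuous_on_mult_mat2 continuous_on_mat2_inv
          continuous_on_compose2[OF continuous_on_umat2[of UNIV]] continuous_intros) (auto simp: D_def)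
  qed (use D in auto)
  then have F: "F \<in> borel_measurable (lborel \<Otimes>\<^sub>M ?U)"
    by (simp add: lborel_prod)
  have sets_eq: "sets (lborel \<Otimes>\<^sub>M ?U) = sets borel" by (simp only: lborel_prod sets_lborel)
  define S where "S = {z. fst z \<in> G \<and> z \<in> D \<and> F z \<in> B}"
  have S: "S \<in> sets (lborel \<Otimes>\<^sub>M ?U)"
  proof -
    have "S = (F -` B \<inter> space (lborel \<Otimes>\<^sub>M ?U)) \<inter> D \<inter> (G \<times> UNIV)" by (auto simp: S_def space_pair_measure)
    moreover have "F -` B \<inter> space (lborel \<Otimes>\<^sub>M ?U) \<in> sets (lborel \<Otimes>\<^sub>M ?U)" using F B(1) by (rule measurable_sets)
    moreover have "D \<in> sets (lborel \<Otimes>\<^sub>M ?U)" unfolding sets_eq by (rule borel_open[OF D])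
    moreover have "G \<times> UNIV \<in> sets (lborel \<Otimes>\<^sub>M ?U)" unfolding sets_eq by (intro borel_open open_Times G open_UNIV)
    ultimately show ?thesis by auto
  qed
  have "AE A in lborel. AE u in ?U. \<not> (A, u) \<in> S"
  proof (rule AE_I2)
    fix A :: "real^2^2^'n"
    show "AE u in ?U. \<not> (A, u) \<in> S"
    proof (cases "A \<in> G")
      case True
      from ae[OF this] show ?thesis by eventually_elim (auto simp: S_def F_def D_def)
    qed (auto simp: S_def)
  qed
  then have "AE u in ?U. AE A in lborel. \<not> (A, u) \<in> S"
  proof (subst (asm) P.AE_commute)
    have e: "{x \<in> space (lborel \<Otimes>\<^sub>M ?U). (fst x, snd x) \<notin> S} = space (lborel \<Otimes>\<^sub>M ?U) - S" by auto
    show "{x \<in> space (lborel \<Otimes>\<^sub>M ?U). (fst x, snd x) \<notin> S} \<in> sets (lborel \<Otimes>\<^sub>M ?U)"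
      unfolding e by (rule sets.compl_sets[OF S])
  qed
  then have aeu: "AE u in lborel. AE A in lborel. (A, u) \<notin> S" by (simp only: lborel_prod not_True_eq_False)
  have dense: "\<exists>u\<in>W. AE A in lborel. (A, u) \<notin> S" if W: "open W" "W \<noteq> {}" for W
  proof (rule ccontr)
    assume no: "\<not> (\<exists>u\<in>W. AE A in lborel. (A, u) \<notin> S)"
    from aeu have "AE u in lborel. u \<notin> W" by eventually_elim (use no in blast)
    then have "W \<in> null_sets lborel" using W(1) AE_iff_null_sets[of W lborel] by simp
    then have "negligible W" by (simp add: negligible_iff_null_sets null_sets_completionI)
    then show False using open_not_negligible W by blast
  qed
  define u0 :: "(real^2) \<times> (real^2)" where "u0 = (axis 1 1, axis 2 1)"
  have u0: "umat2 u0 = mat 1" by (simp add: u0_def umat_def vec_eq_iff forall_2 mat_def axis_def)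
  have "\<exists>u. det (umat2 u) \<noteq> 0 \<and> norm (u - u0) < inverse (real (Suc n)) \<and> (AE A in lborel. (A, u) \<notin> S)" for n
  proof -
    define W where "W = ball u0 (inverse (real (Suc n))) \<inter> {u. det (umat2 u) \<noteq> 0}"
    have "open W" unfolding W_def using cdet by (intro open_Int open_ball open_Collect_neq) auto
    moreover have "u0 \<in> W" unfolding W_def using u0 by simp
    ultimately obtain u where "u \<in> W" "AE A in lborel. (A, u) \<notin> S" using dense[of W] by blast
    then show ?thesis by (intro exI[of _ u]) (auto simp: W_def dist_norm norm_minus_commute)
  qed
  then obtain u where u: "\<And>n. det (umat2 (u n)) \<noteq> 0" "\<And>n. norm (u n - u0) < inverse (real (Suc n))"
    "\<And>n. AE A in lborel. (A, u n) \<notin> S" by metis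
  have u_lim: "u \<longlonglongrightarrow> u0"
  proof (rule LIM_zero_cancel, rule Lim_null_comparison)
    show "(\<lambda>n. inverse (real (Suc n))) \<longlonglongrightarrow> 0" by (rule LIMSEQ_inverse_real_of_nat)
    show "\<forall>\<^sub>F n in sequentially. norm (u n - u0) \<le> inverse (real (Suc n))" using u(2) by (auto simp: less_imp_le)
  qed
  define N where "N n = {A. (A, u n) \<in> S}" for n
  have N_null: "negligible (conj_tuple (umat2 (u n)) ` N n)" for n
  proof (rule negligible_differentiable_image_negligible[OF order_refl])
    have "N n \<in> sets lborel"
    proof -
      have "N n = (\<lambda>A. (A, u n)) -` S \<inter> space lborel" by (auto simp: N_def)
      also have "\<dots> \<in> sets lborel" by (rule measurable_sets[OF _ S]) (auto simp: space_pair_measure)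
      finally show ?thesis .
    qed
    then have "N n \<in> null_sets lborel" using u(3)[of n] AE_iff_null_sets[of "N n" lborel] by (simp add: N_def)
    then show "negligible (N n)" by (simp add: negligible_iff_null_sets null_sets_completionI)
    show "conj_tuple (umat2 (u n)) differentiable_on N n" by (intro linear_imp_differentiable_on linear_conj_tuple)
  qed
  have "B \<subseteq> (\<Union>n. conj_tuple (umat2 (u n)) ` N n)"
  proof
    fix A assume A: "A \<in> B"
    define f where "f w = (\<chi> i. umat2 w ** A $ i ** mat2_inv (umat2 w))" for w
    define V where "V = {w. det (umat2 w) \<noteq> 0}"
    have V: "open V" unfolding V_def using cdet by (intro open_Collect_neq) auto
    have "continuous_on V f"
      unfolding f_def by (intro continuous_on_vec_lambda continuous_on_mult_mat2 continuous_on_mat2_inv continuous_on_umat2 continuous_on_const)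
        (auto simp: V_def)
    moreover have "u0 \<in> V" by (simp add: V_def u0)
    ultimately have "isCont f u0" using V continuous_on_eq_continuous_at by blast
    then have "(\<lambda>n. f (u n)) \<longlonglongrightarrow> f u0" using u_lim by (rule isCont_tendsto_compose)
    moreover have "f u0 = A"
    proof -
      have "mat2_inv (mat 1) = mat 1" using mat2_inv(1)[of "mat 1"] by simp
      then show ?thesis by (simp add: f_def u0)
    qed
    ultimately have "\<forall>\<^sub>F n in sequentially. f (u n) \<in> G"
      using G A B(2) by (metis topological_tendstoD subsetD)
    then obtain n where n: "f (u n) \<in> G" unfolding eventually_sequentially by blast
    have c: "conj_tuple (umat2 (u n)) (f (u n)) = A" unfolding f_def by (rule conj_tuple_inverse[OF u(1)])
    then have fN: "f (u n) \<in> N n" using n A u(1)[of n] by (simp add: N_def S_def D_def F_def)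
    then show "A \<in> (\<Union>n. conj_tuple (umat2 (u n)) ` N n)" using imageI[OF fN, of "conj_tuple (umat2 (u n))"] unfolding c by blast
  qed
  moreover have "negligible (\<Union>n. conj_tuple (umat2 (u n)) ` N n)" by (intro negligible_countable_Union) (auto intro: N_null)
  ultimately have "negligible B" using negligible_subset by blast
  then show ?thesis using B(1) by (simp add: negligible_iff_null_sets null_sets_completion_iff)
qed

section \<open>Exhaustion of the admissible tuples by open sets\<close>

text \<open>For fixed \<open>r\<close> the condition is a finite conjunction of strict inequalities
  between continuous functions, hence open, unlike a condition with a varying attained contraction
  bound it also provides uniform constants.\<close>

definition good :: "real \<Rightarrow> real^2^'n \<Rightarrow> (real^2^2^'n) set"
  where "good r v = {A. \<forall>i. det (A $ i) \<noteq> 0 \<and> op_norm (A $ i) < r \<and>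
    (\<forall>j. i \<noteq> j \<longrightarrow> (op_norm (A $ i) + op_norm (A $ j)) * (max_vec_norm v / (1 - r)) < sqrt 2 / 2 * norm (v $ i - v $ j))}"

lemma transversal_tuple_if_good:
  assumes "0 < r" "r < 1" "A \<in> good r v" shows "transversal_tuple A r v"
proof -
  interpret contracting_tuple A r by standard (use assms in \<open>auto simp: good_def less_imp_le\<close>)
  show ?thesis by standard (use assms in \<open>auto simp: good_def rad_def\<close>)
qed

lemma open_good: "open (good r v)"
proof -
  have "good r v = (\<Inter>i. {A. det (A $ i) \<noteq> 0} \<inter> {A. op_norm (A $ i) < r} \<inter>
    (\<Inter>j\<in>{j. i \<noteq> j}. {A. (op_norm (A $ i) + op_norm (A $ j)) * (max_vec_norm v / (1 - r)) < sqrt 2 / 2 * norm (v $ i - v $ j)}))"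
    unfolding good_def by blast
  also have "open \<dots>"
    by (intro open_INT open_Int open_Collect_neq open_Collect_less ballI continuous_intros) auto
  finally show ?thesis .
qed

text \<open>The strict bound at the largest norm \<open>m\<close> persists for \<open>r\<close>
  slightly above \<open>m\<close>; such an \<open>r\<close> can be rational, so countably many sets
  suffice.\<close>

lemma admissible_subset_good:
  fixes v :: "real^2^'n"
  assumes N: "CARD('n) \<ge> 2" and v: "\<And>i j. i \<noteq> j \<Longrightarrow> v $ i \<noteq> v $ j"
  shows "admissible_tuples v \<subseteq> (\<Union>r\<in>{r \<in> \<rat>. 0 < r \<and> r < 1}. good r v)"
proof
  fix A assume A: "A \<in> admissible_tuples v"
  define m where "m = max_op_norm A"
  define V where "V = max_vec_norm v"
  define f where "f i j = (op_norm (A $ i) + op_norm (A $ j)) / norm (v $ i - v $ j) * (V / (1 - m))" for i j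
  define S where "S = {f i j | i j. i \<noteq> j}"
  have S: "0 < Max S" "Max S < sqrt 2 / 2" and inv: "\<And>i. invertible (A $ i)"
    using A unfolding admissible_tuples_def S_def f_def m_def V_def Let_def by auto
  have finS: "finite S"
  proof -
    have "S \<subseteq> (\<lambda>(i, j). f i j) ` UNIV" unfolding S_def by auto
    then show ?thesis by (rule finite_subset) simp
  qed
  have f_lt: "f i j < sqrt 2 / 2" if "i \<noteq> j" for i j
    using Max_ge[OF finS, of "f i j"] that S(2) unfolding S_def by fastforce
  have le_m: "op_norm (A $ i) \<le> m" for i unfolding m_def max_op_norm_def by (rule Max_ge) auto
  have V: "0 \<le> V" unfolding V_def by (rule max_vec_norm_nonneg)
  obtain i j :: 'n where "i \<noteq> j" using N by (metis card_2_iff' card_le_Suc_iff ex_card finite UNIV_I)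
  then have "S \<noteq> {}" unfolding S_def by blast
  then have "Max S \<in> S" by (rule Max_in[OF finS])
  then obtain i j where "0 < f i j" using S(1) unfolding S_def by auto
  \<comment> \<open>For \<open>m\<close> \<ge> 1 the factor \<open>V / (1 - m)\<close> is at most 0,
    including 0 from division by zero at \<open>m = 1\<close>, against positivity of the
    maximum.\<close>
  have m: "m < 1"
  proof (rule ccontr)
    assume "\<not> m < 1"
    then have "V / (1 - m) \<le> 0" using V by (intro divide_nonneg_nonpos) auto
    then have "f i j \<le> 0" unfolding f_def
      by (intro mult_nonneg_nonpos divide_nonneg_nonneg add_nonneg_nonneg op_norm_nonneg) auto
    then show False using \<open>0 < f i j\<close> by simp
  qed
  have "\<forall>\<^sub>F r in at_right m. \<forall>i j. i \<noteq> j \<longrightarrow> (op_norm (A $ i) + op_norm (A $ j)) * (V / (1 - r)) < sqrt 2 / 2 * norm (v $ i - v $ j)"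
  proof (intro eventually_all_finite)
    fix i j
    show "\<forall>\<^sub>F r in at_right m. i \<noteq> j \<longrightarrow> (op_norm (A $ i) + op_norm (A $ j)) * (V / (1 - r)) < sqrt 2 / 2 * norm (v $ i - v $ j)"
    proof (cases "i = j")
      case False
      then have p: "0 < norm (v $ i - v $ j)" using v by simp
      have "((\<lambda>r. (op_norm (A $ i) + op_norm (A $ j)) * (V / (1 - r))) \<longlongrightarrow> (op_norm (A $ i) + op_norm (A $ j)) * (V / (1 - m))) (at_right m)"
        using m by (intro tendsto_intros) auto
      moreover have "(op_norm (A $ i) + op_norm (A $ j)) * (V / (1 - m)) < sqrt 2 / 2 * norm (v $ i - v $ j)"
      proof -
        have "(op_norm (A $ i) + op_norm (A $ j)) * (V / (1 - m)) = f i j * norm (v $ i - v $ j)"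
          unfolding f_def using p by simp
        then show ?thesis using mult_strict_right_mono[OF f_lt[OF False] p] by simp
      qed
      ultimately have "\<forall>\<^sub>F r in at_right m. (op_norm (A $ i) + op_norm (A $ j)) * (V / (1 - r)) < sqrt 2 / 2 * norm (v $ i - v $ j)"
        by (rule order_tendstoD)
      then show ?thesis by eventually_elim simp
    qed simp
  qed
  then obtain b where b: "m < b" "\<And>r i j. m < r \<Longrightarrow> r < b \<Longrightarrow> i \<noteq> j \<Longrightarrow>
      (op_norm (A $ i) + op_norm (A $ j)) * (V / (1 - r)) < sqrt 2 / 2 * norm (v $ i - v $ j)"
    unfolding eventually_at_right_field by blast
  obtain r where r: "r \<in> \<rat>" "m < r" "r < min b 1" using Rats_dense_in_real[of m "min b 1"] b(1) m by auto
  have "0 < r" using le_m[of undefined] op_norm_nonneg[of "A $ undefined"] r(2) by linarith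
  moreover have "A \<in> good r v"
    unfolding good_def using inv b(2)[of r] r order_le_less_trans[OF le_m r(2)] unfolding V_def
    by (auto simp: invertible_det_nz)
  ultimately show "A \<in> (\<Union>r\<in>{r \<in> \<rat>. 0 < r \<and> r < 1}. good r v)" using r by auto
qed

section \<open>Borel versions of the limits and their behaviour under conjugation\<close>

lemma phi_measurable [measurable]: "phi q \<in> borel_measurable borel"
proof -
  have [measurable]: "op_norm \<in> borel_measurable (borel :: (real^2^2) measure)"
    by (intro borel_measurable_continuous_onI continuous_on_op_norm continuous_on_id)
  have [measurable]: "det \<in> borel_measurable (borel :: (real^2^2) measure)"
    by (intro borel_measurable_continuous_onI continuous_on_det2 continuous_on_id)
  show ?thesis unfolding phi_def[abs_def] sing2_def by measurable
qed

lemma word_matrix_measurable [measurable]: "(\<lambda>A :: real^2^2^'n. word_matrix A w) \<in> borel_measurable borel"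
  by (rule borel_measurable_continuous_onI[OF continuous_on_word_matrix])

text \<open>Unlike \<^const>\<open>lyapunov_exp\<close>, a \<open>THE\<close> over an almost sure limit, the following limits are Borel
  functions of the tuple by their form, and they have the right values on contracting tuples.\<close>

definition pressure_lim :: "real^2^2^'n \<Rightarrow> real \<Rightarrow> real"
  where "pressure_lim A s = lim (\<lambda>n. ln (\<Sum>w\<in>{w. length w = n}. phi s (word_matrix A w)) / real n)"

lemma pressure_lim_measurable [measurable]: "(\<lambda>A :: real^2^2^'n. pressure_lim A s) \<in> borel_measurable borel"
  unfolding pressure_lim_def by measurable

lemma (in contracting_tuple) pressure_eq_lim:
  assumes "0 \<le> s" "s \<le> 2" shows "pressure A s = pressure_lim A s"
  using limI[OF pressure_LIMSEQ(1)[OF assms]] unfolding pressure_lim_def Z_def by simp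

text \<open>Conjugation changes the weight of a word by a factor bounded independently of its
  length. This inequality carries positive pressure of a conjugate back to \<open>A\<close>.\<close>

lemma conj_pressure_le:
  assumes A: "contracting_tuple A r" and B: "contracting_tuple (conj_tuple U A) r'" and U: "det U \<noteq> 0" and s: "0 \<le> s" "s \<le> 2"
  shows "pressure (conj_tuple U A) s \<le> pressure A s"
proof -
  interpret A: contracting_tuple A r by fact
  interpret B: contracting_tuple "conj_tuple U A" r' by fact
  have Ui: "det (mat2_inv U) \<noteq> 0"
    using mat2_inv(1)[OF U] det_mul[of "mat2_inv U" U] by auto
  define C where "C = phi s (mat2_inv U) * phi s U"
  have C: "0 < C" unfolding C_def using phi_pos Ui U by simp
  have le: "phi s (word_matrix (conj_tuple U A) w) \<le> C * phi s (word_matrix A w)" for w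
  proof -
    have "phi s (mat2_inv U ** word_matrix A w ** U) \<le> phi s (mat2_inv U ** word_matrix A w) * phi s U"
      by (rule phi_mult_le) (use U Ui s in \<open>auto simp: det_mul\<close>)
    also have "\<dots> \<le> (phi s (mat2_inv U) * phi s (word_matrix A w)) * phi s U"
      using phi_pos[OF U, of s] by (intro mult_right_mono phi_mult_le Ui s A.det_word_nz) auto
    finally show ?thesis unfolding word_matrix_conj_tuple[OF U] C_def by (simp add: mult_ac)
  qed
  have "B.Z s n \<le> C * A.Z s n" for n
    unfolding A.Z_def B.Z_def sum_distrib_left by (intro sum_mono le)
  then have "ln (B.Z s n) \<le> ln C + ln (A.Z s n)" for n
    using ln_mono[of "B.Z s n" "C * A.Z s n"] B.Z_pos[of s n] A.Z_pos[of s n] C by (simp add: ln_mult_pos)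
  then have "ln (B.Z s n) / real n \<le> ln C / real n + ln (A.Z s n) / real n" for n
    unfolding add_divide_distrib[symmetric] by (intro divide_right_mono) auto
  moreover have "(\<lambda>n. ln C / real n + ln (A.Z s n) / real n) \<longlonglongrightarrow> 0 + pressure A s"
    by (intro tendsto_add lim_const_over_n A.pressure_LIMSEQ s)
  ultimately show ?thesis using LIMSEQ_le[OF B.pressure_LIMSEQ(1)[OF s]] by fastforce
qed

definition lyap1 :: "real^2^2^'n \<Rightarrow> real^'n \<Rightarrow> real"
  where "lyap1 A p = - lim (\<lambda>n. (\<Sum>w\<in>{w. length w = n}. ln (op_norm (word_matrix A w)) * prod_list (map (($) p) w)) / real n)"

definition lyap2 :: "real^2^2^'n \<Rightarrow> real^'n \<Rightarrow> real"
  where "lyap2 A p = - (\<Sum>i\<in>UNIV. p $ i * ln \<bar>det (A $ i)\<bar>) - lyap1 A p"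

lemma lyap_measurable [measurable]:
  "(\<lambda>A :: real^2^2^'n. lyap1 A p) \<in> borel_measurable borel"
  "(\<lambda>A :: real^2^2^'n. lyap2 A p) \<in> borel_measurable borel"
proof -
  have [measurable]: "op_norm \<in> borel_measurable (borel :: (real^2^2) measure)"
    by (intro borel_measurable_continuous_onI continuous_on_op_norm continuous_on_id)
  have [measurable]: "(\<lambda>A :: real^2^2^'n. det (A $ i)) \<in> borel_measurable borel" for i
    by (intro borel_measurable_continuous_onI continuous_intros)
  show [measurable]: "(\<lambda>A :: real^2^2^'n. lyap1 A p) \<in> borel_measurable borel" unfolding lyap1_def by measurable
  show "(\<lambda>A :: real^2^2^'n. lyap2 A p) \<in> borel_measurable borel" unfolding lyap2_def by measurable
qed

lemma (in bernoulli_system) lyap_eq: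
  "lyapunov_exp 1 A p = lyap1 A p" "lyapunov_exp 2 A p = lyap2 A p"
proof -
  show 1: "lyapunov_exp 1 A p = lyap1 A p"
    using limI[OF lyapunov_1_limit] unfolding lyap1_def mean_lognorm_def by simp
  show "lyapunov_exp 2 A p = lyap2 A p" using lyapunov_sum unfolding lyap2_def 1[symmetric] by simp
qed

text \<open>The log-norms of conjugate words differ by at most the constant \<open>C\<close>, which
  disappears after division by \<open>n\<close>; the second exponent follows from invariance of the
  determinants.\<close>

lemma conj_lyap:
  assumes A: "bernoulli_system A r p" and B: "bernoulli_system (conj_tuple U A) r' p" and U: "det U \<noteq> 0"
  shows "lyapunov_exp 1 (conj_tuple U A) p = lyapunov_exp 1 A p" "lyapunov_exp 2 (conj_tuple U A) p = lyapunov_exp 2 A p"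
proof -
  interpret A: bernoulli_system A r p by fact
  interpret B: bernoulli_system "conj_tuple U A" r' p by fact
  have Ui: "det (mat2_inv U) \<noteq> 0"
    using mat2_inv(1)[OF U] det_mul[of "mat2_inv U" U] by auto
  define C where "C = ln (op_norm (mat2_inv U)) + ln (op_norm U)"
  have ub: "ln (op_norm (P ** M ** Q)) \<le> ln (op_norm P) + ln (op_norm Q) + ln (op_norm M)"
    if "det P \<noteq> 0" "det M \<noteq> 0" "det Q \<noteq> 0" for P M Q :: "real^2^2"
    using ln_op_norm_mult_le[of "P ** M" Q] ln_op_norm_mult_le[of P M] that by (simp add: det_mul)
  have le1: "ln (op_norm (word_matrix (conj_tuple U A) w)) \<le> C + ln (op_norm (word_matrix A w))" for w
    unfolding word_matrix_conj_tuple[OF U] C_def by (rule ub) (use U Ui in auto)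
  have le2: "ln (op_norm (word_matrix A w)) \<le> C + ln (op_norm (word_matrix (conj_tuple U A) w))" for w
  proof -
    have "U ** word_matrix (conj_tuple U A) w ** mat2_inv U = (U ** mat2_inv U) ** word_matrix A w ** (U ** mat2_inv U)"
      unfolding word_matrix_conj_tuple[OF U] by (simp only: matrix_mul_assoc)
    then have e: "word_matrix A w = U ** word_matrix (conj_tuple U A) w ** mat2_inv U" by (simp add: mat2_inv[OF U])
    show ?thesis unfolding C_def by (subst e, subst add.commute[of "ln (op_norm (mat2_inv U))"], rule ub) (use U Ui in auto)
  qed
  have mean: "(\<Sum>w\<in>{w. length w = n}. (C + f w) * prod_list (map (($) p) w)) = C + (\<Sum>w\<in>{w. length w = n}. f w * prod_list (map (($) p) w))"
    for f :: "'a list \<Rightarrow> real" and n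
    using A.sum_p_words[of n] by (simp add: distrib_right sum.distrib sum_distrib_left[symmetric])
  have m1: "B.mean_lognorm n \<le> C + A.mean_lognorm n" for n
    unfolding A.mean_lognorm_def B.mean_lognorm_def mean[symmetric]
    by (intro sum_mono mult_right_mono le1) (simp add: A.prob_words_pos less_imp_le)
  have m2: "A.mean_lognorm n \<le> C + B.mean_lognorm n" for n
    unfolding A.mean_lognorm_def B.mean_lognorm_def mean[symmetric]
    by (intro sum_mono mult_right_mono le2) (simp add: A.prob_words_pos less_imp_le)
  have l: "(\<lambda>n. C / real n + f n) \<longlonglongrightarrow> 0 + x" if "f \<longlonglongrightarrow> x" for f x
    by (intro tendsto_add lim_const_over_n that)
  have "- lyapunov_exp 1 (conj_tuple U A) p \<le> 0 + - lyapunov_exp 1 A p"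
    using m1 by (intro LIMSEQ_le[OF B.lyapunov_1_limit l[OF A.lyapunov_1_limit]])
      (auto simp: add_divide_distrib[symmetric] divide_right_mono)
  moreover have "- lyapunov_exp 1 A p \<le> 0 + - lyapunov_exp 1 (conj_tuple U A) p"
    using m2 by (intro LIMSEQ_le[OF A.lyapunov_1_limit l[OF B.lyapunov_1_limit]])
      (auto simp: add_divide_distrib[symmetric] divide_right_mono)
  ultimately show 1: "lyapunov_exp 1 (conj_tuple U A) p = lyapunov_exp 1 A p" by simp
  have "det (conj_tuple U A $ i) = det (A $ i)" for i
    using arg_cong[OF mat2_inv(1)[OF U], of det] by (simp add: conj_tuple_def det_mul algebra_simps)
  then show "lyapunov_exp 2 (conj_tuple U A) p = lyapunov_exp 2 A p"
    using A.lyapunov_sum B.lyapunov_sum 1 by simp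
qed


section \<open>Exceptional sets of tuples\<close>

text \<open>Per letter the error is contracted by \<open>r\<close> and increased by at most
  \<open>e * R\<close>; the fixed point of this recursion is \<open>e * R / (1 - r)\<close>. The
  estimate is uniform in the sequence.\<close>

lemma natural_proj_perturb:
  assumes A: "contracting_tuple A r" and B: "contracting_tuple B r"
    and e: "\<And>i. op_norm (B $ i - A $ i) \<le> e"
  shows "norm (natural_proj B v \<omega> - natural_proj A v \<omega>) \<le> e * (max_vec_norm v / (1 - r)) / (1 - r)"
proof -
  interpret A: contracting_tuple A r by fact
  interpret B: contracting_tuple B r by fact
  define R where "R = max_vec_norm v / (1 - r)"
  have RA: "norm (natural_proj A v \<omega>) \<le> R" and RB: "norm (natural_proj B v \<omega>) \<le> R" for \<omega>
    using A.norm_natural_proj_le B.norm_natural_proj_le unfolding A.rad_def B.rad_def R_def by auto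
  have R: "0 \<le> R" using RA[of undefined] norm_ge_zero order_trans by blast
  have e0: "0 \<le> e" using e[of undefined] op_norm_nonneg order_trans by blast
  have step: "norm (natural_proj B v \<omega> - natural_proj A v \<omega>) \<le> r ^ n * (2 * R) + e * R / (1 - r)" for n \<omega>
  proof (induction n arbitrary: \<omega>)
    case 0
    have "norm (natural_proj B v \<omega> - natural_proj A v \<omega>) \<le> 2 * R"
      using norm_triangle_ineq4[of "natural_proj B v \<omega>" "natural_proj A v \<omega>"] RA[of \<omega>] RB[of \<omega>] by linarith
    moreover have "0 \<le> e * R / (1 - r)" using e0 R A.r_less by simp
    ultimately show ?case by simp
  next
    case (Suc n)
    define i x y where "i = \<omega> 0" and "x = natural_proj B v (seq_shift 1 \<omega>)" and "y = natural_proj A v (seq_shift 1 \<omega>)"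
    have "natural_proj B v \<omega> - natural_proj A v \<omega> = B $ i *v (x - y) + (B $ i - A $ i) *v y"
      using A.natural_proj_shift[of v \<omega> 1] B.natural_proj_shift[of v \<omega> 1] prefix_word_Suc[of \<omega> 0]
      by (simp add: i_def x_def y_def matrix_vector_mult_diff_distrib matrix_vector_mult_diff_rdistrib)
    then have "norm (natural_proj B v \<omega> - natural_proj A v \<omega>) \<le> norm (B $ i *v (x - y)) + norm ((B $ i - A $ i) *v y)"
      by (simp only: norm_triangle_ineq)
    also have "\<dots> \<le> op_norm (B $ i) * norm (x - y) + op_norm (B $ i - A $ i) * norm y"
      by (intro add_mono op_norm_ge)
    also have "\<dots> \<le> r * (r ^ n * (2 * R) + e * R / (1 - r)) + e * R"
      unfolding x_def y_def using A.r_pos e0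
      by (intro add_mono mult_mono B.op_norm_le_r Suc e RA) (auto intro: op_norm_nonneg)
    also have "\<dots> = r ^ Suc n * (2 * R) + e * R / (1 - r)"
      using A.r_less by (simp add: field_simps)
    finally show ?case .
  qed
  have "(\<lambda>n. r ^ n * (2 * R) + e * R / (1 - r)) \<longlonglongrightarrow> 0 * (2 * R) + e * R / (1 - r)"
    using A.r_pos A.r_less by (intro tendsto_intros LIMSEQ_power_zero) auto
  then have "norm (natural_proj B v \<omega> - natural_proj A v \<omega>) \<le> 0 * (2 * R) + e * R / (1 - r)"
    using step by (intro LIMSEQ_le_const) auto
  then show ?thesis unfolding R_def by simp
qed

lemma contracting_tuple_if_good: "0 < r \<Longrightarrow> r < 1 \<Longrightarrow> A \<in> good r v \<Longrightarrow> contracting_tuple A r"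
  using transversal_tuple_if_good transversal_tuple.axioms(1) by blast

text \<open>Upper semicontinuity of the attractor: a compact set inside an open set stays there
  under small perturbations. This is the source of measurability for the Hausdorff
  condition.\<close>

lemma open_good_range_subset:
  assumes r: "0 < r" "r < 1" and O: "open O'"
  shows "open {A \<in> good r v. range (natural_proj A v) \<subseteq> O'}"
proof (subst open_subopen, rule ballI)
  fix A assume A: "A \<in> {A \<in> good r v. range (natural_proj A v) \<subseteq> O'}"
  interpret contracting_tuple A r using contracting_tuple_if_good[OF r] A by blast
  obtain d where d: "0 < d" "(\<Union>x\<in>range (natural_proj A v). ball x d) \<subseteq> O'"
    using compact_subset_open_imp_ball_epsilon_subset[OF compact_range_natural_proj O] A by blast
  \<comment> \<open>Chosen so that the perturbation \<open>e * rad v / (1 - r)\<close> stays below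
    \<open>d\<close>; the added 1 covers radius 0.\<close>
  define e where "e = d * (1 - r) / (rad v + 1)"
  have e: "0 < e" unfolding e_def using d r rad_nonneg[of v] by simp
  have el: "e * rad v / (1 - r) < d"
    unfolding e_def using d r rad_nonneg[of v] by (simp add: divide_less_eq mult_less_cancel_left_pos)
  define W where "W = good r v \<inter> (\<Inter>i. {B. op_norm (B $ i - A $ i) < e})"
  have "open W" unfolding W_def
    by (intro open_Int open_good open_INT ballI open_Collect_less continuous_intros) auto
  moreover have "A \<in> W"
  proof -
    have "(*v) (0 :: real^2^2) = (\<lambda>x. 0)" by (simp add: fun_eq_iff)
    then have "op_norm (0 :: real^2^2) = 0" by (simp add: op_norm_def onorm_zero)
    then show ?thesis using A e unfolding W_def by simp
  qed
  moreover have "W \<subseteq> {A \<in> good r v. range (natural_proj A v) \<subseteq> O'}"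
  proof
    fix B assume B: "B \<in> W"
    have "natural_proj B v \<omega> \<in> O'" for \<omega>
    proof -
      have "norm (natural_proj B v \<omega> - natural_proj A v \<omega>) \<le> e * (max_vec_norm v / (1 - r)) / (1 - r)"
      proof (rule natural_proj_perturb)
        show "contracting_tuple A r" by (rule contracting_tuple_axioms)
        show "contracting_tuple B r" using contracting_tuple_if_good[OF r, of B v] B unfolding W_def by blast
        show "op_norm (B $ i - A $ i) \<le> e" for i using B unfolding W_def by (auto intro: less_imp_le)
      qed
      then have "natural_proj B v \<omega> \<in> ball (natural_proj A v \<omega>) d"
        using el unfolding rad_def by (simp add: dist_norm norm_minus_commute)
      then show ?thesis using d(2) by blast
    qed
    then show "B \<in> {A \<in> good r v. range (natural_proj A v) \<subseteq> O'}" using B unfolding W_def by auto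
  qed
  ultimately show "\<exists>T. open T \<and> A \<in> T \<and> T \<subseteq> {A \<in> good r v. range (natural_proj A v) \<subseteq> O'}" by blast
qed

lemma ennreal_zero_if_le_inverse:
  assumes "\<And>k. K \<le> k \<Longrightarrow> x \<le> ennreal (inverse (real (Suc k)))" shows "x = 0"
proof -
  have "(\<lambda>k. ennreal (inverse (real (Suc k)))) \<longlonglongrightarrow> ennreal 0"
    by (intro tendsto_ennrealI LIMSEQ_inverse_real_of_nat)
  then have "x \<le> ennreal 0" by (rule LIMSEQ_le_const) (use assms in blast)
  then show ?thesis by simp
qed

section \<open>Vanishing Hausdorff measure as a Borel condition\<close>

text \<open>Neither the mesh \<delta> nor general covering sets are needed to detect measure 0: a
  small sum already forces small diameters, and covering sets can be enlarged to open ones. The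
  condition on \<open>E\<close> becomes inclusion in open sets.\<close>

lemma hausdorff_measure_zero_iff:
  fixes E :: "'a::euclidean_space set"
  assumes q: "0 < q"
  shows "hausdorff_measure q E = 0 \<longleftrightarrow> (\<forall>k. \<exists>U :: nat \<Rightarrow> 'a set. (\<forall>j. open (U j) \<and> bounded (U j)) \<and> E \<subseteq> (\<Union>j. U j) \<and>
    (\<Sum>j. ennreal (diameter (U j) powr q)) < ennreal (inverse (real (Suc k))))" (is "_ \<longleftrightarrow> (\<forall>k. ?P k)")
proof
  assume P: "\<forall>k. ?P k"
  have "hausdorff_premeasure q \<delta> E = 0" if \<delta>: "0 < \<delta>" for \<delta>
  proof -
    have "0 < \<delta> powr q" using \<delta> by simp
    then obtain K where K: "inverse (real (Suc K)) < \<delta> powr q" using reals_Archimedean by blast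
    show ?thesis
    proof (rule ennreal_zero_if_le_inverse)
      fix k assume k: "K \<le> k"
      from spec[OF P, of k] obtain U :: "nat \<Rightarrow> 'a set" where oU: "\<forall>j. open (U j) \<and> bounded (U j)"
        and U: "E \<subseteq> (\<Union>j. U j)" "(\<Sum>j. ennreal (diameter (U j) powr q)) < ennreal (inverse (real (Suc k)))"
        by (elim exE conjE)
      have diam: "diameter (U j) \<le> \<delta>" for j
      proof (rule ccontr)
        assume "\<not> diameter (U j) \<le> \<delta>"
        then have "\<delta> powr q \<le> diameter (U j) powr q" using \<delta> q by (intro powr_mono2) auto
        then have "ennreal (\<delta> powr q) \<le> ennreal (diameter (U j) powr q)" by (rule ennreal_leI)
        also have "\<dots> \<le> (\<Sum>j. ennreal (diameter (U j) powr q))"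
        proof -
          have "h j \<le> (\<Sum>j. h j)" for h :: "nat \<Rightarrow> ennreal" using sum_le_suminf[of h "{j}"] by simp
          then show ?thesis .
        qed
        also have "\<dots> < ennreal (inverse (real (Suc k)))" by (rule U(2))
        finally have "\<delta> powr q < inverse (real (Suc k))" by (simp add: ennreal_less_iff del: of_nat_Suc)
        also have "\<dots> \<le> inverse (real (Suc K))" using k by (intro le_imp_inverse_le) auto
        finally show False using K by simp
      qed
      have "hausdorff_premeasure q \<delta> E \<le> (\<Sum>j. diam_pow q (U j))"
        unfolding hausdorff_premeasure_def by (rule INF_lower) (use U oU diam in blast)
      also have "\<dots> \<le> (\<Sum>j. ennreal (diameter (U j) powr q))"
        by (intro suminf_le) (use q in \<open>auto simp: diam_pow_def\<close>)
      finally show "hausdorff_premeasure q \<delta> E \<le> ennreal (inverse (real (Suc k)))" using U(2) by (simp del: of_nat_Suc)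
    qed
  qed
  then show "hausdorff_measure q E = 0" unfolding hausdorff_measure_def by (simp add: SUP_eq_const)
next
  assume H: "hausdorff_measure q E = 0"
  show "\<forall>k. ?P k"
  proof
    fix k
    define e where "e = inverse (real (Suc k)) / 2"
    have e: "0 < e" unfolding e_def by simp
    have "hausdorff_premeasure q 1 E \<le> hausdorff_measure q E" unfolding hausdorff_measure_def by (rule SUP_upper) simp
    then have "hausdorff_premeasure q 1 E < ennreal e" using H e by simp
    then obtain V :: "nat \<Rightarrow> 'a set" where V: "E \<subseteq> (\<Union>j. V j)" "\<And>j. bounded (V j)" "(\<Sum>j. diam_pow q (V j)) < ennreal e"
      unfolding hausdorff_premeasure_def INF_less_iff by blast
    \<comment> \<open>By continuity of the power the j-th set can be thickened at an extra cost
      below e/2^(j+1), and these costs add up to \<open>e\<close>; for diameter 0 this uses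
      \<open>q\<close> > 0.\<close>
    have "\<exists>t>0. (diameter (V j) + 2 * t) powr q < diameter (V j) powr q + e * (1 / 2) ^ Suc j" for j
    proof -
      have "((\<lambda>t. (diameter (V j) + 2 * t) powr q) \<longlongrightarrow> (diameter (V j) + 2 * 0) powr q) (at_right 0)"
      proof (rule tendsto_powr')
        show "((\<lambda>t. diameter (V j) + 2 * t) \<longlongrightarrow> diameter (V j) + 2 * 0) (at_right 0)" by (intro tendsto_intros)
        have "\<forall>\<^sub>F t in at_right (0 :: real). 0 < t" by (rule eventually_at_right_less)
        then have "\<forall>\<^sub>F t in at_right 0. 0 \<le> diameter (V j) + 2 * t"
          by eventually_elim (use diameter_ge_0[OF V(2)[of j]] in simp)
        then show "diameter (V j) + 2 * 0 \<noteq> 0 \<or> 0 < q \<and> (\<forall>\<^sub>F t in at_right 0. 0 \<le> diameter (V j) + 2 * t)" using q by blast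
      qed auto
      then have "\<forall>\<^sub>F t in at_right 0. (diameter (V j) + 2 * t) powr q < diameter (V j) powr q + e * (1 / 2) ^ Suc j"
        using e by (intro order_tendstoD) auto
      then obtain b where b: "0 < b" "\<forall>t>0. t < b \<longrightarrow> (diameter (V j) + 2 * t) powr q < diameter (V j) powr q + e * (1 / 2) ^ Suc j"
        unfolding eventually_at_right_field by blast
      then have "(diameter (V j) + 2 * (b / 2)) powr q < diameter (V j) powr q + e * (1 / 2) ^ Suc j"
        by (elim allE[of _ "b / 2"] conjE impE) (use b in auto)
      then show ?thesis using b(1) by (intro exI[of _ "b / 2"] conjI) auto
    qed
    then obtain t where t: "\<And>j. 0 < t j" "\<And>j. (diameter (V j) + 2 * t j) powr q < diameter (V j) powr q + e * (1 / 2) ^ Suc j" by metis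
    define U where "U j = (\<Union>x\<in>V j. ball x (t j))" for j
    have U_dist: "norm (y - z) \<le> diameter (V j) + 2 * t j" if yz: "y \<in> U j" "z \<in> U j" for y z j
    proof -
      obtain x x' where x: "x \<in> V j" "dist x y < t j" "x' \<in> V j" "dist x' z < t j" using yz unfolding U_def by auto
      have "dist x x' \<le> diameter (V j)" by (rule diameter_bounded_bound[OF V(2) x(1,3)])
      moreover have "dist y z \<le> dist x y + dist x x' + dist x' z"
        using dist_triangle[of y z x] dist_triangle[of x z x'] by (simp add: dist_commute)
      ultimately show ?thesis using x by (simp add: dist_norm)
    qed
    have U_open: "open (U j)" for j unfolding U_def by auto
    have U_bdd: "bounded (U j)" for j
      unfolding bounded_two_points dist_norm using U_dist by blast
    have U_sum: "ennreal (diameter (U j) powr q) \<le> diam_pow q (V j) + ennreal (e * (1 / 2) ^ Suc j)" for j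
    proof (cases "V j = {}")
      case True
      then show ?thesis using q by (simp add: U_def)
    next
      case False
      then have "U j \<noteq> {}" using t(1)[of j] unfolding U_def by auto
      then have "diameter (U j) \<le> diameter (V j) + 2 * t j" using U_dist by (intro diameter_le) auto
      then have "diameter (U j) powr q \<le> (diameter (V j) + 2 * t j) powr q"
        using q diameter_ge_0[OF U_bdd[of j]] by (intro powr_mono2) auto
      then have "diameter (U j) powr q \<le> diameter (V j) powr q + e * (1 / 2) ^ Suc j" using t(2)[of j] by linarith
      then have "ennreal (diameter (U j) powr q) \<le> ennreal (diameter (V j) powr q + e * (1 / 2) ^ Suc j)" by (rule ennreal_leI)
      also have "\<dots> = diam_pow q (V j) + ennreal (e * (1 / 2) ^ Suc j)"
        using False q e by (simp add: diam_pow_def ennreal_plus)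
      finally show ?thesis .
    qed
    have geo: "(\<lambda>j. e * (1 / 2) ^ Suc j) sums (e * 1)" by (intro sums_mult power_half_series)
    have "(\<Sum>j. ennreal (diameter (U j) powr q)) \<le> (\<Sum>j. diam_pow q (V j) + ennreal (e * (1 / 2) ^ Suc j))"
      by (intro suminf_le U_sum) auto
    also have "\<dots> = (\<Sum>j. diam_pow q (V j)) + (\<Sum>j. ennreal (e * (1 / 2) ^ Suc j))" by (intro suminf_add[symmetric]) auto
    also have "(\<Sum>j. ennreal (e * (1 / 2) ^ Suc j)) = ennreal e"
    proof -
      have "(\<Sum>j. ennreal (e * (1 / 2) ^ Suc j)) = ennreal (\<Sum>j. e * (1 / 2) ^ Suc j)"
        by (rule suminf_ennreal2[OF _ sums_summable[OF geo]]) (use e in simp)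
      then show ?thesis unfolding sums_unique[OF geo, symmetric] by simp
    qed
    also have "(\<Sum>j. diam_pow q (V j)) + ennreal e < ennreal e + ennreal e"
      using V(3) unfolding add.commute[of "\<Sum>j. diam_pow q (V j)"] ennreal_add_left_cancel_less by simp
    also have "\<dots> = ennreal (inverse (real (Suc k)))" using e by (simp add: ennreal_plus[symmetric] e_def del: ennreal_plus of_nat_Suc)
    finally have "(\<Sum>j. ennreal (diameter (U j) powr q)) < ennreal (inverse (real (Suc k)))" .
    moreover have "E \<subseteq> (\<Union>j. U j)"
    proof
      fix x assume "x \<in> E"
      then obtain j where "x \<in> V j" using V(1) by blast
      then have "x \<in> U j" unfolding U_def using t(1)[of j] by (intro UN_I[of x]) auto
      then show "x \<in> (\<Union>j. U j)" by blast
    qed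
    ultimately show "?P k" using U_open U_bdd by blast
  qed
qed

text \<open>Lower exponents cannot give measure 0: on sets of diameter at most 1 the q-th power is
  at most the s-th, and small meshes determine the measure.\<close>

lemma hausdorff_dim_ge:
  fixes E :: "'a::metric_space set"
  assumes q: "0 < q" and H: "hausdorff_measure q E \<noteq> 0"
  shows "ereal q \<le> hausdorff_dim E"
  unfolding hausdorff_dim_def
proof (rule INF_greatest)
  fix s assume s: "s \<in> {s. 0 \<le> s \<and> hausdorff_measure s E = 0}"
  show "ereal q \<le> ereal s"
  proof (rule ccontr)
    assume "\<not> ereal q \<le> ereal s"
    then have sq: "s < q" by simp
    have small: "hausdorff_premeasure q \<delta> E = 0" if \<delta>: "0 < \<delta>" "\<delta> \<le> 1" for \<delta>
    proof -
      have dp: "diam_pow q U \<le> diam_pow s U" if "bounded U" "diameter U \<le> \<delta>" for U :: "'a set"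
      proof (cases "U = {}")
        case False
        have d: "0 \<le> diameter U" "diameter U \<le> 1" using diameter_ge_0[OF that(1)] that(2) \<delta> by auto
        show ?thesis
        proof (cases "s = 0")
          case True
          have "diameter U powr q \<le> 1 powr q" using d q by (intro powr_mono2) auto
          then show ?thesis using True False q by (simp add: diam_pow_def)
        next
          case s0: False
          have "diameter U powr q \<le> diameter U powr s"
            using d sq by (cases "diameter U = 0") (auto intro!: powr_mono')
          then show ?thesis using s0 False q by (simp add: diam_pow_def ennreal_leI)
        qed
      qed (simp add: diam_pow_def)
      have "hausdorff_premeasure q \<delta> E \<le> hausdorff_premeasure s \<delta> E"
        unfolding hausdorff_premeasure_def by (intro INF_mono) (blast intro: suminf_le dp)
      also have "\<dots> \<le> hausdorff_measure s E" unfolding hausdorff_measure_def by (rule SUP_upper) (use \<delta> in simp)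
      finally show ?thesis using s by simp
    qed
    have "hausdorff_premeasure q \<delta> E = 0" if \<delta>: "0 < \<delta>" for \<delta>
    proof (cases "\<delta> \<le> 1")
      case False
      have "hausdorff_premeasure q \<delta> E \<le> hausdorff_premeasure q 1 E"
        unfolding hausdorff_premeasure_def by (rule INF_superset_mono) (use False in \<open>auto intro: order_trans[of _ 1]\<close>)
      then show ?thesis using small[of 1] by simp
    qed (use small \<delta> in blast)
    then have "hausdorff_measure q E = 0" unfolding hausdorff_measure_def by (simp add: SUP_eq_const)
    then show False using H by simp
  qed
qed

text \<open>Stated with \<open>pressure_lim\<close>, which is Borel, and with Hausdorff measure,
  which does not mention the tuple-dependent Frostman measure.\<close>

definition bad_sets :: "real \<Rightarrow> real^2^'n \<Rightarrow> real \<Rightarrow> real \<Rightarrow> (real^2^2^'n) set"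
  where "bad_sets r v q' q = {A \<in> good r v. 0 < pressure_lim A q \<and> hausdorff_measure q' (range (natural_proj A v)) = 0}"

text \<open>For each \<open>k\<close> the tuples whose attractor has a cover from \<open>V k\<close>
  form a union of open sets, open although the union is uncountable; the Hausdorff condition is thus
  a countable intersection of open sets.\<close>

lemma bad_sets_borel:
  assumes r: "0 < r" "r < 1" and q: "0 < q'"
  shows "bad_sets r v q' q \<in> sets borel"
proof -
  define V :: "nat \<Rightarrow> (nat \<Rightarrow> (real^2) set) set" where "V k = {U. (\<forall>j. open (U j) \<and> bounded (U j)) \<and>
      (\<Sum>j. ennreal (diameter (U j) powr q')) < ennreal (inverse (real (Suc k)))}" for k
  define C where "C k = (\<Union>U\<in>V k. {A \<in> good r v. range (natural_proj A v) \<subseteq> (\<Union>j. U j)})" for k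
  have zero_iff: "hausdorff_measure q' E = 0 \<longleftrightarrow> (\<forall>k. \<exists>U\<in>V k. E \<subseteq> (\<Union>j. U j))" for E
    unfolding hausdorff_measure_zero_iff[OF q] V_def Bex_def mem_Collect_eq conj_assoc
    by (intro all_cong1 ex_cong1) (rule conj_cong[OF refl conj_commute])
  have "open (C k)" for k
    unfolding C_def
  proof (rule open_UN, rule ballI)
    fix U assume "U \<in> V k"
    then have "\<forall>j. open (U j) \<and> bounded (U j)" unfolding V_def mem_Collect_eq by (rule conjunct1)
    then have "open (\<Union>j. U j)" by (intro open_UN ballI) blast
    then show "open {A \<in> good r v. range (natural_proj A v) \<subseteq> (\<Union>j. U j)}" by (rule open_good_range_subset[OF r])
  qed
  then have C: "C k \<in> sets borel" for k by (rule borel_open)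
  have "bad_sets r v q' q = {A \<in> space borel. 0 < pressure_lim A q} \<inter> (\<Inter>k. C k)"
    unfolding bad_sets_def zero_iff C_def by auto
  also have "\<dots> \<in> sets borel"
  proof (rule sets.Int)
    show "{A \<in> space borel. 0 < pressure_lim A q} \<in> sets borel" by measurable
    show "(\<Inter>k. C k) \<in> sets borel" by (intro sets.countable_INT) (use C in auto)
  qed
  finally show ?thesis .
qed

lemma bad_sets_null:
  assumes r: "0 < r" "r < 1" and q: "0 < q'" "q' < q" "q \<le> 2"
  shows "bad_sets r v q' q \<in> null_sets lborel"
proof (rule null_set_by_conjugation[OF open_good[of r v] bad_sets_borel[OF r q(1)]])
  show "bad_sets r v q' q \<subseteq> good r v" unfolding bad_sets_def by blast
  fix A assume A: "A \<in> good r v"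
  interpret transversal_tuple A r v by (rule transversal_tuple_if_good[OF r A])
  show "AE u in lborel \<Otimes>\<^sub>M lborel. det (umat2 u) \<noteq> 0 \<longrightarrow> conj_tuple (umat2 u) A \<notin> bad_sets r v q' q"
  proof (cases "0 < pressure A q")
    case True
    from AE_conj_hausdorff_measure[OF q True] show ?thesis by eventually_elim (auto simp: bad_sets_def)
  next
    case False
    show ?thesis
    proof (intro AE_I2 impI notI)
      fix u assume d: "det (umat2 u) \<noteq> 0" and b: "conj_tuple (umat2 u) A \<in> bad_sets r v q' q"
      have B: "contracting_tuple (conj_tuple (umat2 u) A) r"
        by (rule contracting_tuple_if_good[OF r, of _ v]) (use b in \<open>simp add: bad_sets_def\<close>)
      have "pressure (conj_tuple (umat2 u) A) q \<le> pressure A q"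
        by (rule conj_pressure_le[OF contracting_tuple_axioms B d]) (use q in auto)
      moreover have "0 < pressure (conj_tuple (umat2 u) A) q"
        using b contracting_tuple.pressure_eq_lim[OF B, of q] q by (simp add: bad_sets_def)
      ultimately show False using False by simp
    qed
  qed
qed

definition lyap_dim :: "real^2^2^'n \<Rightarrow> real^'n \<Rightarrow> real"
  where "lyap_dim A p = min (shannon_entropy p / lyap1 A p) (1 + (shannon_entropy p - lyap1 A p) / lyap2 A p)"

definition bad_measures :: "real \<Rightarrow> real^2^'n \<Rightarrow> real^'n \<Rightarrow> real \<Rightarrow> (real^2^2^'n) set"
  where "bad_measures r v p q = {A \<in> good r v. q < lyap_dim A p \<and>
    \<not> (AE \<omega> in bernoulli_measure p. potential q (bernoulli_measure p) A v \<omega> < \<infinity>)}"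

text \<open>The potential is jointly measurable in tuple and sequence, so the measure of its
  infinite section is a Borel function of the tuple.\<close>

lemma bad_measures_borel:
  fixes p :: "real^'n"
  assumes p: "prob_vector p"
  shows "bad_measures r v p q \<in> sets borel"
proof -
  interpret prob_vector p by (rule p)
  let ?B = "bernoulli_measure p"
  define Q where "Q = {z \<in> space (borel \<Otimes>\<^sub>M ?B). potential q ?B (fst z) v (snd z) = \<infinity>}"
  have pot: "(\<lambda>z. potential q ?B (fst z) v (snd z)) \<in> borel_measurable (borel \<Otimes>\<^sub>M ?B)"
    by (rule measurable_potential[OF B.sigma_finite_measure_axioms sets_bernoulli]) auto
  then have Q: "Q \<in> sets (borel \<Otimes>\<^sub>M ?B)" unfolding Q_def by measurable
  have meas: "(\<lambda>A. emeasure ?B (Pair A -` Q)) \<in> borel_measurable borel" by (rule B.measurable_emeasure_Pair[OF Q])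
  have AE_iff: "(AE \<omega> in ?B. potential q ?B A v \<omega> < \<infinity>) \<longleftrightarrow> emeasure ?B (Pair A -` Q) = 0" for A
  proof -
    have "Pair A -` Q \<in> sets ?B" by (rule sets_Pair1[OF Q])
    then have "emeasure ?B (Pair A -` Q) = 0 \<longleftrightarrow> (AE \<omega> in ?B. \<omega> \<notin> Pair A -` Q)"
      using AE_iff_null_sets[of "Pair A -` Q" ?B] by (simp add: null_sets_def)
    then show ?thesis by (simp add: Q_def space_pair_measure less_top)
  qed
  have [measurable]: "(\<lambda>A. lyap_dim A p) \<in> borel_measurable borel" unfolding lyap_dim_def by measurable
  have "bad_measures r v p q = good r v \<inter> {A \<in> space borel. q < lyap_dim A p \<and> emeasure ?B (Pair A -` Q) \<noteq> 0}"
    unfolding bad_measures_def AE_iff by auto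
  also have "\<dots> \<in> sets borel"
  proof (rule sets.Int)
    show "good r v \<in> sets borel" by (rule borel_open[OF open_good])
    show "{A \<in> space borel. q < lyap_dim A p \<and> emeasure ?B (Pair A -` Q) \<noteq> 0} \<in> sets borel" using meas by measurable
  qed
  finally show ?thesis .
qed

lemma bad_measures_null:
  fixes p :: "real^'n"
  assumes r: "0 < r" "r < 1" and p: "prob_vector p" and q: "0 < q" "q < 2"
  shows "bad_measures r v p q \<in> null_sets lborel"
proof (rule null_set_by_conjugation[OF open_good[of r v] bad_measures_borel[OF p]])
  show "bad_measures r v p q \<subseteq> good r v" unfolding bad_measures_def by blast
  fix A assume A: "A \<in> good r v"
  interpret transversal_tuple A r v by (rule transversal_tuple_if_good[OF r A])
  have sys: "bernoulli_system B r p" if "B \<in> good r v" for B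
    using contracting_tuple_if_good[OF r that] p by (simp add: bernoulli_system_def)
  have inv: "lyap_dim (conj_tuple (umat2 u) A) p = min (shannon_entropy p / lyapunov_exp 1 A p) (1 + (shannon_entropy p - lyapunov_exp 1 A p) / lyapunov_exp 2 A p)"
    if "det (umat2 u) \<noteq> 0" "conj_tuple (umat2 u) A \<in> good r v" for u
    unfolding lyap_dim_def bernoulli_system.lyap_eq[OF sys[OF that(2)], symmetric]
      conj_lyap[OF sys[OF A] sys[OF that(2)] that(1)] ..
  show "AE u in lborel \<Otimes>\<^sub>M lborel. det (umat2 u) \<noteq> 0 \<longrightarrow> conj_tuple (umat2 u) A \<notin> bad_measures r v p q"
  proof (cases "q < min (shannon_entropy p / lyapunov_exp 1 A p) (1 + (shannon_entropy p - lyapunov_exp 1 A p) / lyapunov_exp 2 A p)")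
    case True
    then have "q < shannon_entropy p / lyapunov_exp 1 A p" "q < 1 + (shannon_entropy p - lyapunov_exp 1 A p) / lyapunov_exp 2 A p" by auto
    from AE_conj_potential[OF p q this] show ?thesis by eventually_elim (auto simp: bad_measures_def)
  next
    case False
    then show ?thesis using inv by (intro AE_I2) (auto simp: bad_measures_def)
  qed
qed

section \<open>The dimension formulas outside the exceptional sets\<close>

lemma dimensions_if_not_bad:
  fixes A :: "real^2^2^'n"
  assumes r: "0 < r" "r < 1" and A: "A \<in> good r v" and N: "CARD('n) \<ge> 2"
    and nb: "\<And>q' q. q' \<in> \<rat> \<Longrightarrow> q \<in> \<rat> \<Longrightarrow> 0 < q' \<Longrightarrow> q' < q \<Longrightarrow> q \<le> 2 \<Longrightarrow> A \<notin> bad_sets r v q' q"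
  shows "hausdorff_dim (self_affine_set A v) = upper_minkowski_dim (self_affine_set A v) \<and>
    upper_minkowski_dim (self_affine_set A v) = ereal (affinity_dim A)"
proof -
  interpret transversal_tuple A r v by (rule transversal_tuple_if_good[OF r A])
  note D = sum_det_le_1[OF N]
  note s0 = affinity_dim_zero[OF N D]
  define E where "E = range (natural_proj A v)"
  have up: "upper_minkowski_dim E \<le> ereal (affinity_dim A)" unfolding E_def by (rule upper_minkowski_le[OF N D])
  have mid: "hausdorff_dim E \<le> upper_minkowski_dim E"
    unfolding E_def by (intro hausdorff_dim_le_upper_minkowski_dim compact_imp_bounded compact_range_natural_proj)
  have low: "ereal (affinity_dim A) \<le> hausdorff_dim E"
  proof (rule ereal_le_epsilon2)
    fix e :: real assume e: "0 < e"
    \<comment> \<open>Two rationals below the affinity dimension: at \<open>q\<close> the pressure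
      is still positive, and \<open>q'\<close> is the exponent whose Hausdorff measure is then
      nonzero.\<close>
    obtain q' where q': "q' \<in> \<rat>" "max 0 (affinity_dim A - e) < q'" "q' < affinity_dim A"
      using Rats_dense_in_real[of "max 0 (affinity_dim A - e)" "affinity_dim A"] s0 e by auto
    obtain q where q: "q \<in> \<rat>" "q' < q" "q < affinity_dim A" using Rats_dense_in_real[OF q'(3)] by blast
    have "pressure A (affinity_dim A) < pressure A q" by (rule pressure_strict) (use q q' s0 in auto)
    then have "0 < pressure_lim A q" using s0 pressure_eq_lim[of q] q q' by simp
    then have "hausdorff_measure q' E \<noteq> 0" using nb[of q' q] A q q' s0 unfolding bad_sets_def E_def by auto
    then have "ereal q' \<le> hausdorff_dim E" using q' by (intro hausdorff_dim_ge) auto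
    then have "ereal q' + ereal e \<le> hausdorff_dim E + ereal e" by (intro add_right_mono)
    moreover have "ereal (affinity_dim A) \<le> ereal q' + ereal e" using q' by simp
    ultimately show "ereal (affinity_dim A) \<le> hausdorff_dim E + ereal e" by (rule order_trans[rotated])
  qed
  show ?thesis unfolding self_affine_set_eq E_def[symmetric]
    using up mid low by (metis order_antisym order_trans)
qed

lemma exact_dim_if_not_bad:
  fixes A :: "real^2^2^'n" and p :: "real^'n"
  assumes r: "0 < r" "r < 1" and A: "A \<in> good r v" and N: "CARD('n) \<ge> 2" and p: "prob_vector p"
    and nb: "\<And>q. q \<in> \<rat> \<Longrightarrow> 0 < q \<Longrightarrow> q < 2 \<Longrightarrow> A \<notin> bad_measures r v p q"
  shows "has_exact_dim (self_affine_measure A v p) (lyapunov_dim A p) \<and>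
    lyapunov_dim A p = min (shannon_entropy p / lyapunov_exp 1 A p)
      (1 + (shannon_entropy p - lyapunov_exp 1 A p) / lyapunov_exp 2 A p)"
proof
  interpret transversal_tuple A r v by (rule transversal_tuple_if_good[OF r A])
  interpret prob_vector p by (rule p)
  interpret bernoulli_system A r p ..
  note eq = lyapunov_dim_eq[OF sum_det_le_1[OF N]]
  then show "lyapunov_dim A p = min (shannon_entropy p / lyapunov_exp 1 A p)
      (1 + (shannon_entropy p - lyapunov_exp 1 A p) / lyapunov_exp 2 A p)" .
  define \<mu> where "\<mu> = self_affine_measure A v p"
  define D where "D = lyapunov_dim A p"
  interpret \<mu>: prob_space \<mu> unfolding \<mu>_def self_affine_measure_def
    by (rule B.prob_space_distr[OF natural_proj_measurable_bernoulli])
  have D_lyap: "D = lyap_dim A p" unfolding D_def eq lyap_dim_def lyap_eq ..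
  have D2: "D \<le> 2"
  proof -
    have "(shannon_entropy p - lyapunov_exp 1 A p) / lyapunov_exp 2 A p \<le> 1"
      using entropy_le_lyapunov_sum[OF sum_det_le_1[OF N]] lyapunov_1_pos lyapunov_1_le_2 by (simp add: divide_le_eq)
    then show ?thesis unfolding D_def eq by simp
  qed
  have upper: "AE x in \<mu>. \<forall>\<^sub>F \<rho> in at_right 0. \<rho> powr d \<le> measure \<mu> (cball x \<rho>)" if "D < d" for d
    using that local_dim_upper_1[of d v] local_dim_upper_2[of d v] unfolding D_def eq \<mu>_def by (auto simp: min_less_iff_disj)
  have lower: "AE x in \<mu>. \<exists>K. \<forall>\<rho>>0. measure \<mu> (cball x \<rho>) \<le> K * \<rho> powr q" if "q \<in> \<rat>" "0 < q" "q < D" for q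
  proof -
    have "AE \<omega> in bernoulli_measure p. potential q (bernoulli_measure p) A v \<omega> < \<infinity>"
      using nb[of q] that D2 A unfolding D_lyap bad_measures_def by auto
    then show ?thesis unfolding \<mu>_def self_affine_measure_def
      by (rule local_dim_lower_if_potential_finite[OF prob_space_bernoulli sets_bernoulli that(2)])
  qed
  have "AE x in \<mu>. (\<forall>j. \<forall>\<^sub>F \<rho> in at_right 0. \<rho> powr (D + inverse (real (Suc j))) \<le> measure \<mu> (cball x \<rho>)) \<and>
      (\<forall>q\<in>{q \<in> \<rat>. 0 < q \<and> q < D}. \<exists>K. \<forall>\<rho>>0. measure \<mu> (cball x \<rho>) \<le> K * \<rho> powr q)"
  proof (rule AE_conjI)
    show "AE x in \<mu>. \<forall>j. \<forall>\<^sub>F \<rho> in at_right 0. \<rho> powr (D + inverse (real (Suc j))) \<le> measure \<mu> (cball x \<rho>)"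
      unfolding AE_all_countable by (intro allI upper) simp
    have "countable {q \<in> \<rat>. 0 < q \<and> q < D}" by (rule countable_subset[OF _ countable_rat]) auto
    then show "AE x in \<mu>. \<forall>q\<in>{q \<in> \<rat>. 0 < q \<and> q < D}. \<exists>K. \<forall>\<rho>>0. measure \<mu> (cball x \<rho>) \<le> K * \<rho> powr q"
      by (subst AE_ball_countable) (auto intro: lower)
  qed
  then show "has_exact_dim (self_affine_measure A v p) (lyapunov_dim A p)"
    unfolding has_exact_dim_def \<mu>_def[symmetric] D_def[symmetric]
  proof eventually_elim
    case (elim x)
    have small: "\<forall>\<^sub>F \<rho> in at_right (0 :: real). 0 < \<rho> \<and> \<rho> < 1"
      unfolding eventually_at_right_field by (intro exI[of _ 1]) auto
    show "((\<lambda>\<rho>. ln (measure \<mu> (cball x \<rho>)) / ln \<rho>) \<longlongrightarrow> D) (at_right 0)"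
    proof (rule order_tendstoI)
      fix d assume d: "D < d"
      have "0 < d - D" using d by simp
      then obtain j where "inverse (real (Suc j)) < d - D" using reals_Archimedean by blast
      then have j: "D + inverse (real (Suc j)) < d" by simp
      have "\<forall>\<^sub>F \<rho> in at_right 0. \<rho> powr (D + inverse (real (Suc j))) \<le> measure \<mu> (cball x \<rho>)" using elim by blast
      with small show "\<forall>\<^sub>F \<rho> in at_right 0. ln (measure \<mu> (cball x \<rho>)) / ln \<rho> < d"
      proof eventually_elim
        case (elim \<rho>)
        then have "ln (\<rho> powr (D + inverse (real (Suc j)))) \<le> ln (measure \<mu> (cball x \<rho>))" by (intro ln_mono) auto
        then have "(D + inverse (real (Suc j))) * ln \<rho> \<le> ln (measure \<mu> (cball x \<rho>))" using elim by (simp add: ln_powr)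
        moreover have l: "ln \<rho> < 0" using elim by simp
        ultimately have "ln (measure \<mu> (cball x \<rho>)) / ln \<rho> \<le> D + inverse (real (Suc j))" by (simp add: neg_divide_le_eq)
        then show ?case using j by linarith
      qed
    next
      fix d assume d: "d < D"
      \<comment> \<open>Because \<open>ln 0 = 0\<close>, the logarithmic bounds below need balls of
        positive mass; the upper estimate for the local dimension supplies it.\<close>
      have pos: "\<forall>\<^sub>F \<rho> in at_right 0. 0 < measure \<mu> (cball x \<rho>)"
      proof -
        have "\<forall>\<^sub>F \<rho> in at_right 0. \<rho> powr (D + inverse (real (Suc 0))) \<le> measure \<mu> (cball x \<rho>)" using elim by blast
        with small show ?thesis by eventually_elim (metis order_less_le_trans powr_gt_zero less_irrefl)
      qed
      show "\<forall>\<^sub>F \<rho> in at_right 0. d < ln (measure \<mu> (cball x \<rho>)) / ln \<rho>"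
      proof (cases "d < 0")
        \<comment> \<open>No positive exponent \<open>q\<close> is involved here: the quotient of
          the two logarithms is nonnegative for masses at most 1 and radii below 1.\<close>
        case True
        from small pos show ?thesis
        proof eventually_elim
          case (elim \<rho>)
          then have "ln (measure \<mu> (cball x \<rho>)) \<le> 0" "ln \<rho> < 0" by auto
          then have "0 \<le> ln (measure \<mu> (cball x \<rho>)) / ln \<rho>" by (simp add: divide_nonpos_neg)
          then show ?case using True by linarith
        qed
      next
        case False
        obtain q where q: "q \<in> \<rat>" "d < q" "q < D" using Rats_dense_in_real[OF d] by blast
        have "0 < q" using q False by simp
        then obtain K where K: "\<And>\<rho>. 0 < \<rho> \<Longrightarrow> measure \<mu> (cball x \<rho>) \<le> K * \<rho> powr q" using elim q by blast
        define L where "L = max K 1"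
        have L: "0 < L" "K \<le> L" unfolding L_def by auto
        have "((\<lambda>\<rho>. L * \<rho> powr (q - (d + q) / 2)) \<longlongrightarrow> 0) (at_right 0)"
        proof -
          have "0 < q - (d + q) / 2" using q by (simp add: field_simps)
          then show ?thesis by real_asymp
        qed
        then have "\<forall>\<^sub>F \<rho> in at_right 0. L * \<rho> powr (q - (d + q) / 2) < 1" by (rule order_tendstoD) simp
        with small pos show ?thesis
        proof eventually_elim
          case (elim \<rho>)
          \<comment> \<open>The midpoint of \<open>d\<close> and \<open>q\<close>; the surplus
            \<open>q - d'\<close> in the exponent beats the constant \<open>L\<close>.\<close>
          define d' where "d' = (d + q) / 2"
          have d': "d < d'" using q unfolding d'_def by simp
          have "measure \<mu> (cball x \<rho>) \<le> L * \<rho> powr q"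
            using K[of \<rho>] elim mult_right_mono[OF L(2) powr_ge_zero, of \<rho> q] by linarith
          also have "\<dots> = (L * \<rho> powr (q - d')) * \<rho> powr d'" using elim by (simp add: powr_add[symmetric] mult.assoc)
          also have "\<dots> \<le> 1 * \<rho> powr d'" using elim unfolding d'_def by (intro mult_right_mono) auto
          finally have "ln (measure \<mu> (cball x \<rho>)) \<le> ln (\<rho> powr d')" using elim by (intro ln_mono) auto
          then have "ln (measure \<mu> (cball x \<rho>)) \<le> d' * ln \<rho>" using elim by (simp add: ln_powr)
          moreover have "ln \<rho> < 0" using elim by simp
          ultimately have "d' \<le> ln (measure \<mu> (cball x \<rho>)) / ln \<rho>" by (simp add: neg_le_divide_eq)
          then show ?case using d' by linarith
        qed
      qed
    qed
  qed
qed

theorem theorem1: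
  fixes v :: "real^2^'n"
  assumes "CARD('n) \<ge> 2"
    and "\<And>i j. i \<noteq> j \<Longrightarrow> v $ i \<noteq> v $ j"
  shows "(AE A in lebesgue. A \<in> admissible_tuples v \<longrightarrow>
            hausdorff_dim (self_affine_set A v) = upper_minkowski_dim (self_affine_set A v) \<and>
            upper_minkowski_dim (self_affine_set A v) = ereal (affinity_dim A)) \<and>
         (\<forall>p :: real^'n. (\<forall>i. 0 < p $ i \<and> p $ i < 1) \<and> (\<Sum>i\<in>UNIV. p $ i) = 1 \<longrightarrow>
            (AE A in lebesgue. A \<in> admissible_tuples v \<longrightarrow>
               has_exact_dim (self_affine_measure A v p) (lyapunov_dim A p) \<and>
               lyapunov_dim A p =
                 min (shannon_entropy p / lyapunov_exp 1 A p)
                     (1 + (shannon_entropy p - lyapunov_exp 1 A p) / lyapunov_exp 2 A p)))"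
proof (intro conjI allI impI)
  note cover = admissible_subset_good[OF assms]
  \<comment> \<open>Rational contraction bounds and exponents: the exceptional sets are countable in
    number, and each is null.\<close>
  define I where "I = {r \<in> \<rat>. 0 < r \<and> r < (1 :: real)}"
  have I: "countable I" unfolding I_def by (rule countable_subset[OF _ countable_rat]) auto
  define J where "J = {z \<in> \<rat> \<times> \<rat>. 0 < fst z \<and> fst z < snd z \<and> snd z \<le> (2 :: real)}"
  have J: "countable J" unfolding J_def by (rule countable_subset[of _ "\<rat> \<times> \<rat>"]) (auto intro: countable_rat countable_SIGMA)
  have "AE A in lborel. \<forall>r\<in>I. \<forall>z\<in>J. A \<notin> bad_sets r v (fst z) (snd z)"
    unfolding AE_ball_countable[OF I] AE_ball_countable[OF J]
    by (intro ballI AE_not_in bad_sets_null) (auto simp: I_def J_def)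
  then have "AE A in lebesgue. \<forall>r\<in>I. \<forall>z\<in>J. A \<notin> bad_sets r v (fst z) (snd z)" by (rule AE_completion)
  then show "AE A in lebesgue. A \<in> admissible_tuples v \<longrightarrow>
      hausdorff_dim (self_affine_set A v) = upper_minkowski_dim (self_affine_set A v) \<and>
      upper_minkowski_dim (self_affine_set A v) = ereal (affinity_dim A)"
  proof eventually_elim
    case (elim A)
    show ?case
    proof
      assume "A \<in> admissible_tuples v"
      then obtain r where r: "r \<in> I" "A \<in> good r v" using cover unfolding I_def by blast
      show "hausdorff_dim (self_affine_set A v) = upper_minkowski_dim (self_affine_set A v) \<and>
        upper_minkowski_dim (self_affine_set A v) = ereal (affinity_dim A)"
        by (rule dimensions_if_not_bad[OF _ _ r(2) assms(1)]) (use r elim in \<open>auto simp: I_def J_def\<close>)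
    qed
  qed
  fix p :: "real^'n" assume p: "(\<forall>i. 0 < p $ i \<and> p $ i < 1) \<and> (\<Sum>i\<in>UNIV. p $ i) = 1"
  have pv: "prob_vector p" by standard (use p in auto)
  define Q where "Q = {q \<in> \<rat>. 0 < q \<and> q < (2 :: real)}"
  have Q: "countable Q" unfolding Q_def by (rule countable_subset[OF _ countable_rat]) auto
  have "AE A in lborel. \<forall>r\<in>I. \<forall>q\<in>Q. A \<notin> bad_measures r v p q"
    unfolding AE_ball_countable[OF I] AE_ball_countable[OF Q]
    by (intro ballI AE_not_in bad_measures_null pv) (auto simp: I_def Q_def)
  then have "AE A in lebesgue. \<forall>r\<in>I. \<forall>q\<in>Q. A \<notin> bad_measures r v p q" by (rule AE_completion)
  then show "AE A in lebesgue. A \<in> admissible_tuples v \<longrightarrow>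
      has_exact_dim (self_affine_measure A v p) (lyapunov_dim A p) \<and>
      lyapunov_dim A p = min (shannon_entropy p / lyapunov_exp 1 A p)
        (1 + (shannon_entropy p - lyapunov_exp 1 A p) / lyapunov_exp 2 A p)"
  proof eventually_elim
    case (elim A)
    show ?case
    proof
      assume "A \<in> admissible_tuples v"
      then obtain r where r: "r \<in> I" "A \<in> good r v" using cover unfolding I_def by blast
      show "has_exact_dim (self_affine_measure A v p) (lyapunov_dim A p) \<and>
        lyapunov_dim A p = min (shannon_entropy p / lyapunov_exp 1 A p)
          (1 + (shannon_entropy p - lyapunov_exp 1 A p) / lyapunov_exp 2 A p)"
        by (rule exact_dim_if_not_bad[OF _ _ r(2) assms(1) pv]) (use r elim in \<open>auto simp: I_def Q_def\<close>)
    qed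
  qed
qed

end
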